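(* Let $\tau:[0,\infty)^2\to\mathbb{C}$ be a bounded function satisfying the following three conditions, where $\tau_N(j,k)=\tau(j/N,k/N)$ for $j,k\in\mathbb{Z}_+$, $N\ge 1$: (A) $\sup_{N\ge 1}\|\tau_N\|_{\mathfrak{M}}<\infty$; (B) $\tau(0,0)=1$ and for some $\varepsilon>0$ and some $\beta>1/2$ there exists $C_\beta>0$ such that $|\tau(x,y)-1|\le C_\beta|\log(x+y)|^{-\beta}$ for all $0\le x,y\le\varepsilon$; (C) for some $\alpha>1/2$ there exists $C_\alpha$ such that $|\tau(x,y)|\le C_\alpha(\log(x+y+2))^{-\alpha}$ for all $x,y\ge 0$. Let $\omega\in PC(\mathbb{T})$ and let $\Omega$ be the set of its jump discontinuities. Then for every $t>0$ the limit $$\mathsf{LogDens}_\tau(t;\Gamma(\widehat\omega)):=\lim_{N\to\infty}\frac{\mathsf{n}(t;\tau_N\star\Gamma(\widehat\omega))}{\log N}$$ exists and $$\mathsf{LogDens}_\tau(t;\Gamma(\widehat\omega))=\sum_{z\in\Omega}\mathsf{c}\left(t|\varkappa_z(\omega)|^{-1}\right).$$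
   Context: $\mathbb{Z}_+=\{0,1,2,\dots\}$, $\mathbb{T}$ is the unit circle in $\mathbb{C}$. $PC(\mathbb{T})$ is the class of functions $\omega:\mathbb{T}\to\mathbb{C}$ for which the limits $\omega(z\pm)=\lim_{\epsilon\to0+}\omega(ze^{\pm i\epsilon})$ exist and are finite for all $z\in\mathbb{T}$. Put $\varkappa_z(\omega)=\frac{\omega(z+)-\omega(z-)}{2}$; the jump discontinuities of $\omega$ are the points $z$ with $\varkappa_z(\omega)\ne0$ (an at most countable set; for each $s>0$ only finitely many $z$ have $|\varkappa_z(\omega)|>s$). For a bounded measurable $\omega$ on $\mathbb{T}$, $\widehat\omega(j)=\int_0^{2\pi}\omega(e^{i\theta})e^{-ij\theta}\frac{d\theta}{2\pi}$, and $\Gamma(\widehat\omega)$ is the bounded operator on $\ell^2(\mathbb{Z}_+)$ with matrix entries $\widehat\omega(j+k)$, $j,k\ge0$. Schur–Hadamard multiplication: for a bounded double sequence $\sigma=(\sigma(j,k))_{j,k\ge0}$ and a bounded operator $A$ on $\ell^2(\mathbb{Z}_+)$, $\sigma\star A$ is the operator with entries $((\sigma\star A)e_j,e_k)=\sigma(j,k)(Ae_j,e_k)$, where $(e_j)$ is the standard basis; $\|\sigma\|_{\mathfrak{M}}=\sup_{\|A\|=1}\|\sigma\star A\|$ (operator norm, supremum over bounded operators $A$). For a compact operator $K$ with singular values $s_n(K)$ (counted with multiplicity), $\mathsf{n}(t;K)=\#\{n:s_n(K)>t\}$, $t>0$. $\mathsf{c}(t)=\frac{1}{\pi^2}\log\left(\frac{1+\sqrt{1-t^2}}{t}\right)$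 for $t\in(0,1]$ and $\mathsf{c}(t)=0$ for $t\notin(0,1)$. *)

theory Defs
  imports "HOL-Analysis.Analysis"
begin

typedef ell2 = "{x :: nat \<Rightarrow> complex. summable (\<lambda>n. (cmod (x n))\<^sup>2)}"
  morphisms coord Abs_ell2
  by (rule exI[of _ "\<lambda>_. 0"]) simp

setup_lifting type_definition_ell2

lemma summable_coord: "summable (\<lambda>n. (cmod (coord x n))\<^sup>2)"
  using coord[of x] by simp

lemma ell2_eqI: "(\<And>n. coord x n = coord y n) \<Longrightarrow> x = y"
  by (metis coord_inject ext)

lemma square_summable_add:
  fixes x y :: "nat \<Rightarrow> complex"
  assumes "summable (\<lambda>n. (cmod (x n))\<^sup>2)" "summable (\<lambda>n. (cmod (y n))\<^sup>2)"
  shows "summable (\<lambda>n. (cmod (x n + y n))\<^sup>2)"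
proof (rule summable_comparison_test')
  show "summable (\<lambda>n. 2 * (cmod (x n))\<^sup>2 + 2 * (cmod (y n))\<^sup>2)"
    using assms by (intro summable_add summable_mult)
  fix n :: nat
  have "(cmod (x n + y n))\<^sup>2 \<le> (cmod (x n) + cmod (y n))\<^sup>2"
    by (intro power_mono norm_triangle_ineq) simp
  also have "\<dots> \<le> 2 * (cmod (x n))\<^sup>2 + 2 * (cmod (y n))\<^sup>2"
    using sum_squares_bound[of "cmod (x n)" "cmod (y n)"] by (simp add: power2_sum)
  finally show "norm ((cmod (x n + y n))\<^sup>2) \<le> 2 * (cmod (x n))\<^sup>2 + 2 * (cmod (y n))\<^sup>2"
    by simp
qed

lemma square_summable_scale:
  fixes x :: "nat \<Rightarrow> complex"
  assumes "summable (\<lambda>n. (cmod (x n))\<^sup>2)"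
  shows "summable (\<lambda>n. (cmod (c * x n))\<^sup>2)"
  using summable_mult[OF assms, of "(cmod c)\<^sup>2"] by (simp add: norm_mult power_mult_distrib)

lemma summable_coord_mult: "summable (\<lambda>n. coord x n * cnj (coord y n))"
proof (rule summable_comparison_test')
  show "summable (\<lambda>n. (cmod (coord x n))\<^sup>2 + (cmod (coord y n))\<^sup>2)"
    by (intro summable_add summable_coord)
  fix n :: nat
  show "cmod (coord x n * cnj (coord y n)) \<le> (cmod (coord x n))\<^sup>2 + (cmod (coord y n))\<^sup>2"
    using sum_squares_bound[of "cmod (coord x n)" "cmod (coord y n)"]
      mult_nonneg_nonneg[OF norm_ge_zero[of "coord x n"] norm_ge_zero[of "coord y n"]]
    by (simp add: norm_mult del: mult_nonneg_nonneg)
qed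

lift_definition cscale :: "complex \<Rightarrow> ell2 \<Rightarrow> ell2" is "\<lambda>c x n. c * x n"
  by (rule square_summable_scale)

text \<open>Linear in the first argument, as in \<open>(A e\<^sub>j, e\<^sub>k)\<close>.\<close>

definition cinner :: "ell2 \<Rightarrow> ell2 \<Rightarrow> complex" where
  "cinner x y = (\<Sum>n. coord x n * cnj (coord y n))"

instantiation ell2 :: real_vector
begin

lift_definition zero_ell2 :: ell2 is "\<lambda>_. 0" by simp
lift_definition plus_ell2 :: "ell2 \<Rightarrow> ell2 \<Rightarrow> ell2" is "\<lambda>x y n. x n + y n"
  by (rule square_summable_add)
lift_definition uminus_ell2 :: "ell2 \<Rightarrow> ell2" is "\<lambda>x n. - x n" by simp

definition minus_ell2 :: "ell2 \<Rightarrow> ell2 \<Rightarrow> ell2" where "x - y = x + - y" for x y :: ell2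
definition scaleR_ell2 :: "real \<Rightarrow> ell2 \<Rightarrow> ell2" where "scaleR_ell2 r = cscale (of_real r)"

instance
proof
  fix x y z :: ell2 and a b :: real
  show "x + y + z = x + (y + z)" "x + y = y + x" "0 + x = x" "- x + x = 0"
    by (transfer; simp add: algebra_simps)+
  show "x - y = x + - y" by (simp add: minus_ell2_def)
  show "a *\<^sub>R (x + y) = a *\<^sub>R x + a *\<^sub>R y" "(a + b) *\<^sub>R x = a *\<^sub>R x + b *\<^sub>R x"
    "a *\<^sub>R b *\<^sub>R x = (a * b) *\<^sub>R x" "1 *\<^sub>R x = x"
    unfolding scaleR_ell2_def by (transfer; simp add: algebra_simps)+
qed

end

text \<open>The real inner product is the real part of \<^const>\<open>cinner\<close>; it induces the usual norm
  (lemma \<open>norm_ell2\<close> below).\<close>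

instantiation ell2 :: real_inner
begin

definition inner_ell2 :: "ell2 \<Rightarrow> ell2 \<Rightarrow> real" where "inner_ell2 x y = Re (cinner x y)"
definition norm_ell2 :: "ell2 \<Rightarrow> real" where "norm_ell2 x = sqrt (inner x x)"
definition sgn_ell2 :: "ell2 \<Rightarrow> ell2" where "sgn_ell2 x = x /\<^sub>R norm x"
definition dist_ell2 :: "ell2 \<Rightarrow> ell2 \<Rightarrow> real" where "dist_ell2 x y = norm (x - y)"
definition uniformity_ell2 :: "(ell2 \<times> ell2) filter" where
  "uniformity_ell2 = (INF e\<in>{0<..}. principal {(x :: ell2, y). dist x y < e})"
definition open_ell2 :: "ell2 set \<Rightarrow> bool" where
  "open_ell2 U \<longleftrightarrow> (\<forall>x\<in>U. \<forall>\<^sub>F (x', y) in uniformity. x' = x \<longrightarrow> y \<in> U)"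

instance
proof
  fix x y z :: ell2 and r :: real and U :: "ell2 set"
  show "dist x y = norm (x - y)" by (simp add: dist_ell2_def)
  show "sgn x = x /\<^sub>R norm x" by (simp add: sgn_ell2_def)
  show "(uniformity :: (ell2 \<times> ell2) filter) = (INF e\<in>{0<..}. principal {(x, y). dist x y < e})"
    by (simp add: uniformity_ell2_def)
  show "open U = (\<forall>x\<in>U. \<forall>\<^sub>F (x', y) in uniformity. x' = x \<longrightarrow> y \<in> U)"
    by (simp add: open_ell2_def)
  have inner: "inner u v = (\<Sum>n. Re (coord u n * cnj (coord v n)))" for u v :: ell2
    unfolding inner_ell2_def cinner_def by (rule Re_suminf[OF summable_coord_mult])
  have smb: "summable (\<lambda>n. Re (coord u n * cnj (coord v n)))" for u v :: ell2
    by (rule summable_Re[OF summable_coord_mult])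
  have sq: "Re (coord x n * cnj (coord x n)) = (cmod (coord x n))\<^sup>2" for n
    by (simp add: complex_mult_cnj cmod_power2)
  show "inner x y = inner y x" unfolding inner by (simp add: mult.commute)
  show "inner (x + y) z = inner x z + inner y z"
    unfolding inner suminf_add[OF smb smb] by (simp add: plus_ell2.rep_eq algebra_simps)
  show "inner (r *\<^sub>R x) y = r * inner x y"
    unfolding inner suminf_mult[OF smb, symmetric]
    by (simp add: scaleR_ell2_def cscale.rep_eq algebra_simps)
  show "0 \<le> inner x x"
    unfolding inner sq by (rule suminf_nonneg[OF summable_coord]) simp
  show "(inner x x = 0) = (x = 0)"
    unfolding inner sq suminf_eq_zero_iff[OF summable_coord zero_le_power2]
    by (auto intro!: ell2_eqI simp: zero_ell2.rep_eq)
  show "norm x = sqrt (inner x x)" by (simp add: norm_ell2_def)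
qed

end

lemma norm_ell2: "norm x = sqrt (\<Sum>n. (cmod (coord x n))\<^sup>2)" for x :: ell2
  unfolding norm_ell2_def inner_ell2_def cinner_def Re_suminf[OF summable_coord_mult]
  by (simp add: complex_mult_cnj cmod_power2)

interpretation cvec: vector_space cscale
  by unfold_locales (transfer; simp add: algebra_simps)+

lift_definition basis_vec :: "nat \<Rightarrow> ell2" is "\<lambda>j n. if n = j then 1 else 0"
  by (rule summable_finite[of "{j}" for j]) auto

text \<open>Bounded complex-linear operators; the operator norm is the library's \<^const>\<open>onorm\<close>.\<close>

definition bounded_op :: "(ell2 \<Rightarrow> ell2) \<Rightarrow> bool" where
  "bounded_op A \<longleftrightarrow> bounded_linear A \<and> (\<forall>c x. A (cscale c x) = cscale c (A x))"

definition entry :: "(ell2 \<Rightarrow> ell2) \<Rightarrow> nat \<Rightarrow> nat \<Rightarrow> complex" where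
  "entry A j k = cinner (A (basis_vec j)) (basis_vec k)"

definition has_matrix :: "(ell2 \<Rightarrow> ell2) \<Rightarrow> (nat \<Rightarrow> nat \<Rightarrow> complex) \<Rightarrow> bool" where
  "has_matrix A m \<longleftrightarrow> bounded_op A \<and> (\<forall>j k. entry A j k = m j k)"

text \<open>A bounded operator is determined by its matrix. The value is unspecified if \<open>m\<close> is not the
  matrix of a bounded operator.\<close>

definition op_of_matrix :: "(nat \<Rightarrow> nat \<Rightarrow> complex) \<Rightarrow> (ell2 \<Rightarrow> ell2)" where
  "op_of_matrix m = (THE A. has_matrix A m)"

definition hankel :: "(int \<Rightarrow> complex) \<Rightarrow> (ell2 \<Rightarrow> ell2)" where
  "hankel a = op_of_matrix (\<lambda>j k. a (int j + int k))"

definition schur_mult :: "(nat \<Rightarrow> nat \<Rightarrow> complex) \<Rightarrow> (ell2 \<Rightarrow> ell2) \<Rightarrow> (ell2 \<Rightarrow> ell2)"  (infixr "\<star>" 75)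
  where "\<sigma> \<star> A = op_of_matrix (\<lambda>j k. \<sigma> j k * entry A j k)"

text \<open>The multiplier norm; \<open>\<parallel>\<sigma> \<star> A\<parallel>\<close> counts as \<open>\<infinity>\<close> when the product matrix does not define a bounded
  operator, so that the norm is finite exactly for Schur multipliers.\<close>

definition multiplier_norm :: "(nat \<Rightarrow> nat \<Rightarrow> complex) \<Rightarrow> ereal" where
  "multiplier_norm \<sigma> =
     (SUP A\<in>{A. bounded_op A \<and> onorm A = 1}.
        if \<exists>B. has_matrix B (\<lambda>j k. \<sigma> j k * entry A j k) then ereal (onorm (\<sigma> \<star> A)) else \<infinity>)"

definition hilbert_adjoint :: "(ell2 \<Rightarrow> ell2) \<Rightarrow> (ell2 \<Rightarrow> ell2)" where
  "hilbert_adjoint K = (THE B. \<forall>x y. cinner (K x) y = cinner x (B y))"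

text \<open>For \<open>s > 0\<close>, the \<open>s\<close>-singular space of \<open>K\<close> is \<open>ker (K\<^sup>*K - s\<^sup>2)\<close>; its dimension is the
  multiplicity of \<open>s\<close> as a singular value.\<close>

definition singular_space :: "(ell2 \<Rightarrow> ell2) \<Rightarrow> real \<Rightarrow> ell2 set" where
  "singular_space K s = {x. hilbert_adjoint K (K x) = cscale (of_real (s\<^sup>2)) x}"

text \<open>Number of singular values above \<open>t > 0\<close>, with multiplicity. Meaningful for compact \<open>K\<close>, where
  there are finitely many such values, each of finite multiplicity.\<close>

definition sing_count :: "real \<Rightarrow> (ell2 \<Rightarrow> ell2) \<Rightarrow> nat" where
  "sing_count t K = (\<Sum>s | s > t \<and> singular_space K s \<noteq> {0}. cvec.dim (singular_space K s))"

text \<open>Functions on the circle are total functions on \<open>\<complex>\<close> of which only the values on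
  \<^term>\<open>sphere (0::complex) 1\<close> matter.\<close>

definition PC_circle :: "(complex \<Rightarrow> complex) set" where
  "PC_circle = {\<omega>. \<forall>z\<in>sphere 0 1.
      (\<exists>l. ((\<lambda>\<epsilon>. \<omega> (z * cis \<epsilon>)) \<longlongrightarrow> l) (at_right 0)) \<and>
      (\<exists>l. ((\<lambda>\<epsilon>. \<omega> (z * cis (- \<epsilon>))) \<longlongrightarrow> l) (at_right 0))}"

definition limit_plus :: "(complex \<Rightarrow> complex) \<Rightarrow> complex \<Rightarrow> complex" where
  "limit_plus \<omega> z = Lim (at_right 0) (\<lambda>\<epsilon>. \<omega> (z * cis \<epsilon>))"

definition limit_minus :: "(complex \<Rightarrow> complex) \<Rightarrow> complex \<Rightarrow> complex" where
  "limit_minus \<omega> z = Lim (at_right 0) (\<lambda>\<epsilon>. \<omega> (z * cis (- \<epsilon>)))"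

definition half_jump :: "(complex \<Rightarrow> complex) \<Rightarrow> complex \<Rightarrow> complex" where
  "half_jump \<omega> z = (limit_plus \<omega> z - limit_minus \<omega> z) / 2"

definition jump_set :: "(complex \<Rightarrow> complex) \<Rightarrow> complex set" where
  "jump_set \<omega> = {z \<in> sphere 0 1. half_jump \<omega> z \<noteq> 0}"

definition fourier_coeff :: "(complex \<Rightarrow> complex) \<Rightarrow> int \<Rightarrow> complex" where
  "fourier_coeff \<omega> j =
     (LBINT \<theta>:{0..2 * pi}. \<omega> (cis \<theta>) * cis (- (of_int j * \<theta>))) / of_real (2 * pi)"

definition dilate :: "(real \<Rightarrow> real \<Rightarrow> complex) \<Rightarrow> nat \<Rightarrow> nat \<Rightarrow> nat \<Rightarrow> complex" where
  "dilate \<tau> N j k = \<tau> (real j / real N) (real k / real N)"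

definition log_ratio :: "(real \<Rightarrow> real \<Rightarrow> complex) \<Rightarrow> real \<Rightarrow> (ell2 \<Rightarrow> ell2) \<Rightarrow> nat \<Rightarrow> real" where
  "log_ratio \<tau> t A N = real (sing_count t (dilate \<tau> N \<star> A)) / ln (real N)"

definition LogDens :: "(real \<Rightarrow> real \<Rightarrow> complex) \<Rightarrow> real \<Rightarrow> (ell2 \<Rightarrow> ell2) \<Rightarrow> real" where
  "LogDens \<tau> t A = lim (log_ratio \<tau> t A)"

definition density_c :: "real \<Rightarrow> real" where
  "density_c t = (if 0 < t \<and> t \<le> 1 then 1 / pi\<^sup>2 * ln ((1 + sqrt (1 - t\<^sup>2)) / t) else 0)"

end

theory Submission
  imports Defs "HOL-Complex_Analysis.Complex_Analysis"
begin

text \<open>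
  The function \<open>\<omega>\<close> is within \<open>\<delta>\<close> of a step function, whose Fourier coefficients are
  \<open>\<Sum>\<^sub>z \<kappa>\<^sub>z z\<^sup>-\<^sup>n / (\<pi> \<i> n)\<close>. By (A) the remainder contributes an operator of norm \<open>O(\<delta>)\<close>; by (B) and (C)
  the multiplier may be replaced by the sharp truncation to \<open>1 \<le> j, k \<le> N\<close> at the cost of an operator
  whose Hilbert--Schmidt norm is bounded in \<open>N\<close>, which affects only boundedly many singular values.
  For the truncated model, the vectors \<open>z\<^sup>j j\<^sup>-\<^sup>1\<^sup>/\<^sup>2\<^sup>+\<^sup>i\<^sup>a (log N)\<^sup>-\<^sup>1\<^sup>/\<^sup>2\<close> with \<open>a = 2 \<pi> m / log N\<close>, \<open>m\<close> an integer,
  are orthonormal up to Hilbert--Schmidt bounded errors, and up to such errors they are mapped to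
  \<open>-\<i> \<kappa>\<^sub>z / cosh (\<pi> a)\<close> times the same vectors with \<open>z\<close> replaced by its conjugate, since
  \<open>\<integral> e\<^sup>i\<^sup>a\<^sup>v / (2 cosh (v / 2)) dv = \<pi> / cosh (\<pi> a)\<close>. Counting them gives the lower bound.
  The upper bound needs no completeness argument: the squared Hilbert--Schmidt norm of the model is
  \<open>(log N / \<pi>\<^sup>2) \<Sum>\<^sub>z |\<kappa>\<^sub>z|\<^sup>2 + O(1)\<close>, which the singular values already found exhaust to leading order.
\<close>


section \<open>The Hilbert space of square-summable sequences\<close>

text \<open>\<open>sing_count\<close> is defined through eigenspaces, which are hard to follow under
  perturbation, whereas every approximation here is a sum of operators. The bridge is
  \<open>codim_bound\<close>: smallness off finitely many directions is additive both in the size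
  and in the number of directions, and for compact operators it is equivalent to a bound on
  \<open>sing_count\<close>. An error with Hilbert-Schmidt norm bounded in N then costs a number of
  directions independent of N, which disappears after division by log N. The exponents above 1/2 in
  (B) and (C) produce exactly this: an antidiagonal j + k = s has about s entries of squared size
  1/s^2, and the squared logarithmic error turns the divergent sum of 1/s into a bounded one. The
  upper bound closes because the squared Hilbert-Schmidt norm is the integral of the counting
  function in the variable u = t^2, and the integral of \<open>density_c (sqrt u)\<close> over (0,
  1) is 1 / pi^2, precisely the mass coefficient of a single jump with \<open>half_jump\<close> of
  modulus 1. A lower bound with the right total integral leaves no room for further singular values
  at leading order.\<close>

lemma coord_add [simp]: "coord (x + y) n = coord x n + coord y n"
  by (simp add: plus_ell2.rep_eq)

lemma coord_zero [simp]: "coord 0 n = 0"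
  by (simp add: zero_ell2.rep_eq)

lemma coord_uminus [simp]: "coord (- x) n = - coord x n"
  by (simp add: uminus_ell2.rep_eq)

lemma coord_diff [simp]: "coord (x - y) n = coord x n - coord y n"
  by (simp only: minus_ell2_def coord_add coord_uminus) simp

lemma coord_cscale [simp]: "coord (cscale c x) n = c * coord x n"
  by (simp add: cscale.rep_eq)

lemma coord_basis_vec [simp]: "coord (basis_vec j) n = (if n = j then 1 else 0)"
  by (simp add: basis_vec.rep_eq)

lemma coord_sum [simp]: "coord (sum f A) n = (\<Sum>i\<in>A. coord (f i) n)"
  by (induction A rule: infinite_finite_induct) auto

lemma norm_square_ell2: "(norm x)\<^sup>2 = (\<Sum>n. (cmod (coord x n))\<^sup>2)"
  by (simp add: norm_ell2 suminf_nonneg summable_coord)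

lemma sum_coord_le: "(\<Sum>i<n. (cmod (coord x i))\<^sup>2) \<le> (norm x)\<^sup>2"
  unfolding norm_square_ell2 by (rule sum_le_suminf) (auto simp: summable_coord)

lemma norm_square_le:
  assumes "\<And>n. (\<Sum>i<n. (cmod (coord x i))\<^sup>2) \<le> B"
  shows "(norm x)\<^sup>2 \<le> B"
  unfolding norm_square_ell2 by (rule suminf_le_const[OF summable_coord assms])

lemma ell2_of_bound:
  assumes "\<And>n. (\<Sum>i<n. (cmod (f i))\<^sup>2) \<le> B"
  obtains x where "coord x = f" "(norm x)\<^sup>2 \<le> B"
proof -
  have "summable (\<lambda>n. (cmod (f n))\<^sup>2)"
    by (rule summableI_nonneg_bounded[of _ B]) (use assms in auto)
  then have "coord (Abs_ell2 f) = f"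
    by (simp add: Abs_ell2_inverse)
  then show ?thesis
    using that[of "Abs_ell2 f"] norm_square_le[of "Abs_ell2 f" B] assms by simp
qed

lemma cinner_sums: "(\<lambda>n. coord x n * cnj (coord y n)) sums cinner x y"
  unfolding cinner_def by (rule summable_sums[OF summable_coord_mult])

lemma cinner_add_left: "cinner (x + y) z = cinner x z + cinner y z"
  by (rule sums_unique2[OF cinner_sums])
    (use sums_add[OF cinner_sums[of x z] cinner_sums[of y z]] in \<open>simp add: algebra_simps\<close>)

lemma cinner_cscale_left: "cinner (cscale c x) y = c * cinner x y"
  by (rule sums_unique2[OF cinner_sums])
    (use sums_mult[OF cinner_sums[of x y], of c] in \<open>simp add: algebra_simps\<close>)

lemma cinner_commute: "cinner y x = cnj (cinner x y)"
  by (rule sums_unique2[OF cinner_sums])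
    (use sums_cnj[THEN iffD2, OF cinner_sums[of x y]] in \<open>simp add: algebra_simps\<close>)

lemma cinner_add_right: "cinner z (x + y) = cinner z x + cinner z y"
  by (metis cinner_add_left cinner_commute complex_cnj_add)

lemma cinner_cscale_right: "cinner y (cscale c x) = cnj c * cinner y x"
  by (metis cinner_cscale_left cinner_commute complex_cnj_mult)

lemma cinner_zero_left [simp]: "cinner 0 x = 0"
  by (simp add: cinner_def)

lemma cinner_zero_right [simp]: "cinner x 0 = 0"
  by (simp add: cinner_def)

lemma cinner_diff_left: "cinner (x - y) z = cinner x z - cinner y z"
  using cinner_add_left[of "x - y" y z] by simp

lemma cinner_diff_right: "cinner z (x - y) = cinner z x - cinner z y"
  using cinner_add_right[of z "x - y" y] by simp

lemma cinner_sum_left: "cinner (sum f A) y = (\<Sum>i\<in>A. cinner (f i) y)"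
  by (induction A rule: infinite_finite_induct) (auto simp: cinner_add_left)

lemma cinner_sum_right: "cinner y (sum f A) = (\<Sum>i\<in>A. cinner y (f i))"
  by (induction A rule: infinite_finite_induct) (auto simp: cinner_add_right)

lemma cinner_self: "cinner x x = of_real ((norm x)\<^sup>2)"
proof -
  have "(\<lambda>n. of_real ((cmod (coord x n))\<^sup>2)) sums (of_real ((norm x)\<^sup>2) :: complex)"
    unfolding norm_square_ell2 by (rule sums_of_real[OF summable_sums[OF summable_coord]])
  then have "(\<lambda>n. coord x n * cnj (coord x n)) sums of_real ((norm x)\<^sup>2)"
    by (simp only: complex_norm_square)
  then show ?thesis
    by (rule sums_unique2[OF cinner_sums])
qed

lemma cinner_basis_right [simp]: "cinner x (basis_vec k) = coord x k"
proof -
  have "(\<lambda>n. coord x n * cnj (coord (basis_vec k) n)) sums (\<Sum>n\<in>{k}. coord x n * cnj (coord (basis_vec k) n))"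
    by (rule sums_finite) auto
  then show ?thesis
    using sums_unique2[OF cinner_sums] by fastforce
qed

lemma norm_cscale [simp]: "norm (cscale c x) = cmod c * norm x"
proof -
  have "complex_of_real ((norm (cscale c x))\<^sup>2) = c * cnj c * of_real ((norm x)\<^sup>2)"
    by (simp only: cinner_self[symmetric] cinner_cscale_left cinner_cscale_right mult_ac)
  also have "\<dots> = of_real ((cmod c * norm x)\<^sup>2)"
    by (simp only: complex_norm_square[symmetric] of_real_mult[symmetric] power_mult_distrib)
  finally have "(norm (cscale c x))\<^sup>2 = (cmod c * norm x)\<^sup>2"
    by (simp only: of_real_eq_iff)
  then show ?thesis
    by (rule power2_eq_imp_eq) auto
qed

lemma cinner_bound: "cmod (cinner x y) \<le> norm x * norm y"
proof (cases "cinner x y = 0")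
  case False
  \<comment> \<open>The phase \<open>c\<close> makes the complex product real and nonnegative, which
    reduces the claim to the Cauchy-Schwarz inequality of the real inner product.\<close>
  define c where "c = cnj (cinner x y) / of_real (cmod (cinner x y))"
  have c: "cmod c = 1" using False by (simp add: c_def norm_divide)
  have "c * cinner x y = of_real (cmod (cinner x y))"
  proof -
    have "cnj (cinner x y) * cinner x y = of_real (cmod (cinner x y)) * of_real (cmod (cinner x y))"
      by (metis complex_norm_square mult.commute of_real_mult of_real_power power2_eq_square)
    then show ?thesis using False by (simp add: c_def field_simps)
  qed
  then have "cmod (cinner x y) = inner (cscale c x) y"
    by (simp add: inner_ell2_def cinner_cscale_left)
  also have "\<dots> \<le> norm (cscale c x) * norm y"
    by (rule norm_cauchy_schwarz)
  finally show ?thesis using c by simp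
qed simp

lemma cinner_ext:
  assumes "\<And>x. cinner x y = cinner x z"
  shows "y = z"
proof -
  have "cinner (y - z) (y - z) = 0"
    using assms by (simp add: cinner_diff_right)
  then show ?thesis by (simp add: cinner_self)
qed

lemma norm_basis_vec [simp]: "norm (basis_vec k) = 1"
proof -
  have "complex_of_real ((norm (basis_vec k))\<^sup>2) = of_real 1"
    by (simp only: cinner_self[symmetric]) simp
  then have "(norm (basis_vec k))\<^sup>2 = 1\<^sup>2"
    by (simp only: of_real_eq_iff power_one)
  then show ?thesis
    by (rule power2_eq_imp_eq) auto
qed

lemma cmod_coord_le: "cmod (coord x k) \<le> norm x"
  using cinner_bound[of x "basis_vec k"] by simp

section \<open>Finite sections, bounded operators and adjoints\<close>

definition trunc :: "nat \<Rightarrow> ell2 \<Rightarrow> ell2" where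
  "trunc n x = (\<Sum>j<n. cscale (coord x j) (basis_vec j))"

lemma coord_trunc [simp]: "coord (trunc n x) k = (if k < n then coord x k else 0)"
  by (simp add: trunc_def if_distrib[of "\<lambda>y. _ * y"] cong: if_cong)

lemma trunc_tendsto: "(\<lambda>n. trunc n x) \<longlonglongrightarrow> x"
proof -
  have eq: "(norm (trunc n x - x))\<^sup>2 = (norm x)\<^sup>2 - (\<Sum>i<n. (cmod (coord x i))\<^sup>2)" for n
  proof -
    have "(\<lambda>k. (cmod (coord x k))\<^sup>2 - (if k \<in> {..<n} then (cmod (coord x k))\<^sup>2 else 0)) sums
       ((norm x)\<^sup>2 - (\<Sum>i<n. (cmod (coord x i))\<^sup>2))"
      unfolding norm_square_ell2
      by (intro sums_diff summable_sums summable_coord sums_If_finite_set) auto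
    moreover have "(\<lambda>k. (cmod (coord x k))\<^sup>2 - (if k \<in> {..<n} then (cmod (coord x k))\<^sup>2 else 0)) =
        (\<lambda>k. (cmod (coord (trunc n x - x) k))\<^sup>2)"
      by (rule ext) (simp add: norm_minus_commute)
    ultimately show ?thesis
      unfolding norm_square_ell2[of "trunc n x - x"] by (metis sums_unique)
  qed
  have "(\<lambda>n. (norm x)\<^sup>2 - (\<Sum>i<n. (cmod (coord x i))\<^sup>2)) \<longlonglongrightarrow> (norm x)\<^sup>2 - (norm x)\<^sup>2"
    using summable_LIMSEQ[OF summable_coord[of x]] by (intro tendsto_intros) (simp add: norm_square_ell2)
  then have "(\<lambda>n. sqrt ((norm (trunc n x - x))\<^sup>2)) \<longlonglongrightarrow> sqrt 0"
    unfolding eq by (intro tendsto_real_sqrt) simp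
  then show ?thesis
    by (simp add: tendsto_norm_zero_iff LIM_zero_iff)
qed

lemma tendsto_cinner_left:
  assumes "(f \<longlongrightarrow> l) F"
  shows "((\<lambda>n. cinner (f n) y) \<longlongrightarrow> cinner l y) F"
proof -
  have "bounded_linear (\<lambda>x. cinner x y)"
    by (rule bounded_linear_intro[of _ "norm y"])
      (auto simp: cinner_add_left scaleR_ell2_def cinner_cscale_left scaleR_conv_of_real cinner_bound)
  from bounded_linear.tendsto[OF this assms] show ?thesis .
qed

lemma bounded_opI:
  assumes "\<And>x y. A (x + y) = A x + A y" "\<And>c x. A (cscale c x) = cscale c (A x)"
    and "\<And>x. norm (A x) \<le> B * norm x"
  shows "bounded_op A"
  unfolding bounded_op_def
proof (intro conjI allI)
  show "bounded_linear A"
    by (rule bounded_linear_intro[of _ B]) (use assms in \<open>auto simp: scaleR_ell2_def mult.commute\<close>)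
qed (rule assms)

context
  fixes A assumes A: "bounded_op A"
begin

lemma bounded_op_bl: "bounded_linear A"
  using A by (simp add: bounded_op_def)

lemma bounded_op_cscale: "A (cscale c x) = cscale c (A x)"
  using A by (simp add: bounded_op_def)

lemma bounded_op_add: "A (x + y) = A x + A y"
  using bounded_linear.linear[OF bounded_op_bl] by (simp add: linear_add)

lemma bounded_op_diff: "A (x - y) = A x - A y"
  using bounded_linear.linear[OF bounded_op_bl] by (simp add: linear_diff)

lemma bounded_op_zero: "A 0 = 0"
  using bounded_linear.linear[OF bounded_op_bl] by (simp add: linear_0)

lemma bounded_op_sum: "A (sum f I) = (\<Sum>i\<in>I. A (f i))"
  using bounded_linear.linear[OF bounded_op_bl] by (simp add: linear_sum)

lemma bounded_op_norm_le: "norm (A x) \<le> onorm A * norm x"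
  by (rule onorm[OF bounded_op_bl])

lemma onorm_bounded_op_nonneg: "0 \<le> onorm A"
  by (rule onorm_pos_le[OF bounded_op_bl])

lemma bounded_op_trunc: "A (trunc n x) = (\<Sum>j<n. cscale (coord x j) (A (basis_vec j)))"
  by (simp add: trunc_def bounded_op_sum bounded_op_cscale)

lemma bounded_op_trunc_tendsto: "(\<lambda>n. A (trunc n x)) \<longlonglongrightarrow> A x"
  by (rule bounded_linear.tendsto[OF bounded_op_bl trunc_tendsto])

text \<open>Riesz representation in coordinates. The only candidate has coordinates
  \<open>f j\<close>; it is square-summable because testing \<open>A\<close> on the cut-off
  candidate itself bounds the squared norm of the latter by a constant times its norm.\<close>

lemma adjoint_exists: "\<exists>z. (\<forall>x. cinner (A x) y = cinner x z)"
proof -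
  define f where "f j = cnj (cinner (A (basis_vec j)) y)" for j
  have "(\<Sum>i<n. (cmod (f i))\<^sup>2) \<le> (onorm A * norm y)\<^sup>2" for n
  proof -
    define S where "S = (\<Sum>i<n. (cmod (f i))\<^sup>2)"
    define x where "x = (\<Sum>j<n. cscale (f j) (basis_vec j))"
    have cx: "coord x k = (if k < n then f k else 0)" for k
      by (simp add: x_def if_distrib[of "\<lambda>y. _ * y"] cong: if_cong)
    have nx: "(norm x)\<^sup>2 = S"
      unfolding norm_square_ell2 S_def by (subst suminf_finite[of "{..<n}"]) (auto simp: cx)
    have "cinner (A x) y = (\<Sum>j<n. f j * cnj (f j))"
      by (simp add: x_def bounded_op_sum bounded_op_cscale cinner_sum_left cinner_cscale_left f_def)
    also have "\<dots> = of_real S"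
      by (simp only: S_def of_real_sum complex_norm_square)
    finally have "cmod (cinner (A x) y) = S"
      by (simp only: norm_of_real) (simp add: S_def sum_nonneg)
    moreover have "cmod (cinner (A x) y) \<le> norm (A x) * norm y"
      by (rule cinner_bound)
    moreover have "norm (A x) * norm y \<le> onorm A * norm x * norm y"
      by (intro mult_right_mono bounded_op_norm_le) auto
    ultimately have "(norm x)\<^sup>2 \<le> (onorm A * norm y) * norm x"
      using nx by (simp add: mult_ac)
    then have "norm x \<le> onorm A * norm y"
      by (cases "norm x = 0") (auto simp: power2_eq_square onorm_bounded_op_nonneg mult_le_cancel_right)
    then show ?thesis
      using nx S_def by (metis norm_ge_zero power_mono)
  qed
  then obtain z where z: "coord z = f" by (rule ell2_of_bound)
  have "cinner (A x) y = cinner x z" for x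
  proof (rule LIMSEQ_unique)
    show "(\<lambda>n. cinner (A (trunc n x)) y) \<longlonglongrightarrow> cinner (A x) y"
      by (rule tendsto_cinner_left[OF bounded_op_trunc_tendsto])
    have "cinner (A (trunc n x)) y = cinner (trunc n x) z" for n
      unfolding bounded_op_trunc unfolding trunc_def cinner_sum_left cinner_cscale_left
      by (intro sum.cong refl) (metis cinner_commute cinner_basis_right complex_cnj_cnj f_def z)
    then show "(\<lambda>n. cinner (A (trunc n x)) y) \<longlonglongrightarrow> cinner x z"
      using tendsto_cinner_left[OF trunc_tendsto, of x z] by simp
  qed
  then show ?thesis by blast
qed

lemma hilbert_adjoint: "cinner (A x) y = cinner x (hilbert_adjoint A y)"
proof -
  define B where "B y = (SOME z. \<forall>x. cinner (A x) y = cinner x z)" for y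
  have B: "cinner (A x) y = cinner x (B y)" for x y
    using someI_ex[OF adjoint_exists[of y], folded B_def] by blast
  have "hilbert_adjoint A = B"
    unfolding hilbert_adjoint_def
    by (rule the_equality) (auto simp: B intro!: ext cinner_ext)
  then show ?thesis by (simp add: B)
qed

lemma hilbert_adjoint_left: "cinner (hilbert_adjoint A y) x = cinner y (A x)"
  by (metis cinner_commute hilbert_adjoint)

lemma hilbert_adjoint_add: "hilbert_adjoint A (x + y) = hilbert_adjoint A x + hilbert_adjoint A y"
  by (rule cinner_ext) (simp add: cinner_add_right hilbert_adjoint[symmetric])

lemma hilbert_adjoint_cscale: "hilbert_adjoint A (cscale c x) = cscale c (hilbert_adjoint A x)"
  by (rule cinner_ext) (simp add: cinner_cscale_right hilbert_adjoint[symmetric])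

end

lemma bounded_op_ext:
  assumes "bounded_op A" "bounded_op B" "\<And>j. A (basis_vec j) = B (basis_vec j)"
  shows "A = B"
proof
  fix x
  have "A (trunc n x) = B (trunc n x)" for n
    using assms by (simp add: bounded_op_trunc)
  then show "A x = B x"
    using bounded_op_trunc_tendsto[OF assms(1), of x] bounded_op_trunc_tendsto[OF assms(2), of x]
      LIMSEQ_unique by auto
qed

lemma entry_eq: "entry A j k = coord (A (basis_vec j)) k"
  by (simp add: entry_def)

text \<open>Uniqueness behind the \<open>THE\<close> of the definition: a bounded operator is fixed
  by its values on basis vectors, so exhibiting any operator with the right matrix evaluates
  \<open>hankel\<close> and Schur products.\<close>

lemma op_of_matrix_eq:
  assumes "has_matrix A m"
  shows "op_of_matrix m = A"
  unfolding op_of_matrix_def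
  by (rule the_equality)
    (use assms in \<open>auto simp: has_matrix_def entry_eq intro!: bounded_op_ext ell2_eqI\<close>)

lemma bounded_op_plus:
  assumes "bounded_op A" "bounded_op B"
  shows "bounded_op (\<lambda>x. A x + B x)"
  using assms unfolding bounded_op_def
  by (auto intro: bounded_linear_add simp: cvec.scale_right_distrib)

lemma bounded_op_cmul:
  assumes "bounded_op A"
  shows "bounded_op (\<lambda>x. cscale c (A x))"
proof (rule bounded_opI)
  show "norm (cscale c (A x)) \<le> (cmod c * onorm A) * norm x" for x
    using mult_left_mono[OF bounded_op_norm_le[OF assms, of x], of "cmod c"] by (simp add: mult_ac)
qed (use assms in \<open>auto simp: bounded_op_add bounded_op_cscale cvec.scale_right_distrib mult_ac\<close>)

lemma has_matrix_plus:
  assumes "has_matrix A m" "has_matrix B m'"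
  shows "has_matrix (\<lambda>x. A x + B x) (\<lambda>j k. m j k + m' j k)"
  using assms by (auto simp: has_matrix_def entry_eq bounded_op_plus)

lemma has_matrix_cmul:
  assumes "has_matrix A m"
  shows "has_matrix (\<lambda>x. cscale c (A x)) (\<lambda>j k. c * m j k)"
  using assms by (auto simp: has_matrix_def entry_eq bounded_op_cmul)

lemma has_matrix_minus:
  assumes "has_matrix A m" "has_matrix B m'"
  shows "has_matrix (\<lambda>x. A x - B x) (\<lambda>j k. m j k - m' j k)"
proof -
  have "cscale (-1) x = - x" for x by (rule ell2_eqI) simp
  then show ?thesis
    using has_matrix_plus[OF assms(1) has_matrix_cmul[OF assms(2), of "-1"]] by simp
qed

text \<open>The witness \<open>r k\<close> is the adjoint applied to \<open>basis_vec k\<close>.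
  Having the conjugated rows as vectors of the space makes Bessel's inequality available row by
  row.\<close>

lemma coord_has_matrix:
  assumes "has_matrix A m"
  shows "\<exists>r. \<forall>k. (\<forall>x. coord (A x) k = cinner x (r k)) \<and> (\<forall>j. coord (r k) j = cnj (m j k))"
proof (intro exI allI conjI)
  have A: "bounded_op A" using assms by (simp add: has_matrix_def)
  fix k
  show "coord (A x) k = cinner x (hilbert_adjoint A (basis_vec k))" for x
    using hilbert_adjoint[OF A, of x "basis_vec k"] by simp
  show "coord (hilbert_adjoint A (basis_vec k)) j = cnj (m j k)" for j
  proof -
    have "coord (hilbert_adjoint A (basis_vec k)) j = cinner (hilbert_adjoint A (basis_vec k)) (basis_vec j)"
      by simp
    also have "\<dots> = cinner (basis_vec k) (A (basis_vec j))"
      by (rule hilbert_adjoint_left[OF A])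
    also have "\<dots> = cnj (m j k)"
      using assms by (metis cinner_basis_right cinner_commute entry_eq has_matrix_def)
    finally show ?thesis .
  qed
qed

section \<open>Singular values through codimension\<close>

text \<open>Gaussian elimination. The dimension counts below are reduced to this: among many vectors
  some nontrivial combination satisfies few linear conditions.\<close>

lemma homogeneous_system:
  fixes M :: "'i \<Rightarrow> 'l \<Rightarrow> 'a::field"
  assumes "finite I" "finite J" "card I < card J"
  shows "\<exists>a. (\<exists>l\<in>J. a l \<noteq> 0) \<and> (\<forall>i\<in>I. (\<Sum>l\<in>J. a l * M i l) = 0)"
  using assms
proof (induction I arbitrary: J M rule: finite_induct)
  case empty
  then have "J \<noteq> {}" by auto
  then show ?case by (intro exI[of _ "\<lambda>_. 1"]) auto
next
  case (insert i I)
  show ?case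
  proof (cases "\<forall>l\<in>J. M i l = 0")
    case True
    from insert.IH[of J M] insert.prems insert.hyps obtain a where
      "\<exists>l\<in>J. a l \<noteq> 0" "\<forall>i\<in>I. (\<Sum>l\<in>J. a l * M i l) = 0" by auto
    then show ?thesis using True by (intro exI[of _ a]) auto
  next
    case False
    then obtain p where p: "p \<in> J" "M i p \<noteq> 0" by auto
    \<comment> \<open>Subtracting multiples of row \<open>i\<close>, with pivot \<open>p\<close>,
      removes the unknown \<open>p\<close> from the other equations; \<open>b\<close> below recovers
      it by back substitution.\<close>
    define M' where "M' k l = M k l - M k p * M i l / M i p" for k l
    have "card I < card (J - {p})"
      using insert.prems insert.hyps p by (simp add: card_insert_if)
    from insert.IH[OF _ this, of M'] insert.prems obtain a where
      a: "\<exists>l\<in>J-{p}. a l \<noteq> 0" "\<And>k. k \<in> I \<Longrightarrow> (\<Sum>l\<in>J-{p}. a l * M' k l) = 0" by auto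
    define b where "b = a(p := - (\<Sum>l\<in>J-{p}. a l * M i l) / M i p)"
    have sum_b: "(\<Sum>l\<in>J. b l * M k l) = (\<Sum>l\<in>J-{p}. a l * M k l)
        - (\<Sum>l\<in>J-{p}. a l * M i l) / M i p * M k p" for k
    proof -
      have "(\<Sum>l\<in>J. b l * M k l) = b p * M k p + (\<Sum>l\<in>J-{p}. b l * M k l)"
        using p insert.prems by (simp add: sum.remove)
      also have "(\<Sum>l\<in>J-{p}. b l * M k l) = (\<Sum>l\<in>J-{p}. a l * M k l)"
        by (intro sum.cong) (auto simp: b_def)
      finally show ?thesis by (simp add: b_def)
    qed
    have "(\<Sum>l\<in>J. b l * M k l) = 0" if "k \<in> insert i I" for k
    proof (cases "k = i")
      case True
      then show ?thesis using p by (simp add: sum_b)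
    next
      case False
      then have "k \<in> I" using that by auto
      have "(\<Sum>l\<in>J-{p}. a l * M' k l) = (\<Sum>l\<in>J-{p}. a l * M k l)
          - (\<Sum>l\<in>J-{p}. a l * M i l) / M i p * M k p"
        unfolding M'_def sum_divide_distrib sum_distrib_right
        by (subst sum_subtractf[symmetric], intro sum.cong refl) (simp add: field_simps)
      then show ?thesis
        using a(2)[OF \<open>k \<in> I\<close>] by (simp add: sum_b)
    qed
    moreover have "\<exists>l\<in>J. b l \<noteq> 0"
      using a(1) by (auto simp: b_def)
    ultimately show ?thesis by blast
  qed
qed

definition orthonormal :: "nat \<Rightarrow> (nat \<Rightarrow> ell2) \<Rightarrow> bool" where
  "orthonormal n x \<longleftrightarrow> (\<forall>i<n. \<forall>j<n. cinner (x i) (x j) = (if i = j then 1 else 0))"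

lemma norm_minus_projection:
  assumes "orthonormal n x"
  defines "p \<equiv> \<lambda>y. \<Sum>i<n. cscale (cinner y (x i)) (x i)"
  shows "(norm (y - p y))\<^sup>2 = (norm y)\<^sup>2 - (\<Sum>i<n. (cmod (cinner y (x i)))\<^sup>2)"
    and "\<And>i. i < n \<Longrightarrow> cinner (y - p y) (x i) = 0"
proof -
  define S where "S = (\<Sum>i<n. (cmod (cinner y (x i)))\<^sup>2)"
  have pi: "cinner (p y) (x i) = cinner y (x i)" if "i < n" for i
  proof -
    have "cinner (p y) (x i) = (\<Sum>j<n. cinner y (x j) * (if j = i then 1 else 0))"
      unfolding p_def cinner_sum_left cinner_cscale_left
      using assms(1) that by (intro sum.cong) (auto simp: orthonormal_def)
    then show ?thesis using that by (simp add: if_distrib[of "\<lambda>y. _ * y"] cong: if_cong)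
  qed
  show "cinner (y - p y) (x i) = 0" if "i < n" for i
    using that by (simp add: cinner_diff_left pi)
  have S: "complex_of_real S = (\<Sum>i<n. cinner y (x i) * cnj (cinner y (x i)))"
    unfolding S_def of_real_sum complex_norm_square ..
  have "cinner z (p y) = (\<Sum>i<n. cnj (cinner y (x i)) * cinner z (x i))" for z
    by (simp add: p_def cinner_sum_right cinner_cscale_right)
  then have yp: "cinner y (p y) = of_real S" and pp: "cinner (p y) (p y) = of_real S"
    unfolding S by (auto intro!: sum.cong simp: pi)
  have py: "cinner (p y) y = of_real S"
    using yp by (metis cinner_commute complex_cnj_complex_of_real)
  have "complex_of_real ((norm (y - p y))\<^sup>2) = of_real ((norm y)\<^sup>2 - S)"
    unfolding cinner_self[symmetric] of_real_diff
    by (simp only: cinner_diff_left cinner_diff_right yp pp py diff_self diff_zero)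
  then show "(norm (y - p y))\<^sup>2 = (norm y)\<^sup>2 - (\<Sum>i<n. (cmod (cinner y (x i)))\<^sup>2)"
    by (simp only: of_real_eq_iff S_def)
qed

lemma Bessel:
  assumes "orthonormal n x"
  shows "(\<Sum>i<n. (cmod (cinner y (x i)))\<^sup>2) \<le> (norm y)\<^sup>2"
  using norm_minus_projection(1)[OF assms, of y]
  by (smt (verit) zero_le_power2)

lemma orthonormal_extend:
  assumes "orthonormal n x" "\<And>i. i < n \<Longrightarrow> cinner y (x i) = 0" "y \<noteq> 0"
  shows "orthonormal (Suc n) (x(n := cscale (1 / of_real (norm y)) y))"
proof -
  have "cinner (x i) y = 0" if "i < n" for i
    using assms(2)[OF that] by (metis cinner_commute complex_cnj_zero)
  moreover have "cinner y y / (of_real (norm y) * of_real (norm y)) = 1"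
    using assms(3) by (simp add: cinner_self power2_eq_square)
  ultimately show ?thesis
    using assms(1,2) unfolding orthonormal_def
    by (auto simp: less_Suc_eq cinner_cscale_left cinner_cscale_right)
qed

text \<open>Phrased through orthogonal complements instead of spans. A vector already in the span of
  the earlier ones is skipped, so linear dependence among the \<open>v i\<close> is harmless and
  \<open>m\<close> may differ from \<open>n\<close>.\<close>

lemma Gram_Schmidt:
  fixes v :: "nat \<Rightarrow> ell2"
  shows "\<exists>m x. orthonormal m x \<and> (\<forall>y. (\<forall>i<m. cinner y (x i) = 0) \<longrightarrow> (\<forall>i<n. cinner y (v i) = 0))"
proof (induction n)
  case 0
  show ?case by (intro exI[of _ 0]) (auto simp: orthonormal_def)
next
  case (Suc n)
  then obtain m x where x: "orthonormal m x"
    "\<And>y i. (\<forall>i<m. cinner y (x i) = 0) \<Longrightarrow> i < n \<Longrightarrow> cinner y (v i) = 0" by blast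
  define p where "p = (\<Sum>i<m. cscale (cinner (v n) (x i)) (x i))"
  have vp: "cinner y (v n) = cinner y (v n - p)" if "\<forall>i<m. cinner y (x i) = 0" for y
    using that by (simp add: p_def cinner_diff_right cinner_sum_right cinner_cscale_right)
  show ?case
  proof (cases "v n - p = 0")
    case True
    then show ?thesis
      using x vp by (intro exI[of _ m] exI[of _ x]) (auto simp: less_Suc_eq)
  next
    case False
    define z where "z = x(m := cscale (1 / of_real (norm (v n - p))) (v n - p))"
    have "orthonormal (Suc m) z"
      unfolding z_def
      by (rule orthonormal_extend[OF x(1) _ False]) (simp add: p_def norm_minus_projection(2)[OF x(1)])
    moreover have "cinner y (v i) = 0" if y: "\<forall>i<Suc m. cinner y (z i) = 0" and i: "i < Suc n" for y i
    proof -
      have 1: "\<forall>i<m. cinner y (x i) = 0"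
        using y by (metis fun_upd_apply less_Suc_eq nat_neq_iff z_def)
      have "cinner y (z m) = 0" using y by blast
      then have "cinner y (v n - p) = 0"
        using False by (simp add: z_def cinner_cscale_right)
      then show ?thesis
        using 1 x(2) vp i by (metis less_Suc_eq)
    qed
    ultimately show ?thesis by blast
  qed
qed

text \<open>For compact \<open>K\<close> this says \<open>s\<^bsub>n+1\<^esub>(K) \<le> t\<close>, by the minimax principle.\<close>

definition codim_bound :: "(ell2 \<Rightarrow> ell2) \<Rightarrow> real \<Rightarrow> nat \<Rightarrow> bool" where
  "codim_bound K t n \<longleftrightarrow> (\<exists>v. \<forall>x. (\<forall>i<n. cinner x (v i) = 0) \<longrightarrow> norm (K x) \<le> t * norm x)"

lemma codim_bound_mono:
  assumes "codim_bound K s m" "s \<le> t" "m \<le> n"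
  shows "codim_bound K t n"
proof -
  obtain v where "\<And>x. (\<forall>i<m. cinner x (v i) = 0) \<Longrightarrow> norm (K x) \<le> s * norm x"
    using assms(1) by (auto simp: codim_bound_def)
  moreover have "s * norm x \<le> t * norm x" for x :: ell2
    using assms(2) by (simp add: mult_right_mono)
  ultimately show ?thesis
    unfolding codim_bound_def using assms(3) by (meson order.trans order.strict_trans2)
qed

text \<open>Weyl's inequality for the singular values of a sum: concatenating the two lists of
  vectors makes both estimates hold at once.\<close>

lemma codim_bound_add:
  assumes "codim_bound A s p" "codim_bound B t q"
  shows "codim_bound (\<lambda>x. A x + B x) (s + t) (p + q)"
proof -
  obtain v w where v: "\<And>x. (\<forall>i<p. cinner x (v i) = 0) \<Longrightarrow> norm (A x) \<le> s * norm x"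
    and w: "\<And>x. (\<forall>i<q. cinner x (w i) = 0) \<Longrightarrow> norm (B x) \<le> t * norm x"
    using assms by (auto simp: codim_bound_def)
  define u where "u i = (if i < p then v i else w (i - p))" for i
  have "norm (A x + B x) \<le> (s + t) * norm x" if u: "\<forall>i<p+q. cinner x (u i) = 0" for x
  proof -
    have "cinner x (v i) = 0" if "i < p" for i
      using u[rule_format, of i] that by (simp add: u_def)
    moreover have "cinner x (w i) = 0" if "i < q" for i
      using u[rule_format, of "p + i"] that by (simp add: u_def)
    ultimately show ?thesis
      using v[of x] w[of x] norm_triangle_ineq[of "A x" "B x"] by (simp add: distrib_right)
  qed
  then show ?thesis unfolding codim_bound_def by blast
qed

lemma codim_bound_norm:
  assumes "\<And>x. norm (A x) \<le> t * norm x"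
  shows "codim_bound A t 0"
  using assms by (auto simp: codim_bound_def)

text \<open>A failure of \<open>codim_bound A (T i) i\<close> defeats every list of \<open>i\<close>
  vectors, in particular the \<open>i\<close> vectors already chosen, so the next one can be taken
  orthogonal to all of them.\<close>

lemma greedy_orthonormal:
  assumes "bounded_op A" "\<And>i. i < n \<Longrightarrow> \<not> codim_bound A (T i) i"
  shows "\<exists>x. orthonormal n x \<and> (\<forall>i<n. T i < norm (A (x i)))"
  using assms(2)
proof (induction n)
  case 0
  then show ?case by (auto simp: orthonormal_def)
next
  case (Suc n)
  then obtain x where x: "orthonormal n x" "\<And>i. i < n \<Longrightarrow> T i < norm (A (x i))" by auto
  have "\<not> codim_bound A (T n) n" using Suc.prems by simp
  then obtain y where y: "\<And>i. i < n \<Longrightarrow> cinner y (x i) = 0" "T n * norm y < norm (A y)"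
    unfolding codim_bound_def by (metis not_le)
  have "y \<noteq> 0" using y(2) bounded_op_zero[OF assms(1)] by auto
  define z where "z = x(n := cscale (1 / of_real (norm y)) y)"
  have "orthonormal (Suc n) z"
    unfolding z_def by (rule orthonormal_extend[OF x(1) y(1) \<open>y \<noteq> 0\<close>])
  moreover have "T i < norm (A (z i))" if "i < Suc n" for i
    using that x(2) y(2) \<open>y \<noteq> 0\<close>
    by (auto simp: z_def less_Suc_eq bounded_op_cscale[OF assms(1)] norm_divide field_simps)
  ultimately show ?case by blast
qed

text \<open>After exchanging the sums over \<open>i\<close> and over coordinates, Bessel's
  inequality bounds the contribution of each coordinate by the squared norm of the corresponding
  row.\<close>

lemma Hilbert_Schmidt_sum_le:
  assumes "has_matrix A m" "\<And>n. (\<Sum>k<n. \<Sum>j<n. (cmod (m j k))\<^sup>2) \<le> H" "orthonormal n x"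
  shows "(\<Sum>i<n. (norm (A (x i)))\<^sup>2) \<le> H"
proof -
  obtain r where r: "\<And>k x. coord (A x) k = cinner x (r k)" "\<And>k j. coord (r k) j = cnj (m j k)"
    using coord_has_matrix[OF assms(1)] by blast
  \<comment> \<open>The hypothesis concerns square sections only. Letting the row length grow first,
    with the number of rows fixed, turns it into a bound for sums of full rows.\<close>
  have row: "(\<lambda>J. \<Sum>j<J. (cmod (m j k))\<^sup>2) \<longlonglongrightarrow> (norm (r k))\<^sup>2" for k
    using summable_LIMSEQ[OF summable_coord[of "r k"]] by (simp add: norm_square_ell2 r(2))
  have rows: "(\<Sum>k<K. (norm (r k))\<^sup>2) \<le> H" for K
  proof (rule LIMSEQ_le_const2)
    show "(\<lambda>J. \<Sum>k<K. \<Sum>j<J. (cmod (m j k))\<^sup>2) \<longlonglongrightarrow> (\<Sum>k<K. (norm (r k))\<^sup>2)"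
      by (intro tendsto_sum row)
    have "(\<Sum>k<K. \<Sum>j<J. (cmod (m j k))\<^sup>2) \<le> H" if "J \<ge> K" for J
    proof -
      have "(\<Sum>k<K. \<Sum>j<J. (cmod (m j k))\<^sup>2) \<le> (\<Sum>k<J. \<Sum>j<J. (cmod (m j k))\<^sup>2)"
        using that by (intro sum_mono2) (auto intro: sum_nonneg)
      then show ?thesis using assms(2)[of J] by linarith
    qed
    then show "\<exists>N. \<forall>J\<ge>N. (\<Sum>k<K. \<Sum>j<J. (cmod (m j k))\<^sup>2) \<le> H" by blast
  qed
  show ?thesis
  proof (rule LIMSEQ_le_const2)
    show "(\<lambda>K. \<Sum>i<n. \<Sum>k<K. (cmod (coord (A (x i)) k))\<^sup>2) \<longlonglongrightarrow> (\<Sum>i<n. (norm (A (x i)))\<^sup>2)"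
      using summable_LIMSEQ[OF summable_coord] by (intro tendsto_sum) (simp add: norm_square_ell2)
    have "(\<Sum>i<n. \<Sum>k<K. (cmod (coord (A (x i)) k))\<^sup>2) \<le> H" for K
    proof -
      have "(\<Sum>i<n. \<Sum>k<K. (cmod (coord (A (x i)) k))\<^sup>2) = (\<Sum>k<K. \<Sum>i<n. (cmod (cinner (r k) (x i)))\<^sup>2)"
      proof -
        have "cmod (coord (A (x i)) k) = cmod (cinner (r k) (x i))" for i k
          using cinner_commute[of "x i" "r k"] by (simp add: r(1))
        then show ?thesis by (subst sum.swap) simp
      qed
      also have "\<dots> \<le> (\<Sum>k<K. (norm (r k))\<^sup>2)"
        by (intro sum_mono Bessel assms)
      finally show ?thesis using rows[of K] by linarith
    qed
    then show "\<exists>N. \<forall>K\<ge>N. (\<Sum>i<n. \<Sum>k<K. (cmod (coord (A (x i)) k))\<^sup>2) \<le> H" by blast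
  qed
qed

text \<open>A threshold form of the inequality between the sum of squared singular values and the
  squared Hilbert-Schmidt norm: a failing bound at index \<open>i\<close> means that the singular
  value of that index exceeds \<open>T i\<close>. Constant thresholds give Chebyshev's inequality,
  variable ones the layer-cake estimate \<open>count_above_mass\<close>.\<close>

lemma Hilbert_Schmidt_count:
  assumes "has_matrix A m" "\<And>n. (\<Sum>k<n. \<Sum>j<n. (cmod (m j k))\<^sup>2) \<le> H"
    and "\<And>i. i < n \<Longrightarrow> 0 \<le> T i" "\<And>i. i < n \<Longrightarrow> \<not> codim_bound A (T i) i"
  shows "(\<Sum>i<n. (T i)\<^sup>2) \<le> H"
proof -
  obtain x where x: "orthonormal n x" "\<And>i. i < n \<Longrightarrow> T i < norm (A (x i))"
    using greedy_orthonormal[of A n T] assms by (auto simp: has_matrix_def)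
  have "(\<Sum>i<n. (T i)\<^sup>2) \<le> (\<Sum>i<n. (norm (A (x i)))\<^sup>2)"
    using x(2) assms(3) by (intro sum_mono power_mono) (auto intro: less_imp_le)
  also have "\<dots> \<le> H" by (rule Hilbert_Schmidt_sum_le[OF assms(1,2) x(1)])
  finally show ?thesis .
qed

text \<open>Chebyshev's inequality: every singular value above \<open>t\<close> uses up at least
  \<open>t\<^sup>2\<close> of \<open>H\<close>. It converts a Hilbert-Schmidt bound uniform in N
  into a number of exceptional directions uniform in N.\<close>

lemma Hilbert_Schmidt_codim_bound:
  assumes "has_matrix A m" "\<And>n. (\<Sum>k<n. \<Sum>j<n. (cmod (m j k))\<^sup>2) \<le> H" "t > 0"
  shows "\<exists>q. real q \<le> H / t\<^sup>2 \<and> codim_bound A t q"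
proof (rule ccontr)
  assume contra: "\<not> ?thesis"
  have "H \<ge> 0" using assms(2)[of 0] by simp
  \<comment> \<open>All indices below \<open>n\<close> are admissible values of \<open>q\<close>, so
    in the contrary case the bound fails at each of them; their number \<open>n\<close> just exceeds
    what \<open>H\<close> allows.\<close>
  define n where "n = nat \<lfloor>H / t\<^sup>2\<rfloor> + 1"
  have "0 \<le> H / t\<^sup>2" using \<open>H \<ge> 0\<close> by simp
  then have "real i \<le> H / t\<^sup>2" if "i < n" for i
    using that unfolding n_def by linarith
  then have "(\<Sum>i<n. t\<^sup>2) \<le> H"
    using contra assms(3) by (intro Hilbert_Schmidt_count[OF assms(1,2)]) auto
  then have "real n \<le> H / t\<^sup>2"
    using assms(3) by (simp add: field_simps)
  then show False
    unfolding n_def by linarith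
qed

text \<open>A diagonal subsequence converges in every coordinate. The norm bound keeps the limit in
  the space, and cutting off \<open>y\<close>, whose tail is uniformly negligible on the ball of
  radius \<open>B\<close>, passes from coordinates to all functionals.\<close>

lemma ell2_weak_compactness:
  fixes x :: "nat \<Rightarrow> ell2"
  assumes "\<And>n. norm (x n) \<le> B"
  obtains r z where "strict_mono r" "norm z \<le> B" "\<And>y. (\<lambda>n. cinner (x (r n)) y) \<longlonglongrightarrow> cinner z y"
proof -
  have B: "B \<ge> 0" using assms[of 0] norm_ge_zero order_trans by blast
  have "\<And>n k. k \<in> (UNIV :: nat set) \<Longrightarrow> norm (coord (x n) k) \<le> B"
    using assms cmod_coord_le order_trans by blast
  then obtain r where r: "strict_mono r" "\<And>k. \<exists>l. (\<lambda>n. coord (x (r n)) k) \<longlonglongrightarrow> l"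
    using function_convergent_subsequence[of "UNIV :: nat set" "\<lambda>n k. coord (x n) k" B]
    by (metis UNIV_I countableI_type)
  then obtain f where f: "\<And>k. (\<lambda>n. coord (x (r n)) k) \<longlonglongrightarrow> f k" by metis
  have "(\<Sum>i<K. (cmod (f i))\<^sup>2) \<le> B\<^sup>2" for K
  proof (rule LIMSEQ_le_const2)
    show "(\<lambda>n. \<Sum>i<K. (cmod (coord (x (r n)) i))\<^sup>2) \<longlonglongrightarrow> (\<Sum>i<K. (cmod (f i))\<^sup>2)"
      by (intro tendsto_intros f)
    have "(\<Sum>i<K. (cmod (coord (x (r n)) i))\<^sup>2) \<le> B\<^sup>2" for n
      using sum_coord_le[of "x (r n)" K] power_mono[OF assms[of "r n"], of 2] by simp
    then show "\<exists>N. \<forall>n\<ge>N. (\<Sum>i<K. (cmod (coord (x (r n)) i))\<^sup>2) \<le> B\<^sup>2" by blast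
  qed
  then obtain z where z: "coord z = f" "(norm z)\<^sup>2 \<le> B\<^sup>2" by (rule ell2_of_bound)
  have nz: "norm z \<le> B" using z(2) B by (rule power2_le_imp_le)
  have "(\<lambda>n. cinner (x (r n)) y) \<longlonglongrightarrow> cinner z y" for y
  proof (rule LIMSEQ_I)
    fix e :: real assume e: "e > 0"
    have "eventually (\<lambda>k. norm (trunc k y - y) < e / (4 * (B + 1))) sequentially"
      using trunc_tendsto[of y] e B by (auto dest!: tendstoD[where e = "e / (4 * (B + 1))"] simp: dist_norm)
    then obtain k where k: "norm (trunc k y - y) < e / (4 * (B + 1))"
      by (auto simp: eventually_sequentially)
    have "cinner w (trunc k y) = (\<Sum>j<k. cnj (coord y j) * coord w j)" for w
      by (simp add: trunc_def cinner_sum_right cinner_cscale_right)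
    moreover have "(\<lambda>n. \<Sum>j<k. cnj (coord y j) * coord (x (r n)) j) \<longlonglongrightarrow> (\<Sum>j<k. cnj (coord y j) * coord z j)"
      unfolding z by (intro tendsto_intros f)
    ultimately have "(\<lambda>n. cinner (x (r n)) (trunc k y)) \<longlonglongrightarrow> cinner z (trunc k y)" by simp
    from LIMSEQ_D[OF this, of "e / 2"] e obtain N where
      N: "\<And>n. n \<ge> N \<Longrightarrow> cmod (cinner (x (r n)) (trunc k y) - cinner z (trunc k y)) < e / 2" by auto
    have "cmod (cinner (x (r n)) y - cinner z y) < e" if "n \<ge> N" for n
    proof -
      have tail: "cmod (cinner w (trunc k y - y)) \<le> e / 4" if "norm w \<le> B" for w
      proof -
        have "cmod (cinner w (trunc k y - y)) \<le> norm w * norm (trunc k y - y)"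
          by (rule cinner_bound)
        also have "\<dots> \<le> B * (e / (4 * (B + 1)))"
          using that k B by (intro mult_mono) auto
        also have "\<dots> \<le> e / 4"
          using B e by (simp add: field_simps)
        finally show ?thesis .
      qed
      have "cinner (x (r n)) y - cinner z y = (cinner (x (r n)) (trunc k y) - cinner z (trunc k y))
          - cinner (x (r n)) (trunc k y - y) + cinner z (trunc k y - y)"
        by (simp add: cinner_diff_right)
      also have "cmod \<dots> \<le> cmod (cinner (x (r n)) (trunc k y) - cinner z (trunc k y))
          + cmod (cinner (x (r n)) (trunc k y - y)) + cmod (cinner z (trunc k y - y))"
        by (meson add_mono norm_triangle_ineq norm_triangle_ineq4 order_refl order_trans)
      finally show ?thesis
        using tail[OF assms[of "r n"]] tail[OF nz] N[OF that] by linarith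
    qed
    then show "\<exists>N. \<forall>n\<ge>N. norm (cinner (x (r n)) y - cinner z y) < e" by auto
  qed
  then show ?thesis using that r(1) nz by blast
qed

text \<open>Equivalent to compactness: it says that \<open>K\<close> is a norm limit of operators of finite rank.\<close>

definition compact_op :: "(ell2 \<Rightarrow> ell2) \<Rightarrow> bool" where
  "compact_op K \<longleftrightarrow> (\<forall>t>0. \<exists>n. codim_bound K t n)"

text \<open>The directions on which \<open>K\<close> may be large span a finite-dimensional space,
  where weak convergence is norm convergence; on its complement \<open>K\<close> is at most
  \<open>t\<close>, chosen so that \<open>t * B\<close> is at most half of \<open>e\<close>.\<close>

lemma compact_op_tendsto:
  assumes K: "bounded_op K" "compact_op K" and d: "\<And>n. norm (d n) \<le> B"
    and weak: "\<And>y. (\<lambda>n. cinner (d n) y) \<longlonglongrightarrow> 0"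
  shows "(\<lambda>n. K (d n)) \<longlonglongrightarrow> 0"
proof (rule LIMSEQ_I)
  fix e :: real assume e: "e > 0"
  have B: "B \<ge> 0" using d[of 0] norm_ge_zero order_trans by blast
  define t where "t = e / (2 * (B + 1))"
  have "t > 0" using e B by (simp add: t_def)
  then obtain q :: nat and v where v: "\<And>x. (\<forall>i<q. cinner x (v i) = 0) \<Longrightarrow> norm (K x) \<le> t * norm x"
    using K(2) unfolding compact_op_def codim_bound_def by (metis (no_types, lifting))
  obtain m u where u: "orthonormal m u" "\<And>y. (\<forall>i<m. cinner y (u i) = 0) \<Longrightarrow> (\<forall>i<q. cinner y (v i) = 0)"
    using Gram_Schmidt[of q v] by blast
  define p where "p y = (\<Sum>i<m. cscale (cinner y (u i)) (u i))" for y
  have Kp: "K (p y) = (\<Sum>i<m. cscale (cinner y (u i)) (K (u i)))" for y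
    by (simp add: p_def bounded_op_sum[OF K(1)] bounded_op_cscale[OF K(1)])
  have "(\<lambda>n. \<Sum>i<m. cmod (cinner (d n) (u i)) * norm (K (u i))) \<longlonglongrightarrow> (\<Sum>i<m. cmod 0 * norm (K (u i)))"
    by (intro tendsto_intros weak)
  then have "(\<lambda>n. \<Sum>i<m. cmod (cinner (d n) (u i)) * norm (K (u i))) \<longlonglongrightarrow> 0"
    by simp
  from LIMSEQ_D[OF this, of "e / 2"] e obtain N where
    N: "\<And>n. n \<ge> N \<Longrightarrow> (\<Sum>i<m. cmod (cinner (d n) (u i)) * norm (K (u i))) < e / 2"
    by (auto simp: abs_of_nonneg sum_nonneg)
  have "norm (K (d n)) < e" if "n \<ge> N" for n
  proof -
    have "norm (K (p (d n))) \<le> (\<Sum>i<m. cmod (cinner (d n) (u i)) * norm (K (u i)))"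
      unfolding Kp by (rule order_trans[OF norm_sum]) simp
    then have 1: "norm (K (p (d n))) < e / 2" using N[OF that] by simp
    have "(norm (d n - p (d n)))\<^sup>2 \<le> (norm (d n))\<^sup>2"
      unfolding p_def norm_minus_projection(1)[OF u(1)] by (simp add: sum_nonneg)
    then have "norm (d n - p (d n)) \<le> norm (d n)"
      by (rule power2_le_imp_le) simp
    then have "norm (d n - p (d n)) \<le> B" using d[of n] by linarith
    then have le: "t * norm (d n - p (d n)) \<le> t * B"
      using \<open>t > 0\<close> by simp
    have "\<forall>i<m. cinner (d n - p (d n)) (u i) = 0"
      using norm_minus_projection(2)[OF u(1)] by (simp add: p_def)
    then have "norm (K (d n - p (d n))) \<le> t * norm (d n - p (d n))"
      using v u(2) by blast
    also note le
    also have "t * B \<le> e / 2"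
      using B e by (simp add: t_def field_simps)
    finally have 2: "norm (K (d n - p (d n))) \<le> e / 2" .
    have "K (d n) = K (p (d n)) + K (d n - p (d n))"
      by (simp add: bounded_op_diff[OF K(1)])
    then show ?thesis
      using 1 2 norm_triangle_ineq[of "K (p (d n))" "K (d n - p (d n))"] by simp
  qed
  then show "\<exists>N. \<forall>n\<ge>N. norm (K (d n) - 0) < e" by auto
qed

section \<open>Singular spaces and the minimax principle\<close>

context
  fixes K assumes K: "bounded_op K"
begin

lemma cinner_adjoint_self: "cinner (hilbert_adjoint K (K x)) y = cinner (K x) (K y)"
  by (rule hilbert_adjoint_left[OF K])

lemma norm_square_adjoint: "complex_of_real ((norm (K x))\<^sup>2) = cinner (hilbert_adjoint K (K x)) x"
  by (simp only: cinner_adjoint_self cinner_self)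

lemma singular_space_subspace: "cvec.subspace (singular_space K s)"
proof (rule cvec.subspaceI)
  show "0 \<in> singular_space K s"
    using hilbert_adjoint_cscale[OF K, of 0 0] by (simp add: singular_space_def bounded_op_zero[OF K])
  show "x + y \<in> singular_space K s" if "x \<in> singular_space K s" "y \<in> singular_space K s" for x y
    using that by (simp add: singular_space_def bounded_op_add[OF K] hilbert_adjoint_add[OF K] cvec.scale_right_distrib)
  show "cscale c x \<in> singular_space K s" if "x \<in> singular_space K s" for c x
    using that by (simp add: singular_space_def bounded_op_cscale[OF K] hilbert_adjoint_cscale[OF K] mult.commute)
qed

lemma singular_space_orthogonal:
  assumes "x \<in> singular_space K s" "y \<in> singular_space K s'" "s \<noteq> s'" "s \<ge> 0" "s' \<ge> 0"
  shows "cinner x y = 0"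
proof -
  have "of_real (s\<^sup>2) * cinner x y = cinner (K x) (K y)"
    using assms(1) cinner_adjoint_self[of x y] by (simp add: singular_space_def cinner_cscale_left)
  also have "\<dots> = cinner x (hilbert_adjoint K (K y))"
    by (rule hilbert_adjoint[OF K])
  also have "\<dots> = of_real (s'\<^sup>2) * cinner x y"
    using assms(2) by (simp add: singular_space_def cinner_cscale_right)
  finally have "complex_of_real (s\<^sup>2 - s'\<^sup>2) * cinner x y = 0"
    by (simp add: algebra_simps)
  moreover have "s\<^sup>2 \<noteq> s'\<^sup>2"
    using assms(3-5) by (simp add: power2_eq_iff_nonneg)
  ultimately show ?thesis
    by (metis eq_iff_diff_eq_0 mult_eq_0_iff of_real_eq_0_iff)
qed

text \<open>With more than \<open>n\<close> independent singular vectors, a nonzero combination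
  \<open>x\<close> would be orthogonal to all \<open>v i\<close>, whence
  \<open>norm (K x) \<le> t * norm x\<close>. But the components of \<open>x\<close> for different
  \<open>s\<close> are orthogonal, and so are their images, so \<open>K\<close> stretches
  \<open>x\<close> by more than \<open>t\<close>.\<close>

lemma card_singular_vectors_le:
  assumes t: "0 \<le> t" and n: "codim_bound K t n"
    and S: "finite S" "\<And>s. s \<in> S \<Longrightarrow> s > t"
    and B: "\<And>s. s \<in> S \<Longrightarrow> finite (B s)" "\<And>s. s \<in> S \<Longrightarrow> B s \<subseteq> singular_space K s"
      "\<And>s. s \<in> S \<Longrightarrow> cvec.independent (B s)"
  shows "(\<Sum>s\<in>S. card (B s)) \<le> n"
proof (rule ccontr)
  assume contra: "\<not> (\<Sum>s\<in>S. card (B s)) \<le> n"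
  obtain v where v: "\<And>x. (\<forall>i<n. cinner x (v i) = 0) \<Longrightarrow> norm (K x) \<le> t * norm x"
    using n by (auto simp: codim_bound_def)
  define J where "J = (SIGMA s:S. B s)"
  have "finite J" "card {..<n} < card J"
    using S B contra by (auto simp: J_def)
  from homogeneous_system[OF _ this, of "\<lambda>i p. cinner (snd p) (v i)"] obtain a where
    a: "\<exists>p\<in>J. a p \<noteq> 0" "\<And>i. i < n \<Longrightarrow> (\<Sum>p\<in>J. a p * cinner (snd p) (v i)) = 0" by auto
  define y where "y s = (\<Sum>b\<in>B s. cscale (a (s, b)) b)" for s
  define x where "x = (\<Sum>s\<in>S. y s)"
  have x_eq: "x = (\<Sum>p\<in>J. cscale (a p) (snd p))"
    unfolding x_def y_def J_def using S(1) B(1) by (subst sum.Sigma) (auto intro!: sum.cong)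
  have "norm (K x) \<le> t * norm x"
  proof (rule v, intro allI impI)
    fix i assume "i < n"
    then show "cinner x (v i) = 0"
      using a(2) by (simp add: x_eq cinner_sum_left cinner_cscale_left)
  qed
  moreover have y: "y s \<in> singular_space K s" if "s \<in> S" for s
    unfolding y_def using B(2)[OF that]
    by (intro cvec.subspace_sum[OF singular_space_subspace] cvec.subspace_scale[OF singular_space_subspace]) auto
  have Ay: "hilbert_adjoint K (K (y s)) = cscale (of_real (s\<^sup>2)) (y s)" if "s \<in> S" for s
    using y[OF that] by (simp add: singular_space_def)
  have orth: "cinner (y s) (y s') = (if s = s' then of_real ((norm (y s))\<^sup>2) else 0)"
    if "s \<in> S" "s' \<in> S" for s s'
    using singular_space_orthogonal[OF y y, OF that] S(2)[OF that(1)] S(2)[OF that(2)] t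
    by (auto simp: cinner_self)
  have nx: "(norm x)\<^sup>2 = (\<Sum>s\<in>S. (norm (y s))\<^sup>2)"
  proof -
    have "complex_of_real ((norm x)\<^sup>2) = (\<Sum>s\<in>S. \<Sum>s'\<in>S. cinner (y s) (y s'))"
      by (simp only: cinner_self[symmetric] x_def cinner_sum_left cinner_sum_right)
        (rule sum.swap)
    also have "\<dots> = (\<Sum>s\<in>S. \<Sum>s'\<in>S. if s = s' then of_real ((norm (y s))\<^sup>2) else 0)"
      by (intro sum.cong refl orth)
    also have "\<dots> = of_real (\<Sum>s\<in>S. (norm (y s))\<^sup>2)"
      using S(1) by (simp del: of_real_power)
    finally show ?thesis by (simp only: of_real_eq_iff)
  qed
  have nKx: "(norm (K x))\<^sup>2 = (\<Sum>s\<in>S. s\<^sup>2 * (norm (y s))\<^sup>2)"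
  proof -
    have "cinner (K (y s)) (K (y s')) = of_real (s\<^sup>2) * cinner (y s) (y s')" if "s \<in> S" for s s'
      using cinner_adjoint_self[of "y s" "y s'"] Ay[OF that] by (simp add: cinner_cscale_left)
    moreover have "complex_of_real ((norm (K x))\<^sup>2) = (\<Sum>s\<in>S. \<Sum>s'\<in>S. cinner (K (y s)) (K (y s')))"
      by (simp only: cinner_self[symmetric] x_def bounded_op_sum[OF K] cinner_sum_left cinner_sum_right)
        (rule sum.swap)
    ultimately have "complex_of_real ((norm (K x))\<^sup>2) = (\<Sum>s\<in>S. \<Sum>s'\<in>S. of_real (s\<^sup>2) * cinner (y s) (y s'))"
      by simp
    also have "\<dots> = (\<Sum>s\<in>S. \<Sum>s'\<in>S. if s = s' then of_real (s\<^sup>2 * (norm (y s))\<^sup>2) else 0)"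
      by (intro sum.cong refl) (simp add: orth)
    also have "\<dots> = of_real (\<Sum>s\<in>S. s\<^sup>2 * (norm (y s))\<^sup>2)"
      using S(1) by (simp del: of_real_power of_real_mult)
    finally show ?thesis by (simp only: of_real_eq_iff)
  qed
  obtain s b where sb: "s \<in> S" "b \<in> B s" "a (s, b) \<noteq> 0"
    using a(1) by (auto simp: J_def)
  have "y s \<noteq> 0"
    using cvec.independentD[OF B(3)[OF sb(1)] B(1)[OF sb(1)] order_refl, of "\<lambda>b. a (s, b)" b] sb
    by (auto simp: y_def)
  have "t\<^sup>2 * (norm x)\<^sup>2 < (norm (K x))\<^sup>2"
    unfolding nx nKx sum_distrib_left
  proof (rule sum_strict_mono_ex1[OF S(1)])
    show "\<forall>s\<in>S. t\<^sup>2 * (norm (y s))\<^sup>2 \<le> s\<^sup>2 * (norm (y s))\<^sup>2"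
      using S(2) t by (intro ballI mult_right_mono power_mono) (auto intro: less_imp_le)
    have "t\<^sup>2 < s\<^sup>2" using S(2)[OF sb(1)] t by (intro power_strict_mono) auto
    then show "\<exists>s\<in>S. t\<^sup>2 * (norm (y s))\<^sup>2 < s\<^sup>2 * (norm (y s))\<^sup>2"
      using \<open>y s \<noteq> 0\<close> sb(1) by (intro bexI[of _ s]) auto
  qed
  then have "(t * norm x)\<^sup>2 < (norm (K x))\<^sup>2" by (simp add: power_mult_distrib)
  moreover have "(norm (K x))\<^sup>2 \<le> (t * norm x)\<^sup>2"
    using \<open>norm (K x) \<le> t * norm x\<close> by (intro power_mono) auto
  ultimately show False by linarith
qed

text \<open>By convention a sum over an infinite set is 0, and so is the dimension of an
  infinite-dimensional space; \<open>sing_count\<close> has its intended meaning only once both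
  cases are excluded. The finite spanning sets of the second claim serve as the list of vectors for
  the converse bound.\<close>

lemma sing_count_le:
  assumes t: "0 \<le> t" and n: "codim_bound K t n"
  defines "S \<equiv> {s. s > t \<and> singular_space K s \<noteq> {0}}"
  shows "sing_count t K \<le> n"
    and "\<exists>B. finite S \<and> (\<forall>s\<in>S. finite (B s) \<and> singular_space K s \<subseteq> cvec.span (B s)) \<and>
           (\<Sum>s\<in>S. card (B s)) = sing_count t K"
proof -
  have finS: "finite S"
  proof (rule ccontr)
    assume "infinite S"
    then obtain S' where S': "finite S'" "card S' = Suc n" "S' \<subseteq> S"
      by (metis infinite_arbitrarily_large)
    have "\<exists>b. b \<in> singular_space K s \<and> b \<noteq> 0" if "s \<in> S" for s
      using that cvec.subspace_0[OF singular_space_subspace[of s]] by (auto simp: S_def)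
    then obtain b where b: "\<And>s. s \<in> S \<Longrightarrow> b s \<in> singular_space K s \<and> b s \<noteq> 0" by metis
    have "(\<Sum>s\<in>S'. card {b s}) \<le> n"
      using b S'(3) by (intro card_singular_vectors_le[OF t n S'(1)]) (fastforce simp: S_def)+
    then show False using S' by simp
  qed
  define B where "B s = (SOME B. B \<subseteq> singular_space K s \<and> cvec.independent B \<and>
      singular_space K s \<subseteq> cvec.span B \<and> card B = cvec.dim (singular_space K s))" for s
  have B: "B s \<subseteq> singular_space K s \<and> cvec.independent (B s) \<and>
      singular_space K s \<subseteq> cvec.span (B s) \<and> card (B s) = cvec.dim (singular_space K s)" for s
    unfolding B_def by (rule someI_ex) (use cvec.basis_exists in metis)
  have finB: "finite (B s)" if "s \<in> S" for s
  proof (rule ccontr)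
    assume "infinite (B s)"
    then obtain B' where B': "finite B'" "card B' = Suc n" "B' \<subseteq> B s"
      by (metis infinite_arbitrarily_large)
    have "cvec.independent B'"
      using cvec.independent_mono B[of s] B'(3) by blast
    then have "(\<Sum>s\<in>{s}. card B') \<le> n"
      using B[of s] B' that by (intro card_singular_vectors_le[OF t n]) (auto simp: S_def)
    then show False using B' by simp
  qed
  have eq: "(\<Sum>s\<in>S. card (B s)) = sing_count t K"
    unfolding sing_count_def S_def using B by (intro sum.cong) auto
  have "(\<Sum>s\<in>S. card (B s)) \<le> n"
    using B finB by (intro card_singular_vectors_le[OF t n finS]) (auto simp: S_def)
  then show "sing_count t K \<le> n" using eq by simp
  show "\<exists>B. finite S \<and> (\<forall>s\<in>S. finite (B s) \<and> singular_space K s \<subseteq> cvec.span (B s)) \<and>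
           (\<Sum>s\<in>S. card (B s)) = sing_count t K"
    using eq B finB finS by blast
qed

text \<open>The equality case of Cauchy-Schwarz. With \<open>z\<close> the image of \<open>x\<close>
  under the adjoint times \<open>K\<close>, one has \<open>norm z \<le> r\<^sup>2\<close> while the
  product of \<open>z\<close> and \<open>x\<close> equals \<open>r\<^sup>2\<close>, which leaves no
  room for \<open>z\<close> to differ from \<open>r\<^sup>2\<close> times \<open>x\<close>.\<close>

lemma singular_vector_of_maximum:
  assumes W: "\<And>x. x \<in> W \<Longrightarrow> hilbert_adjoint K (K x) \<in> W"
    and r: "\<And>x. x \<in> W \<Longrightarrow> norm (K x) \<le> r * norm x"
    and x: "x \<in> W" "norm (K x) = r" "norm x = 1"
  shows "x \<in> singular_space K r"
proof -
  define z where "z = hilbert_adjoint K (K x)"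
  have "r \<ge> 0" using x(2) norm_ge_zero by metis
  have "cmod (of_real ((norm z)\<^sup>2)) = cmod (cinner (K x) (K z))"
    by (simp only: cinner_self[symmetric] z_def cinner_adjoint_self)
  also have "\<dots> \<le> norm (K x) * norm (K z)" by (rule cinner_bound)
  also have "\<dots> \<le> r * (r * norm z)"
    using x r[OF W[OF x(1)]] \<open>r \<ge> 0\<close> by (auto simp: z_def intro: mult_left_mono)
  finally have "(norm z)\<^sup>2 \<le> r\<^sup>2 * norm z"
    by (simp only: norm_of_real) (simp add: power2_eq_square)
  then have "norm z \<le> r\<^sup>2"
    by (cases "norm z = 0") (auto simp: power2_eq_square mult_le_cancel_right)
  have zx: "cinner z x = of_real (r\<^sup>2)"
    using norm_square_adjoint[of x] x(2) by (simp add: z_def)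
  have xz: "cinner x z = of_real (r\<^sup>2)"
    using zx by (metis cinner_commute complex_cnj_complex_of_real)
  have xx: "cinner x x = 1" using x(3) by (simp add: cinner_self)
  have "complex_of_real ((norm (z - cscale (of_real (r\<^sup>2)) x))\<^sup>2) = of_real ((norm z)\<^sup>2 - r\<^sup>2 * r\<^sup>2)"
    unfolding cinner_self[symmetric] of_real_diff of_real_mult
    by (simp add: cinner_diff_left cinner_diff_right cinner_cscale_left cinner_cscale_right zx xz xx
        del: of_real_power)
  then have "(norm (z - cscale (of_real (r\<^sup>2)) x))\<^sup>2 = (norm z)\<^sup>2 - r\<^sup>2 * r\<^sup>2"
    by (simp only: of_real_eq_iff)
  also have "\<dots> \<le> 0"
    using mult_mono[OF \<open>norm z \<le> r\<^sup>2\<close> \<open>norm z \<le> r\<^sup>2\<close>] by (simp add: power2_eq_square[of "norm z"])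
  finally show ?thesis
    by (simp add: singular_space_def z_def[symmetric])
qed

text \<open>A weak limit of a maximizing sequence stays in \<open>W\<close>, which is cut out by
  continuous functionals, and by compactness the images converge in norm. Since the supremum exceeds
  \<open>t \<ge> 0\<close>, the limit cannot have norm below 1.\<close>

lemma compact_op_attains:
  assumes cpt: "compact_op K" and t: "t \<ge> 0"
    and W: "W = {x. \<forall>i\<in>I. cinner x (v i) = 0}"
    and ex: "\<exists>x\<in>W. t * norm x < norm (K x)"
  shows "\<exists>r>t. \<exists>x\<in>W. norm x = 1 \<and> norm (K x) = r \<and> (\<forall>x\<in>W. norm (K x) \<le> r * norm x)"
proof -
  define R where "R = {norm (K x) | x. x \<in> W \<and> norm x \<le> 1}"
  define r where "r = Sup R"
  have scale: "cscale c x \<in> W" if "x \<in> W" for c x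
    using that by (simp add: W cinner_cscale_left)
  have bdd: "bdd_above R"
  proof (rule bdd_aboveI)
    fix y assume "y \<in> R"
    then obtain x where "y = norm (K x)" "norm x \<le> 1" by (auto simp: R_def)
    then show "y \<le> onorm K"
      using bounded_op_norm_le[OF K, of x] onorm_bounded_op_nonneg[OF K] mult_left_mono[of "norm x" 1 "onorm K"] by auto
  qed
  have r: "norm (K x) \<le> r * norm x" if "x \<in> W" for x
  proof (cases "x = 0")
    case False
    have "norm (K (cscale (1 / of_real (norm x)) x)) \<in> R"
      using False scale[OF that] by (auto simp: R_def norm_divide)
    then have "norm (K (cscale (1 / of_real (norm x)) x)) \<le> r"
      unfolding r_def by (rule cSup_upper[OF _ bdd])
    then show ?thesis
      using False by (simp add: bounded_op_cscale[OF K] norm_divide field_simps)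
  qed (simp add: bounded_op_zero[OF K])
  obtain x0 where x0: "x0 \<in> W" "t * norm x0 < norm (K x0)" using ex by auto
  have "t * norm x0 < r * norm x0" using x0 r[OF x0(1)] by linarith
  then have "t < r" by (simp add: mult_less_cancel_right)
  have "R \<noteq> {}" using scale[of x0 0] x0(1) by (auto simp: R_def intro!: exI[of _ 0])
  have "\<exists>x. x \<in> W \<and> norm x \<le> 1 \<and> r - 1 / Suc n < norm (K x)" for n
  proof -
    have "r - 1 / Suc n < Sup R" by (simp add: r_def)
    then show ?thesis
      using less_cSup_iff[OF \<open>R \<noteq> {}\<close> bdd] by (auto simp: R_def)
  qed
  then obtain x where x: "\<And>n. x n \<in> W" "\<And>n. norm (x n) \<le> 1" "\<And>n. r - 1 / Suc n < norm (K (x n))"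
    by metis
  obtain h z where hz: "strict_mono h" "norm z \<le> 1" "\<And>y. (\<lambda>n. cinner (x (h n)) y) \<longlonglongrightarrow> cinner z y"
    using ell2_weak_compactness[of x 1, OF x(2)] by blast
  have "z \<in> W"
    unfolding W
  proof (clarify)
    fix i assume "i \<in> I"
    then have "cinner (x (h n)) (v i) = 0" for n using x(1)[of "h n"] by (simp add: W)
    then show "cinner z (v i) = 0" using hz(3)[of "v i"] by (simp add: LIMSEQ_const_iff)
  qed
  have "(\<lambda>n. K (x (h n) - z)) \<longlonglongrightarrow> 0"
  proof (rule compact_op_tendsto[OF K cpt])
    show "norm (x (h n) - z) \<le> 2" for n
      using norm_triangle_ineq4[of "x (h n)" z] x(2)[of "h n"] hz(2) by linarith
    show "(\<lambda>n. cinner (x (h n) - z) y) \<longlonglongrightarrow> 0" for y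
      unfolding cinner_diff_left using hz(3)[of y] by (simp add: LIM_zero_iff)
  qed
  then have "(\<lambda>n. K (x (h n))) \<longlonglongrightarrow> K z"
    unfolding bounded_op_diff[OF K] by (simp add: LIM_zero_iff)
  then have lim: "(\<lambda>n. norm (K (x (h n)))) \<longlonglongrightarrow> norm (K z)"
    by (rule tendsto_norm)
  have "(\<lambda>n. r - 1 / Suc (h n)) \<longlonglongrightarrow> r - 0"
    by (intro tendsto_diff tendsto_const) (use LIMSEQ_subseq_LIMSEQ[OF LIMSEQ_inverse_real_of_nat hz(1)] in \<open>simp add: o_def inverse_eq_divide\<close>)
  then have "r \<le> norm (K z)"
    using lim x(3) by (intro LIMSEQ_le[of "\<lambda>n. r - 1 / Suc (h n)" r]) (auto intro: less_imp_le)
  moreover have "norm (K z) \<le> r * norm z" by (rule r[OF \<open>z \<in> W\<close>])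
  moreover have "r * norm z \<le> r * 1"
    using \<open>t < r\<close> t hz(2) by (intro mult_left_mono) auto
  ultimately have "norm (K z) = r" "r * norm z = r * 1" by linarith+
  then have "norm z = 1" using \<open>t < r\<close> t by simp
  then show ?thesis using \<open>norm (K z) = r\<close> \<open>z \<in> W\<close> \<open>t < r\<close> r by blast
qed

text \<open>For the nontrivial direction the list of vectors spans all singular spaces above
  \<open>t\<close>. If \<open>K\<close> exceeded \<open>t\<close> somewhere on their orthogonal
  complement, it would have there a maximizing vector, which is itself a singular vector above
  \<open>t\<close> and hence orthogonal to itself.\<close>

theorem codim_bound_iff_sing_count:
  assumes cpt: "compact_op K" and t: "t > 0"
  shows "codim_bound K t n \<longleftrightarrow> sing_count t K \<le> n"
proof -
  define S where "S = {s. s > t \<and> singular_space K s \<noteq> {0}}"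
  obtain n0 where n0: "codim_bound K t n0" using cpt t by (auto simp: compact_op_def)
  obtain B where B: "finite S" "\<And>s. s \<in> S \<Longrightarrow> finite (B s)"
    "\<And>s. s \<in> S \<Longrightarrow> singular_space K s \<subseteq> cvec.span (B s)" "(\<Sum>s\<in>S. card (B s)) = sing_count t K"
    using sing_count_le(2)[OF less_imp_le[OF t] n0] unfolding S_def by blast
  define E where "E = (\<Union>s\<in>S. singular_space K s)"
  define W where "W = {x. \<forall>e\<in>E. cinner x e = 0}"
  have Wbound: "norm (K x) \<le> t * norm x" if "x \<in> W" for x
  proof (rule ccontr)
    assume "\<not> norm (K x) \<le> t * norm x"
    then have "\<exists>x\<in>W. t * norm x < norm (K x)" using that by force
    from compact_op_attains[OF cpt less_imp_le[OF t], of W E "\<lambda>e. e"] this obtain r z where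
      rz: "r > t" "z \<in> W" "norm z = 1" "norm (K z) = r" "\<And>x. x \<in> W \<Longrightarrow> norm (K x) \<le> r * norm x"
      by (auto simp: W_def)
    have inv: "hilbert_adjoint K (K x) \<in> W" if "x \<in> W" for x
      unfolding W_def
    proof (clarify)
      fix e assume "e \<in> E"
      then obtain s where s: "hilbert_adjoint K (K e) = cscale (of_real (s\<^sup>2)) e"
        by (auto simp: E_def singular_space_def)
      have "cinner (hilbert_adjoint K (K x)) e = cinner x (hilbert_adjoint K (K e))"
        by (simp add: cinner_adjoint_self hilbert_adjoint[OF K])
      then show "cinner (hilbert_adjoint K (K x)) e = 0"
        using that \<open>e \<in> E\<close> by (simp add: s cinner_cscale_right W_def)
    qed
    have "z \<in> singular_space K r"
      by (rule singular_vector_of_maximum[OF inv rz(5) rz(2,4,3)])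
    moreover have "z \<noteq> 0" using rz(3) by auto
    ultimately have "z \<in> E" using rz(1) by (auto simp: E_def S_def)
    then have "cinner z z = 0" using rz(2) by (simp add: W_def)
    then show False using rz(3) by (simp add: cinner_self)
  qed
  define J where "J = (SIGMA s:S. B s)"
  have J: "finite J" "card J = sing_count t K"
    using B by (auto simp: J_def)
  then obtain f where f: "bij_betw f {..<sing_count t K} J"
    by (metis atLeast0LessThan ex_bij_betw_nat_finite)
  have "codim_bound K t (sing_count t K)"
    unfolding codim_bound_def
  proof (intro exI allI impI)
    fix x assume x: "\<forall>i<sing_count t K. cinner x (snd (f i)) = 0"
    have xb: "cinner x b = 0" if "s \<in> S" "b \<in> B s" for s b
    proof -
      have "(s, b) \<in> J" using that by (auto simp: J_def)
      then obtain i where "i < sing_count t K" "f i = (s, b)"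
        using f by (metis bij_betw_imp_surj_on imageE lessThan_iff)
      then show ?thesis using x by (metis snd_conv)
    qed
    have "x \<in> W"
      unfolding W_def
    proof (clarify)
      fix e assume "e \<in> E"
      then obtain s where s: "s \<in> S" "e \<in> singular_space K s" by (auto simp: E_def)
      then have "e \<in> cvec.span (B s)" using B(3) by blast
      moreover have "cvec.span (B s) \<subseteq> {e. cinner x e = 0}"
        using xb[OF s(1)]
        by (intro cvec.span_minimal cvec.subspaceI) (auto simp: cinner_add_right cinner_cscale_right)
      ultimately show "cinner x e = 0" by auto
    qed
    then show "norm (K x) \<le> t * norm x" by (rule Wbound)
  qed
  then show ?thesis
    using sing_count_le(1)[OF less_imp_le[OF t]] codim_bound_mono[OF _ order_refl] by blast
qed

end

section \<open>Bounded forms, Schur multipliers and Hankel operators\<close>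

text \<open>Builds the operator from uniformly bounded finite sections. The form is bilinear,
  without conjugation, because that is the shape in which a Hankel form becomes an integral of a
  product.\<close>

lemma has_matrix_of_form:
  assumes B: "B \<ge> 0"
    and form: "\<And>n x y. cmod (\<Sum>j<n. \<Sum>k<n. m j k * x j * y k) \<le>
      B * sqrt (\<Sum>j<n. (cmod (x j))\<^sup>2) * sqrt (\<Sum>k<n. (cmod (y k))\<^sup>2)"
  obtains A where "has_matrix A m" "\<And>x. norm (A x) \<le> B * norm x"
proof -
  \<comment> \<open>Both applications test the form on the conjugate of the vector to be estimated,
    which bounds a squared norm by a multiple of the norm.\<close>
  have sq: "S \<le> c\<^sup>2" if "S \<le> c * sqrt S" "0 \<le> S" "0 \<le> c" for S c :: real
  proof -
    have "sqrt S * sqrt S \<le> c * sqrt S" using that by simp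
    then have "sqrt S \<le> c"
      using that mult_right_le_imp_le[of "sqrt S" "sqrt S" c] by (cases "S = 0") (simp, simp del: real_sqrt_mult_self)
    then have "(sqrt S)\<^sup>2 \<le> c\<^sup>2" by (rule power_mono) (use that in auto)
    then show ?thesis using that by simp
  qed
  have row: "(\<Sum>j<n. (cmod (cnj (m j k)))\<^sup>2) \<le> B\<^sup>2" for n k
  proof -
    define n' where "n' = max n (Suc k)"
    define S where "S = (\<Sum>j<n'. (cmod (m j k))\<^sup>2)"
    have "(\<Sum>j<n'. \<Sum>l<n'. m j l * cnj (m j k) * (if l = k then 1 else 0)) = complex_of_real S"
      by (simp add: S_def n'_def less_max_iff_disj complex_norm_square if_distrib[of "\<lambda>y. _ * y"] del: of_real_power cong: if_cong)
    moreover have "(\<Sum>l<n'. (cmod (if l = k then 1 else 0))\<^sup>2) = 1"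
      by (simp add: n'_def less_max_iff_disj if_distrib[of cmod] if_distrib[of "\<lambda>y. y\<^sup>2"] cong: if_cong)
    moreover have "S \<ge> 0" by (simp add: S_def sum_nonneg)
    moreover have "(\<Sum>j<n'. (cmod (cnj (m j k)))\<^sup>2) = S" by (simp add: S_def)
    ultimately have "S \<le> B * sqrt S"
      using form[where n = n' and x = "\<lambda>j. cnj (m j k)" and y = "\<lambda>l. if l = k then 1 else 0"] by (simp only: norm_of_real) simp
    then have "S \<le> B\<^sup>2" using sq \<open>S \<ge> 0\<close> B by blast
    moreover have "(\<Sum>j<n. (cmod (m j k))\<^sup>2) \<le> S"
      unfolding S_def by (rule sum_mono2) (auto simp: n'_def)
    ultimately show ?thesis by simp
  qed
  have "\<exists>r. coord r = (\<lambda>j. cnj (m j k))" for k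
    by (rule ell2_of_bound[of "\<lambda>j. cnj (m j k)" "B\<^sup>2"]) (use row in auto)
  then obtain r where r: "\<And>k. coord (r k) = (\<lambda>j. cnj (m j k))" by metis
  have bound: "(\<Sum>k<K. (cmod (cinner x (r k)))\<^sup>2) \<le> (B * norm x)\<^sup>2" for K x
  proof (rule sq)
    define T where "T = (\<Sum>k<K. (cmod (cinner x (r k)))\<^sup>2)"
    \<comment> \<open>The conjugated image, cut off at \<open>K\<close>: with this test vector the
      form takes the value \<open>T\<close>, the squared length to be bounded.\<close>
    define y where "y k = (if k < K then cnj (cinner x (r k)) else 0)" for k
    have T: "complex_of_real T = (\<Sum>k<K. cinner x (r k) * y k)"
      by (simp add: T_def y_def complex_norm_square del: of_real_power)
    have lim: "(\<lambda>n. cmod (\<Sum>k<K. cinner (trunc n x) (r k) * y k)) \<longlonglongrightarrow> cmod (of_real T)"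
      unfolding T by (intro tendsto_intros tendsto_cinner_left trunc_tendsto)
    have le: "cmod (\<Sum>k<K. cinner (trunc n x) (r k) * y k) \<le> B * norm x * sqrt T" if "n \<ge> K" for n
    proof -
      have "(\<Sum>k<K. cinner (trunc n x) (r k) * y k) = (\<Sum>k<n. cinner (trunc n x) (r k) * y k)"
        using that by (intro sum.mono_neutral_left) (auto simp: y_def)
      also have "\<dots> = (\<Sum>k<n. \<Sum>j<n. m j k * coord x j * y k)"
      proof (rule sum.cong)
        fix k
        have "cinner (trunc n x) (r k) = (\<Sum>j<n. coord x j * m j k)"
          unfolding trunc_def cinner_sum_left cinner_cscale_left
        proof (rule sum.cong)
          fix j
          have "cinner (basis_vec j) (r k) = m j k"
            by (metis cinner_basis_right cinner_commute complex_cnj_cnj r)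
          then show "coord x j * cinner (basis_vec j) (r k) = coord x j * m j k" by simp
        qed simp
        then show "cinner (trunc n x) (r k) * y k = (\<Sum>j<n. m j k * coord x j * y k)"
          by (simp only: sum_distrib_right) (simp only: mult_ac)
      qed simp
      also have "\<dots> = (\<Sum>j<n. \<Sum>k<n. m j k * coord x j * y k)"
        by (rule sum.swap)
      finally have "cmod (\<Sum>k<K. cinner (trunc n x) (r k) * y k) \<le>
          B * sqrt (\<Sum>j<n. (cmod (coord x j))\<^sup>2) * sqrt (\<Sum>k<n. (cmod (y k))\<^sup>2)"
        using form[where x = "coord x" and y = y and n = n] by simp
      also have "(\<Sum>k<n. (cmod (y k))\<^sup>2) = T"
        using that unfolding T_def by (intro sum.mono_neutral_cong_right) (auto simp: y_def)
      also have "B * sqrt (\<Sum>j<n. (cmod (coord x j))\<^sup>2) * sqrt T \<le> B * norm x * sqrt T"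
        using B sum_coord_le[of x n]
        by (intro mult_right_mono mult_left_mono) (auto intro!: real_le_lsqrt simp: T_def sum_nonneg)
      finally show ?thesis .
    qed
    have "cmod (of_real T) \<le> B * norm x * sqrt T"
      by (rule LIMSEQ_le_const2[OF lim]) (use le in blast)
    moreover have "T \<ge> 0" by (simp add: T_def sum_nonneg)
    ultimately show "(\<Sum>k<K. (cmod (cinner x (r k)))\<^sup>2) \<le> B * norm x * sqrt (\<Sum>k<K. (cmod (cinner x (r k)))\<^sup>2)"
      unfolding T_def[symmetric] by (simp only: norm_of_real abs_of_nonneg)
  qed (use B in \<open>auto simp: sum_nonneg\<close>)
  have "\<exists>z. coord z = (\<lambda>k. cinner x (r k)) \<and> (norm z)\<^sup>2 \<le> (B * norm x)\<^sup>2" for x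
    by (rule ell2_of_bound[of "\<lambda>k. cinner x (r k)" "(B * norm x)\<^sup>2"]) (use bound in auto)
  then obtain A where A: "\<And>x. coord (A x) = (\<lambda>k. cinner x (r k))" "\<And>x. (norm (A x))\<^sup>2 \<le> (B * norm x)\<^sup>2"
    by metis
  have norm_A: "norm (A x) \<le> B * norm x" for x
    by (rule power2_le_imp_le[OF A(2)]) (use B in auto)
  have "bounded_op A"
    by (rule bounded_opI[OF _ _ norm_A]; rule ell2_eqI) (simp_all add: A cinner_add_left cinner_cscale_left)
  moreover have "entry A j k = m j k" for j k
    by (simp add: entry_eq A(1)) (metis cinner_basis_right cinner_commute complex_cnj_cnj r)
  ultimately show ?thesis using that norm_A by (auto simp: has_matrix_def)
qed

text \<open>\<open>multiplier_norm\<close> tests operators of norm 1 only, hence the rescaling by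
  \<open>r\<close> and the separate treatment of norm 0. The value \<open>\<infinity>\<close> in its
  definition is what makes a finite multiplier norm imply that the product matrix comes from a
  bounded operator.\<close>

lemma schur_mult_bounded:
  assumes \<sigma>: "multiplier_norm \<sigma> \<le> ereal M" and A: "bounded_op A"
  shows "has_matrix (\<sigma> \<star> A) (\<lambda>j k. \<sigma> j k * entry A j k)"
    and "norm ((\<sigma> \<star> A) x) \<le> M * onorm A * norm x"
proof -
  have "has_matrix (\<sigma> \<star> A) (\<lambda>j k. \<sigma> j k * entry A j k) \<and> (\<forall>x. norm ((\<sigma> \<star> A) x) \<le> M * onorm A * norm x)"
  proof (cases "onorm A = 0")
    case True
    then have "A x = 0" for x using bounded_op_norm_le[OF A, of x] by simp
    then have "entry A j k = 0" for j k by (simp add: entry_eq)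
    then have "has_matrix (\<lambda>_. 0) (\<lambda>j k. \<sigma> j k * entry A j k)"
      by (auto simp: has_matrix_def entry_eq intro!: bounded_opI[of _ 0])
    then show ?thesis
      using op_of_matrix_eq[of "\<lambda>_. 0"] True unfolding schur_mult_def by simp
  next
    case False
    define r where "r = onorm A"
    have r: "r > 0" using False onorm_bounded_op_nonneg[OF A] by (simp add: r_def)
    define A' where "A' x = cscale (of_real (1 / r)) (A x)" for x
    have A': "bounded_op A'"
      unfolding A'_def by (rule bounded_op_cmul[OF A])
    have "onorm A' = 1"
      using onorm_scaleR[OF bounded_op_bl[OF A], of "1 / r"] r
      by (simp add: A'_def[abs_def] scaleR_ell2_def r_def)
    then have "(if \<exists>B. has_matrix B (\<lambda>j k. \<sigma> j k * entry A' j k) then ereal (onorm (\<sigma> \<star> A')) else \<infinity>)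
        \<le> multiplier_norm \<sigma>"
      unfolding multiplier_norm_def using A' by (intro SUP_upper) auto
    then have le: "(if \<exists>B. has_matrix B (\<lambda>j k. \<sigma> j k * entry A' j k) then ereal (onorm (\<sigma> \<star> A')) else \<infinity>) \<le> ereal M"
      using \<sigma> order_trans by blast
    then have "\<exists>B. has_matrix B (\<lambda>j k. \<sigma> j k * entry A' j k)"
      by (rule contrapos_pp) simp
    then obtain B where B: "has_matrix B (\<lambda>j k. \<sigma> j k * entry A' j k)" ..
    then have "\<sigma> \<star> A' = B" unfolding schur_mult_def by (rule op_of_matrix_eq)
    then have nB: "onorm B \<le> M" using le B by (auto split: if_splits)
    have "has_matrix (\<lambda>x. cscale (of_real r) (B x)) (\<lambda>j k. of_real r * (\<sigma> j k * entry A' j k))"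
      by (rule has_matrix_cmul[OF B])
    moreover have "of_real r * (\<sigma> j k * entry A' j k) = \<sigma> j k * entry A j k" for j k
      using r by (simp add: entry_eq A'_def)
    ultimately have hm: "has_matrix (\<lambda>x. cscale (of_real r) (B x)) (\<lambda>j k. \<sigma> j k * entry A j k)" by simp
    have eq: "\<sigma> \<star> A = (\<lambda>x. cscale (of_real r) (B x))"
      unfolding schur_mult_def by (rule op_of_matrix_eq[OF hm])
    have "norm (cscale (of_real r) (B x)) \<le> M * onorm A * norm x" for x
    proof -
      have "norm (B x) \<le> onorm B * norm x"
        using B by (intro bounded_op_norm_le) (simp add: has_matrix_def)
      also have "\<dots> \<le> M * norm x" using nB by (rule mult_right_mono) simp
      finally show ?thesis using r by (simp add: r_def[symmetric] mult_ac)
    qed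
    then show ?thesis using hm eq by simp
  qed
  then show "has_matrix (\<sigma> \<star> A) (\<lambda>j k. \<sigma> j k * entry A j k)"
    "norm ((\<sigma> \<star> A) x) \<le> M * onorm A * norm x" by auto
qed

section \<open>Fourier integrals and Hankel forms on the circle\<close>

lemma has_integral_cis:
  assumes "a \<noteq> 0" "u \<le> v"
  shows "((\<lambda>\<theta>. cis (a * \<theta>)) has_integral (cis (a * v) - cis (a * u)) / (\<i> * of_real a)) {u..v}"
proof -
  have "((\<lambda>\<theta>. cis (a * \<theta>) / (\<i> * of_real a)) has_vector_derivative cis (a * \<theta>)) (at \<theta> within {u..v})" for \<theta>
  proof -
    have "((\<lambda>z. exp (\<i> * of_real a * z) / (\<i> * of_real a)) has_field_derivative exp (\<i> * of_real a * of_real \<theta>)) (at (of_real \<theta>))"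
      using assms(1) by (auto intro!: derivative_eq_intros)
    from has_vector_derivative_real_field[OF this] show ?thesis
      by (simp add: cis_conv_exp o_def mult.assoc)
  qed
  from fundamental_theorem_of_calculus[OF assms(2) this] show ?thesis
    by (simp add: diff_divide_distrib)
qed

text \<open>The same normalization as \<open>fourier_coeff\<close>, but for functions of the angle,
  so that step functions on an interval need not be written as functions on the circle.\<close>

definition fourier_int :: "(real \<Rightarrow> complex) \<Rightarrow> int \<Rightarrow> complex" where
  "fourier_int h j = (LBINT \<theta>:{0..2 * pi}. h \<theta> * cis (- (of_int j * \<theta>))) / of_real (2 * pi)"

abbreviation circle_measure :: "real measure" where
  "circle_measure \<equiv> restrict_space lborel {0..2 * pi}"

lemma integral_circle_measure: "integral\<^sup>L circle_measure f = (LBINT \<theta>:{0..2 * pi}. f \<theta>)"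
  for f :: "real \<Rightarrow> 'a :: {banach, second_countable_topology}"
  by (subst integral_restrict_space) (auto simp: set_lebesgue_integral_def)

lemma finite_circle_measure: "finite_measure circle_measure"
  by (rule finite_measureI) (simp add: space_restrict_space emeasure_restrict_space)

lemma integrable_circle_measure:
  fixes f :: "real \<Rightarrow> 'a :: {banach, second_countable_topology}"
  assumes "f \<in> borel_measurable circle_measure" "\<And>\<theta>. \<theta> \<in> {0..2 * pi} \<Longrightarrow> norm (f \<theta>) \<le> B"
  shows "integrable circle_measure f"
  by (rule finite_measure.integrable_const_bound[OF finite_circle_measure _ assms(1), of B])
    (auto simp: space_restrict_space assms(2))

lemma borel_measurable_circle_continuous:
  fixes f :: "real \<Rightarrow> 'a :: topological_space"
  assumes "continuous_on UNIV f"
  shows "f \<in> borel_measurable circle_measure"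
  by (rule measurable_restrict_space1) (use borel_measurable_continuous_onI[OF assms] in simp)

lemma continuous_cis [continuous_intros]:
  "continuous_on S f \<Longrightarrow> continuous_on S (\<lambda>x. cis (f x))" for f :: "_ \<Rightarrow> real"
  unfolding cis_conv_exp by (intro continuous_intros)

lemma integral_circle_cis:
  "(\<integral>\<theta>. cis (of_int n * \<theta>) \<partial>circle_measure) = (if n = 0 then of_real (2 * pi) else 0)"
proof -
  have "integrable circle_measure (\<lambda>\<theta>. cis (of_int n * \<theta>))"
    by (rule integrable_circle_measure[of _ 1])
      (auto intro!: borel_measurable_circle_continuous continuous_intros)
  then have "set_integrable lborel {0..2 * pi} (\<lambda>\<theta>. cis (of_int n * \<theta>))"
    by (subst (asm) integrable_restrict_space) (auto simp: set_integrable_def)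
  then have "(LBINT \<theta>:{0..2 * pi}. cis (of_int n * \<theta>)) = integral {0..2 * pi} (\<lambda>\<theta>. cis (of_int n * \<theta>))"
    by (rule set_borel_integral_eq_integral)
  also have "\<dots> = (if n = 0 then of_real (2 * pi) else 0)"
  proof (cases "n = 0")
    case False
    have "cis (of_int n * (2 * pi)) = 1"
      using cis_multiple_2pi[of "of_int n"] by (simp add: mult_ac)
    then show ?thesis
      using integral_unique[OF has_integral_cis[of "of_int n" 0 "2 * pi"]] False by simp
  qed (simp add: scaleR_conv_of_real)
  finally show ?thesis by (simp add: integral_circle_measure)
qed

lemma trig_poly_Parseval:
  "(\<integral>\<theta>. (cmod (\<Sum>j<n. x j * cis (- (of_int (int j) * \<theta>))))\<^sup>2 \<partial>circle_measure) = 2 * pi * (\<Sum>j<n. (cmod (x j))\<^sup>2)"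
  (is "(\<integral>\<theta>. (cmod (?X \<theta>))\<^sup>2 \<partial>circle_measure) = _")
proof -
  have int: "integrable circle_measure (\<lambda>\<theta>. cis (of_int m * \<theta>))" for m
    by (rule integrable_circle_measure[of _ 1])
      (auto intro!: borel_measurable_circle_continuous continuous_intros)
  have "complex_of_real (\<integral>\<theta>. (cmod (?X \<theta>))\<^sup>2 \<partial>circle_measure) = (\<integral>\<theta>. of_real ((cmod (?X \<theta>))\<^sup>2) \<partial>circle_measure)"
    by (rule integral_complex_of_real[symmetric])
  also have "\<dots> = (\<integral>\<theta>. (\<Sum>j<n. \<Sum>k<n. x j * cnj (x k) * cis (of_int (int k - int j) * \<theta>)) \<partial>circle_measure)"
    by (intro arg_cong[where f = "integral\<^sup>L circle_measure"] ext)
      (simp only: complex_norm_square cnj_sum sum_product complex_cnj_mult cis_cnj,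
       intro sum.cong refl, simp add: cis_mult[symmetric] algebra_simps cis_cnj[symmetric] complex_cnj_mult,
       simp add: cis_cnj cis_mult algebra_simps)
  also have "\<dots> = (\<Sum>j<n. \<Sum>k<n. x j * cnj (x k) * (if int k - int j = 0 then of_real (2 * pi) else 0))"
    by (simp only: Bochner_Integration.integral_sum Bochner_Integration.integrable_sum int
        integrable_mult_right integral_mult_right_zero integral_circle_cis)
  also have "\<dots> = of_real (2 * pi) * (\<Sum>j<n. x j * cnj (x j))"
    by (simp add: if_distrib[of "\<lambda>y. _ * y"] sum_distrib_left mult_ac cong: if_cong)
  also have "\<dots> = of_real (2 * pi * (\<Sum>j<n. (cmod (x j))\<^sup>2))"
    by (simp only: complex_norm_square[symmetric] of_real_mult of_real_sum)
  finally show ?thesis by (simp only: of_real_eq_iff)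
qed

text \<open>The easy half of Nehari's theorem: the form is the mean of \<open>h\<close> times two
  trigonometric polynomials, so the supremum of the symbol bounds it. The Cauchy-Schwarz inequality
  for the integral is obtained from a weighted Young inequality.\<close>

lemma hankel_form_bound:
  fixes h :: "real \<Rightarrow> complex"
  assumes h: "h \<in> borel_measurable circle_measure" "\<And>\<theta>. \<theta> \<in> {0..2 * pi} \<Longrightarrow> cmod (h \<theta>) \<le> B"
  shows "cmod (\<Sum>j<n. \<Sum>k<n. fourier_int h (int j + int k) * x j * y k) \<le>
      B * sqrt (\<Sum>j<n. (cmod (x j))\<^sup>2) * sqrt (\<Sum>k<n. (cmod (y k))\<^sup>2)"
proof -
  define X where "X x \<theta> = (\<Sum>j<n. x j * cis (- (of_int (int j) * \<theta>)))" for x \<theta>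
  define N where "N x = (\<Sum>j<n. (cmod (x j))\<^sup>2)" for x :: "nat \<Rightarrow> complex"
  have B: "B \<ge> 0" using order_trans[OF norm_ge_zero h(2)[of 0]] by simp
  have contX: "continuous_on UNIV (X x)" for x
    unfolding X_def by (intro continuous_intros)
  have Xb: "cmod (X x \<theta>) \<le> (\<Sum>j<n. cmod (x j))" for x \<theta>
    unfolding X_def by (rule order_trans[OF norm_sum]) (simp add: norm_mult)
  have mX: "X x \<in> borel_measurable circle_measure" for x
    by (rule borel_measurable_circle_continuous[OF contX])
  have int_h: "integrable circle_measure (\<lambda>\<theta>. h \<theta> * cis (- (of_int j * \<theta>)))" for j
    by (rule integrable_circle_measure[of _ B], intro borel_measurable_times h(1),
        intro borel_measurable_circle_continuous continuous_intros)
      (simp add: norm_mult h(2))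
  have eq: "(\<Sum>j<n. \<Sum>k<n. fourier_int h (int j + int k) * x j * y k) =
      (\<integral>\<theta>. h \<theta> * X x \<theta> * X y \<theta> \<partial>circle_measure) / of_real (2 * pi)"
  proof -
    have "(\<lambda>\<theta>. h \<theta> * X x \<theta> * X y \<theta>) =
        (\<lambda>\<theta>. \<Sum>j<n. \<Sum>k<n. x j * y k * (h \<theta> * cis (- (of_int (int j + int k) * \<theta>))))"
      unfolding X_def
      by (rule ext, simp only: mult.assoc sum_product, simp only: sum_distrib_left,
          intro sum.cong refl, simp add: cis_mult[symmetric] algebra_simps)
        (simp add: cis_mult add.commute)
    then show ?thesis
      by (simp only: Bochner_Integration.integral_sum Bochner_Integration.integrable_sum int_h
        integrable_mult_right integral_mult_right_zero,
       simp only: fourier_int_def integral_circle_measure[symmetric] sum_divide_distrib,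
        intro sum.cong refl, simp add: mult_ac)
  qed
  have intX2: "integrable circle_measure (\<lambda>\<theta>. (cmod (X x \<theta>))\<^sup>2)" for x
    by (rule integrable_circle_measure[of _ "(\<Sum>j<n. cmod (x j))\<^sup>2"])
      (auto intro!: borel_measurable_circle_continuous continuous_intros contX power_mono Xb)
  have young: "cmod (\<Sum>j<n. \<Sum>k<n. fourier_int h (int j + int k) * x j * y k) \<le> B * (r * N x + N y / r) / 2"
    if r: "r > 0" for r
  proof -
    have "cmod (\<integral>\<theta>. h \<theta> * X x \<theta> * X y \<theta> \<partial>circle_measure) \<le>
        (\<integral>\<theta>. B / 2 * (r * (cmod (X x \<theta>))\<^sup>2 + (1 / r) * (cmod (X y \<theta>))\<^sup>2) \<partial>circle_measure)"
    proof (rule Bochner_Integration.integral_norm_bound_integral)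
      show "integrable circle_measure (\<lambda>\<theta>. h \<theta> * X x \<theta> * X y \<theta>)"
        by (rule integrable_circle_measure[of _ "B * (\<Sum>j<n. cmod (x j)) * (\<Sum>j<n. cmod (y j))"])
          (auto simp: norm_mult B sum_nonneg intro!: mult_mono h(2) Xb borel_measurable_times h(1) mX)
      show "integrable circle_measure (\<lambda>\<theta>. B / 2 * (r * (cmod (X x \<theta>))\<^sup>2 + (1 / r) * (cmod (X y \<theta>))\<^sup>2))"
        by (intro integrable_mult_right Bochner_Integration.integrable_add intX2)
      fix \<theta> assume "\<theta> \<in> space circle_measure"
      then have "cmod (h \<theta>) \<le> B" by (intro h(2)) (simp add: space_restrict_space)
      moreover have "cmod (X x \<theta>) * cmod (X y \<theta>) \<le> (r * (cmod (X x \<theta>))\<^sup>2 + (1 / r) * (cmod (X y \<theta>))\<^sup>2) / 2"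
      proof -
        have "0 \<le> (r * cmod (X x \<theta>) - cmod (X y \<theta>))\<^sup>2 / r" using r by simp
        then show ?thesis using r by (simp add: field_simps power2_eq_square)
      qed
      ultimately have "cmod (h \<theta>) * (cmod (X x \<theta>) * cmod (X y \<theta>)) \<le>
          B * ((r * (cmod (X x \<theta>))\<^sup>2 + (1 / r) * (cmod (X y \<theta>))\<^sup>2) / 2)"
        using B by (intro mult_mono) auto
      then show "cmod (h \<theta> * X x \<theta> * X y \<theta>) \<le> B / 2 * (r * (cmod (X x \<theta>))\<^sup>2 + (1 / r) * (cmod (X y \<theta>))\<^sup>2)"
        by (simp add: norm_mult mult_ac)
    qed
    also have "\<dots> = B / 2 * (r * (2 * pi * N x) + (1 / r) * (2 * pi * N y))"
      using intX2 trig_poly_Parseval[where n = n]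
      by (simp add: N_def X_def)
    also have "\<dots> = B * (r * N x + N y / r) / 2 * (2 * pi)"
      by (simp add: algebra_simps)
    finally show ?thesis
      unfolding eq by (simp add: norm_divide pos_divide_le_eq)
  qed
  show ?thesis
  proof (cases "N x = 0 \<or> N y = 0")
    case True
    have "\<forall>j<n. x j = 0" if "N x = 0" for x
      using that by (simp add: N_def sum_nonneg_eq_0_iff)
    then have "(\<Sum>j<n. \<Sum>k<n. fourier_int h (int j + int k) * x j * y k) = 0"
      using True by (intro sum.neutral ballI) auto
    then show ?thesis using B by (simp add: sum_nonneg)
  next
    case False
    then have pos: "N x > 0" "N y > 0"
      by (simp_all add: N_def less_le sum_nonneg)
    \<comment> \<open>This ratio is the weight \<open>r\<close> that minimizes the right-hand side
      of \<open>young\<close>.\<close>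
    have "sqrt (N y) / sqrt (N x) * N x + N y / (sqrt (N y) / sqrt (N x)) = 2 * (sqrt (N x) * sqrt (N y))"
    proof -
      have "N x = sqrt (N x) * sqrt (N x)" "N y = sqrt (N y) * sqrt (N y)" using pos by auto
      then show ?thesis using pos by (simp add: field_simps)
    qed
    then show ?thesis
      using young[of "sqrt (N y) / sqrt (N x)"] pos by (simp add: N_def[symmetric] mult.assoc)
  qed
qed

section \<open>Step function approximation\<close>

text \<open>Compactness by bisection. The property passes to a union of two adjacent intervals when
  their common endpoint joins \<open>D\<close>, and near a point \<open>x\<close> the one-sided
  limits allow \<open>D = {x}\<close>.\<close>

lemma regulated_oscillation:
  fixes h :: "real \<Rightarrow> complex"
  assumes "a \<le> b" "\<delta> > 0"
    and right: "\<And>x. \<exists>l. (h \<longlongrightarrow> l) (at_right x)" and left: "\<And>x. \<exists>l. (h \<longlongrightarrow> l) (at_left x)"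
  shows "\<exists>D. finite D \<and> (\<forall>x y. a \<le> x \<and> x \<le> y \<and> y \<le> b \<and> {x..y} \<inter> D = {} \<longrightarrow> cmod (h x - h y) \<le> \<delta>)"
  using assms(1)
proof (induction rule: Bolzano)
  case (trans a b c)
  then obtain D1 D2 where D: "finite D1" "finite D2"
    "\<And>x y. a \<le> x \<Longrightarrow> x \<le> y \<Longrightarrow> y \<le> b \<Longrightarrow> {x..y} \<inter> D1 = {} \<Longrightarrow> cmod (h x - h y) \<le> \<delta>"
    "\<And>x y. b \<le> x \<Longrightarrow> x \<le> y \<Longrightarrow> y \<le> c \<Longrightarrow> {x..y} \<inter> D2 = {} \<Longrightarrow> cmod (h x - h y) \<le> \<delta>"
    by metis
  show ?case
  proof (intro exI[of _ "insert b (D1 \<union> D2)"] conjI allI impI)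
    fix x y assume xy: "a \<le> x \<and> x \<le> y \<and> y \<le> c \<and> {x..y} \<inter> insert b (D1 \<union> D2) = {}"
    then have "b \<notin> {x..y}" by blast
    then have "y \<le> b \<or> b \<le> x" using xy by auto
    then show "cmod (h x - h y) \<le> \<delta>" using D(3,4)[of x y] xy by blast
  qed (use D in auto)
next
  case (local x)
  obtain l r where l: "(h \<longlongrightarrow> l) (at_left x)" and r: "(h \<longlongrightarrow> r) (at_right x)"
    using left right by blast
  have "eventually (\<lambda>y. dist (h y) l < \<delta> / 2) (at_left x)" "eventually (\<lambda>y. dist (h y) r < \<delta> / 2) (at_right x)"
    using tendstoD[OF l, of "\<delta> / 2"] tendstoD[OF r, of "\<delta> / 2"] \<open>\<delta> > 0\<close> by auto
  then obtain u v where u: "u < x" "\<And>y. u < y \<Longrightarrow> y < x \<Longrightarrow> dist (h y) l < \<delta> / 2"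
    and v: "v > x" "\<And>y. x < y \<Longrightarrow> y < v \<Longrightarrow> dist (h y) r < \<delta> / 2"
    by (auto simp: eventually_at_left[of "x - 1" x] eventually_at_right[of x "x + 1"])
  show ?case
  proof (intro exI[of _ "min (x - u) (v - x)"] conjI allI impI)
    fix a b assume ab: "a \<le> x \<and> x \<le> b \<and> b - a < min (x - u) (v - x)"
    show "\<exists>D. finite D \<and> (\<forall>x y. a \<le> x \<and> x \<le> y \<and> y \<le> b \<and> {x..y} \<inter> D = {} \<longrightarrow> cmod (h x - h y) \<le> \<delta>)"
    proof (intro exI[of _ "{x}"] conjI allI impI)
      fix p q assume pq: "a \<le> p \<and> p \<le> q \<and> q \<le> b \<and> {p..q} \<inter> {x} = {}"
      then have "q < x \<or> x < p" by auto
      then have "\<exists>m. dist (h p) m < \<delta> / 2 \<and> dist (h q) m < \<delta> / 2"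
      proof
        assume "q < x"
        then show ?thesis using u(2)[of p] u(2)[of q] pq ab by (intro exI[of _ l]) auto
      next
        assume "x < p"
        then show ?thesis using v(2)[of p] v(2)[of q] pq ab by (intro exI[of _ r]) auto
      qed
      then have "dist (h p) (h q) \<le> \<delta>"
        by (metis dist_commute dist_triangle_half_l less_eq_real_def)
      then show "cmod (h p - h q) \<le> \<delta>" by (simp add: dist_norm)
    qed simp
  qed (use u v in auto)
qed

text \<open>The partition consists of the endpoints and the exceptional points, in increasing order;
  between two consecutive ones no exceptional point is left.\<close>

lemma regulated_partition:
  fixes h :: "real \<Rightarrow> complex"
  assumes "a < b" "\<delta> > 0"
    and "\<And>x. \<exists>l. (h \<longlongrightarrow> l) (at_right x)" "\<And>x. \<exists>l. (h \<longlongrightarrow> l) (at_left x)"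
  obtains p \<theta> where "p > 0" "\<theta> 0 = a" "\<theta> p = b" "\<And>i j. i < j \<Longrightarrow> j \<le> p \<Longrightarrow> \<theta> i < \<theta> j"
    "\<And>i x y. i < p \<Longrightarrow> \<theta> i < x \<Longrightarrow> x < \<theta> (Suc i) \<Longrightarrow> \<theta> i < y \<Longrightarrow> y < \<theta> (Suc i) \<Longrightarrow> cmod (h x - h y) \<le> \<delta>"
proof -
  obtain D where D: "finite D"
    "\<And>x y. a \<le> x \<Longrightarrow> x \<le> y \<Longrightarrow> y \<le> b \<Longrightarrow> {x..y} \<inter> D = {} \<Longrightarrow> cmod (h x - h y) \<le> \<delta>"
    using regulated_oscillation[OF less_imp_le[OF assms(1)] assms(2-4)] by metis
  define E where "E = insert a (insert b (D \<inter> {a..b}))"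
  define xs where "xs = sorted_list_of_set E"
  have E: "finite E" "a \<in> E" "b \<in> E" "E \<subseteq> {a..b}" using D(1) assms(1) by (auto simp: E_def)
  have xs: "set xs = E" "sorted_wrt (<) xs" by (simp_all add: xs_def E)
  define p where "p = length xs - 1"
  define \<theta> where "\<theta> i = xs ! i" for i
  have len: "length xs = Suc p" using xs(1) E(2) by (cases xs) (auto simp: p_def)
  have mono: "\<theta> i < \<theta> j" if "i < j" "j \<le> p" for i j
    using sorted_wrt_nth_less[OF xs(2), of i j] that len by (simp add: \<theta>_def)
  have in_E: "\<theta> i \<in> E" if "i \<le> p" for i
    using that len xs(1) by (auto simp: \<theta>_def)
  have ex: "\<exists>i\<le>p. \<theta> i = x" if "x \<in> E" for x
    using that len xs(1) by (metis in_set_conv_nth less_Suc_eq_le \<theta>_def)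
  have 0: "\<theta> 0 = a"
  proof -
    obtain i where "i \<le> p" "\<theta> i = a" using ex[OF E(2)] by blast
    then show ?thesis using mono[of 0 i] in_E[of 0] E(4) by (cases "i = 0") force+
  qed
  have p: "\<theta> p = b"
  proof -
    obtain i where "i \<le> p" "\<theta> i = b" using ex[OF E(3)] by blast
    then show ?thesis using mono[of i p] in_E[of p] E(4) by (cases "i = p") force+
  qed
  have "p > 0" using 0 p assms(1) by (cases p) auto
  have osc: "cmod (h x - h y) \<le> \<delta>"
    if i: "i < p" and x: "\<theta> i < x" "x < \<theta> (Suc i)" and y: "\<theta> i < y" "y < \<theta> (Suc i)" and "x \<le> y" for i x y
  proof (rule D(2))
    have ai: "a \<le> \<theta> i" "\<theta> (Suc i) \<le> b" using in_E[of i] in_E[of "Suc i"] i E(4) by auto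
    show "a \<le> x" "x \<le> y" "y \<le> b" using ai x y that by auto
    show "{x..y} \<inter> D = {}"
    proof (rule ccontr)
      assume "{x..y} \<inter> D \<noteq> {}"
      then obtain z where z: "z \<in> D" "x \<le> z" "z \<le> y" by auto
      then have "z \<in> E" using ai x y by (auto simp: E_def)
      then obtain k where k: "k \<le> p" "\<theta> k = z" using ex by blast
      have "\<theta> i < \<theta> k" "\<theta> k < \<theta> (Suc i)" using z x y k by auto
      then have "\<not> k \<le> i" "\<not> Suc i \<le> k" using mono[of k i] mono[of "Suc i" k] i k
        by (auto simp: le_less)
      then show False by simp
    qed
  qed
  show ?thesis
  proof (rule that[OF \<open>p > 0\<close> 0 p mono])
    fix i x y assume *: "i < p" "\<theta> i < x" "x < \<theta> (Suc i)" "\<theta> i < y" "y < \<theta> (Suc i)"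
    show "cmod (h x - h y) \<le> \<delta>"
      using osc[OF *] osc[OF *(1) *(4,5,2,3)] by (cases "x \<le> y") (auto simp: norm_minus_commute)
  qed
qed

section \<open>Piecewise continuous symbols\<close>

context
  fixes \<omega> :: "complex \<Rightarrow> complex"
  assumes PC: "\<omega> \<in> PC_circle"
begin

lemma PC_tendsto_right: "((\<lambda>x. \<omega> (cis x)) \<longlongrightarrow> limit_plus \<omega> (cis x)) (at_right x)"
proof -
  have "\<exists>l. ((\<lambda>\<epsilon>. \<omega> (cis x * cis \<epsilon>)) \<longlongrightarrow> l) (at_right 0)"
    using PC by (auto simp: PC_circle_def)
  then have "((\<lambda>\<epsilon>. \<omega> (cis x * cis \<epsilon>)) \<longlongrightarrow> limit_plus \<omega> (cis x)) (at_right 0)"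
    unfolding limit_plus_def by (metis tendsto_Lim trivial_limit_at_right_real)
  then show ?thesis
    by (subst filterlim_at_right_to_0) (simp add: cis_mult add.commute)
qed

lemma PC_tendsto_left: "((\<lambda>x. \<omega> (cis x)) \<longlongrightarrow> limit_minus \<omega> (cis x)) (at_left x)"
proof -
  have "\<exists>l. ((\<lambda>\<epsilon>. \<omega> (cis x * cis (- \<epsilon>))) \<longlongrightarrow> l) (at_right 0)"
    using PC by (auto simp: PC_circle_def)
  then have "((\<lambda>\<epsilon>. \<omega> (cis x * cis (- \<epsilon>))) \<longlongrightarrow> limit_minus \<omega> (cis x)) (at_right 0)"
    unfolding limit_minus_def by (metis tendsto_Lim trivial_limit_at_right_real)
  then show ?thesis
    by (subst filterlim_at_left_to_right, subst filterlim_at_right_to_0) (simp add: cis_mult)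
qed

lemma limit_bounds:
  assumes "u < v" "\<And>y. u < y \<Longrightarrow> y < v \<Longrightarrow> cmod (\<omega> (cis y) - c) \<le> \<delta>"
  shows "u \<le> x \<Longrightarrow> x < v \<Longrightarrow> cmod (limit_plus \<omega> (cis x) - c) \<le> \<delta>"
    and "u < x \<Longrightarrow> x \<le> v \<Longrightarrow> cmod (limit_minus \<omega> (cis x) - c) \<le> \<delta>"
proof -
  assume x: "u \<le> x" "x < v"
  have "((\<lambda>y. \<omega> (cis y) - c) \<longlongrightarrow> limit_plus \<omega> (cis x) - c) (at_right x)"
    by (intro tendsto_intros PC_tendsto_right)
  moreover have "eventually (\<lambda>y. cmod (\<omega> (cis y) - c) \<le> \<delta>) (at_right x)"
    using x assms(2) by (auto simp: eventually_at_right[OF x(2)] intro!: exI[of _ v])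
  ultimately show "cmod (limit_plus \<omega> (cis x) - c) \<le> \<delta>"
    by (intro Lim_norm_ubound[of "at_right x"]) auto
next
  assume x: "u < x" "x \<le> v"
  have "((\<lambda>y. \<omega> (cis y) - c) \<longlongrightarrow> limit_minus \<omega> (cis x) - c) (at_left x)"
    by (intro tendsto_intros PC_tendsto_left)
  moreover have "eventually (\<lambda>y. cmod (\<omega> (cis y) - c) \<le> \<delta>) (at_left x)"
    using x assms(2) by (auto simp: eventually_at_left[OF x(1)] intro!: exI[of _ u])
  ultimately show "cmod (limit_minus \<omega> (cis x) - c) \<le> \<delta>"
    by (intro Lim_norm_ubound[of "at_left x"]) auto
qed

text \<open>The step function takes on each arc a value of \<open>\<omega>\<close> inside that arc.
  Each one-sided limit of \<open>\<omega>\<close> at a node is within \<open>\<delta>\<close> of the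
  adjacent step value, so half the jump of the step function is within \<open>\<delta>\<close> of
  \<open>half_jump\<close>; away from the nodes both limits are close to the same value.
  \<open>Z\<close> contains all nodes, including those where the step function happens not to
  jump.\<close>

lemma PC_step_approximation:
  assumes "\<delta> > 0"
  obtains Z \<kappa> s M where "finite Z" "Z \<subseteq> sphere 0 1" "s \<in> borel_measurable circle_measure"
    "\<And>x. cmod (s x) \<le> M"
    "\<And>x. x \<in> {0..2 * pi} \<Longrightarrow> cmod (\<omega> (cis x) - s x) \<le> \<delta>"
    "\<And>n. n \<noteq> 0 \<Longrightarrow> fourier_int s n = (\<Sum>z\<in>Z. \<kappa> z * z powi (- n)) / (\<i> * pi * of_int n)"
    "\<And>z. z \<in> Z \<Longrightarrow> cmod (\<kappa> z - half_jump \<omega> z) \<le> \<delta>"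
    "\<And>z. z \<in> sphere 0 1 - Z \<Longrightarrow> cmod (half_jump \<omega> z) \<le> \<delta>"
proof -
  define h where "h x = \<omega> (cis x)" for x
  obtain p \<theta> where p: "p > 0" "\<theta> 0 = 0" "\<theta> p = 2 * pi" and mono: "\<And>i j. i < j \<Longrightarrow> j \<le> p \<Longrightarrow> \<theta> i < \<theta> j"
    and osc: "\<And>i x y. i < p \<Longrightarrow> \<theta> i < x \<Longrightarrow> x < \<theta> (Suc i) \<Longrightarrow> \<theta> i < y \<Longrightarrow> y < \<theta> (Suc i) \<Longrightarrow> cmod (h x - h y) \<le> \<delta>"
    using regulated_partition[of 0 "2 * pi" \<delta> h] PC_tendsto_right PC_tendsto_left assms unfolding h_def
    by (smt (verit) pi_gt_zero)
  define c where "c i = h ((\<theta> i + \<theta> (Suc i)) / 2)" for i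
  have step: "\<theta> i < \<theta> (Suc i)" if "i < p" for i using mono[of i "Suc i"] that by auto
  have hc: "cmod (h y - c i) \<le> \<delta>" if "i < p" "\<theta> i < y" "y < \<theta> (Suc i)" for i y
    unfolding c_def by (rule osc[OF that]) (use step[OF that(1)] in auto)
  have uniq: "i = j" if "i < p" "j < p" "\<theta> i < x" "x < \<theta> (Suc i)" "\<theta> j < x" "x \<le> \<theta> (Suc j)" for i j x
  proof (rule ccontr)
    assume "i \<noteq> j"
    then consider "Suc i \<le> j" | "Suc j \<le> i" by linarith
    then show False
    proof cases
      case 1
      then have "\<theta> (Suc i) \<le> \<theta> j" using mono[of "Suc i" j] that by (cases "Suc i = j") auto
      then show False using that by linarith
    next
      case 2
      then have "\<theta> (Suc j) \<le> \<theta> i" using mono[of "Suc j" i] that by (cases "Suc j = i") auto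
      then show False using that by linarith
    qed
  qed
  have locate: "\<exists>i<p. \<theta> i < x \<and> x \<le> \<theta> (Suc i)" if "0 < x" "x \<le> 2 * pi" for x
  proof -
    have "\<exists>i<k. \<theta> i < x \<and> x \<le> \<theta> (Suc i)" if "x \<le> \<theta> k" for k
      using that
    proof (induction k)
      case 0
      then show ?case using \<open>0 < x\<close> p by simp
    next
      case (Suc k)
      then show ?case by (cases "x \<le> \<theta> k") (auto simp: less_Suc_eq)
    qed
    then show ?thesis using that p by simp
  qed
  define P where "P = \<theta> ` {..p}"
  define s0 where "s0 x = (\<Sum>i<p. indicator {\<theta> i<..<\<theta> (Suc i)} x *\<^sub>R c i)" for x
  \<comment> \<open>Copying \<open>h\<close> at the nodes makes the approximation uniform at every
    point, and a finite set does not affect the Fourier integrals.\<close>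
  define s where "s x = (if x \<in> P then h x else s0 x)" for x
  have "finite P" by (simp add: P_def)
  have s0: "s0 x = c i" if "i < p" "\<theta> i < x" "x < \<theta> (Suc i)" for i x
  proof -
    have "s0 x = (\<Sum>j<p. if j = i then c j else 0)"
      unfolding s0_def
    proof (intro sum.cong refl)
      fix j assume "j \<in> {..<p}"
      then have "x \<in> {\<theta> j<..<\<theta> (Suc j)} \<longleftrightarrow> j = i"
        using that uniq[of j i x] by (metis greaterThanLessThan_iff lessThan_iff less_imp_le)
      then show "indicator {\<theta> j<..<\<theta> (Suc j)} x *\<^sub>R c j = (if j = i then c j else 0)"
        by (simp only: indicator_def of_bool_def split: if_splits) simp
    qed
    then show ?thesis using that by simp
  qed
  have s0_meas: "s0 \<in> borel_measurable borel"
    unfolding s0_def[abs_def] by measurable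
  have s_meas: "s \<in> borel_measurable borel"
  proof -
    have "(\<lambda>x. s0 x + (\<Sum>y\<in>P. indicator {y} x *\<^sub>R (h y - s0 y))) \<in> borel_measurable borel"
      using s0_meas by measurable
    moreover have "(\<lambda>x. s0 x + (\<Sum>y\<in>P. indicator {y} x *\<^sub>R (h y - s0 y))) = s"
    proof
      fix x
      have "(\<Sum>y\<in>P. indicator {y} x *\<^sub>R (h y - s0 y)) = (\<Sum>y\<in>P. if y = x then h y - s0 y else 0)"
        by (intro sum.cong) (auto simp: indicator_def)
      then show "s0 x + (\<Sum>y\<in>P. indicator {y} x *\<^sub>R (h y - s0 y)) = s x"
        using \<open>finite P\<close> by (simp add: s_def)
    qed
    ultimately show ?thesis by simp
  qed
  have close: "cmod (h x - s x) \<le> \<delta>" if x: "x \<in> {0..2 * pi}" for x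
  proof (cases "x \<in> P")
    case False
    have "\<theta> 0 \<in> P" by (auto simp: P_def)
    then have "0 < x" using that False p(2) by (cases "x = 0") auto
    then obtain i where i: "i < p" "\<theta> i < x" "x \<le> \<theta> (Suc i)" using locate[of x] x by auto
    then have "x \<noteq> \<theta> (Suc i)" using False by (auto simp: P_def)
    then show ?thesis using i s0[of i x] hc[of i x] False by (simp add: s_def)
  qed (use assms in \<open>simp add: s_def\<close>)
  define M where "M = (\<Sum>i<p. cmod (c i)) + (\<Sum>y\<in>P. cmod (h y))"
  have s_bound: "cmod (s x) \<le> M" for x
  proof (cases "x \<in> P")
    case True
    then have "cmod (h x) \<le> (\<Sum>y\<in>P. cmod (h y))"
      using \<open>finite P\<close> by (intro member_le_sum) auto
    moreover have "0 \<le> (\<Sum>i<p. cmod (c i))" by (simp add: sum_nonneg)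
    ultimately show ?thesis using True by (simp add: s_def M_def)
  next
    case False
    have "cmod (s0 x) \<le> (\<Sum>i<p. cmod (indicator {\<theta> i<..<\<theta> (Suc i)} x *\<^sub>R c i))"
      unfolding s0_def by (rule norm_sum)
    also have "\<dots> \<le> (\<Sum>i<p. cmod (c i))"
      by (intro sum_mono) (auto simp: indicator_def)
    finally have "cmod (s0 x) \<le> (\<Sum>i<p. cmod (c i))" .
    moreover have "0 \<le> (\<Sum>y\<in>P. cmod (h y))" by (simp add: sum_nonneg)
    ultimately show ?thesis using False by (simp add: s_def M_def)
  qed
  \<comment> \<open>Nodes are indexed by right endpoints, which lie in (0, 2 pi], so that the point
    1 of the circle occurs once only; the index \<open>Suc i mod p\<close> below closes the
    circle.\<close>
  define \<zeta> where "\<zeta> i = cis (\<theta> (Suc i))" for i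
  define k where "k i = (c (Suc i mod p) - c i) / 2" for i
  have range: "0 < \<theta> (Suc i) \<and> \<theta> (Suc i) \<le> 2 * pi" if "i < p" for i
    using mono[of 0 "Suc i"] mono[of "Suc i" p] p that by (cases "Suc i = p") auto
  have cis_inj: "x = y" if "cis x = cis y" "0 < x" "x \<le> 2 * pi" "0 < y" "y \<le> 2 * pi" for x y
  proof -
    have "cis (x - y) = 1" using that(1) by (simp add: cis_divide[symmetric])
    then have "cos (x - y) = 1" by (metis cis.sel(1) one_complex.sel(1))
    then obtain n :: int where n: "x - y = 2 * pi * of_int n"
      unfolding cos_one_2pi_int by (auto simp: mult_ac)
    have "\<bar>2 * pi * real_of_int n\<bar> < 2 * pi" using that unfolding n[symmetric] by auto
    then have "\<bar>real_of_int n\<bar> < 1" by (simp add: abs_mult)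
    then have "n = 0" by linarith
    then show ?thesis using n by simp
  qed
  have inj: "inj_on \<zeta> {..<p}"
  proof (rule inj_onI)
    fix i j assume ij: "i \<in> {..<p}" "j \<in> {..<p}" "\<zeta> i = \<zeta> j"
    then have "\<theta> (Suc i) = \<theta> (Suc j)" using cis_inj range by (simp add: \<zeta>_def)
    then show "i = j" using mono[of "Suc i" "Suc j"] mono[of "Suc j" "Suc i"] ij by (cases i j rule: linorder_cases) auto
  qed
  define Z where "Z = \<zeta> ` {..<p}"
  define \<kappa> where "\<kappa> z = k (inv_into {..<p} \<zeta> z)" for z
  have \<kappa>: "\<kappa> (\<zeta> i) = k i" if "i < p" for i using inj that by (simp add: \<kappa>_def)
  have fourier: "fourier_int s n = (\<Sum>z\<in>Z. \<kappa> z * z powi (- n)) / (\<i> * pi * of_int n)" if n: "n \<noteq> 0" for n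
  proof -
    define w where "w x = cis (- of_int n * x)" for x :: real
    have cw: "continuous_on UNIV w" unfolding w_def by (intro continuous_intros)
    have piece: "(\<integral>x. indicator {\<theta> i<..<\<theta> (Suc i)} x *\<^sub>R w x \<partial>circle_measure) = (w (\<theta> (Suc i)) - w (\<theta> i)) / (- \<i> * of_int n)"
      and piece_int: "integrable circle_measure (\<lambda>x. indicator {\<theta> i<..<\<theta> (Suc i)} x *\<^sub>R w x)" if "i < p" for i
    proof -
      show "integrable circle_measure (\<lambda>x. indicator {\<theta> i<..<\<theta> (Suc i)} x *\<^sub>R w x)"
        by (rule integrable_circle_measure[of _ 1])
          (auto simp: indicator_def w_def intro!: borel_measurable_scaleR measurable_restrict_space1
            borel_measurable_continuous_onI continuous_intros)
      have sub: "{\<theta> i<..<\<theta> (Suc i)} \<subseteq> {0..2 * pi}"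
        using range[OF that] that p(2) mono[of 0 i] by (cases "i = 0") force+
      have "(\<integral>x. indicator {\<theta> i<..<\<theta> (Suc i)} x *\<^sub>R w x \<partial>circle_measure) = (LBINT x:{\<theta> i<..<\<theta> (Suc i)}. w x)"
        unfolding integral_circle_measure set_lebesgue_integral_def
        using sub by (intro arg_cong[where f = "integral\<^sup>L lborel"] ext) (auto simp: indicator_def)
      also have "\<dots> = integral {\<theta> i<..<\<theta> (Suc i)} w"
      proof (rule set_borel_integral_eq_integral)
        have "set_integrable lborel {\<theta> i..\<theta> (Suc i)} w"
          by (rule borel_integrable_atLeastAtMost') (use cw continuous_on_subset in blast)
        then show "set_integrable lborel {\<theta> i<..<\<theta> (Suc i)} w"
          by (rule set_integrable_subset) auto
      qed
      also have "\<dots> = integral {\<theta> i..\<theta> (Suc i)} w"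
        by (simp add: integral_def integrable_on_def has_integral_Icc_iff_Ioo)
      also have "\<dots> = (w (\<theta> (Suc i)) - w (\<theta> i)) / (- \<i> * of_int n)"
        using integral_unique[OF has_integral_cis[of "- of_int n" "\<theta> i" "\<theta> (Suc i)"]] n step[OF that]
        by (simp add: w_def[abs_def])
      finally show "(\<integral>x. indicator {\<theta> i<..<\<theta> (Suc i)} x *\<^sub>R w x \<partial>circle_measure) = (w (\<theta> (Suc i)) - w (\<theta> i)) / (- \<i> * of_int n)" .
    qed
    have "(\<integral>x. s x * w x \<partial>circle_measure) = (\<integral>x. s0 x * w x \<partial>circle_measure)"
    proof (rule integral_cong_AE)
      have "AE x in lborel. x \<notin> P"
        using \<open>finite P\<close> by (intro AE_not_in finite_imp_null_set_lborel)
      then have "AE x in circle_measure. x \<notin> P"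
        by (subst AE_restrict_space_iff) auto
      then show "AE x in circle_measure. s x * w x = s0 x * w x"
        by eventually_elim (simp add: s_def)
    qed (auto intro!: borel_measurable_times measurable_restrict_space1 s_meas s0_meas borel_measurable_continuous_onI[OF cw])
    also have "\<dots> = (\<integral>x. (\<Sum>i<p. c i * (indicator {\<theta> i<..<\<theta> (Suc i)} x *\<^sub>R w x)) \<partial>circle_measure)"
      by (simp add: s0_def sum_distrib_right sum_distrib_left mult_ac)
    also have "\<dots> = (\<Sum>i<p. \<integral>x. c i * (indicator {\<theta> i<..<\<theta> (Suc i)} x *\<^sub>R w x) \<partial>circle_measure)"
      by (rule Bochner_Integration.integral_sum) (simp only: integrable_mult_right piece_int lessThan_iff)
    also have "\<dots> = (\<Sum>i<p. c i * ((w (\<theta> (Suc i)) - w (\<theta> i)) / (- \<i> * of_int n)))"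
      by (intro sum.cong refl) (simp only: integral_mult_right_zero piece lessThan_iff)
    also have "\<dots> = (\<Sum>i<p. c i * w (\<theta> i) - c i * w (\<theta> (Suc i))) / (\<i> * of_int n)"
      unfolding sum_divide_distrib by (intro sum.cong) (auto simp: n field_simps)
    \<comment> \<open>Cyclic summation by parts: \<open>w\<close> takes the value 1 at both 0 and 2
      pi, so regrouping by nodes leaves no boundary term.\<close>
    also have "(\<Sum>i<p. c i * w (\<theta> i) - c i * w (\<theta> (Suc i))) = (\<Sum>i<p. 2 * (k i * w (\<theta> (Suc i))))"
    proof -
      obtain q where q: "p = Suc q" using p(1) by (cases p) auto
      have "w (\<theta> p) = 1" "w (\<theta> 0) = 1"
        using cis_multiple_2pi[of "- of_int n"] p by (simp_all add: w_def mult_ac)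
      then have "(\<Sum>i<p. c i * w (\<theta> i)) = (\<Sum>i<p. c (Suc i mod p) * w (\<theta> (Suc i)))"
        unfolding q by (subst sum.lessThan_Suc_shift) (simp add: q)
      moreover have "2 * (k i * v) = c (Suc i mod p) * v - c i * v" for i v
        by (simp add: k_def left_diff_distrib)
      ultimately show ?thesis
        by (simp only: sum_subtractf)
    qed
    also have "\<dots> = 2 * (\<Sum>z\<in>Z. \<kappa> z * z powi (- n))"
      unfolding Z_def sum.reindex[OF inj] sum_distrib_left
      by (intro sum.cong refl) (simp add: \<kappa>, simp add: \<zeta>_def w_def cis_power_int)
    finally show ?thesis
      unfolding fourier_int_def integral_circle_measure[symmetric] by (simp add: w_def n field_simps)
  qed
  have jumps: "cmod (\<kappa> z - half_jump \<omega> z) \<le> \<delta>" if z: "z \<in> Z" for z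
  proof -
    obtain i where i: "i < p" "z = \<zeta> i" using z by (auto simp: Z_def)
    have minus: "cmod (limit_minus \<omega> z - c i) \<le> \<delta>"
      unfolding i(2) \<zeta>_def
      by (rule limit_bounds(2)[of "\<theta> i" "\<theta> (Suc i)"]) (use hc[OF i(1)] step[OF i(1)] in \<open>auto simp: h_def\<close>)
    define j where "j = Suc i mod p"
    have j: "j < p" "z = cis (\<theta> j)"
      using i p by (auto simp: j_def \<zeta>_def mod_Suc)
    have plus: "cmod (limit_plus \<omega> z - c j) \<le> \<delta>"
      unfolding j(2)
      by (rule limit_bounds(1)[of "\<theta> j" "\<theta> (Suc j)"]) (use hc[OF j(1)] step[OF j(1)] in \<open>auto simp: h_def\<close>)
    have "\<kappa> z - half_jump \<omega> z = ((limit_minus \<omega> z - c i) - (limit_plus \<omega> z - c j)) / 2"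
      using i \<kappa>[of i] by (simp add: half_jump_def k_def j_def diff_divide_distrib)
    also have "cmod \<dots> \<le> (cmod (limit_minus \<omega> z - c i) + cmod (limit_plus \<omega> z - c j)) / 2"
      using norm_triangle_ineq4 by (simp add: norm_divide)
    also have "\<dots> \<le> (\<delta> + \<delta>) / 2"
      using minus plus by (intro divide_right_mono add_mono) auto
    finally show ?thesis by simp
  qed
  have no_jumps: "cmod (half_jump \<omega> z) \<le> \<delta>" if z: "z \<in> sphere 0 1 - Z" for z
  proof -
    obtain x where x: "0 < x" "x \<le> 2 * pi" "z = cis x"
    proof -
      have "z = cis (Arg2pi z)"
        using z Arg2pi_eq[of z] by (metis Diff_iff complex_norm_eq_1_exp cis_conv_exp mem_sphere_0)
      then show thesis
        using that[of "Arg2pi z"] that[of "2 * pi"] Arg2pi_ge_0[of z] Arg2pi_lt_2pi[of z]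
        by (cases "Arg2pi z = 0") auto
    qed
    obtain i where i: "i < p" "\<theta> i < x" "x \<le> \<theta> (Suc i)" using locate x by blast
    then have "x \<noteq> \<theta> (Suc i)" using z x by (auto simp: Z_def \<zeta>_def)
    then have xi: "x < \<theta> (Suc i)" using i by simp
    have plus: "cmod (limit_plus \<omega> z - c i) \<le> \<delta>"
      unfolding x(3)
      by (rule limit_bounds(1)[of "\<theta> i" "\<theta> (Suc i)"]) (use hc[OF i(1)] i xi in \<open>auto simp: h_def\<close>)
    have minus: "cmod (limit_minus \<omega> z - c i) \<le> \<delta>"
      unfolding x(3)
      by (rule limit_bounds(2)[of "\<theta> i" "\<theta> (Suc i)"]) (use hc[OF i(1)] i xi in \<open>auto simp: h_def\<close>)
    have "half_jump \<omega> z = ((limit_plus \<omega> z - c i) - (limit_minus \<omega> z - c i)) / 2"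
      by (simp add: half_jump_def)
    also have "cmod \<dots> \<le> (cmod (limit_plus \<omega> z - c i) + cmod (limit_minus \<omega> z - c i)) / 2"
      using norm_triangle_ineq4[of "limit_plus \<omega> z - c i" "limit_minus \<omega> z - c i"] by (simp add: norm_divide)
    also have "\<dots> \<le> (\<delta> + \<delta>) / 2"
      using minus plus by (intro divide_right_mono add_mono) auto
    finally show ?thesis by simp
  qed
  show ?thesis
  proof (rule that[of Z s M \<kappa>])
    show "s \<in> borel_measurable circle_measure"
      by (rule measurable_restrict_space1) (use s_meas in simp)
    show "Z \<subseteq> sphere 0 1" by (auto simp: Z_def \<zeta>_def)
  qed (use s_bound close fourier jumps no_jumps in \<open>auto simp: Z_def h_def\<close>)
qed

text \<open>Measurability is inherited from the step functions, of which the symbol is a uniform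
  limit.\<close>

lemma PC_measurable: "(\<lambda>x. \<omega> (cis x)) \<in> borel_measurable circle_measure"
proof -
  have "\<exists>s. s \<in> borel_measurable circle_measure \<and>
      (\<forall>x\<in>{0..2 * pi}. cmod (\<omega> (cis x) - s x) \<le> 1 / real (Suc n))" for n
    using PC_step_approximation[of "1 / real (Suc n)"] by (metis of_nat_0_less_iff zero_less_Suc zero_less_divide_1_iff)
  then obtain s where s: "\<And>n. s n \<in> borel_measurable circle_measure"
    "\<And>n x. x \<in> {0..2 * pi} \<Longrightarrow> cmod (\<omega> (cis x) - s n x) \<le> 1 / real (Suc n)" by metis
  show ?thesis
  proof (rule borel_measurable_LIMSEQ_metric[OF s(1)])
    fix x assume "x \<in> space circle_measure"
    then have "norm (s n x - \<omega> (cis x)) \<le> 1 / real (Suc n)" for n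
      using s(2)[of x n] by (simp add: norm_minus_commute space_restrict_space)
    then have "(\<lambda>n. s n x - \<omega> (cis x)) \<longlonglongrightarrow> 0"
      by (intro Lim_null_comparison[OF _ LIMSEQ_inverse_real_of_nat]) (auto simp: inverse_eq_divide)
    then show "(\<lambda>n. s n x) \<longlonglongrightarrow> \<omega> (cis x)" by (simp add: LIM_zero_iff)
  qed
qed

end

section \<open>The Fourier transform of the hyperbolic secant\<close>

lemma cosh_denominator_eq_0_iff: "exp (z / 2) + exp (- z / 2) = 0 \<longleftrightarrow> exp z = -1" for z :: complex
proof -
  have "exp (z / 2) + exp (- z / 2) = exp (- z / 2) * (exp z + 1)"
    by (simp add: algebra_simps flip: exp_add)
  then show ?thesis by (simp only: mult_eq_0_iff exp_not_eq_zero simp_thms add_eq_0_iff2)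
qed

text \<open>Residue theorem on the rectangle with corners -R and R + 2 pi i. Translation by 2 pi i
  multiplies the integrand by a constant, so the top side reproduces the bottom one; the only pole
  inside is pi i, and the right-hand side is the estimate for the two vertical sides.\<close>

lemma sech_rectangle_bound:
  fixes a R :: real
  assumes R: "R > 0"
  shows "cmod ((1 + exp (- 2 * pi * a)) * integral {-R..R} (\<lambda>v. cis (a * v) / of_real (exp (v / 2) + exp (- v / 2)))
      - 2 * pi * exp (- pi * a)) \<le> 4 * pi * exp (2 * pi * \<bar>a\<bar>) / (exp (R / 2) - exp (- R / 2))"
proof -
  define g where "g z = exp (z / 2) + exp (- z / 2)" for z :: complex
  define f where "f z = exp (\<i> * a * z) / g z" for z :: complex
  \<comment> \<open>The widest open strip around the rectangle that avoids the neighbouring poles,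
    whose imaginary parts are -pi and 3 pi.\<close>
  define S where "S = {z. -pi < Im z \<and> Im z < 3 * pi}"
  define p where "p = \<i> * of_real pi"
  define b where "b = 2 * pi * \<i>"
  define c1 c2 c3 c4 where "c1 = complex_of_real (-R)" and "c2 = complex_of_real R"
    and "c3 = of_real R + b" and "c4 = of_real (-R) + b"
  have S_eq: "S = {z. Im z > -pi} \<inter> {z. Im z < 3 * pi}" by (auto simp: S_def)
  have "open S" "convex S"
    unfolding S_eq by (auto intro: open_Int convex_Int open_halfspace_Im_gt open_halfspace_Im_lt
        convex_halfspace_Im_gt convex_halfspace_Im_lt)
  have pS: "p \<in> S" by (simp add: p_def S_def)
  have zero: "z = p" if "z \<in> S" "g z = 0" for z
  proof -
    have "exp z = exp p"
      using that(2) unfolding g_def cosh_denominator_eq_0_iff by (simp add: p_def)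
    then obtain n :: int where n: "z = p + (of_int (2 * n) * pi) * \<i>"
      by (auto simp: exp_eq)
    have "-pi < pi + 2 * n * pi" "pi + 2 * n * pi < 3 * pi"
      using that(1) unfolding n by (simp_all add: S_def p_def)
    then have "(-1 - real_of_int n) * pi < 0" "(real_of_int n - 1) * pi < 0"
      by (simp_all add: algebra_simps)
    then have "-1 - real_of_int n < 0" "real_of_int n - 1 < 0"
      using pi_gt_zero by (auto simp: mult_less_0_iff)
    then have "n > -1" "n < 1" by linarith+
    then show ?thesis using n by simp
  qed
  have "exp p = -1" by (simp add: p_def)
  then have gp: "g p = 0" unfolding g_def cosh_denominator_eq_0_iff .
  have e1: "exp (p / 2) = \<i>" and e2: "exp (- p / 2) = - \<i>"
    using cis_conv_exp[of "pi / 2"] cis_conv_exp[of "- (pi / 2)"]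
    by (simp_all add: p_def mult.commute)
  have dg: "(g has_field_derivative \<i>) (at p)"
  proof -
    have "(g has_field_derivative exp (p / 2) * (1 / 2) + exp (- p / 2) * (- 1 / 2)) (at p)"
      unfolding g_def[abs_def] by (auto intro!: derivative_eq_intros)
    then show ?thesis unfolding e1 e2 by simp
  qed
  have g_hol: "g holomorphic_on A" for A
    unfolding g_def[abs_def] by (intro holomorphic_intros) auto
  have f_hol: "f holomorphic_on S - {p}"
    unfolding f_def[abs_def] using zero by (intro holomorphic_intros g_hol) auto
  have res: "residue f p = exp (- pi * a) / \<i>"
  proof -
    have "residue (\<lambda>w. exp (\<i> * a * w) / g w) p = exp (\<i> * a * p) / \<i>"
      by (rule residue_simple_pole_deriv[where s = S])
        (auto intro!: holomorphic_intros g_hol convex_connected simp: \<open>convex S\<close> \<open>open S\<close> pS dg gp)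
    moreover have "\<i> * a * p = - pi * a" by (simp add: p_def complex_eq_iff)
    ultimately show ?thesis by (simp add: f_def[abs_def] flip: exp_of_real)
  qed
  have c13: "Re c1 = -R" "Im c1 = 0" "Re c3 = R" "Im c3 = 2 * pi" by (simp_all add: c1_def c3_def b_def)
  have c_eq: "Complex (Re c3) (Im c1) = c2" "Complex (Re c1) (Im c3) = c4"
    by (simp_all add: c2_def c4_def b_def c13 complex_eq_iff)
  have inS: "cbox c1 c3 \<subseteq> S"
  proof
    fix x assume "x \<in> cbox c1 c3"
    then have "0 \<le> Im x" "Im x \<le> 2 * pi" by (auto simp: in_cbox_complex_iff c13)
    then show "x \<in> S" using pi_gt_zero unfolding S_def mem_Collect_eq by linarith
  qed
  have pbox: "p \<in> box c1 c3" using R by (simp add: in_box_complex_iff c13 p_def)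
  have img: "path_image (rectpath c1 c3) \<subseteq> S - {p}"
    using path_image_rectpath_subset_cbox[of c1 c3] inS path_image_rectpath_inter_box[of c1 c3] pbox R
    by (auto simp: c13)
  have "contour_integral (rectpath c1 c3) f = 2 * pi * \<i> * (\<Sum>q\<in>{p}. winding_number (rectpath c1 c3) q * residue f q)"
  proof (rule Residue_theorem[OF \<open>open S\<close> convex_connected[OF \<open>convex S\<close>] _ f_hol _ _ img])
    show "\<forall>z. z \<notin> S \<longrightarrow> winding_number (rectpath c1 c3) z = 0"
      using inS R by (intro allI impI winding_number_rectpath_outside) (auto simp: c13)
  qed auto
  then have "contour_integral (rectpath c1 c3) f = of_real (2 * pi) * \<i> * (of_real (exp (- pi * a)) / \<i>)"
    using winding_number_rectpath[OF pbox] by (simp only: res sum.insert sum.empty finite.emptyI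
        empty_iff not_False_eq_True mult_1_left add_0_right)
  moreover have "x * \<i> * (y / \<i>) = x * y" for x y :: complex
    by (simp add: complex_eq_iff)
  ultimately have rect: "contour_integral (rectpath c1 c3) f = of_real (2 * pi) * of_real (exp (- pi * a))"
    by (simp only:)
  have segs: "closed_segment c1 c2 \<union> closed_segment c2 c3 \<union> closed_segment c3 c4 \<union> closed_segment c4 c1 \<subseteq> S - {p}"
    using img unfolding rectpath_def Let_def c_eq by (simp add: path_image_join Un_assoc)
  have cont: "continuous_on (S - {p}) f" by (rule holomorphic_on_imp_continuous_on[OF f_hol])
  have int: "f contour_integrable_on linepath c1 c2" "f contour_integrable_on linepath c2 c3"
    "f contour_integrable_on linepath c3 c4" "f contour_integrable_on linepath c4 c1"
    using segs by (auto intro!: contour_integrable_continuous_linepath continuous_on_subset[OF cont])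
  have split: "contour_integral (rectpath c1 c3) f = contour_integral (linepath c1 c2) f
      + contour_integral (linepath c2 c3) f + contour_integral (linepath c3 c4) f + contour_integral (linepath c4 c1) f"
    unfolding rectpath_def Let_def c_eq using int
    by (simp add: contour_integrable_join add.assoc)
  define J where "J = integral {-R..R} (\<lambda>v. cis (a * v) / of_real (exp (v / 2) + exp (- v / 2)))"
  have bottom: "contour_integral (linepath c1 c2) f = J"
  proof -
    have "contour_integral (linepath c1 c2) f = integral {Re c1..Re c2} (\<lambda>x. f (of_real x))"
      by (rule contour_integral_linepath_Reals_eq) (use R in \<open>auto simp: c1_def c2_def\<close>)
    also have "(\<lambda>x. f (of_real x)) = (\<lambda>v. cis (a * v) / of_real (exp (v / 2) + exp (- v / 2)))"
      by (rule ext) (simp add: f_def g_def cis_conv_exp mult.assoc flip: exp_of_real)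
    finally show ?thesis by (simp add: J_def c1_def c2_def)
  qed
  \<comment> \<open>The denominator changes sign under translation by 2 pi i. Together with the
    reversed orientation of the top side this yields the factor
    \<open>1 + exp (- 2 * pi * a)\<close> instead of a difference.\<close>
  have shift: "f (z + b) = - exp (- 2 * pi * a) * f z" for z
  proof -
    have "exp ((z + b) / 2) = - exp (z / 2)" "exp (- (z + b) / 2) = - exp (- z / 2)"
      by (simp_all add: b_def add_divide_distrib exp_add diff_divide_distrib exp_diff exp_minus)
    then have "g (z + b) = - g z" by (simp add: g_def)
    moreover have "\<i> * a * (z + b) = \<i> * a * z + of_real (- 2 * pi * a)"
      by (simp add: b_def algebra_simps)
    then have "exp (\<i> * a * (z + b)) = exp (\<i> * a * z) * exp (- 2 * pi * a)"
      by (simp only: exp_add exp_of_real)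
    ultimately show ?thesis by (simp add: f_def)
  qed
  have top: "contour_integral (linepath c3 c4) f = exp (- 2 * pi * a) * J"
  proof -
    have "contour_integral (linepath c3 c4) f = - contour_integral (linepath c4 c3) f"
      by (metis contour_integral_reversepath reversepath_linepath valid_path_linepath)
    also have "contour_integral (linepath c4 c3) f = - exp (- 2 * pi * a) * J"
    proof (rule contour_integral_unique)
      have "(f has_contour_integral J) (linepath c1 c2)"
        using int(1) bottom has_contour_integral_integral by metis
      then have "((\<lambda>x. f (linepath c1 c2 x) * (c2 - c1)) has_integral J) {0..1}"
        by (simp add: has_contour_integral_linepath)
      then have "((\<lambda>x. - exp (- 2 * pi * a) * (f (linepath c1 c2 x) * (c2 - c1))) has_integral - exp (- 2 * pi * a) * J) {0..1}"
        by (rule has_integral_mult_right)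
      moreover have "- exp (- 2 * pi * a) * (f (linepath c1 c2 x) * (c2 - c1)) = f (linepath c4 c3 x) * (c3 - c4)" for x
      proof -
        have "linepath c4 c3 x = linepath c1 c2 x + b"
          by (simp add: linepath_def c1_def c2_def c3_def c4_def scaleR_conv_of_real algebra_simps)
        then show ?thesis
          by (simp only: shift) (simp add: c1_def c2_def c3_def c4_def)
      qed
      ultimately show "(f has_contour_integral - exp (- 2 * pi * a) * J) (linepath c4 c3)"
        by (simp add: has_contour_integral_linepath)
    qed
    finally show ?thesis by simp
  qed
  define B where "B = exp (2 * pi * \<bar>a\<bar>) / (exp (R / 2) - exp (- R / 2))"
  have Rpos: "exp (R / 2) - exp (- R / 2) > 0" using R by simp
  have side: "cmod (f z) \<le> B" if "\<bar>Re z\<bar> = R" "0 \<le> Im z" "Im z \<le> 2 * pi" for z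
  proof -
    have "cmod (exp (\<i> * a * z)) = exp (- a * Im z)" by (simp add: norm_exp_eq_Re)
    also have "\<dots> \<le> exp (2 * pi * \<bar>a\<bar>)"
    proof -
      have "- a * Im z \<le> \<bar>a\<bar> * Im z" using that by (intro mult_right_mono) auto
      also have "\<dots> \<le> \<bar>a\<bar> * (2 * pi)" using that by (intro mult_left_mono) auto
      finally show ?thesis by (simp add: mult_ac)
    qed
    finally have num: "cmod (exp (\<i> * a * z)) \<le> exp (2 * pi * \<bar>a\<bar>)" .
    have "exp (R / 2) - exp (- R / 2) \<le> \<bar>cmod (exp (z / 2)) - cmod (exp (- z / 2))\<bar>"
      using that by (cases "Re z \<ge> 0") (auto simp: norm_exp_eq_Re)
    also have "\<dots> \<le> cmod (exp (z / 2) - - exp (- z / 2))"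
      using norm_triangle_ineq3[of "exp (z / 2)" "- exp (- z / 2)"] by simp
    finally have "exp (R / 2) - exp (- R / 2) \<le> cmod (g z)" by (simp add: g_def)
    then show ?thesis
      unfolding f_def B_def norm_divide using num Rpos by (intro frac_le) auto
  qed
  have "B \<ge> 0" using Rpos by (simp add: B_def)
  have cb: "cmod b = 2 * pi" by (simp add: b_def norm_mult)
  have right: "cmod (contour_integral (linepath c2 c3) f) \<le> B * cmod (c3 - c2)"
  proof (rule contour_integral_bound_linepath[OF int(2) \<open>B \<ge> 0\<close>])
    fix z assume "z \<in> closed_segment c2 c3"
    then show "cmod (f z) \<le> B"
      using R pi_gt_zero by (intro side) (auto simp: closed_segment_same_Re closed_segment_eq_real_ivl c2_def c3_def b_def split: if_splits)
  qed
  have left: "cmod (contour_integral (linepath c4 c1) f) \<le> B * cmod (c1 - c4)"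
  proof (rule contour_integral_bound_linepath[OF int(4) \<open>B \<ge> 0\<close>])
    fix z assume "z \<in> closed_segment c4 c1"
    then show "cmod (f z) \<le> B"
      using R pi_gt_zero by (intro side) (auto simp: closed_segment_same_Re closed_segment_eq_real_ivl c1_def c4_def b_def split: if_splits)
  qed
  define u v where "u = contour_integral (linepath c2 c3) f" and "v = contour_integral (linepath c4 c1) f"
  have uv: "cmod u \<le> B * (2 * pi)" "cmod v \<le> B * (2 * pi)"
    using right left cb by (simp_all add: u_def v_def c1_def c2_def c3_def c4_def)
  have eq: "(1 + exp (- 2 * pi * a)) * J - 2 * pi * exp (- pi * a) = - (u + v)"
    using rect unfolding split bottom top u_def v_def by (simp add: algebra_simps)
  have "cmod ((1 + exp (- 2 * pi * a)) * J - 2 * pi * exp (- pi * a)) \<le> cmod u + cmod v"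
    unfolding eq norm_minus_cancel by (rule norm_triangle_ineq)
  also have "\<dots> \<le> 4 * pi * exp (2 * pi * \<bar>a\<bar>) / (exp (R / 2) - exp (- R / 2))"
  proof -
    have "cmod u + cmod v \<le> B * (2 * pi) + B * (2 * pi)" by (rule add_mono[OF uv])
    also have "\<dots> = 4 * pi * B" by (simp add: algebra_simps)
    finally show ?thesis by (simp add: B_def)
  qed
  finally show ?thesis by (simp add: J_def)
qed

lemma sech_symmetric_integral_tendsto:
  fixes a :: real
  shows "(\<lambda>n. integral {- real n..real n} (\<lambda>v. cis (a * v) / of_real (exp (v / 2) + exp (- v / 2))))
    \<longlonglongrightarrow> of_real (pi / cosh (pi * a))"
proof -
  define J where "J n = integral {- real n..real n} (\<lambda>v. cis (a * v) / of_real (exp (v / 2) + exp (- v / 2)))" for n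
  define E where "E = 1 + exp (- 2 * pi * a)"
  have E: "E > 0" unfolding E_def by (simp add: add_pos_pos)
  have "(\<lambda>n. 4 * pi * exp (2 * pi * \<bar>a\<bar>) / (exp (real n / 2) - exp (- real n / 2))) \<longlonglongrightarrow> 0"
    by real_asymp
  then have "(\<lambda>n. E * J n - 2 * pi * exp (- pi * a)) \<longlonglongrightarrow> 0"
  proof (rule Lim_null_comparison[rotated], intro eventually_sequentiallyI[of 1])
    fix n :: nat assume "1 \<le> n"
    then show "norm (E * J n - 2 * pi * exp (- pi * a)) \<le>
        4 * pi * exp (2 * pi * \<bar>a\<bar>) / (exp (real n / 2) - exp (- real n / 2))"
      using sech_rectangle_bound[of "real n" a] unfolding E_def J_def by simp
  qed
  then have "(\<lambda>n. (E * J n - 2 * pi * exp (- pi * a)) / E + of_real (2 * pi * exp (- pi * a) / E)) \<longlonglongrightarrow>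
      0 / complex_of_real E + complex_of_real (2 * pi * exp (- pi * a) / E)"
    using E by (intro tendsto_intros) auto
  moreover have "(E * J n - 2 * pi * exp (- pi * a)) / E + of_real (2 * pi * exp (- pi * a) / E) = J n" for n
    using E by (simp add: field_simps)
  moreover have "2 * pi * exp (- pi * a) / E = pi / cosh (pi * a)"
  proof -
    have "E = exp (- pi * a) * (2 * cosh (pi * a))"
      by (simp add: E_def cosh_field_def algebra_simps flip: exp_add)
    then show ?thesis by simp
  qed
  ultimately show ?thesis
    unfolding J_def[symmetric] by (simp only: div_0 add_0)
qed

lemma sech_tail:
  fixes a X R :: real
  assumes "X \<le> R"
  defines "f \<equiv> \<lambda>v. cis (a * v) / of_real (exp (v / 2) + exp (- v / 2))"
  shows "cmod (integral {X..R} f) \<le> 2 * exp (- X / 2)"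
    and "cmod (integral {-R..-X} f) \<le> 2 * exp (- X / 2)"
proof -
  have pos: "exp (v / 2) + exp (- v / 2) > 0" for v :: real by (simp add: add_pos_pos)
  have "complex_of_real (exp (v / 2) + exp (- v / 2)) \<noteq> 0" for v :: real
    using pos[of v] by (metis less_irrefl of_real_eq_0_iff)
  then have cont: "continuous_on A f" for A
    unfolding f_def by (intro continuous_intros ballI) auto
  have nf: "cmod (f v) = 1 / (exp (v / 2) + exp (- v / 2))" for v
    using pos[of v] by (simp add: f_def norm_divide del: of_real_add)
  have prim: "((\<lambda>v. exp (- v / 2)) has_integral (- 2 * exp (- R / 2) - - 2 * exp (- X / 2))) {X..R}"
    by (rule fundamental_theorem_of_calculus[OF assms(1)])
      (auto intro!: derivative_eq_intros simp: has_real_derivative_iff_has_vector_derivative[symmetric])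
  have "norm (integral {X..R} f) \<le> integral {X..R} (\<lambda>v. exp (- v / 2))"
  proof (rule integral_norm_bound_integral)
    fix v assume "v \<in> {X..R}"
    have "1 / (exp (v / 2) + exp (- v / 2)) \<le> 1 / exp (v / 2)"
      by (rule divide_left_mono) (auto simp: add_pos_pos)
    then show "norm (f v) \<le> exp (- v / 2)" unfolding nf by (simp add: exp_minus field_simps)
  qed (auto intro!: integrable_continuous_interval cont continuous_intros)
  then show right: "cmod (integral {X..R} f) \<le> 2 * exp (- X / 2)"
    unfolding integral_unique[OF prim] by (smt (verit) exp_gt_zero)
  have "((\<lambda>v. exp (v / 2)) has_integral (2 * exp ((- X) / 2) - 2 * exp ((- R) / 2))) {-R..-X}"
    by (rule fundamental_theorem_of_calculus[where f = "\<lambda>v. 2 * exp (v / 2)"])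
      (use assms(1) in \<open>auto intro!: derivative_eq_intros simp: has_real_derivative_iff_has_vector_derivative[symmetric]\<close>)
  then have prim': "((\<lambda>v. exp (v / 2)) has_integral (2 * exp (- X / 2) - 2 * exp (- R / 2))) {-R..-X}"
    by simp
  have "norm (integral {-R..-X} f) \<le> integral {-R..-X} (\<lambda>v. exp (v / 2))"
  proof (rule integral_norm_bound_integral)
    fix v assume "v \<in> {-R..-X}"
    have "1 / (exp (v / 2) + exp (- v / 2)) \<le> 1 / exp (- v / 2)"
      by (rule divide_left_mono) (auto simp: add_pos_pos)
    then show "norm (f v) \<le> exp (v / 2)" unfolding nf by (simp add: exp_minus field_simps)
  qed (auto intro!: integrable_continuous_interval cont continuous_intros)
  then show "cmod (integral {-R..-X} f) \<le> 2 * exp (- X / 2)"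
    unfolding integral_unique[OF prim'] by (smt (verit) exp_gt_zero)
qed

text \<open>The two ends are independent because the substitution x = k exp v carries [1, N] to
  [- ln k, ln (N / k)]; the two errors then become 2 / sqrt k and 2 sqrt (k / N).\<close>

lemma sech_truncated_integral:
  fixes a X Y :: real
  assumes "0 \<le> X" "0 \<le> Y"
  defines "f \<equiv> \<lambda>v. cis (a * v) / of_real (exp (v / 2) + exp (- v / 2))"
  shows "cmod (integral {-X..Y} f - of_real (pi / cosh (pi * a))) \<le> 2 * exp (- X / 2) + 2 * exp (- Y / 2)"
proof -
  have pos: "exp (v / 2) + exp (- v / 2) > 0" for v :: real by (simp add: add_pos_pos)
  have "complex_of_real (exp (v / 2) + exp (- v / 2)) \<noteq> 0" for v :: real
    using pos[of v] by (metis less_irrefl of_real_eq_0_iff)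
  then have int: "f integrable_on {u..v}" for u v
    unfolding f_def by (intro integrable_continuous_interval continuous_intros ballI) auto
  have lim: "(\<lambda>n. cmod (integral {-X..Y} f - integral {- real n..real n} f)) \<longlonglongrightarrow>
      cmod (integral {-X..Y} f - of_real (pi / cosh (pi * a)))"
    unfolding f_def by (intro tendsto_intros sech_symmetric_integral_tendsto)
  show ?thesis
  proof (rule LIMSEQ_le_const2[OF lim], intro exI allI impI)
    fix n assume n: "n \<ge> nat \<lceil>max X Y\<rceil>"
    then have R: "X \<le> real n" "Y \<le> real n" by linarith+
    have "integral {- real n..real n} f = integral {- real n..-X} f + integral {-X..real n} f"
      using R assms(1) by (intro Henstock_Kurzweil_Integration.integral_combine[symmetric] int) auto
    also have "integral {-X..real n} f = integral {-X..Y} f + integral {Y..real n} f"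
      using R assms(1,2) by (intro Henstock_Kurzweil_Integration.integral_combine[symmetric] int) auto
    finally have "integral {-X..Y} f - integral {- real n..real n} f = - (integral {- real n..-X} f + integral {Y..real n} f)"
      by simp
    also have "cmod \<dots> \<le> cmod (integral {- real n..-X} f) + cmod (integral {Y..real n} f)"
      by (simp only: norm_minus_cancel norm_triangle_ineq)
    also have "\<dots> \<le> 2 * exp (- X / 2) + 2 * exp (- Y / 2)"
      unfolding f_def by (intro add_mono sech_tail R)
    finally show "cmod (integral {-X..Y} f - integral {- real n..real n} f) \<le> 2 * exp (- X / 2) + 2 * exp (- Y / 2)" .
  qed
qed

section \<open>Sums of slowly varying functions\<close>

text \<open>Comparison with the telescoping differences of 2 / sqrt n: the first term 1 and the
  remaining total of at most 2 give 3, a constant that enters most explicit error terms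
  below.\<close>

lemma sum_powr_three_halves_le: "(\<Sum>j=1..n. real j powr (-3/2)) \<le> 3"
proof -
  have "(\<Sum>j=1..n. real j powr (-3/2)) \<le> 3 - 2 / sqrt (real n)" if "n \<ge> 1" for n
    using that
  proof (induction n rule: nat_induct_at_least)
    case (Suc n)
    define s t where "s = sqrt (real n)" and "t = sqrt (real (Suc n))"
    have st: "0 < s" "s \<le> t" "t * t - s * s = 1" using Suc.hyps by (auto simp: s_def t_def)
    have "real (Suc n) powr (-3/2) = 1 / (t * t * t)"
    proof -
      have "real (Suc n) powr (-3/2) = real (Suc n) powr (- 1 + (- 1/2))" by simp
      also have "\<dots> = real (Suc n) powr (-1) * real (Suc n) powr (-1/2)" by (subst powr_add) simp
      also have "real (Suc n) powr (-1) = 1 / (t * t)" by (simp add: powr_minus_divide t_def)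
      also have "real (Suc n) powr (-1/2) = 1 / t"
        using powr_minus_divide[of "real (Suc n)" "1/2"] by (simp add: powr_half_sqrt t_def)
      finally show ?thesis by simp
    qed
    also have "\<dots> \<le> 2 / s - 2 / t"
    proof -
      have "s * (s + t) \<le> 2 * (t * t)" using st mult_mono[of s t s t] mult_mono[of s t t t] by (auto simp: algebra_simps)
      then have "s * t * (s + t) \<le> 2 * (t * t * t)" using st mult_left_mono[of "s * (s + t)" "2 * (t * t)" t] by (simp add: algebra_simps)
      then have "2 / (2 * (t * t * t)) \<le> 2 / (s * t * (s + t))" using st by (intro divide_left_mono) auto
      then have "1 / (t * t * t) \<le> 2 / (s * t * (s + t))" by simp
      also have "\<dots> = 2 * ((t * t - s * s) / (s * t * (s + t)))" by (simp add: st)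
      also have "t * t - s * s = (t - s) * (s + t)" by (simp add: algebra_simps)
      also have "2 * ((t - s) * (s + t) / (s * t * (s + t))) = 2 / s - 2 / t"
        using st by (simp add: diff_divide_distrib)
      finally show ?thesis .
    qed
    finally show ?case using Suc.IH by (simp add: s_def t_def)
  qed simp
  moreover have "0 \<le> 2 / sqrt (real n)" by simp
  ultimately show ?thesis
    by (cases "n \<ge> 1") (smt (verit), simp)
qed

text \<open>The decay x^(-3/2) is what differentiating x^(-1/2) produces, and it is summable; so
  both the passage from a sum to an integral and an Abel summation cost only
  O(\<open>b\<close>).\<close>

locale slowly_varying =
  fixes f f' :: "real \<Rightarrow> complex" and b :: real and N :: nat
  assumes N: "N \<ge> 1"
    and deriv: "\<And>x. x \<ge> 1 \<Longrightarrow> (f has_vector_derivative f' x) (at x)"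
    and bound: "\<And>x. x \<ge> 1 \<Longrightarrow> cmod (f' x) \<le> b * x powr (-3/2)"
begin

lemma b_nonneg: "b \<ge> 0"
  using order_trans[OF norm_ge_zero bound[of 1]] by simp

lemma local_variation:
  assumes "j \<ge> 1" "real j \<le> x" "x \<le> real j + 1"
  shows "cmod (f x - f (real j)) \<le> b * real j powr (-3/2)"
proof -
  have "cmod (f x - f (real j)) \<le> (b * real j powr (-3/2)) * norm (x - real j)"
  proof (rule differentiable_bound[of "{real j..x}" f "\<lambda>y h. h *\<^sub>R f' y"])
    fix y assume y: "y \<in> {real j..x}"
    then have "y \<ge> 1" using assms by auto
    show "(f has_derivative (\<lambda>h. h *\<^sub>R f' y)) (at y within {real j..x})"
      using deriv[OF \<open>y \<ge> 1\<close>] has_derivative_at_withinI unfolding has_vector_derivative_def by blast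
    have "onorm (\<lambda>h. h *\<^sub>R f' y) \<le> cmod (f' y)"
      by (rule onorm_le) (simp add: mult.commute)
    also have "\<dots> \<le> b * y powr (-3/2)" by (rule bound[OF \<open>y \<ge> 1\<close>])
    also have "\<dots> \<le> b * real j powr (-3/2)"
      using assms y b_nonneg by (intro mult_left_mono powr_mono2') auto
    finally show "onorm (\<lambda>h. h *\<^sub>R f' y) \<le> b * real j powr (-3/2)" .
  qed (use assms in auto)
  also have "\<dots> \<le> b * real j powr (-3/2) * 1"
    using assms b_nonneg by (intro mult_left_mono) auto
  finally show ?thesis by simp
qed

lemma sum_variation: "(\<Sum>j=1..<N. b * real j powr (-3/2)) \<le> 3 * b"
proof -
  have "(\<Sum>j=1..<N. real j powr (-3/2)) \<le> (\<Sum>j=1..N. real j powr (-3/2))"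
    by (rule sum_mono2) auto
  also have "\<dots> \<le> 3" by (rule sum_powr_three_halves_le)
  finally have "b * (\<Sum>j=1..<N. real j powr (-3/2)) \<le> b * 3"
    by (rule mult_left_mono[OF _ b_nonneg])
  then show ?thesis by (simp add: sum_distrib_left mult.commute)
qed

lemma continuous: "continuous_on {1..x} f"
proof (rule continuous_at_imp_continuous_on, intro ballI)
  fix y assume "y \<in> {1..x}"
  then show "isCont f y" using has_vector_derivative_continuous[OF deriv[of y]] by simp
qed

lemma integrable: "1 \<le> u \<Longrightarrow> f integrable_on {u..v}"
  by (rule integrable_continuous_interval, rule continuous_on_subset[OF continuous[of v]]) auto

text \<open>Each term with index below \<open>N\<close> is compared with the integral over the unit
  interval to its right, which leaves over the value at \<open>N\<close>; the factor 3 comes from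
  \<open>sum_powr_three_halves_le\<close>.\<close>

lemma sum_vs_integral:
  "cmod ((\<Sum>j=1..N. f (real j)) - integral {1..real N} f) \<le> cmod (f (real N)) + 3 * b"
proof -
  have eq: "integral {1..real N} f = (\<Sum>j=1..<N. integral {real j..real j + 1} f)"
    using N
  proof (induction N rule: nat_induct_at_least)
    case (Suc n)
    have "integral {1..real n} f + integral {real n..real n + 1} f = integral {1..real n + 1} f"
      using Suc.hyps by (intro Henstock_Kurzweil_Integration.integral_combine integrable) auto
    then show ?case using Suc by (simp add: add.commute)
  qed simp
  have "cmod (f (real j) - integral {real j..real j + 1} f) \<le> b * real j powr (-3/2)" if "j \<ge> 1" for j
  proof -
    have "integral {real j..real j + 1} (\<lambda>x. f x - f (real j)) = integral {real j..real j + 1} f - f (real j)"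
      using that by (subst Henstock_Kurzweil_Integration.integral_diff) (auto intro: integrable)
    moreover have "cmod (integral {real j..real j + 1} (\<lambda>x. f x - f (real j))) \<le> b * real j powr (-3/2) * (real j + 1 - real j)"
      using that local_variation[OF that]
      by (intro integral_bound continuous_intros continuous_on_subset[OF continuous[of "real j + 1"]]) auto
    ultimately show ?thesis by (simp add: norm_minus_commute)
  qed
  then have "cmod (\<Sum>j=1..<N. f (real j) - integral {real j..real j + 1} f) \<le> (\<Sum>j=1..<N. b * real j powr (-3/2))"
    by (intro order_trans[OF norm_sum] sum_mono) auto
  also note sum_variation
  finally have le: "cmod (\<Sum>j=1..<N. f (real j) - integral {real j..real j + 1} f) \<le> 3 * b" .
  have "(\<Sum>j=1..N. f (real j)) = (\<Sum>j=1..<N. f (real j)) + f (real N)"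
    using N by (simp add: sum.last_plus atLeastLessThanSuc_atLeastAtMost[symmetric])
  then have "(\<Sum>j=1..N. f (real j)) - integral {1..real N} f =
      f (real N) + (\<Sum>j=1..<N. f (real j) - integral {real j..real j + 1} f)"
    by (simp add: eq sum_subtractf)
  also have "cmod \<dots> \<le> cmod (f (real N)) + 3 * b"
    using norm_triangle_ineq[of "f (real N)"] le by (meson add_left_mono order_trans)
  finally show ?thesis .
qed

text \<open>Abel summation: the partial geometric sums \<open>W n\<close> stay bounded by 2 / |1 -
  w|, and the increments of \<open>f\<close> are summable.\<close>

lemma oscillating_sum:
  assumes w: "cmod w = 1" "w \<noteq> 1"
  shows "cmod (\<Sum>j=1..N. w ^ j * f (real j)) \<le> 2 / cmod (1 - w) * (cmod (f (real N)) + 3 * b)"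
proof -
  define W where "W n = (\<Sum>j=1..n. w ^ j)" for n
  have W: "cmod (W n) \<le> 2 / cmod (1 - w)" for n
  proof -
    have "W n * (1 - w) = w - w ^ Suc n"
    proof (induction n)
      case (Suc n)
      have "W (Suc n) = W n + w ^ Suc n" by (simp add: W_def)
      then have "W (Suc n) * (1 - w) = W n * (1 - w) + w ^ Suc n * (1 - w)"
        by (simp only: distrib_right)
      then show ?case unfolding Suc by (simp add: algebra_simps)
    qed (simp add: W_def)
    then have "W n = (w - w ^ Suc n) / (1 - w)" using w by (simp add: field_simps)
    moreover have "cmod (w - w ^ Suc n) \<le> 2"
      using norm_triangle_ineq4[of w "w ^ Suc n"] w by (simp add: norm_mult norm_power)
    ultimately show ?thesis by (simp add: norm_divide divide_right_mono)
  qed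
  have abel: "(\<Sum>j=1..N. w ^ j * f (real j)) = W N * f (real N) - (\<Sum>j=1..<N. W j * (f (real j + 1) - f (real j)))"
    using N
  proof (induction N rule: nat_induct_at_least)
    case (Suc n)
    have "W (Suc n) = W n + w ^ Suc n" by (simp add: W_def)
    then show ?case using Suc by (simp add: algebra_simps)
  qed (simp add: W_def)
  have "cmod (\<Sum>j=1..<N. W j * (f (real j + 1) - f (real j))) \<le> (\<Sum>j=1..<N. 2 / cmod (1 - w) * (b * real j powr (-3/2)))"
  proof (intro order_trans[OF norm_sum] sum_mono)
    fix j assume "j \<in> {1..<N}"
    then have "cmod (f (real j + 1) - f (real j)) \<le> b * real j powr (-3/2)"
      by (intro local_variation) auto
    then show "cmod (W j * (f (real j + 1) - f (real j))) \<le> 2 / cmod (1 - w) * (b * real j powr (-3/2))"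
      unfolding norm_mult by (intro mult_mono W) auto
  qed
  also have "\<dots> = 2 / cmod (1 - w) * (\<Sum>j=1..<N. b * real j powr (-3/2))"
    by (simp only: sum_distrib_left)
  also have "\<dots> \<le> 2 / cmod (1 - w) * (3 * b)"
    by (intro mult_left_mono sum_variation) auto
  finally have 1: "cmod (\<Sum>j=1..<N. W j * (f (real j + 1) - f (real j))) \<le> 2 / cmod (1 - w) * (3 * b)" .
  have 2: "cmod (W N * f (real N)) \<le> 2 / cmod (1 - w) * cmod (f (real N))"
    unfolding norm_mult by (intro mult_right_mono W) auto
  show ?thesis
    unfolding abel distrib_left using norm_triangle_ineq4 1 2 by (meson add_mono order_trans)
qed

end

lemma DERIV_powr_cis:
  fixes a s :: real
  assumes "x > 0"
  shows "((\<lambda>x. of_real (x powr s) * cis (a * ln x)) has_vector_derivative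
     (of_real s + \<i> * of_real a) * (of_real (x powr (s - 1)) * cis (a * ln x))) (at x)"
proof -
  have 1: "((\<lambda>x. x powr s) has_real_derivative s * x powr (s - 1)) (at x)"
    using assms by (auto intro!: derivative_eq_intros)
  have 2: "((\<lambda>x. cis (a * ln x)) has_vector_derivative (a / x) *\<^sub>R (\<i> * cis (a * ln x))) (at x)"
  proof -
    have "((\<lambda>x. a * ln x) has_vector_derivative a / x) (at x)"
      using assms by (auto intro!: derivative_eq_intros simp: has_real_derivative_iff_has_vector_derivative[symmetric])
    moreover have "(cis has_vector_derivative \<i> * cis y) (at y)" for y
    proof -
      have "((\<lambda>z. exp (\<i> * z)) has_field_derivative \<i> * exp (\<i> * of_real y)) (at (of_real y))"
        by (auto intro!: derivative_eq_intros)
      from has_vector_derivative_real_field[OF this] show ?thesis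
        by (simp add: cis_conv_exp[abs_def] o_def)
    qed
    ultimately show ?thesis
      using vector_diff_chain_at[of "\<lambda>x. a * ln x" "a / x" x cis] by (simp add: o_def)
  qed
  have "((\<lambda>x. complex_of_real (x powr s)) has_vector_derivative of_real (s * x powr (s - 1))) (at x)"
    using 1 by (intro has_vector_derivative_of_real) (simp add: has_real_derivative_iff_has_vector_derivative)
  from has_vector_derivative_mult[OF this 2] show ?thesis
    using assms by (simp add: scaleR_conv_of_real powr_diff field_simps)
qed

section \<open>Approximate eigenfunctions of the Hilbert matrix\<close>

text \<open>The function x^(-1/2 + i a), a generalized eigenfunction of the Carleman operator with
  kernel 1 / (x + y), for the eigenvalue pi / cosh (pi a).\<close>

definition power_wave :: "real \<Rightarrow> real \<Rightarrow> complex" where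
  "power_wave a x = of_real (x powr (- 1 / 2)) * cis (a * ln x)"

lemma cmod_power_wave: "cmod (power_wave a x) = x powr (- 1 / 2)"
  by (simp add: power_wave_def norm_mult)

lemma power_wave_kernel_slowly_varying:
  fixes a k :: real
  assumes "k \<ge> 1" "N \<ge> 1"
  shows "slowly_varying (\<lambda>x. (1 / (x + k)) *\<^sub>R power_wave a x)
    (\<lambda>x. (1 / (x + k)) *\<^sub>R ((of_real (- 1 / 2) + \<i> * of_real a) * (of_real (x powr (- 1 / 2 - 1)) * cis (a * ln x)))
      + (- 1 / (x + k)\<^sup>2) *\<^sub>R power_wave a x) ((3 / 2 + \<bar>a\<bar>) / k) N"
proof
  fix x :: real assume x: "1 \<le> x"
  have xk: "x + k > 0" using x assms by simp
  show "((\<lambda>x. (1 / (x + k)) *\<^sub>R power_wave a x) has_vector_derivative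
    (1 / (x + k)) *\<^sub>R ((of_real (- 1 / 2) + \<i> * of_real a) * (of_real (x powr (- 1 / 2 - 1)) * cis (a * ln x)))
      + (- 1 / (x + k)\<^sup>2) *\<^sub>R power_wave a x) (at x)"
    unfolding power_wave_def
  proof (rule has_vector_derivative_scaleR)
    show "((\<lambda>x. 1 / (x + k)) has_real_derivative - 1 / (x + k)\<^sup>2) (at x)"
      using xk by (auto intro!: derivative_eq_intros simp: power2_eq_square)
    show "((\<lambda>x. of_real (x powr (- 1 / 2)) * cis (a * ln x)) has_vector_derivative
        (of_real (- 1 / 2) + \<i> * of_real a) * (of_real (x powr (- 1 / 2 - 1)) * cis (a * ln x))) (at x)"
      by (rule DERIV_powr_cis) (use x in simp)
  qed
  define p where "p = x powr (-3/2)"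
  have p: "p > 0" "x powr (- 1 / 2 - 1) = p" using x by (simp_all add: p_def)
  have half: "x powr (- 1 / 2) = x * p"
    using x powr_add[of x 1 "-3/2"] by (simp add: p_def)
  have coef: "cmod (of_real (- 1 / 2) + \<i> * of_real a) \<le> 1 / 2 + \<bar>a\<bar>"
    by (rule order_trans[OF norm_triangle_ineq]) (simp add: norm_mult)
  have "cmod ((1 / (x + k)) *\<^sub>R ((of_real (- 1 / 2) + \<i> * of_real a) * (of_real (x powr (- 1 / 2 - 1)) * cis (a * ln x)))
      + (- 1 / (x + k)\<^sup>2) *\<^sub>R power_wave a x) \<le> (1 / (x + k)) * ((1 / 2 + \<bar>a\<bar>) * p) + (1 / (x + k)\<^sup>2) * (x * p)"
  proof (intro order_trans[OF norm_triangle_ineq] add_mono)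
    have "cmod (of_real (- 1 / 2) + \<i> * of_real a) * p \<le> (1 / 2 + \<bar>a\<bar>) * p"
      using coef p(1) by (intro mult_right_mono) auto
    then have "(1 / (x + k)) * (cmod (of_real (- 1 / 2) + \<i> * of_real a) * p) \<le> (1 / (x + k)) * ((1 / 2 + \<bar>a\<bar>) * p)"
      using xk by (intro mult_left_mono) auto
    then show "cmod ((1 / (x + k)) *\<^sub>R ((of_real (- 1 / 2) + \<i> * of_real a) * (of_real (x powr (- 1 / 2 - 1)) * cis (a * ln x))))
        \<le> (1 / (x + k)) * ((1 / 2 + \<bar>a\<bar>) * p)"
      using xk p(1) unfolding p(2) norm_scaleR norm_mult norm_of_real norm_cis by simp
    show "cmod ((- 1 / (x + k)\<^sup>2) *\<^sub>R power_wave a x) \<le> (1 / (x + k)\<^sup>2) * (x * p)"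
      unfolding norm_scaleR cmod_power_wave half by (simp add: abs_mult)
  qed
  also have "\<dots> \<le> (1 / (x + k)) * ((1 / 2 + \<bar>a\<bar>) * p) + (1 / (x + k)) * p"
  proof -
    have "x * p / (x + k)\<^sup>2 \<le> p / (x + k)"
      using xk p x assms by (simp add: power2_eq_square divide_simps)
    then show ?thesis by simp
  qed
  also have "\<dots> = (3 / 2 + \<bar>a\<bar>) * p * (1 / (x + k))"
  proof -
    have "y * ((1 / 2 + \<bar>a\<bar>) * p) + y * p = (3 / 2 + \<bar>a\<bar>) * p * y" for y :: real
      by (simp add: algebra_simps)
    then show ?thesis .
  qed
  also have "\<dots> \<le> (3 / 2 + \<bar>a\<bar>) * p * (1 / k)"
    using x assms p by (intro mult_left_mono divide_left_mono) auto
  finally show "cmod ((1 / (x + k)) *\<^sub>R ((of_real (- 1 / 2) + \<i> * of_real a) * (of_real (x powr (- 1 / 2 - 1)) * cis (a * ln x)))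
      + (- 1 / (x + k)\<^sup>2) *\<^sub>R power_wave a x) \<le> (3 / 2 + \<bar>a\<bar>) / k * x powr (-3/2)"
    by (simp add: p_def)
qed (use assms in auto)

lemma power_wave_kernel_end:
  assumes "k \<ge> 1" "N \<ge> 1"
  shows "cmod ((1 / (real N + k)) *\<^sub>R power_wave a (real N)) \<le> 1 / k"
proof -
  have "real N powr (- 1 / 2) \<le> 1"
    using assms by (simp add: powr_minus_divide powr_half_sqrt divide_le_eq_1)
  moreover have "1 / (real N + k) \<le> 1 / k" using assms by (intro divide_left_mono) auto
  ultimately have "1 / (real N + k) * (real N powr (- 1 / 2)) \<le> 1 / k * 1"
    using assms by (intro mult_mono) auto
  then show ?thesis using assms by (simp add: cmod_power_wave)
qed

text \<open>The substitution x = k exp v uses the homogeneity of the kernel: the wave factors out at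
  \<open>k\<close> and what remains is the Fourier integrand of the hyperbolic secant.\<close>

lemma power_wave_kernel_integral:
  assumes k: "1 \<le> k" "k \<le> real N"
  shows "integral {1..real N} (\<lambda>x. (1 / (x + k)) *\<^sub>R power_wave a x) =
    power_wave a k * integral {- ln k..ln (real N / k)} (\<lambda>v. cis (a * v) / of_real (exp (v / 2) + exp (- v / 2)))"
proof -
  define f where "f x = (1 / (x + k)) *\<^sub>R power_wave a x" for x
  interpret slowly_varying f
    "\<lambda>x. (1 / (x + k)) *\<^sub>R ((of_real (- 1 / 2) + \<i> * of_real a) * (of_real (x powr (- 1 / 2 - 1)) * cis (a * ln x)))
      + (- 1 / (x + k)\<^sup>2) *\<^sub>R power_wave a x" "(3 / 2 + \<bar>a\<bar>) / k" N
    unfolding f_def by (rule power_wave_kernel_slowly_varying) (use k in auto)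
  have kpos: "k > 0" "real N > 0" using k by auto
  have "((\<lambda>v. (k * exp v) *\<^sub>R f (k * exp v)) has_integral
      (integral {k * exp (- ln k)..k * exp (ln (real N / k))} f)) {- ln k..ln (real N / k)}"
  proof (rule has_integral_substitution)
    show "- ln k \<le> ln (real N / k)" using kpos k by (simp add: ln_div)
    show "k * exp (- ln k) \<le> k * exp (ln (real N / k))" using kpos k by (simp add: exp_minus)
    show "(\<lambda>v. k * exp v) ` {- ln k..ln (real N / k)} \<subseteq> {1..real N}"
    proof clarify
      fix v assume v: "v \<in> {- ln k..ln (real N / k)}"
      then have "exp (- ln k) \<le> exp v" "exp v \<le> exp (ln (real N / k))" by auto
      then have "inverse k \<le> exp v" "exp v \<le> real N / k" using kpos by (auto simp: exp_minus)
      then show "k * exp v \<in> {1..real N}" using kpos by (auto simp: field_simps)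
    qed
    show "continuous_on {1..real N} f" by (rule continuous)
    show "((\<lambda>v. k * exp v) has_real_derivative k * exp v) (at v within {- ln k..ln (real N / k)})" for v
      by (auto intro!: derivative_eq_intros)
  qed
  moreover have "k * exp (- ln k) = 1" "k * exp (ln (real N / k)) = real N"
    using kpos by (simp_all add: exp_minus)
  moreover have "(k * exp v) *\<^sub>R f (k * exp v) =
      power_wave a k * (cis (a * v) / of_real (exp (v / 2) + exp (- v / 2)))" for v
  proof -
    have ev: "exp v = exp (v / 2) * exp (v / 2)" by (simp flip: exp_add)
    have "(k * exp v) powr (- 1 / 2) = k powr (- 1 / 2) * exp (- v / 2)"
    proof -
      have "exp v powr (- 1 / 2) = exp (- v / 2)" by (simp add: powr_def)
      then show ?thesis using kpos powr_mult[of k "exp v" "- 1 / 2"] by simp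
    qed
    moreover have "cis (a * ln (k * exp v)) = cis (a * ln k) * cis (a * v)"
      using kpos by (simp add: ln_mult cis_mult distrib_left)
    ultimately have "(k * exp v) *\<^sub>R f (k * exp v) =
        of_real ((k * exp v) / (k * exp v + k) * exp (- v / 2)) * (power_wave a k * cis (a * v))"
      by (simp add: f_def power_wave_def scaleR_conv_of_real)
    also have "(k * exp v) / (k * exp v + k) * exp (- v / 2) = 1 / (exp (v / 2) + exp (- v / 2))"
    proof -
      define E where "E = exp (v / 2)"
      have E: "E > 0" by (simp add: E_def)
      have "(k * exp v) / (k * exp v + k) * exp (- v / 2) = (k * (E * E)) / (k * (E * E) + k) * (1 / E)"
      proof -
        have "exp v = E * E" unfolding E_def by (rule ev)
        moreover have "exp (- v / 2) = 1 / E" by (simp add: E_def exp_minus inverse_eq_divide)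
        ultimately show ?thesis by (simp only:)
      qed
      also have "k * (E * E) + k = k * (E * E + 1)" by (simp add: distrib_left)
      also have "k * (E * E) / (k * (E * E + 1)) * (1 / E) = E / (E * E + 1)"
        using kpos E by simp
      also have "\<dots> = 1 / ((E * E + 1) / E)" by simp
      also have "(E * E + 1) / E = E + 1 / E" using E by (simp add: add_divide_distrib)
      finally show ?thesis by (simp add: E_def exp_minus inverse_eq_divide)
    qed
    finally show ?thesis by (simp add: mult_ac)
  qed
  ultimately have "((\<lambda>v. power_wave a k * (cis (a * v) / of_real (exp (v / 2) + exp (- v / 2)))) has_integral
      integral {1..real N} f) {- ln k..ln (real N / k)}" by simp
  then have "integral {1..real N} f = integral {- ln k..ln (real N / k)} (\<lambda>v. power_wave a k * (cis (a * v) / of_real (exp (v / 2) + exp (- v / 2))))"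
    by (simp add: integral_unique)
  also have "\<dots> = power_wave a k * integral {- ln k..ln (real N / k)} (\<lambda>v. cis (a * v) / of_real (exp (v / 2) + exp (- v / 2)))"
    by (rule integral_mult_right)
  finally show ?thesis by (simp add: f_def[abs_def])
qed

lemma power_wave_kernel_sum:
  fixes a :: real
  assumes k: "1 \<le> k" "k \<le> N"
  shows "cmod ((\<Sum>j=1..N. (1 / (real j + real k)) *\<^sub>R power_wave a (real j)) - of_real (pi / cosh (pi * a)) * power_wave a (real k))
     \<le> (8 + 3 * \<bar>a\<bar>) / real k + 2 / sqrt (real N)"
proof -
  define F where "F = integral {- ln (real k)..ln (real N / real k)} (\<lambda>v. cis (a * v) / of_real (exp (v / 2) + exp (- v / 2)))"
  have Nk: "N \<ge> 1" "real k \<ge> 1" using k by auto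
  interpret slowly_varying "\<lambda>x. (1 / (x + real k)) *\<^sub>R power_wave a x"
    "\<lambda>x. (1 / (x + real k)) *\<^sub>R ((of_real (- 1 / 2) + \<i> * of_real a) * (of_real (x powr (- 1 / 2 - 1)) * cis (a * ln x)))
      + (- 1 / (x + real k)\<^sup>2) *\<^sub>R power_wave a x" "(3 / 2 + \<bar>a\<bar>) / real k" N
    by (rule power_wave_kernel_slowly_varying[OF Nk(2,1)])
  have 1: "cmod ((\<Sum>j=1..N. (1 / (real j + real k)) *\<^sub>R power_wave a (real j)) - power_wave a (real k) * F)
      \<le> 1 / real k + 3 * ((3 / 2 + \<bar>a\<bar>) / real k)"
    using sum_vs_integral power_wave_kernel_end[OF Nk(2,1), of a] power_wave_kernel_integral[of "real k" N a] k
    by (simp add: F_def)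
  have "cmod (F - of_real (pi / cosh (pi * a))) \<le> 2 * exp (- ln (real k) / 2) + 2 * exp (- ln (real N / real k) / 2)"
    unfolding F_def using k by (intro sech_truncated_integral) auto
  moreover have "exp (- ln (real k) / 2) = 1 / sqrt (real k)"
    using k by (simp add: exp_minus ln_sqrt[symmetric] inverse_eq_divide)
  moreover have "exp (- ln (real N / real k) / 2) = 1 / sqrt (real N / real k)"
    using k by (simp add: exp_minus ln_sqrt[symmetric] inverse_eq_divide)
  moreover have "cmod (power_wave a (real k)) = 1 / sqrt (real k)"
    using k by (simp add: cmod_power_wave powr_minus_divide powr_half_sqrt)
  ultimately have "cmod (power_wave a (real k)) * cmod (F - of_real (pi / cosh (pi * a)))
      \<le> 1 / sqrt (real k) * (2 * (1 / sqrt (real k)) + 2 * (1 / sqrt (real N / real k)))"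
    by (intro mult_mono) auto
  also have "\<dots> = 2 / real k + 2 / sqrt (real N)"
    using k by (simp add: real_sqrt_divide field_simps)
  finally have 2: "cmod (power_wave a (real k) * (F - of_real (pi / cosh (pi * a)))) \<le> 2 / real k + 2 / sqrt (real N)"
    by (simp add: norm_mult)
  have "(\<Sum>j=1..N. (1 / (real j + real k)) *\<^sub>R power_wave a (real j)) - of_real (pi / cosh (pi * a)) * power_wave a (real k)
      = ((\<Sum>j=1..N. (1 / (real j + real k)) *\<^sub>R power_wave a (real j)) - power_wave a (real k) * F)
        + power_wave a (real k) * (F - of_real (pi / cosh (pi * a)))"
    by (simp add: algebra_simps)
  also have "cmod \<dots> \<le> (1 / real k + 3 * ((3 / 2 + \<bar>a\<bar>) / real k)) + (2 / real k + 2 / sqrt (real N))"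
    by (rule order_trans[OF norm_triangle_ineq add_mono[OF 1 2]])
  \<comment> \<open>The constants are 1 from the last term of the sum, 9/2 from the sum-integral
    comparison and 2 from the lower tail of the secant integral, in all at most 8.\<close>
  also have "\<dots> \<le> (8 + 3 * \<bar>a\<bar>) / real k + 2 / sqrt (real N)"
    using k by (simp add: field_simps)
  finally show ?thesis .
qed

text \<open>Without resonance there is no main term. The bound has the same shape as the error in
  the resonant case, so that both can be treated together.\<close>

lemma power_wave_kernel_oscillating:
  fixes a :: real
  assumes k: "1 \<le> k" "1 \<le> N" and w: "cmod w = 1" "w \<noteq> 1"
  shows "cmod (\<Sum>j=1..N. w ^ j * ((1 / (real j + real k)) *\<^sub>R power_wave a (real j)))
     \<le> 2 / cmod (1 - w) * ((8 + 3 * \<bar>a\<bar>) / real k)"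
proof -
  have Nk: "N \<ge> 1" "real k \<ge> 1" using k by auto
  interpret slowly_varying "\<lambda>x. (1 / (x + real k)) *\<^sub>R power_wave a x"
    "\<lambda>x. (1 / (x + real k)) *\<^sub>R ((of_real (- 1 / 2) + \<i> * of_real a) * (of_real (x powr (- 1 / 2 - 1)) * cis (a * ln x)))
      + (- 1 / (x + real k)\<^sup>2) *\<^sub>R power_wave a x" "(3 / 2 + \<bar>a\<bar>) / real k" N
    by (rule power_wave_kernel_slowly_varying[OF Nk(2,1)])
  have "1 / real k + 3 * ((3 / 2 + \<bar>a\<bar>) / real k) \<le> (8 + 3 * \<bar>a\<bar>) / real k"
    using k by (simp add: field_simps)
  then have "cmod ((1 / (real N + real k)) *\<^sub>R power_wave a (real N)) + 3 * ((3 / 2 + \<bar>a\<bar>) / real k) \<le> (8 + 3 * \<bar>a\<bar>) / real k"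
    using power_wave_kernel_end[OF Nk(2,1), of a] by linarith
  then show ?thesis
    by (intro order_trans[OF oscillating_sum[OF w]] mult_left_mono) auto
qed

lemma power_wave_mult_cnj:
  assumes "x > 0"
  shows "power_wave a x * cnj (power_wave b x) = of_real (x powr (-1)) * cis ((a - b) * ln x)"
proof -
  have "x powr (- 1 / 2) * x powr (- 1 / 2) = x powr (-1)"
    using powr_add[of x "-1/2" "-1/2"] by simp
  then have "complex_of_real (x powr (- 1 / 2)) * complex_of_real (x powr (- 1 / 2)) = of_real (x powr (-1))"
    by (metis of_real_mult)
  moreover have "cis (a * ln x) * cnj (cis (b * ln x)) = cis ((a - b) * ln x)"
    by (simp add: cis_cnj cis_mult left_diff_distrib)
  ultimately show ?thesis
    by (simp add: power_wave_def mult_ac)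
qed

lemma reciprocal_wave_slowly_varying:
  fixes a :: real
  assumes "N \<ge> 1"
  shows "slowly_varying (\<lambda>x. of_real (x powr (-1)) * cis (a * ln x))
    (\<lambda>x. (of_real (-1) + \<i> * of_real a) * (of_real (x powr (- 1 - 1)) * cis (a * ln x))) (1 + \<bar>a\<bar>) N"
proof
  fix x :: real assume x: "1 \<le> x"
  show "((\<lambda>x. of_real (x powr (-1)) * cis (a * ln x)) has_vector_derivative
      (of_real (-1) + \<i> * of_real a) * (of_real (x powr (- 1 - 1)) * cis (a * ln x))) (at x)"
    by (rule DERIV_powr_cis) (use x in simp)
  have "cmod (of_real (-1) + \<i> * of_real a) \<le> 1 + \<bar>a\<bar>"
    by (rule order_trans[OF norm_triangle_ineq]) (simp add: norm_mult)
  moreover have "x powr (- 1 - 1) \<le> x powr (-3/2)" using x by (intro powr_mono) auto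
  ultimately have "cmod (of_real (-1) + \<i> * of_real a) * (x powr (- 1 - 1)) \<le> (1 + \<bar>a\<bar>) * x powr (-3/2)"
    by (intro mult_mono) auto
  then show "cmod ((of_real (-1) + \<i> * of_real a) * (of_real (x powr (- 1 - 1)) * cis (a * ln x))) \<le> (1 + \<bar>a\<bar>) * x powr (-3/2)"
    by (simp add: norm_mult)
qed (rule assms)

lemma reciprocal_wave_end:
  "N \<ge> 1 \<Longrightarrow> cmod (of_real (real N powr (-1)) * cis (a * ln (real N))) \<le> 1"
  by (simp add: norm_mult norm_divide powr_minus_divide)

text \<open>The frequencies are quantized so that in the variable ln x the wave has a whole number
  of periods over [1, N]; the integrals are then exactly orthogonal.\<close>

lemma reciprocal_wave_integral:
  assumes N: "N \<ge> 2" and a: "a = 2 * pi * of_int m / ln (real N)"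
  shows "integral {1..real N} (\<lambda>x. of_real (x powr (-1)) * cis (a * ln x)) = (if m = 0 then of_real (ln (real N)) else 0)"
proof (cases "m = 0")
  case True
  have "((\<lambda>x. 1 / x) has_integral (ln (real N) - ln 1)) {1..real N}"
    by (rule fundamental_theorem_of_calculus)
      (use N in \<open>auto intro!: derivative_eq_intros simp: has_real_derivative_iff_has_vector_derivative[symmetric]\<close>)
  then have "((\<lambda>x. complex_of_real (1 / x)) has_integral of_real (ln (real N) - ln 1)) {1..real N}"
    by (rule has_integral_of_real)
  then have "((\<lambda>x. complex_of_real (1 / x)) has_integral of_real (ln (real N))) {1..real N}"
    by (simp only: ln_one diff_zero)
  moreover have "((\<lambda>x. complex_of_real (1 / x)) has_integral of_real (ln (real N))) {1..real N} \<longleftrightarrow>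
    ((\<lambda>x. of_real (x powr (-1)) * cis (a * ln x)) has_integral of_real (ln (real N))) {1..real N}"
    by (rule has_integral_cong) (simp add: a True powr_minus_divide)
  ultimately show ?thesis using True by (simp add: integral_unique)
next
  case False
  have L: "ln (real N) > 0" using N by simp
  then have a0: "a \<noteq> 0" using False by (simp add: a)
  have hi: "((\<lambda>x. of_real (x powr (-1)) * cis (a * ln x)) has_integral
      (of_real (real N powr 0) * cis (a * ln (real N)) / (\<i> * of_real a) - of_real (1 powr 0) * cis (a * ln 1) / (\<i> * of_real a))) {1..real N}"
  proof (rule fundamental_theorem_of_calculus)
    fix x assume "x \<in> {1..real N}"
    then have x: "x > 0" by simp
    have d: "((\<lambda>x. of_real (x powr 0) * cis (a * ln x) / (\<i> * of_real a)) has_vector_derivative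
        ((of_real 0 + \<i> * of_real a) * (of_real (x powr (0 - 1)) * cis (a * ln x))) / (\<i> * of_real a)) (at x)"
      by (rule has_vector_derivative_divide[OF DERIV_powr_cis[OF x]])
    have e: "((of_real 0 + \<i> * of_real a) * (of_real (x powr (0 - 1)) * cis (a * ln x))) / (\<i> * of_real a)
        = of_real (x powr (-1)) * cis (a * ln x)"
      using a0 by simp
    show "((\<lambda>x. of_real (x powr 0) * cis (a * ln x) / (\<i> * of_real a)) has_vector_derivative
        of_real (x powr (-1)) * cis (a * ln x)) (at x within {1..real N})"
      by (rule has_vector_derivative_at_within[OF d[unfolded e]])
  qed (use N in simp)
  have "a * ln (real N) = 2 * pi * of_int m" using L by (simp add: a)
  then have "cis (a * ln (real N)) = 1"
    using cis_multiple_2pi[of "of_int m"] by simp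
  moreover have "real N powr 0 = 1" "ln (1::real) = 0" using N by auto
  ultimately show ?thesis
    unfolding integral_unique[OF hi] using False by simp
qed

text \<open>The constant is the sum of the end value 1 and the variation
  \<open>3 * (1 + \<bar>a\<bar>)\<close>.\<close>

lemma reciprocal_wave_sum:
  assumes N2: "N \<ge> 2" and a: "a = 2 * pi * of_int m / ln (real N)"
  shows "cmod ((\<Sum>j=1..N. of_real (real j powr (-1)) * cis (a * ln (real j))) - (if m = 0 then of_real (ln (real N)) else 0))
    \<le> 4 + 3 * \<bar>a\<bar>"
proof -
  interpret slowly_varying "\<lambda>x. of_real (x powr (-1)) * cis (a * ln x)"
    "\<lambda>x. (of_real (-1) + \<i> * of_real a) * (of_real (x powr (- 1 - 1)) * cis (a * ln x))" "1 + \<bar>a\<bar>" N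
    by (rule reciprocal_wave_slowly_varying) (use N2 in simp)
  show ?thesis
    using sum_vs_integral reciprocal_wave_end[of N a] N2 unfolding reciprocal_wave_integral[OF N2 a] by simp
qed

lemma reciprocal_wave_oscillating:
  assumes N: "N \<ge> 1" and w: "cmod w = 1" "w \<noteq> 1"
  shows "cmod (\<Sum>j=1..N. w ^ j * (of_real (real j powr (-1)) * cis (a * ln (real j)))) \<le> 2 / cmod (1 - w) * (4 + 3 * \<bar>a\<bar>)"
proof -
  interpret slowly_varying "\<lambda>x. of_real (x powr (-1)) * cis (a * ln x)"
    "\<lambda>x. (of_real (-1) + \<i> * of_real a) * (of_real (x powr (- 1 - 1)) * cis (a * ln x))" "1 + \<bar>a\<bar>" N
    by (rule reciprocal_wave_slowly_varying[OF N])
  show ?thesis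
    using reciprocal_wave_end[OF N, of a]
    by (intro order_trans[OF oscillating_sum[OF w]] mult_left_mono) auto
qed

text \<open>The cube in the derivative is split evenly between \<open>j\<close> and
  \<open>x\<close>, so that the bound is summable in \<open>j\<close> as well; the constant is 7 = 1
  + 3 * 2.\<close>

lemma inverse_square_oscillating:
  assumes j: "j \<ge> 1" and N: "N \<ge> 1" and w: "cmod w = 1" "w \<noteq> 1"
  shows "cmod (\<Sum>k=1..N. w ^ k * of_real (1 / (real j + real k)\<^sup>2)) \<le> 2 / cmod (1 - w) * (7 * real j powr (-3/2))"
proof -
  interpret slowly_varying "\<lambda>x. of_real (1 / (real j + x)\<^sup>2)" "\<lambda>x. of_real (- 2 / (real j + x) ^ 3)" "2 * real j powr (-3/2)" N
  proof
    fix x :: real assume x: "1 \<le> x"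
    have pos: "real j + x > 0" using x by simp
    have "((\<lambda>x. 1 / (real j + x)\<^sup>2) has_real_derivative - 2 / (real j + x) ^ 3) (at x)"
      using pos by (auto intro!: derivative_eq_intros simp: power2_eq_square power3_eq_cube divide_simps)
    then show "((\<lambda>x. complex_of_real (1 / (real j + x)\<^sup>2)) has_vector_derivative of_real (- 2 / (real j + x) ^ 3)) (at x)"
      by (intro has_vector_derivative_of_real) (simp add: has_real_derivative_iff_has_vector_derivative)
    have "real j powr (3/2) * x powr (3/2) \<le> (real j + x) powr (3/2) * (real j + x) powr (3/2)"
      using x by (intro mult_mono powr_mono2) auto
    also have "\<dots> = (real j + x) ^ 3"
      using pos by (simp add: powr_add[symmetric] powr_numeral)
    finally have "2 / (real j + x) ^ 3 \<le> 2 / (real j powr (3/2) * x powr (3/2))"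
      using j x pos by (intro divide_left_mono) auto
    also have "\<dots> = 2 * real j powr (-3/2) * x powr (-3/2)"
      by (simp add: powr_minus_divide)
    finally show "cmod (of_real (- 2 / (real j + x) ^ 3)) \<le> 2 * real j powr (-3/2) * x powr (-3/2)"
      using pos by (simp only: norm_of_real) simp
  qed (rule N)
  have "1 / (real j + real N)\<^sup>2 \<le> 1 / (real j)\<^sup>2"
    using j by (intro divide_left_mono power_mono) auto
  also have "\<dots> = real j powr (-2)" using j by (simp add: powr_minus_divide powr_numeral)
  also have "\<dots> \<le> real j powr (-3/2)" using j by (intro powr_mono) auto
  finally have "cmod (of_real (1 / (real j + real N)\<^sup>2)) + 3 * (2 * real j powr (-3/2)) \<le> 7 * real j powr (-3/2)"
    by (simp only: norm_of_real) simp
  then show ?thesis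
    by (intro order_trans[OF oscillating_sum[OF w]] mult_left_mono) auto
qed

text \<open>Each row telescopes to at most 1 / j, leaving a harmonic sum. The leading coefficient 1
  has to be sharp here, because the upper bound rests on comparing exact masses.\<close>

lemma inverse_square_sum:
  assumes "N \<ge> 1"
  shows "(\<Sum>j=1..N. \<Sum>k=1..N. 1 / (real j + real k)\<^sup>2) \<le> ln (real N) + 1"
proof -
  have row: "(\<Sum>k=1..n. 1 / (real j + real k)\<^sup>2) \<le> 1 / real j - 1 / (real j + real n)" if j: "j \<ge> 1" for j n
  proof (induction n)
    case (Suc n)
    define x where "x = real j + real n"
    have x: "x > 0" using j by (simp add: x_def)
    have "1 / (x + 1)\<^sup>2 \<le> 1 / (x * (x + 1))"
      using x by (intro divide_left_mono) (auto simp: power2_eq_square)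
    also have "\<dots> = 1 / x - 1 / (x + 1)" using x by (simp add: field_simps)
    finally show ?case using Suc by (simp add: x_def add.assoc add.commute[of 1])
  qed simp
  have "(\<Sum>j=1..N. \<Sum>k=1..N. 1 / (real j + real k)\<^sup>2) \<le> (\<Sum>j=1..N. 1 / real j)"
  proof (rule sum_mono)
    fix j assume "j \<in> {1..N}"
    then show "(\<Sum>k=1..N. 1 / (real j + real k)\<^sup>2) \<le> 1 / real j"
      using row[of j N] by (smt (verit) atLeastAtMost_iff of_nat_0_le_iff zero_le_divide_1_iff)
  qed
  also have "\<dots> \<le> ln (real N) + 1"
    using assms
  proof (induction N rule: nat_induct_at_least)
    case (Suc n)
    have "ln (real n / real (Suc n)) \<le> real n / real (Suc n) - 1"
      using Suc.hyps by (intro ln_le_minus_one) auto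
    then have "1 / real (Suc n) \<le> ln (real (Suc n)) - ln (real n)"
      using Suc.hyps by (simp add: ln_div field_simps)
    then show ?case using Suc.IH by simp
  qed simp
  finally show ?thesis .
qed

section \<open>Counting approximate eigenvectors\<close>

text \<open>The synthesis operator of a finite family, defined on the whole space by ignoring
  further coordinates so that \<open>codim_bound\<close> applies to it.\<close>

definition combination :: "nat \<Rightarrow> (nat \<Rightarrow> ell2) \<Rightarrow> ell2 \<Rightarrow> ell2" where
  "combination n v a = (\<Sum>l<n. cscale (coord a l) (v l))"

lemma has_matrix_combination:
  "has_matrix (combination n v) (\<lambda>j k. if j < n then coord (v j) k else 0)"
proof -
  have "norm (combination n v a) \<le> (\<Sum>l<n. norm (v l)) * norm a" for a
    unfolding combination_def sum_distrib_right
    by (intro order_trans[OF norm_sum] sum_mono)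
      (simp add: mult.commute[of _ "norm a"] mult_right_mono cmod_coord_le)
  then have "bounded_op (combination n v)"
    by (intro bounded_opI[of _ "\<Sum>l<n. norm (v l)"])
      (auto simp: combination_def cvec.scale_left_distrib sum.distrib cvec.scale_sum_right)
  then show ?thesis
    by (simp add: has_matrix_def entry_eq combination_def if_distrib[of "\<lambda>y. y * _"] cong: if_cong)
qed

text \<open>The squared Hilbert-Schmidt norm of the synthesis operator is the sum of the squared
  norms of the family, so Chebyshev's inequality applies.\<close>

lemma small_combination:
  assumes H: "(\<Sum>l<n. (norm (v l))\<^sup>2) \<le> H" and "\<delta> > 0"
  shows "\<exists>p. real p \<le> H / \<delta>\<^sup>2 \<and> codim_bound (combination n v) \<delta> p"
proof (rule Hilbert_Schmidt_codim_bound[OF has_matrix_combination _ assms(2)])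
  fix K
  have "(\<Sum>k<K. \<Sum>j<K. (cmod (if j < n then coord (v j) k else 0))\<^sup>2) =
      (\<Sum>j<K. \<Sum>k<K. (cmod (if j < n then coord (v j) k else 0))\<^sup>2)"
    by (rule sum.swap)
  also have "\<dots> = (\<Sum>j\<in>{..<K} \<inter> {..<n}. \<Sum>k<K. (cmod (coord (v j) k))\<^sup>2)"
    by (rule sum.mono_neutral_cong_right) auto
  also have "\<dots> \<le> (\<Sum>j<n. \<Sum>k<K. (cmod (coord (v j) k))\<^sup>2)"
    by (rule sum_mono2) (auto intro: sum_nonneg)
  also have "\<dots> \<le> (\<Sum>j<n. (norm (v j))\<^sup>2)"
    by (intro sum_mono sum_coord_le)
  finally show "(\<Sum>k<K. \<Sum>j<K. (cmod (if j < n then coord (v j) k else 0))\<^sup>2) \<le> H"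
    using H by linarith
qed

lemma norm_square_finite:
  assumes "\<And>l. l \<ge> n \<Longrightarrow> coord a l = 0"
  shows "(norm a)\<^sup>2 = (\<Sum>l<n. (cmod (coord a l))\<^sup>2)"
  unfolding norm_square_ell2 by (rule suminf_finite) (auto simp: assms)

text \<open>The defect of isometry is the quadratic form of the Gram matrix minus the identity. A
  Hilbert-Schmidt bound on this matrix makes the form at most \<open>\<delta>\<close> off few
  directions, even though the family itself need not be close to orthonormal in norm.\<close>

lemma near_isometric_combination:
  fixes \<phi> :: "nat \<Rightarrow> ell2"
  assumes H: "(\<Sum>l<n. \<Sum>m<n. (cmod (cinner (\<phi> l) (\<phi> m) - (if l = m then 1 else 0)))\<^sup>2) \<le> H" and \<delta>: "\<delta> > 0"
  shows "\<exists>p u. real p \<le> H / \<delta>\<^sup>2 \<and> (\<forall>a. (\<forall>l\<ge>n. coord a l = 0) \<longrightarrow> (\<forall>i<p. cinner a (u i) = 0) \<longrightarrow>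
      \<bar>(norm (combination n \<phi> a))\<^sup>2 - (norm a)\<^sup>2\<bar> \<le> \<delta> * (norm a)\<^sup>2)"
proof -
  define g where "g l m = cinner (\<phi> l) (\<phi> m) - (if l = m then 1 else 0)" for l m
  define v where "v l = (\<Sum>m<n. cscale (g l m) (basis_vec m))" for l
  have cv: "coord (v l) m = (if m < n then g l m else 0)" for l m
    by (simp add: v_def if_distrib[of "\<lambda>y. _ * y"] cong: if_cong)
  have "(norm (v l))\<^sup>2 = (\<Sum>m<n. (cmod (g l m))\<^sup>2)" for l
    by (subst norm_square_finite[of n]) (auto simp: cv)
  then have "(\<Sum>l<n. (norm (v l))\<^sup>2) \<le> H" using H by (simp add: g_def)
  from small_combination[OF this \<delta>] obtain p u where p: "real p \<le> H / \<delta>\<^sup>2"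
    and u: "\<And>a. (\<forall>i<p. cinner a (u i) = 0) \<Longrightarrow> norm (combination n v a) \<le> \<delta> * norm a"
    unfolding codim_bound_def by metis
  have "\<bar>(norm (combination n \<phi> a))\<^sup>2 - (norm a)\<^sup>2\<bar> \<le> \<delta> * (norm a)\<^sup>2"
    if a: "\<forall>l\<ge>n. coord a l = 0" "\<forall>i<p. cinner a (u i) = 0" for a
  proof -
    have "complex_of_real ((norm (combination n \<phi> a))\<^sup>2) = (\<Sum>l<n. \<Sum>m<n. coord a l * cnj (coord a m) * cinner (\<phi> l) (\<phi> m))"
      unfolding cinner_self[symmetric] combination_def
      by (simp add: cinner_sum_left cinner_sum_right cinner_cscale_left cinner_cscale_right sum_distrib_left mult_ac)
        (rule sum.swap)
    moreover have "complex_of_real ((norm a)\<^sup>2) = (\<Sum>l<n. \<Sum>m<n. coord a l * cnj (coord a m) * (if l = m then 1 else 0))"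
    proof -
      have "(norm a)\<^sup>2 = (\<Sum>l<n. (cmod (coord a l))\<^sup>2)"
        by (rule norm_square_finite) (use a(1) in auto)
      then have "complex_of_real ((norm a)\<^sup>2) = (\<Sum>l<n. coord a l * cnj (coord a l))"
        by (simp only: of_real_sum complex_norm_square)
      then show ?thesis by (simp add: if_distrib[of "\<lambda>y. _ * y"] cong: if_cong)
    qed
    ultimately have "complex_of_real ((norm (combination n \<phi> a))\<^sup>2 - (norm a)\<^sup>2) = (\<Sum>l<n. \<Sum>m<n. coord a l * cnj (coord a m) * g l m)"
      by (simp only: of_real_diff sum_subtractf[symmetric] right_diff_distrib[symmetric] g_def)
    also have "\<dots> = cinner (combination n v a) a"
    proof -
      have "cinner (v l) a = (\<Sum>m<n. cnj (coord a m) * g l m)" for l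
      proof -
        have "cinner (basis_vec m) a = cnj (coord a m)" for m
          by (metis cinner_basis_right cinner_commute)
        then show ?thesis by (simp add: v_def cinner_sum_left cinner_cscale_left mult.commute)
      qed
      then show ?thesis
        by (simp add: combination_def cinner_sum_left cinner_cscale_left sum_distrib_left mult_ac)
    qed
    finally have "\<bar>(norm (combination n \<phi> a))\<^sup>2 - (norm a)\<^sup>2\<bar> = cmod (cinner (combination n v a) a)"
      by (metis norm_of_real)
    also have "\<dots> \<le> norm (combination n v a) * norm a" by (rule cinner_bound)
    also have "\<dots> \<le> \<delta> * norm a * norm a" using u[OF a(2)] by (rule mult_right_mono) simp
    finally show ?thesis by (simp add: power2_eq_square)
  qed
  then show ?thesis using p by blast
qed

text \<open>If \<open>n\<close> were larger, some nonzero coefficient vector would avoid the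
  exceptional directions of both Gram matrices and of the error, and its image under the synthesis
  of \<open>\<phi>\<close> those of \<open>A\<close> at level \<open>t\<close>. On it
  \<open>A\<close> would be at most \<open>t\<close> up to \<open>\<delta>\<close>, but also at
  least \<open>t1\<close> up to \<open>\<delta>\<close>. The three Hilbert-Schmidt conditions
  account for \<open>3 * H / \<delta>\<^sup>2\<close>.\<close>

lemma approximate_eigenvectors_count:
  assumes A: "bounded_op A" and q: "codim_bound A t q"
    and gram_\<phi>: "(\<Sum>l<n. \<Sum>m<n. (cmod (cinner (\<phi> l) (\<phi> m) - (if l = m then 1 else 0)))\<^sup>2) \<le> H"
    and gram_\<psi>: "(\<Sum>l<n. \<Sum>m<n. (cmod (cinner (\<psi> l) (\<psi> m) - (if l = m then 1 else 0)))\<^sup>2) \<le> H"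
    and eig: "(\<Sum>l<n. (norm (A (\<phi> l) - cscale (\<mu> l) (\<psi> l)))\<^sup>2) \<le> H"
    and \<mu>: "\<And>l. l < n \<Longrightarrow> t1 \<le> cmod (\<mu> l)"
    and t: "0 \<le> t" "0 \<le> t1" and \<delta>: "0 < \<delta>" "\<delta> < 1" "t * sqrt (1 + \<delta>) + \<delta> < sqrt (1 - \<delta>) * t1"
  shows "real n \<le> real q + 3 * H / \<delta>\<^sup>2"
proof (rule ccontr)
  assume contra: "\<not> ?thesis"
  define E where "E l = A (\<phi> l) - cscale (\<mu> l) (\<psi> l)" for l
  obtain p1 u1 where 1: "real p1 \<le> H / \<delta>\<^sup>2" "\<And>a. (\<forall>l\<ge>n. coord a l = 0) \<Longrightarrow> (\<forall>i<p1. cinner a (u1 i) = 0) \<Longrightarrow>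
      \<bar>(norm (combination n \<phi> a))\<^sup>2 - (norm a)\<^sup>2\<bar> \<le> \<delta> * (norm a)\<^sup>2"
    using near_isometric_combination[OF gram_\<phi> \<delta>(1)] by metis
  obtain p2 u2 where 2: "real p2 \<le> H / \<delta>\<^sup>2" "\<And>a. (\<forall>l\<ge>n. coord a l = 0) \<Longrightarrow> (\<forall>i<p2. cinner a (u2 i) = 0) \<Longrightarrow>
      \<bar>(norm (combination n \<psi> a))\<^sup>2 - (norm a)\<^sup>2\<bar> \<le> \<delta> * (norm a)\<^sup>2"
    using near_isometric_combination[OF gram_\<psi> \<delta>(1)] by metis
  obtain p3 u3 where 3: "real p3 \<le> H / \<delta>\<^sup>2"
    "\<And>a. (\<forall>i<p3. cinner a (u3 i) = 0) \<Longrightarrow> norm (combination n E a) \<le> \<delta> * norm a"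
    using small_combination[OF eig[folded E_def] \<delta>(1)] unfolding codim_bound_def by metis
  obtain v where v: "\<And>x. (\<forall>i<q. cinner x (v i) = 0) \<Longrightarrow> norm (A x) \<le> t * norm x"
    using q unfolding codim_bound_def by metis
  \<comment> \<open>Each condition is written as a functional of the coefficients \<open>a\<close>.
    The second one concerns the coefficients after multiplication by the eigenvalues, hence the
    factor \<open>\<mu> l\<close> in \<open>R2\<close>.\<close>
  define R1 R2 R3 R4 where "R1 = (\<lambda>i l. cinner (basis_vec l) (u1 i)) ` {..<p1}"
    and "R2 = (\<lambda>i l. \<mu> l * cinner (basis_vec l) (u2 i)) ` {..<p2}"
    and "R3 = (\<lambda>i l. cinner (basis_vec l) (u3 i)) ` {..<p3}"
    and "R4 = (\<lambda>i l. cinner (\<phi> l) (v i)) ` {..<q}"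
  define R where "R = R1 \<union> (R2 \<union> (R3 \<union> R4))"
  have "finite R" by (simp add: R_def R1_def R2_def R3_def R4_def)
  have "card R \<le> card R1 + (card R2 + (card R3 + card R4))"
    unfolding R_def by (meson add_left_mono card_Un_le order_trans)
  also have "\<dots> \<le> p1 + (p2 + (p3 + q))"
    unfolding R1_def R2_def R3_def R4_def by (intro add_mono) (metis card_image_le card_lessThan finite_lessThan)+
  finally have "real (card R) \<le> real p1 + real p2 + real p3 + real q" by linarith
  also have "\<dots> < real n" using contra 1(1) 2(1) 3(1) by simp
  finally have "card R < card {..<n}" by simp
  from homogeneous_system[OF \<open>finite R\<close> _ this, of "\<lambda>r l. r l"] obtain a where
    a: "\<exists>l<n. a l \<noteq> 0" "\<And>r. r \<in> R \<Longrightarrow> (\<Sum>l<n. a l * r l) = 0" by auto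
  define x where "x = (\<Sum>l<n. cscale (a l) (basis_vec l))"
  define y where "y = (\<Sum>l<n. cscale (\<mu> l * a l) (basis_vec l))"
  have cx: "coord x l = (if l < n then a l else 0)" and cy: "coord y l = (if l < n then \<mu> l * a l else 0)" for l
    by (simp_all add: x_def y_def if_distrib[of "\<lambda>y. _ * y"] cong: if_cong)
  have "x \<noteq> 0" using a(1) cx by (metis coord_zero)
  have x1: "cinner x (u1 i) = 0" if "i < p1" for i
    using a(2)[of "\<lambda>l. cinner (basis_vec l) (u1 i)"] that
    by (auto simp: x_def cinner_sum_left cinner_cscale_left R_def R1_def)
  have y2: "cinner y (u2 i) = 0" if "i < p2" for i
    using a(2)[of "\<lambda>l. \<mu> l * cinner (basis_vec l) (u2 i)"] that
    by (auto simp: y_def cinner_sum_left cinner_cscale_left R_def R2_def mult_ac)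
  have x3: "cinner x (u3 i) = 0" if "i < p3" for i
    using a(2)[of "\<lambda>l. cinner (basis_vec l) (u3 i)"] that
    by (auto simp: x_def cinner_sum_left cinner_cscale_left R_def R3_def)
  have comb: "combination n w x = (\<Sum>l<n. cscale (a l) (w l))" for w
    unfolding combination_def by (intro sum.cong) (auto simp: cx)
  have x4: "cinner (combination n \<phi> x) (v i) = 0" if "i < q" for i
    using a(2)[of "\<lambda>l. cinner (\<phi> l) (v i)"] that
    by (auto simp: comb cinner_sum_left cinner_cscale_left R_def R4_def)
  define X where "X = combination n \<phi> x"
  have "(norm X)\<^sup>2 \<le> (1 + \<delta>) * (norm x)\<^sup>2"
    using 1(2)[of x] x1 cx by (simp add: X_def abs_le_iff algebra_simps)
  then have "(norm X)\<^sup>2 \<le> (sqrt (1 + \<delta>) * norm x)\<^sup>2" using \<delta> by (simp add: power_mult_distrib)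
  then have nX: "norm X \<le> sqrt (1 + \<delta>) * norm x" by (rule power2_le_imp_le) (use \<delta> in auto)
  have "t1\<^sup>2 * (norm x)\<^sup>2 \<le> (norm y)\<^sup>2"
  proof -
    have "(norm x)\<^sup>2 = (\<Sum>l<n. (cmod (a l))\<^sup>2)" "(norm y)\<^sup>2 = (\<Sum>l<n. (cmod (\<mu> l))\<^sup>2 * (cmod (a l))\<^sup>2)"
      by (subst norm_square_finite[of n]; auto simp: cx cy norm_mult power_mult_distrib)+
    then show ?thesis
      unfolding sum_distrib_left using \<mu> t by (auto simp: sum_distrib_left intro!: sum_mono mult_right_mono power_mono)
  qed
  moreover have "(1 - \<delta>) * (norm y)\<^sup>2 \<le> (norm (combination n \<psi> y))\<^sup>2"
    using 2(2)[of y] y2 cy by (simp add: abs_le_iff algebra_simps)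
  ultimately have "(1 - \<delta>) * (t1\<^sup>2 * (norm x)\<^sup>2) \<le> (norm (combination n \<psi> y))\<^sup>2"
    using \<delta> mult_left_mono[of "t1\<^sup>2 * (norm x)\<^sup>2" "(norm y)\<^sup>2" "1 - \<delta>"] by linarith
  then have "(sqrt (1 - \<delta>) * t1 * norm x)\<^sup>2 \<le> (norm (combination n \<psi> y))\<^sup>2"
    using \<delta> by (simp add: power_mult_distrib mult_ac)
  then have nY: "sqrt (1 - \<delta>) * t1 * norm x \<le> norm (combination n \<psi> y)"
    by (rule power2_le_imp_le) simp
  have AX: "A X = combination n \<psi> y + combination n E x"
    unfolding X_def comb bounded_op_sum[OF A] bounded_op_cscale[OF A]
    unfolding combination_def sum.distrib[symmetric] E_def
    by (intro sum.cong refl ell2_eqI) (simp add: cx cy algebra_simps)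
  have "sqrt (1 - \<delta>) * t1 * norm x \<le> norm (combination n \<psi> y)" by (rule nY)
  also have "combination n \<psi> y = A X - combination n E x" by (simp add: AX)
  also have "norm (A X - combination n E x) \<le> norm (A X) + norm (combination n E x)" by (rule norm_triangle_ineq4)
  also have "\<dots> \<le> t * norm X + \<delta> * norm x"
    using v[of X] x4 3(2)[of x] x3 by (intro add_mono) (auto simp: X_def)
  also have "\<dots> \<le> t * (sqrt (1 + \<delta>) * norm x) + \<delta> * norm x"
    using nX t \<delta> by (intro add_mono mult_left_mono) auto
  also have "\<dots> = (t * sqrt (1 + \<delta>) + \<delta>) * norm x" by (simp add: algebra_simps)
  also have "\<dots> < sqrt (1 - \<delta>) * t1 * norm x"
    using \<delta>(3) \<open>x \<noteq> 0\<close> by (intro mult_strict_right_mono) auto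
  finally show False by simp
qed

section \<open>Asymptotic densities\<close>

text \<open>The clamp by \<open>max\<close> removes the case distinction at s = 1, which gives
  monotonicity and continuity there; \<open>arcosh\<close> is also what solving |\<kappa>| / cosh
  (pi a) = t for \<open>a\<close> produces.\<close>

lemma density_c_eq: "s > 0 \<Longrightarrow> density_c s = arcosh (max 1 (1 / s)) / pi\<^sup>2"
proof (cases "s \<le> 1")
  case True
  assume s: "s > 0"
  have "1 / s + sqrt ((1 / s)\<^sup>2 - 1) = (1 + sqrt (1 - s\<^sup>2)) / s"
  proof -
    have "(1 / s)\<^sup>2 - 1 = (1 - s\<^sup>2) / s\<^sup>2" using s by (simp add: field_simps)
    then have "sqrt ((1 / s)\<^sup>2 - 1) = sqrt (1 - s\<^sup>2) / s" using s by (simp add: real_sqrt_divide)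
    then show ?thesis by (simp add: add_divide_distrib)
  qed
  then show ?thesis
    using True s by (simp add: density_c_def arcosh_real_def max_def)
qed (simp add: density_c_def max_def arcosh_real_def)

lemma arcosh_mono:
  fixes x y :: real
  assumes "1 \<le> x" "x \<le> y"
  shows "arcosh x \<le> arcosh y"
proof -
  have "x + sqrt (x\<^sup>2 - 1) \<le> y + sqrt (y\<^sup>2 - 1)"
    using assms by (intro add_mono real_sqrt_le_mono diff_right_mono power_mono) auto
  moreover have "0 < x + sqrt (x\<^sup>2 - 1)"
    using assms by (intro add_pos_nonneg) auto
  ultimately show ?thesis using assms by (simp add: arcosh_real_def)
qed

lemma density_c_antimono:
  assumes "0 < s" "s \<le> s'"
  shows "density_c s' \<le> density_c s"
proof -
  have "1 / s' \<le> 1 / s" using assms by (intro divide_left_mono) auto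
  then have "max 1 (1 / s') \<le> max 1 (1 / s)" by auto
  then have "arcosh (max 1 (1 / s')) \<le> arcosh (max 1 (1 / s))"
    by (intro arcosh_mono) auto
  then show ?thesis using assms by (simp add: density_c_eq divide_right_mono)
qed

lemma density_c_ge_1 [simp]: "s \<ge> 1 \<Longrightarrow> density_c s = 0"
  by (cases "s = 1") (auto simp: density_c_def)

lemma density_c_nonneg: "density_c s \<ge> 0"
proof (cases "s > 0")
  case True
  then show ?thesis using density_c_antimono[of s "max 1 s"] by simp
qed (simp add: density_c_def)

lemma isCont_density_c:
  assumes "s > 0"
  shows "isCont density_c s"
proof -
  have "0 \<le> (max 1 x)\<^sup>2 - 1" for x :: real
    using one_le_power[of "max 1 x" 2] by simp
  then have "max 1 x + sqrt ((max 1 x)\<^sup>2 - 1) > 0" for x :: real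
    by (intro add_pos_nonneg) auto
  then have "max 1 x + sqrt ((max 1 x)\<^sup>2 - 1) \<noteq> 0" for x :: real
    by (metis less_irrefl)
  then have "isCont (\<lambda>s. ln (max 1 (1 / s) + sqrt ((max 1 (1 / s))\<^sup>2 - 1)) / pi\<^sup>2) s"
    using assms by (intro continuous_intros) auto
  moreover have "\<forall>\<^sub>F x in nhds s. density_c x = ln (max 1 (1 / x) + sqrt ((max 1 (1 / x))\<^sup>2 - 1)) / pi\<^sup>2"
    using eventually_nhds_in_open[of "{0<..}" s] assms
    by (auto elim!: eventually_mono simp: density_c_eq arcosh_real_def)
  ultimately show ?thesis by (subst isCont_cong)
qed

text \<open>The primitive of \<open>density_c (sqrt u)\<close> on u > 0 that tends to 0 at 0. Its
  constant value 1 / pi^2 from u = 1 on is the total integral of the density in the squared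
  variable.\<close>

definition density_primitive :: "real \<Rightarrow> real" where
  "density_primitive u = (if u < 1 then (u * (ln (1 + sqrt (1 - u)) - ln u / 2) - sqrt (1 - u) + 1) / pi\<^sup>2 else 1 / pi\<^sup>2)"

lemma density_primitive_tendsto: "(density_primitive \<longlongrightarrow> 0) (at_right 0)"
proof -
  have "((\<lambda>u. (u * (ln (1 + sqrt (1 - u)) - ln u / 2) - sqrt (1 - u) + 1) / pi\<^sup>2) \<longlongrightarrow> 0) (at_right 0)"
    by real_asymp
  moreover have "\<forall>\<^sub>F u in at_right 0. density_primitive u = (u * (ln (1 + sqrt (1 - u)) - ln u / 2) - sqrt (1 - u) + 1) / pi\<^sup>2"
  proof -
    have "\<forall>\<^sub>F u in at_right (0::real). u < 1"
      by (auto simp: eventually_at_right[of 0 1] intro!: exI[of _ 1])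
    then show ?thesis by eventually_elim (simp add: density_primitive_def)
  qed
  ultimately show ?thesis by (simp add: tendsto_cong)
qed

lemma density_c_sqrt:
  assumes "0 < u" "u < 1"
  shows "density_c (sqrt u) = (ln (1 + sqrt (1 - u)) - ln u / 2) / pi\<^sup>2"
proof -
  have "ln ((1 + sqrt (1 - u)) / sqrt u) = ln (1 + sqrt (1 - u)) - ln u / 2"
  proof -
    have "1 + sqrt (1 - u) > 0" using assms by (intro add_pos_nonneg) auto
    then show ?thesis using assms by (simp add: ln_div ln_sqrt)
  qed
  then show ?thesis using assms by (simp add: density_c_def)
qed

text \<open>The mean value theorem and the monotonicity of the density: the value at the left
  endpoint dominates the mean over the interval.\<close>

lemma density_primitive_increment:
  assumes "0 < u" "u \<le> v"
  shows "density_primitive v - density_primitive u \<le> (v - u) * density_c (sqrt u)"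
proof (cases "u < 1")
  case True
  define F where "F u = (u * (ln (1 + sqrt (1 - u)) - ln u / 2) - sqrt (1 - u) + 1) / pi\<^sup>2" for u
  \<comment> \<open>Beyond 1 the primitive is constant, and the formula \<open>F\<close> is valid
    only up to there.\<close>
  define w where "w = min v 1"
  have w: "u \<le> w" "w \<le> 1" "w \<le> v" using True assms by (auto simp: w_def)
  have Fw: "density_primitive v = F w"
    using True assms by (auto simp: density_primitive_def F_def w_def min_def)
  have Fu: "density_primitive u = F u" using True by (simp add: density_primitive_def F_def)
  have "F w - F u \<le> (w - u) * density_c (sqrt u)"
  proof (cases "u = w")
    case False
    then have "u < w" using w by simp
    have cont: "continuous_on {u..w} F"
    proof -
      have "1 + sqrt (1 - x) \<noteq> 0" if "x \<le> 1" for x :: real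
        using add_pos_nonneg[of 1 "sqrt (1 - x)"] that by simp
      then show ?thesis
        unfolding F_def using assms w by (intro continuous_intros) auto
    qed
    have der: "(F has_real_derivative density_c (sqrt x)) (at x)" if "u < x" "x < w" for x
    proof -
      have x: "0 < x" "x < 1" using that assms w by auto
      define r where "r = sqrt (1 - x)"
      have r: "0 < r" "r * r = 1 - x" using x by (simp_all add: r_def)
      have "0 < 1 + sqrt (1 - x)"
        using x by (intro add_pos_nonneg) auto
      then have ne: "0 < 1 + sqrt (1 - x)" "1 + sqrt (1 - x) \<noteq> 0"
        by (metis less_irrefl)+
      have "((\<lambda>u. u * (ln (1 + sqrt (1 - u)) - ln u / 2) - sqrt (1 - u) + 1) has_real_derivative
        (ln (1 + r) - ln x / 2) + x * ((- 1 / (2 * r)) / (1 + r) - 1 / (2 * x)) + 1 / (2 * r)) (at x)"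
        unfolding r_def using x ne
        by (auto intro!: derivative_eq_intros simp: divide_simps) (simp_all add: algebra_simps)
      from DERIV_cdivide[OF this, of "pi\<^sup>2"] have "(F has_real_derivative
        ((ln (1 + r) - ln x / 2) + x * ((- 1 / (2 * r)) / (1 + r) - 1 / (2 * x)) + 1 / (2 * r)) / pi\<^sup>2) (at x)"
        by (simp only: F_def[abs_def])
      \<comment> \<open>The derivatives of the logarithms and of the square root cancel, which
        leaves only the bracket of the primitive, that is \<open>pi\<^sup>2\<close> times the
        density.\<close>
      moreover have "x * ((- 1 / (2 * r)) / (1 + r) - 1 / (2 * x)) + 1 / (2 * r) = 0"
      proof -
        have "x = (1 - r) * (1 + r)" using r by (simp add: algebra_simps)
        moreover have "(1 - r) * (1 + r) * (y / (1 + r)) = (1 - r) * y" for y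
          using r by simp
        ultimately have "x * ((- 1 / (2 * r)) / (1 + r)) = (1 - r) * (- 1 / (2 * r))"
          by metis
        moreover have "x * (y - 1 / (2 * x)) = x * y - 1 / 2" for y
          using x by (simp add: right_diff_distrib)
        moreover have "(1 - r) * (- 1 / (2 * r)) = 1 / 2 - 1 / (2 * r)"
          using r by (simp add: field_simps)
        ultimately show ?thesis by simp
      qed
      ultimately show ?thesis
        using density_c_sqrt[OF x] by (simp add: r_def add.assoc)
    qed
    obtain \<xi> where \<xi>: "u < \<xi>" "\<xi> < w" "F w - F u = (w - u) * density_c (sqrt \<xi>)"
      using MVT[OF \<open>u < w\<close> cont] der real_differentiable_def DERIV_unique by metis
    have "density_c (sqrt \<xi>) \<le> density_c (sqrt u)"
      using \<xi> assms by (intro density_c_antimono) auto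
    then show ?thesis unfolding \<xi>(3) using w by (intro mult_left_mono) auto
  qed simp
  also have "\<dots> \<le> (v - u) * density_c (sqrt u)"
    using w density_c_nonneg by (intro mult_right_mono) auto
  finally show ?thesis by (simp add: Fw Fu)
next
  case False
  then show ?thesis using assms density_c_nonneg[of "sqrt u"] by (simp add: density_primitive_def)
qed

text \<open>If the total mass of the counting functions is asymptotically at most that of their
  asymptotic lower bound \<open>G\<close>, then monotonicity turns \<open>G\<close> into an upper bound as well.\<close>

lemma counting_upper_bound:
  fixes c :: "nat \<Rightarrow> real \<Rightarrow> real" and G F :: "real \<Rightarrow> real" and L :: "nat \<Rightarrow> real"
  assumes L: "filterlim L at_top sequentially"
    and c_anti: "\<And>N u v. 0 < u \<Longrightarrow> u \<le> v \<Longrightarrow> c N v \<le> c N u"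
    and G_anti: "\<And>u v. 0 < u \<Longrightarrow> u \<le> v \<Longrightarrow> G v \<le> G u"
    and F: "\<And>u v. 0 < u \<Longrightarrow> u \<le> v \<Longrightarrow> F v - F u \<le> (v - u) * G u"
    and FV: "\<And>u. u \<ge> U \<Longrightarrow> F u = V" and F0: "(F \<longlongrightarrow> 0) (at_right 0)"
    and lower: "\<And>u \<epsilon>. 0 < u \<Longrightarrow> 0 < \<epsilon> \<Longrightarrow> \<forall>\<^sub>F N in sequentially. (G u - \<epsilon>) * L N \<le> c N u"
    and mass: "\<And>h k. 0 < h \<Longrightarrow> \<forall>\<^sub>F N in sequentially. h * (\<Sum>j=1..k. c N (real j * h)) \<le> V * L N + C"
    and u: "0 < u1" "u1 < u0" and \<epsilon>: "\<epsilon> > 0"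
  shows "\<forall>\<^sub>F N in sequentially. c N u0 \<le> (G u1 + \<epsilon>) * L N"
proof -
  define D where "D = u0 - u1"
  have D: "D > 0" using u by (simp add: D_def)
  \<comment> \<open>The grid of mesh \<open>h\<close> starts at \<open>h\<close>, so the integral
    over the first cell is lost; this choice makes the loss negligible.\<close>
  have "\<forall>\<^sub>F h in at_right 0. F h < \<epsilon> * D / 8"
    by (rule order_tendstoD(2)[OF F0]) (use D \<epsilon> in simp)
  then obtain h0 where h0: "h0 > 0" "\<And>h. 0 < h \<Longrightarrow> h < h0 \<Longrightarrow> F h < \<epsilon> * D / 8"
    by (auto simp: eventually_at_right[of 0 1])
  obtain r where r: "real r > u0 / min h0 (D / 2)" by (meson reals_Archimedean2)
  have "u0 / min h0 (D / 2) > 0" using u D h0 by simp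
  then have rpos: "real r > 0" using r by linarith
  define h where "h = u0 / real r"
  have h: "h > 0" using u rpos by (simp add: h_def)
  have "h < min h0 (D / 2)" using r rpos h0 D u unfolding h_def
    by (simp add: pos_divide_less_eq mult.commute del: min_less_iff_conj)
  then have h': "h < h0" "h < D / 2" by auto
  have rh: "real r * h = u0" using rpos by (simp add: h_def)
  \<comment> \<open>The first grid point at or after \<open>u1\<close>. The grid points from
    \<open>j1 + 1\<close> to \<open>r\<close> lie between \<open>u1\<close> and \<open>u0\<close>,
    and h < D / 2 ensures that they fill more than half of that interval.\<close>
  define j1 where "j1 = nat \<lceil>u1 / h\<rceil>"
  have "u1 / h > 0" using u h by simp
  then have "real j1 \<ge> u1 / h" "real j1 < u1 / h + 1" unfolding j1_def by linarith+
  then have j1: "u1 \<le> real j1 * h" "real j1 * h < u1 + h"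
    using h by (simp_all add: field_simps)
  have "real j1 * h < real r * h" using j1(2) h'(2) D by (simp add: rh D_def)
  then have "j1 < r" using h by simp
  \<comment> \<open>The grid must reach beyond \<open>U\<close>, where \<open>F\<close> has attained
    its final value \<open>V\<close>.\<close>
  obtain k where k: "r \<le> k" "U / h \<le> real k" by (metis max.bounded_iff nat_le_real_less real_arch_simple of_nat_le_iff order_trans nle_le)
  define d where "d = h * (real r - real j1)"
  have "d = u0 - real j1 * h" by (simp add: d_def rh[symmetric] algebra_simps)
  moreover have "d' > D / 2" if "d' = u0 - P" "P < u1 + h" for d' P
    using that h'(2) by (simp add: D_def)
  ultimately have d: "d > D / 2" using j1(2) by blast
  \<comment> \<open>Chosen so that the error of the lower bounds, summed over all \<open>k\<close>
    grid points and multiplied by \<open>h\<close>, is \<epsilon> D / 8.\<close>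
  define \<epsilon>1 where "\<epsilon>1 = \<epsilon> * D / (8 * h * real k)"
  have kpos: "real k > 0" using k rpos by linarith
  have \<epsilon>1: "\<epsilon>1 > 0" using \<epsilon> D h kpos by (simp add: \<epsilon>1_def)
  have ev1: "\<forall>\<^sub>F N in sequentially. \<forall>j\<in>{1..k}. (G (real j * h) - \<epsilon>1) * L N \<le> c N (real j * h)"
    by (rule eventually_ball_finite) (use h \<epsilon>1 lower in auto)
  have ev2: "\<forall>\<^sub>F N in sequentially. L N > max 0 (8 * C / (\<epsilon> * D))"
    using L unfolding filterlim_at_top_dense by blast
  show ?thesis
    using ev1 ev2 mass[OF h, of k]
  proof eventually_elim
    case (elim N)
    have LN: "L N > 0" using elim(2) by simp
    have CL: "C \<le> \<epsilon> * D / 8 * L N"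
      using elim(2) \<epsilon> D by (simp add: field_simps)
    \<comment> \<open>On \<open>S1\<close> the counts are at least the count at \<open>u0\<close>;
      on \<open>S2\<close> the asymptotic lower bound already uses up its share of the mass, and the
      rest of the mass caps what \<open>S1\<close> can carry.\<close>
    define S1 S2 where "S1 = {j1+1..r}" and "S2 = {1..k} - {j1+1..r}"
    have split: "sum f {1..k} = sum f S1 + sum f S2" for f :: "nat \<Rightarrow> real"
      using k(1) sum.subset_diff[of "{j1+1..r}" "{1..k}" f] by (simp add: S1_def S2_def add.commute)
    have card1: "real (card S1) = real r - real j1" using \<open>j1 < r\<close> by (simp add: S1_def)
    have s1: "h * (\<Sum>j\<in>S1. c N (real j * h)) \<ge> d * c N u0"
    proof -
      have "(\<Sum>j\<in>S1. c N u0) \<le> (\<Sum>j\<in>S1. c N (real j * h))"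
      proof (intro sum_mono c_anti)
        fix j assume "j \<in> S1"
        then show "0 < real j * h" using h by (auto simp: S1_def)
        show "real j * h \<le> u0" using \<open>j \<in> S1\<close> h unfolding rh[symmetric] by (auto simp: S1_def)
      qed
      then show ?thesis using h by (simp add: card1 d_def)
    qed
    have s2: "h * (\<Sum>j\<in>S2. c N (real j * h)) \<ge> L N * (h * (\<Sum>j\<in>S2. G (real j * h)) - \<epsilon> * D / 8)"
    proof -
      have "(\<Sum>j\<in>S2. (G (real j * h) - \<epsilon>1) * L N) \<le> (\<Sum>j\<in>S2. c N (real j * h))"
        using elim(1) by (intro sum_mono) (auto simp: S2_def)
      moreover have "(\<Sum>j\<in>S2. (G (real j * h) - \<epsilon>1) * L N) = L N * ((\<Sum>j\<in>S2. G (real j * h)) - real (card S2) * \<epsilon>1)"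
        by (simp only: sum_distrib_right[symmetric] sum_subtractf sum_constant) (simp add: mult.commute)
      moreover have "real (card S2) * \<epsilon>1 \<le> real k * \<epsilon>1"
      proof -
        have "card S2 \<le> card {1..k}" unfolding S2_def by (rule card_mono) auto
        then show ?thesis using \<epsilon>1 by (intro mult_right_mono) auto
      qed
      ultimately have "L N * ((\<Sum>j\<in>S2. G (real j * h)) - real k * \<epsilon>1) \<le> (\<Sum>j\<in>S2. c N (real j * h))"
        using LN by (smt (verit) mult_left_mono)
      then have "h * (L N * ((\<Sum>j\<in>S2. G (real j * h)) - real k * \<epsilon>1)) \<le> h * (\<Sum>j\<in>S2. c N (real j * h))"
        using h by (intro mult_left_mono) auto
      moreover have "h * (real k * \<epsilon>1) = \<epsilon> * D / 8" using h kpos by (simp add: \<epsilon>1_def)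
      moreover have "h * (L N * (S - real k * \<epsilon>1)) = L N * (h * S - h * (real k * \<epsilon>1))" for S
        by (simp add: algebra_simps)
      ultimately show ?thesis by simp
    qed
    \<comment> \<open>By \<open>F\<close>, the value of \<open>G\<close> at the left end of a cell
      dominates the increment of \<open>F\<close> over it, so the grid sum is at least the whole
      integral except for the first cell.\<close>
    have g_all: "h * (\<Sum>j\<in>{1..k}. G (real j * h)) \<ge> V - \<epsilon> * D / 8"
    proof -
      have "F (real (Suc n) * h) - F h \<le> h * (\<Sum>j\<in>{1..n}. G (real j * h))" for n
      proof (induction n)
        case (Suc n)
        have "F (real (Suc (Suc n)) * h) - F (real (Suc n) * h) \<le> (real (Suc (Suc n)) * h - real (Suc n) * h) * G (real (Suc n) * h)"
          using h by (intro F) auto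
        also have "real (Suc (Suc n)) * h - real (Suc n) * h = h" by (simp add: algebra_simps)
        finally show ?case using Suc by (simp add: distrib_left)
      qed simp
      moreover have "F (real (Suc k) * h) = V"
      proof (rule FV)
        have "U \<le> real k * h" using k(2) h by (simp add: pos_divide_le_eq)
        also have "\<dots> \<le> real (Suc k) * h" using h by simp
        finally show "U \<le> real (Suc k) * h" .
      qed
      ultimately have "V - F h \<le> h * (\<Sum>j\<in>{1..k}. G (real j * h))" by metis
      then show ?thesis using h0(2)[OF h h'(1)] by linarith
    qed
    have g1: "h * (\<Sum>j\<in>S1. G (real j * h)) \<le> d * G u1"
    proof -
      have "(\<Sum>j\<in>S1. G (real j * h)) \<le> (\<Sum>j\<in>S1. G u1)"
      proof (intro sum_mono G_anti)
        fix j assume "j \<in> S1"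
        then have "real j1 * h \<le> real j * h" using h by (auto simp: S1_def)
        then show "u1 \<le> real j * h" using j1 by linarith
      qed (use u in auto)
      then show ?thesis using h mult_left_mono[of "\<Sum>j\<in>S1. G (real j * h)" _ h] by (simp add: card1 d_def mult_ac)
    qed
    have g2: "h * (\<Sum>j\<in>S2. G (real j * h)) \<ge> V - \<epsilon> * D / 8 - d * G u1"
      using g_all g1 unfolding split[of "\<lambda>j. G (real j * h)"] distrib_left by linarith
    have "L N * (V - \<epsilon> * D / 8 - d * G u1 - \<epsilon> * D / 8) \<le> L N * (h * (\<Sum>j\<in>S2. G (real j * h)) - \<epsilon> * D / 8)"
      by (rule mult_left_mono[OF diff_right_mono[OF g2]]) (use LN in simp)
    moreover have "h * (\<Sum>j\<in>S1. c N (real j * h)) + h * (\<Sum>j\<in>S2. c N (real j * h)) \<le> V * L N + C"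
      using elim(3) unfolding split[of "\<lambda>j. c N (real j * h)"] distrib_left .
    ultimately have "d * c N u0 + L N * (V - \<epsilon> * D / 8 - d * G u1 - \<epsilon> * D / 8) \<le> V * L N + \<epsilon> * D / 8 * L N"
      using s1 s2 CL by linarith
    \<comment> \<open>Three errors of \<epsilon> D / 8 each: the first cell, the lower bounds on
      \<open>S2\<close> and the constant \<open>C\<close>. Their sum is below \<epsilon> d because d
      > D / 2.\<close>
    then have "d * c N u0 \<le> L N * (d * G u1 + 3 * (\<epsilon> * D / 8))"
      by (simp add: algebra_simps)
    also have "\<dots> \<le> L N * (d * G u1 + d * \<epsilon>)"
    proof -
      have "3 * (\<epsilon> * D / 8) \<le> \<epsilon> * (D / 2)" using \<epsilon> D by simp
      also have "\<dots> \<le> \<epsilon> * d" using d \<epsilon> by (intro mult_left_mono) auto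
      finally show ?thesis using LN by (intro mult_left_mono) (auto simp: mult.commute)
    qed
    also have "\<dots> = d * ((G u1 + \<epsilon>) * L N)" by (simp add: algebra_simps)
    finally show ?case using d D by (simp add: mult_le_cancel_left)
  qed
qed

section \<open>The model operator\<close>

text \<open>The counting function read off directly from \<open>codim_bound\<close>. It serves for
  the model operators, so that the link to \<open>sing_count\<close> is needed only for the original
  ones.\<close>

definition count_above :: "(ell2 \<Rightarrow> ell2) \<Rightarrow> real \<Rightarrow> nat" where
  "count_above A t = (LEAST q. codim_bound A t q)"

context
  fixes A m H
  assumes A: "has_matrix A m" and HS: "\<And>n. (\<Sum>k<n. \<Sum>j<n. (cmod (m j k))\<^sup>2) \<le> H"
begin

lemma codim_bound_iff_count_above:
  assumes "t > 0"
  shows "codim_bound A t q \<longleftrightarrow> count_above A t \<le> q"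
proof -
  have "\<exists>q. codim_bound A t q"
    using Hilbert_Schmidt_codim_bound[OF A HS assms] by blast
  then have "codim_bound A t (count_above A t)" unfolding count_above_def by (rule LeastI_ex)
  then show ?thesis
    using codim_bound_mono[OF _ order_refl] Least_le[of "codim_bound A t" q] unfolding count_above_def by blast
qed

lemma count_above_antimono:
  assumes "0 < s" "s \<le> t"
  shows "count_above A t \<le> count_above A s"
  using codim_bound_iff_count_above[of s] codim_bound_iff_count_above[of t] codim_bound_mono[OF _ assms(2) order_refl] assms
  by force

text \<open>The layer-cake formula for the squared singular values, discretized with mesh
  \<open>h\<close> in the squared variable.\<close>

lemma count_above_mass:
  assumes h: "h > 0"
  shows "h * (\<Sum>j=1..k. real (count_above A (sqrt (real j * h)))) \<le> H"
proof (cases "k = 0")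
  case True
  then show ?thesis using HS[of 0] by simp
next
  case False
  define c where "c j = count_above A (sqrt (real j * h))" for j
  have anti: "c j' \<le> c j" if "1 \<le> j" "j \<le> j'" for j j'
    unfolding c_def using that h by (intro count_above_antimono) auto
  define S where "S i = {j\<in>{1..k}. i < c j}" for i
  \<comment> \<open>By monotonicity \<open>S i\<close> is an initial segment {1..M}, so
    \<open>T i\<close> is the largest grid level that the singular value of index \<open>i\<close>
    exceeds, and its square counts the grid levels below that value.\<close>
  define T where "T i = sqrt (real (card (S i)) * h)" for i
  have "(\<Sum>i<c 1. (T i)\<^sup>2) \<le> H"
  proof (rule Hilbert_Schmidt_count[OF A HS])
    fix i assume i: "i < c 1"
    show "0 \<le> T i" using h by (simp add: T_def)
    have fin: "finite (S i)" by (simp add: S_def)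
    have "1 \<in> S i" using i False by (simp add: S_def)
    define M where "M = Max (S i)"
    have M: "M \<in> S i" unfolding M_def using fin \<open>1 \<in> S i\<close> by (intro Max_in) auto
    have "S i = {1..M}"
    proof
      show "S i \<subseteq> {1..M}" using Max_ge[OF fin] by (auto simp: S_def M_def)
      show "{1..M} \<subseteq> S i"
      proof
        fix j assume "j \<in> {1..M}"
        then show "j \<in> S i" using M anti[of j M] by (auto simp: S_def)
      qed
    qed
    then have "card (S i) = M" by simp
    moreover have "0 < sqrt (real M * h)" using M h by (simp add: S_def)
    ultimately show "\<not> codim_bound A (T i) i"
      using M codim_bound_iff_count_above[of "sqrt (real M * h)" i] by (simp add: T_def S_def c_def)
  qed
  also have "(\<Sum>i<c 1. (T i)\<^sup>2) = h * (\<Sum>i<c 1. \<Sum>j=1..k. if i < c j then 1 else 0)"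
    using h by (simp add: T_def S_def sum_distrib_left mult.commute sum.If_cases Int_def)
  also have "(\<Sum>i<c 1. \<Sum>j=1..k. if i < c j then 1 else (0::real)) = (\<Sum>j=1..k. \<Sum>i<c 1. if i < c j then 1 else 0)"
    by (rule sum.swap)
  also have "\<dots> = (\<Sum>j=1..k. real (c j))"
  proof (rule sum.cong[OF refl])
    fix j assume "j \<in> {1..k}"
    then have "{..<c 1} \<inter> {i. i < c j} = {..<c j}" using anti[of 1 j] by auto
    then show "(\<Sum>i<c 1. if i < c j then 1 else (0::real)) = real (c j)"
      by (simp add: sum.If_cases)
  qed
  finally show ?thesis by (simp add: c_def)
qed

end

lemma sum_square_support_le:
  fixes f :: "nat \<Rightarrow> nat \<Rightarrow> real"
  assumes "\<And>j k. 0 \<le> f j k" "\<And>j k. (j, k) \<notin> {1..N} \<times> {1..N} \<Longrightarrow> f j k = 0"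
  shows "(\<Sum>k<n. \<Sum>j<n. f j k) \<le> (\<Sum>k=1..N. \<Sum>j=1..N. f j k)"
proof -
  have "(\<Sum>k<n. \<Sum>j<n. f j k) = (\<Sum>(k, j)\<in>{..<n} \<times> {..<n}. f j k)"
    by (simp add: sum.cartesian_product)
  also have "\<dots> = (\<Sum>(k, j)\<in>({..<n} \<times> {..<n}) \<inter> ({1..N} \<times> {1..N}). f j k)"
  proof (rule sum.mono_neutral_right)
    show "\<forall>p\<in>{..<n} \<times> {..<n} - ({..<n} \<times> {..<n}) \<inter> ({1..N} \<times> {1..N}). (case p of (k, j) \<Rightarrow> f j k) = 0"
    proof
      fix p assume p: "p \<in> {..<n} \<times> {..<n} - ({..<n} \<times> {..<n}) \<inter> ({1..N} \<times> {1..N})"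
      then have "(snd p, fst p) \<notin> {1..N} \<times> {1..N}" by (cases p) auto
      from assms(2)[OF this] show "(case p of (k, j) \<Rightarrow> f j k) = 0" by (simp add: case_prod_beta)
    qed
  qed auto
  also have "\<dots> \<le> (\<Sum>(k, j)\<in>{1..N} \<times> {1..N}. f j k)"
    using assms(1) by (intro sum_mono2) auto
  finally show ?thesis by (simp add: sum.cartesian_product)
qed

section \<open>Jump matrices and waves\<close>

definition jump_coeff :: "complex set \<Rightarrow> (complex \<Rightarrow> complex) \<Rightarrow> nat \<Rightarrow> complex" where
  "jump_coeff Z \<kappa> n = (\<Sum>z\<in>Z. \<kappa> z * cnj z ^ n) / (\<i> * of_real pi * of_nat n)"

text \<open>The box starts at 1, where the waves and the kernel 1 / (j + k) are defined without
  exceptions; row and column 0 are left to the truncation error.\<close>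

definition jump_matrix :: "complex set \<Rightarrow> (complex \<Rightarrow> complex) \<Rightarrow> nat \<Rightarrow> nat \<Rightarrow> nat \<Rightarrow> complex" where
  "jump_matrix Z \<kappa> N j k = (if j \<in> {1..N} \<and> k \<in> {1..N} then jump_coeff Z \<kappa> (j + k) else 0)"

definition jump_density :: "complex set \<Rightarrow> (complex \<Rightarrow> complex) \<Rightarrow> real \<Rightarrow> real" where
  "jump_density Z \<kappa> t = (\<Sum>z\<in>Z. density_c (t / cmod (\<kappa> z)))"

lemma cmod_coeff_square:
  fixes S :: complex
  assumes "n > 0"
  shows "complex_of_real ((cmod (S / (\<i> * of_real pi * of_nat n)))\<^sup>2) = S * cnj S * of_real (1 / (real n)\<^sup>2) / of_real (pi\<^sup>2)"
proof -
  have "(cmod (S / (\<i> * of_real pi * of_nat n)))\<^sup>2 = (cmod S)\<^sup>2 * (1 / (real n)\<^sup>2) / pi\<^sup>2"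
    by (simp add: norm_divide norm_mult power_divide power_mult_distrib)
  then have "complex_of_real ((cmod (S / (\<i> * of_real pi * of_nat n)))\<^sup>2) =
      of_real ((cmod S)\<^sup>2) * of_real (1 / (real n)\<^sup>2) / of_real (pi\<^sup>2)"
    by (simp only: of_real_mult of_real_divide)
  then show ?thesis by (simp only: complex_norm_square)
qed

definition wave :: "nat \<Rightarrow> complex \<Rightarrow> real \<Rightarrow> ell2" where
  "wave N z a = (\<Sum>j=1..N. cscale (z ^ j * power_wave a (real j) / of_real (sqrt (ln (real N)))) (basis_vec j))"

lemma coord_wave:
  "coord (wave N z a) k = (if k \<in> {1..N} then z ^ k * power_wave a (real k) / of_real (sqrt (ln (real N))) else 0)"
  by (simp add: wave_def if_distrib[of "\<lambda>y. _ * y"] cong: if_cong)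

lemma cinner_wave:
  assumes "N \<ge> 2"
  shows "cinner (wave N z a) (wave N z' b) =
    (\<Sum>j=1..N. (z * cnj z') ^ j * (of_real (real j powr (-1)) * cis ((a - b) * ln (real j)))) / of_real (ln (real N))"
proof -
  have L: "ln (real N) > 0" using assms by simp
  have sq: "complex_of_real (sqrt (ln (real N))) * of_real (sqrt (ln (real N))) = of_real (ln (real N))"
    using L by (simp flip: of_real_mult)
  have "cinner (wave N z a) (wave N z' b) = (\<Sum>j=1..N. z ^ j * power_wave a (real j) / of_real (sqrt (ln (real N)))
      * cnj (coord (wave N z' b) j))"
    unfolding wave_def[of N z a] cinner_sum_left cinner_cscale_left
    by (intro sum.cong refl arg_cong2[where f = "(*)"]) (metis cinner_basis_right cinner_commute)
  also have "\<dots> = (\<Sum>j=1..N. (z * cnj z') ^ j * (of_real (real j powr (-1)) * cis ((a - b) * ln (real j))) / of_real (ln (real N)))"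
  proof (rule sum.cong[OF refl])
    fix j assume j: "j \<in> {1..N}"
    have "z ^ j * power_wave a (real j) / of_real (sqrt (ln (real N))) * cnj (coord (wave N z' b) j) =
        (z * cnj z') ^ j * (power_wave a (real j) * cnj (power_wave b (real j))) / (of_real (sqrt (ln (real N))) * of_real (sqrt (ln (real N))))"
      using j by (simp add: coord_wave power_mult_distrib)
    also have "power_wave a (real j) * cnj (power_wave b (real j)) = of_real (real j powr (-1)) * cis ((a - b) * ln (real j))"
      using j by (intro power_wave_mult_cnj) auto
    finally show "z ^ j * power_wave a (real j) / of_real (sqrt (ln (real N))) * cnj (coord (wave N z' b) j) =
        (z * cnj z') ^ j * (of_real (real j powr (-1)) * cis ((a - b) * ln (real j))) / of_real (ln (real N))"
      by (simp only: sq)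
  qed
  finally show ?thesis by (simp only: sum_divide_distrib)
qed

lemma unit_mult_cnj_eq_1_iff:
  assumes "cmod z = 1" "cmod z' = 1"
  shows "z * cnj z' = 1 \<longleftrightarrow> z = z'"
proof
  have 1: "z' * cnj z' = 1" using assms complex_norm_square[of z'] by simp
  show "z = z'" if "z * cnj z' = 1"
    using that 1 by (metis mult_cancel_right mult_zero_right zero_neq_one)
  show "z * cnj z' = 1" if "z = z'" using 1 that by simp
qed

text \<open>Equal \<open>z\<close> give a sum close to an exactly orthogonal integral, different
  \<open>z\<close> an oscillating sum. The entries deviate by O(1 / ln N), and with O(ln N) waves
  the whole deviation stays bounded in Hilbert-Schmidt norm.\<close>

lemma wave_gram:
  assumes N: "N \<ge> 2" and z: "cmod z = 1" "cmod z' = 1"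
    and D: "D \<ge> 1" "z \<noteq> z' \<Longrightarrow> 2 / cmod (1 - z * cnj z') \<le> D"
    and a: "a = 2 * pi * of_int m / ln (real N)" "\<bar>a\<bar> \<le> a0" and b: "b = 2 * pi * of_int m' / ln (real N)" "\<bar>b\<bar> \<le> a0"
  shows "cmod (cinner (wave N z a) (wave N z' b) - (if z = z' \<and> m = m' then 1 else 0)) \<le> D * (4 + 6 * a0) / ln (real N)"
proof -
  have L: "ln (real N) > 0" using N by simp
  have ab: "4 + 3 * \<bar>a - b\<bar> \<le> 4 + 6 * a0" using abs_triangle_ineq4[of a b] a(2) b(2) by simp
  have a0: "0 \<le> a0" using a(2) by simp
  show ?thesis
  proof (cases "z = z'")
    case True
    have "z * cnj z' = 1" using unit_mult_cnj_eq_1_iff[OF z] True by simp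
    then have "cinner (wave N z a) (wave N z' b) - (if z = z' \<and> m = m' then 1 else 0) =
        ((\<Sum>j=1..N. of_real (real j powr (-1)) * cis ((a - b) * ln (real j))) - (if m - m' = 0 then of_real (ln (real N)) else 0)) / of_real (ln (real N))"
      unfolding cinner_wave[OF N] using True L by (simp add: diff_divide_distrib)
    moreover have "cmod ((\<Sum>j=1..N. of_real (real j powr (-1)) * cis ((a - b) * ln (real j))) - (if m - m' = 0 then of_real (ln (real N)) else 0)) \<le> 4 + 3 * \<bar>a - b\<bar>"
      by (rule reciprocal_wave_sum[OF N]) (simp add: a(1) b(1) diff_divide_distrib[symmetric] right_diff_distrib)
    ultimately have "cmod (cinner (wave N z a) (wave N z' b) - (if z = z' \<and> m = m' then 1 else 0)) \<le> (4 + 3 * \<bar>a - b\<bar>) / ln (real N)"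
      using L by (simp only: norm_divide norm_of_real) (simp add: divide_right_mono)
    also have "\<dots> \<le> D * (4 + 6 * a0) / ln (real N)"
      using ab L mult_mono[of 1 D "4 + 3 * \<bar>a - b\<bar>" "4 + 6 * a0"] D(1) by (intro divide_right_mono) auto
    finally show ?thesis .
  next
    case False
    have w: "cmod (z * cnj z') = 1" "z * cnj z' \<noteq> 1"
      using z False unit_mult_cnj_eq_1_iff[OF z] by (auto simp: norm_mult)
    have "cmod (\<Sum>j=1..N. (z * cnj z') ^ j * (of_real (real j powr (-1)) * cis ((a - b) * ln (real j)))) \<le> 2 / cmod (1 - z * cnj z') * (4 + 3 * \<bar>a - b\<bar>)"
      by (rule reciprocal_wave_oscillating[OF _ w]) (use N in simp)
    also have "\<dots> \<le> D * (4 + 6 * a0)"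
      using ab D(2)[OF False] D(1) by (intro mult_mono) auto
    finally show ?thesis
      unfolding cinner_wave[OF N] using False L by (simp add: norm_divide divide_right_mono)
  qed
qed

lemma card_int_interval:
  assumes "x \<ge> 0"
  shows "finite {m::int. \<bar>real_of_int m\<bar> \<le> x}" "2 * x - 1 \<le> real (card {m::int. \<bar>real_of_int m\<bar> \<le> x})"
    "real (card {m::int. \<bar>real_of_int m\<bar> \<le> x}) \<le> 2 * x + 1"
proof -
  have eq: "{m::int. \<bar>real_of_int m\<bar> \<le> x} = {- \<lfloor>x\<rfloor>..\<lfloor>x\<rfloor>}"
    by (auto simp: abs_le_iff le_floor_iff) (linarith+)
  have "\<lfloor>x\<rfloor> \<ge> 0" using assms by simp
  then have "real (card {m::int. \<bar>real_of_int m\<bar> \<le> x}) = 2 * real_of_int \<lfloor>x\<rfloor> + 1"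
    unfolding eq by simp
  then show "2 * x - 1 \<le> real (card {m::int. \<bar>real_of_int m\<bar> \<le> x})" "real (card {m::int. \<bar>real_of_int m\<bar> \<le> x}) \<le> 2 * x + 1"
    by linarith+
  show "finite {m::int. \<bar>real_of_int m\<bar> \<le> x}" unfolding eq by simp
qed

locale jump_model =
  fixes Z :: "complex set" and \<kappa> :: "complex \<Rightarrow> complex"
  assumes finite_Z: "finite Z" and unit_Z: "\<And>z. z \<in> Z \<Longrightarrow> cmod z = 1" and nonzero: "\<And>z. z \<in> Z \<Longrightarrow> \<kappa> z \<noteq> 0"
begin

text \<open>Controls all the oscillating sums over \<open>(z z'\<^sup>*)\<^sup>j\<close>; the terms with \<open>z = z'\<close> are \<open>2 / 0 = 0\<close>.\<close>

definition D :: real where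
  "D = 1 + (\<Sum>z\<in>Z. \<Sum>z'\<in>Z. 2 / cmod (1 - z * cnj z'))"

text \<open>The coefficient of ln N in the squared Hilbert-Schmidt norm of the model, and at the
  same time the integral of \<open>jump_density\<close> in the squared variable; this coincidence
  drives the upper bound.\<close>

definition mass :: real where
  "mass = (\<Sum>z\<in>Z. (cmod (\<kappa> z))\<^sup>2) / pi\<^sup>2"

definition total :: real where
  "total = (\<Sum>z\<in>Z. cmod (\<kappa> z))"

lemma D_ge_1: "D \<ge> 1"
  unfolding D_def by (simp add: sum_nonneg)

lemma D_ge: "z \<in> Z \<Longrightarrow> z' \<in> Z \<Longrightarrow> 2 / cmod (1 - z * cnj z') \<le> D"
proof -
  assume z: "z \<in> Z" "z' \<in> Z"
  have "2 / cmod (1 - z * cnj z') \<le> (\<Sum>z'\<in>Z. 2 / cmod (1 - z * cnj z'))"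
    by (rule member_le_sum[OF z(2)]) (auto simp: finite_Z)
  also have "\<dots> \<le> (\<Sum>z\<in>Z. \<Sum>z'\<in>Z. 2 / cmod (1 - z * cnj z'))"
    by (rule member_le_sum[OF z(1)]) (auto simp: finite_Z sum_nonneg)
  finally show ?thesis by (simp add: D_def)
qed

lemma D_ge': "z \<in> Z \<Longrightarrow> z' \<in> Z \<Longrightarrow> 2 / cmod (1 - cnj z * z') \<le> D"
  using D_ge[of z' z] by (simp add: mult.commute)

lemma total_nonneg: "total \<ge> 0"
  by (simp add: total_def sum_nonneg)

text \<open>The squared modulus of a coefficient is a double sum over pairs of jumps. Diagonal pairs
  contribute ln N + 1 each. In the others the factor (cnj z z')^(j + k) oscillates in
  \<open>j\<close>, the bounds are summable in \<open>k\<close>, and 21 = 7 * 3.\<close>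

lemma jump_matrix_mass:
  "(\<Sum>k<n. \<Sum>j<n. (cmod (jump_matrix Z \<kappa> N j k))\<^sup>2) \<le> mass * ln (real N) + (mass + 21 * D * total\<^sup>2)"
proof (cases "N = 0")
  case True
  then show ?thesis using D_ge_1 by (simp add: jump_matrix_def mass_def sum_nonneg)
next
  case False
  then have N: "N \<ge> 1" by simp
  define T where "T z z' = (\<Sum>k=1..N. \<Sum>j=1..N. (cnj z * z') ^ (j + k) * of_real (1 / (real j + real k)\<^sup>2))" for z z'
  define S where "S = (\<Sum>k=1..N. \<Sum>j=1..N. (cmod (jump_coeff Z \<kappa> (j + k)))\<^sup>2)"
  have pt: "complex_of_real ((cmod (jump_coeff Z \<kappa> (j + k)))\<^sup>2) =
      (\<Sum>z\<in>Z. \<Sum>z'\<in>Z. \<kappa> z * cnj (\<kappa> z') * ((cnj z * z') ^ (j + k) * of_real (1 / (real j + real k)\<^sup>2))) / of_real (pi\<^sup>2)"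
    if "j \<ge> 1" for j k
  proof -
    have "(\<Sum>z\<in>Z. \<kappa> z * cnj z ^ (j + k)) * cnj (\<Sum>z\<in>Z. \<kappa> z * cnj z ^ (j + k)) * c =
        (\<Sum>z\<in>Z. \<Sum>z'\<in>Z. \<kappa> z * cnj (\<kappa> z') * ((cnj z * z') ^ (j + k) * c))" for c
      by (simp only: cnj_sum sum_product, simp only: sum_distrib_right)
        (intro sum.cong refl, simp add: power_mult_distrib mult_ac)
    then show ?thesis
      unfolding jump_coeff_def using cmod_coeff_square[of "j + k"] that by (simp only:) simp
  qed
  have "complex_of_real S = (\<Sum>k=1..N. \<Sum>j=1..N.
      (\<Sum>z\<in>Z. \<Sum>z'\<in>Z. \<kappa> z * cnj (\<kappa> z') * ((cnj z * z') ^ (j + k) * of_real (1 / (real j + real k)\<^sup>2))) / of_real (pi\<^sup>2))"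
    unfolding S_def of_real_sum by (intro sum.cong refl pt) auto
  also have "\<dots> = (\<Sum>z\<in>Z. \<Sum>z'\<in>Z. \<kappa> z * cnj (\<kappa> z') * T z z') / of_real (pi\<^sup>2)"
  proof -
    have "(\<Sum>k=1..N. \<Sum>j=1..N. \<Sum>z\<in>Z. \<Sum>z'\<in>Z. f k j z z') = (\<Sum>z\<in>Z. \<Sum>z'\<in>Z. \<Sum>k=1..N. \<Sum>j=1..N. f k j z z')"
      for f :: "nat \<Rightarrow> nat \<Rightarrow> complex \<Rightarrow> complex \<Rightarrow> complex"
      by (simp only: sum.swap[of _ Z "{1..N}"])
    then show ?thesis
      unfolding T_def sum_distrib_left sum_divide_distrib by (simp only:)
  qed
  finally have S_eq: "complex_of_real S = (\<Sum>z\<in>Z. \<Sum>z'\<in>Z. \<kappa> z * cnj (\<kappa> z') * T z z') / of_real (pi\<^sup>2)" .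
  have "S \<ge> 0" by (simp add: S_def sum_nonneg)
  then have "S = cmod (complex_of_real S)" by (simp only: norm_of_real abs_of_nonneg)
  also have "\<dots> = cmod ((\<Sum>z\<in>Z. \<Sum>z'\<in>Z. \<kappa> z * cnj (\<kappa> z') * T z z') / of_real (pi\<^sup>2))"
    by (simp only: S_eq)
  also have "\<dots> = cmod (\<Sum>z\<in>Z. \<Sum>z'\<in>Z. \<kappa> z * cnj (\<kappa> z') * T z z') / pi\<^sup>2"
    by (simp add: norm_divide norm_power)
  also have "\<dots> \<le> (\<Sum>z\<in>Z. \<Sum>z'\<in>Z. cmod (\<kappa> z) * cmod (\<kappa> z') * ((if z = z' then ln (real N) + 1 else 0) + 21 * D)) / pi\<^sup>2"
  proof (intro divide_right_mono order_trans[OF norm_sum] sum_mono)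
    fix z z' assume z: "z \<in> Z" "z' \<in> Z"
    have "cmod (T z z') \<le> (if z = z' then ln (real N) + 1 else 0) + 21 * D"
    proof (cases "z = z'")
      case True
      have "cnj z * z' = 1" using True unit_mult_cnj_eq_1_iff[of z' z] unit_Z z by (simp add: mult.commute)
      then have "T z z' = of_real (\<Sum>k=1..N. \<Sum>j=1..N. 1 / (real j + real k)\<^sup>2)" by (simp add: T_def)
      then have "cmod (T z z') = (\<Sum>k=1..N. \<Sum>j=1..N. 1 / (real j + real k)\<^sup>2)"
        by (simp only: norm_of_real) (simp add: sum_nonneg)
      also have "\<dots> = (\<Sum>j=1..N. \<Sum>k=1..N. 1 / (real j + real k)\<^sup>2)" by (rule sum.swap)
      also have "\<dots> \<le> ln (real N) + 1" by (rule inverse_square_sum[OF N])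
      finally show ?thesis using True D_ge_1 by simp
    next
      case False
      have w: "cmod (cnj z * z') = 1" "cnj z * z' \<noteq> 1"
        using False unit_mult_cnj_eq_1_iff[of z' z] unit_Z z by (auto simp: norm_mult mult.commute)
      have "cmod (T z z') \<le> (\<Sum>k=1..N. cmod (\<Sum>j=1..N. (cnj z * z') ^ (j + k) * of_real (1 / (real j + real k)\<^sup>2)))"
        unfolding T_def by (rule norm_sum)
      also have "\<dots> \<le> (\<Sum>k=1..N. D * (7 * real k powr (-3/2)))"
      proof (rule sum_mono)
        fix k assume k: "k \<in> {1..N}"
        have "(\<Sum>j=1..N. (cnj z * z') ^ (j + k) * of_real (1 / (real j + real k)\<^sup>2)) =
            (cnj z * z') ^ k * (\<Sum>j=1..N. (cnj z * z') ^ j * of_real (1 / (real k + real j)\<^sup>2))"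
          unfolding sum_distrib_left by (intro sum.cong refl) (simp add: power_add mult_ac add.commute)
        then have "cmod (\<Sum>j=1..N. (cnj z * z') ^ (j + k) * of_real (1 / (real j + real k)\<^sup>2)) =
            cmod (\<Sum>j=1..N. (cnj z * z') ^ j * of_real (1 / (real k + real j)\<^sup>2))"
          by (simp only: norm_mult[of "(cnj z * z') ^ k"] norm_power w(1) power_one mult_1_left)
        also have "\<dots> \<le> 2 / cmod (1 - cnj z * z') * (7 * real k powr (-3/2))"
          by (rule inverse_square_oscillating[OF _ N w]) (use k in simp)
        also have "\<dots> \<le> D * (7 * real k powr (-3/2))"
          using D_ge'[OF z] by (intro mult_right_mono) auto
        finally show "cmod (\<Sum>j=1..N. (cnj z * z') ^ (j + k) * of_real (1 / (real j + real k)\<^sup>2)) \<le> D * (7 * real k powr (-3/2))" .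
      qed
      also have "\<dots> = 7 * D * (\<Sum>k=1..N. real k powr (-3/2))" by (simp add: sum_distrib_left mult_ac)
      also have "\<dots> \<le> 7 * D * 3" using D_ge_1 by (intro mult_left_mono sum_powr_three_halves_le) auto
      finally show ?thesis using False by simp
    qed
    then show "cmod (\<kappa> z * cnj (\<kappa> z') * T z z') \<le> cmod (\<kappa> z) * cmod (\<kappa> z') * ((if z = z' then ln (real N) + 1 else 0) + 21 * D)"
      unfolding norm_mult complex_mod_cnj by (intro mult_left_mono) auto
  qed simp
  also have "(\<Sum>z\<in>Z. \<Sum>z'\<in>Z. cmod (\<kappa> z) * cmod (\<kappa> z') * ((if z = z' then ln (real N) + 1 else 0) + 21 * D)) =
      (\<Sum>z\<in>Z. (cmod (\<kappa> z))\<^sup>2) * (ln (real N) + 1) + 21 * D * total\<^sup>2"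
    using finite_Z
    by (simp add: distrib_left sum.distrib if_distrib[of "\<lambda>y. _ * y"] sum_distrib_right power2_eq_square total_def
        sum_product sum_distrib_left mult_ac cong: if_cong)
  also have "((\<Sum>z\<in>Z. (cmod (\<kappa> z))\<^sup>2) * (ln (real N) + 1) + 21 * D * total\<^sup>2) / pi\<^sup>2 \<le> mass * ln (real N) + (mass + 21 * D * total\<^sup>2)"
  proof -
    have "1 \<le> pi\<^sup>2" using pi_ge_two one_le_power[of pi 2] by linarith
    then have "21 * D * total\<^sup>2 / pi\<^sup>2 \<le> 21 * D * total\<^sup>2 / 1"
      using D_ge_1 by (intro divide_left_mono) auto
    then show ?thesis by (simp add: mass_def add_divide_distrib distrib_left)
  qed
  finally have S: "S \<le> mass * ln (real N) + (mass + 21 * D * total\<^sup>2)" .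
  have "(\<Sum>k<n. \<Sum>j<n. (cmod (jump_matrix Z \<kappa> N j k))\<^sup>2) \<le> (\<Sum>k=1..N. \<Sum>j=1..N. (cmod (jump_matrix Z \<kappa> N j k))\<^sup>2)"
    by (rule sum_square_support_le) (auto simp: jump_matrix_def)
  also have "\<dots> = S" unfolding S_def by (intro sum.cong refl) (auto simp: jump_matrix_def)
  finally show ?thesis using S by linarith
qed

text \<open>Among the products of the wave with the jumps z' only z' = z does not oscillate in
  \<open>j\<close>, and it leaves the factor \<open>cnj z ^ k\<close> in the output. The squared
  error is O(1 / ln N) per wave, hence bounded in total over O(ln N) waves.\<close>

lemma jump_operator_wave:
  assumes A: "has_matrix A (jump_matrix Z \<kappa> N)" and N: "N \<ge> 2" and z: "z \<in> Z" and a: "\<bar>a\<bar> \<le> a0"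
  shows "(norm (A (wave N z a) - cscale (\<kappa> z / (\<i> * of_real (cosh (pi * a)))) (wave N (cnj z) a)))\<^sup>2
    \<le> 8 * (total * D * (8 + 3 * a0))\<^sup>2 / ln (real N)"
proof -
  define L where "L = ln (real N)"
  have L: "L > 0" using N by (simp add: L_def)
  have bA: "bounded_op A" using A by (simp add: has_matrix_def)
  define E where "E = A (wave N z a) - cscale (\<kappa> z / (\<i> * of_real (cosh (pi * a)))) (wave N (cnj z) a)"
  define C where "C = total * D * (8 + 3 * a0)"
  have a0: "0 \<le> a0" using a by simp
  have C: "C \<ge> 0" using total_nonneg D_ge_1 a0 by (simp add: C_def)
  have cA: "coord (A (wave N z a)) k = (\<Sum>j=1..N. z ^ j * power_wave a (real j) / of_real (sqrt L) * jump_matrix Z \<kappa> N j k)" for k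
  proof -
    have "coord (A (basis_vec j)) k = jump_matrix Z \<kappa> N j k" for j
      using A by (simp add: has_matrix_def entry_eq)
    then show ?thesis
      by (simp add: wave_def bounded_op_sum[OF bA] bounded_op_cscale[OF bA] L_def)
  qed
  have E0: "coord E k = 0" if "k \<notin> {1..N}" for k
  proof -
    have "jump_matrix Z \<kappa> N j k = 0" for j using that by (auto simp: jump_matrix_def)
    moreover have "coord (wave N w b) k = 0" for w b using that by (auto simp: coord_wave)
    ultimately show ?thesis unfolding E_def coord_diff cA coord_cscale by simp
  qed
  have Ek: "cmod (coord E k) \<le> C / sqrt L * (1 / real k + 1 / sqrt (real N))" if k: "k \<in> {1..N}" for k
  proof -
    define S where "S z' = (\<Sum>j=1..N. (z * cnj z') ^ j * ((1 / (real j + real k)) *\<^sub>R power_wave a (real j)))" for z'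
    define W where "W = of_real (pi / cosh (pi * a)) * power_wave a (real k)"
    have "coord (A (wave N z a)) k = (\<Sum>j=1..N. \<Sum>z'\<in>Z. \<kappa> z' * cnj z' ^ k * ((z * cnj z') ^ j * ((1 / (real j + real k)) *\<^sub>R power_wave a (real j)))) / (\<i> * of_real pi * of_real (sqrt L))"
      unfolding cA sum_divide_distrib
    proof (rule sum.cong[OF refl])
      fix j assume j: "j \<in> {1..N}"
      have "z ^ j * power_wave a (real j) / of_real (sqrt L) * jump_matrix Z \<kappa> N j k =
          (\<Sum>z'\<in>Z. \<kappa> z' * cnj z' ^ (j + k)) * (z ^ j * (of_real (1 / (real j + real k)) * power_wave a (real j))) / (\<i> * of_real pi * of_real (sqrt L))"
        using j k by (simp add: jump_matrix_def jump_coeff_def) (simp only: mult_ac)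
      also have "(\<Sum>z'\<in>Z. \<kappa> z' * cnj z' ^ (j + k)) * (z ^ j * (of_real (1 / (real j + real k)) * power_wave a (real j))) =
          (\<Sum>z'\<in>Z. \<kappa> z' * cnj z' ^ k * ((z * cnj z') ^ j * ((1 / (real j + real k)) *\<^sub>R power_wave a (real j))))"
        unfolding sum_distrib_right
        by (intro sum.cong refl) (simp only: power_add power_mult_distrib scaleR_conv_of_real mult_ac)
      finally show "z ^ j * power_wave a (real j) / of_real (sqrt L) * jump_matrix Z \<kappa> N j k =
          (\<Sum>z'\<in>Z. \<kappa> z' * cnj z' ^ k * ((z * cnj z') ^ j * ((1 / (real j + real k)) *\<^sub>R power_wave a (real j))) / (\<i> * of_real pi * of_real (sqrt L)))"
        by (simp only: sum_divide_distrib)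
    qed
    also have "(\<Sum>j=1..N. \<Sum>z'\<in>Z. \<kappa> z' * cnj z' ^ k * ((z * cnj z') ^ j * ((1 / (real j + real k)) *\<^sub>R power_wave a (real j)))) =
        (\<Sum>z'\<in>Z. \<kappa> z' * cnj z' ^ k * S z')"
      unfolding S_def sum_distrib_left by (rule sum.swap)
    finally have 1: "coord (A (wave N z a)) k = (\<Sum>z'\<in>Z. \<kappa> z' * cnj z' ^ k * S z') / (\<i> * of_real pi * of_real (sqrt L))" .
    have "coord (cscale (\<kappa> z / (\<i> * of_real (cosh (pi * a)))) (wave N (cnj z) a)) k = \<kappa> z * cnj z ^ k * W / (\<i> * of_real pi * of_real (sqrt L))"
      using k by (simp add: coord_wave W_def L_def)
    \<comment> \<open>Spreading the main term over all jumps allows a comparison term by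
      term.\<close>
    also have "\<kappa> z * cnj z ^ k * W = (\<Sum>z'\<in>Z. \<kappa> z' * cnj z' ^ k * (if z' = z then W else 0))"
      using finite_Z z by (simp add: if_distrib[of "\<lambda>y. _ * y"] cong: if_cong)
    finally have "coord E k = (\<Sum>z'\<in>Z. \<kappa> z' * cnj z' ^ k * (S z' - (if z' = z then W else 0))) / (\<i> * of_real pi * of_real (sqrt L))"
      unfolding E_def coord_diff 1 by (simp only: diff_divide_distrib[symmetric] sum_subtractf[symmetric] right_diff_distrib[symmetric])
    then have "cmod (coord E k) = cmod (\<Sum>z'\<in>Z. \<kappa> z' * cnj z' ^ k * (S z' - (if z' = z then W else 0))) / (pi * sqrt L)"
      using L by (simp add: norm_divide norm_mult)
    also have "\<dots> \<le> (\<Sum>z'\<in>Z. cmod (\<kappa> z') * (D * ((8 + 3 * a0) * (1 / real k + 1 / sqrt (real N))))) / (pi * sqrt L)"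
    proof (intro divide_right_mono order_trans[OF norm_sum] sum_mono)
      fix z' assume z': "z' \<in> Z"
      have k1: "1 \<le> k" "k \<le> N" using k by auto
      have c: "(8 + 3 * \<bar>a\<bar>) / real k \<le> (8 + 3 * a0) / real k" using a by (intro divide_right_mono) auto
      have "cmod (S z' - (if z' = z then W else 0)) \<le> D * ((8 + 3 * a0) * (1 / real k + 1 / sqrt (real N)))"
      proof (cases "z' = z")
        case True
        have "z * cnj z' = 1" using True unit_mult_cnj_eq_1_iff[of z z'] unit_Z z by simp
        then have "cmod (S z' - W) \<le> (8 + 3 * \<bar>a\<bar>) / real k + 2 / sqrt (real N)"
          unfolding S_def W_def using power_wave_kernel_sum[OF k1, of a] by simp
        also have "\<dots> \<le> (8 + 3 * a0) / real k + (8 + 3 * a0) / sqrt (real N)"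
          using a a0 by (intro add_mono divide_right_mono) auto
        also have "\<dots> = 1 * ((8 + 3 * a0) * (1 / real k + 1 / sqrt (real N)))" by (simp add: distrib_left)
        also have "\<dots> \<le> D * ((8 + 3 * a0) * (1 / real k + 1 / sqrt (real N)))"
          using D_ge_1 a0 by (intro mult_right_mono) auto
        finally show ?thesis using True by simp
      next
        case False
        have w: "cmod (z * cnj z') = 1" "z * cnj z' \<noteq> 1"
          using False unit_mult_cnj_eq_1_iff[of z z'] unit_Z z z' by (auto simp: norm_mult)
        have "cmod (S z') \<le> 2 / cmod (1 - z * cnj z') * ((8 + 3 * \<bar>a\<bar>) / real k)"
          unfolding S_def by (rule power_wave_kernel_oscillating[OF k1(1) _ w]) (use N in simp)
        also have "\<dots> \<le> D * ((8 + 3 * a0) / real k)"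
          using D_ge[OF z z'] c D_ge_1 a0 by (intro mult_mono) auto
        also have "\<dots> \<le> D * ((8 + 3 * a0) * (1 / real k + 1 / sqrt (real N)))"
        proof -
          have "(8 + 3 * a0) * (1 / real k) \<le> (8 + 3 * a0) * (1 / real k + 1 / sqrt (real N))"
            using a0 by (intro mult_left_mono) auto
          then show ?thesis using D_ge_1 by (intro mult_left_mono) auto
        qed
        finally show ?thesis using False by simp
      qed
      then show "cmod (\<kappa> z' * cnj z' ^ k * (S z' - (if z' = z then W else 0))) \<le> cmod (\<kappa> z') * (D * ((8 + 3 * a0) * (1 / real k + 1 / sqrt (real N))))"
        by (simp add: norm_mult norm_power unit_Z[OF z'] mult_left_mono)
    qed (use L in auto)
    also have "(\<Sum>z'\<in>Z. cmod (\<kappa> z') * (D * ((8 + 3 * a0) * (1 / real k + 1 / sqrt (real N))))) = C * (1 / real k + 1 / sqrt (real N))"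
      by (simp only: sum_distrib_right[symmetric] C_def total_def mult.assoc)
    also have "C * (1 / real k + 1 / sqrt (real N)) / (pi * sqrt L) \<le> C * (1 / real k + 1 / sqrt (real N)) / (1 * sqrt L)"
      using C L pi_ge_two by (intro divide_left_mono mult_right_mono mult_nonneg_nonneg) auto
    finally show ?thesis by simp
  qed
  have "(norm E)\<^sup>2 = (\<Sum>k<Suc N. (cmod (coord E k))\<^sup>2)"
    by (rule norm_square_finite) (simp add: E0)
  also have "\<dots> = (\<Sum>k=1..N. (cmod (coord E k))\<^sup>2)"
    by (rule sum.mono_neutral_right) (auto simp: E0)
  also have "\<dots> \<le> (\<Sum>k=1..N. C\<^sup>2 / L * (2 * (real k powr (-3/2) + 1 / real N)))"
  proof (rule sum_mono)
    fix k assume k: "k \<in> {1..N}"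
    have "(cmod (coord E k))\<^sup>2 \<le> (C / sqrt L * (1 / real k + 1 / sqrt (real N)))\<^sup>2"
      by (rule power_mono[OF Ek[OF k]]) simp
    also have "\<dots> = C\<^sup>2 / L * (1 / real k + 1 / sqrt (real N))\<^sup>2"
      using L by (simp add: power_mult_distrib power_divide)
    also have "\<dots> \<le> C\<^sup>2 / L * (2 * (real k powr (-3/2) + 1 / real N))"
    proof -
      have "(1 / real k + 1 / sqrt (real N))\<^sup>2 \<le> 2 * ((1 / real k)\<^sup>2 + (1 / sqrt (real N))\<^sup>2)"
        using sum_squares_bound[of "1 / real k" "1 / sqrt (real N)"] by (simp add: power2_sum)
      also have "(1 / real k)\<^sup>2 = real k powr (-2)" using k by (simp add: powr_minus_divide powr_numeral power_divide)
      also have "\<dots> \<le> real k powr (-3/2)" using k by (intro powr_mono) auto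
      finally have "(1 / real k + 1 / sqrt (real N))\<^sup>2 \<le> 2 * (real k powr (-3/2) + 1 / real N)"
        by (simp add: power_divide)
      then show ?thesis using L by (intro mult_left_mono) auto
    qed
    finally show "(cmod (coord E k))\<^sup>2 \<le> C\<^sup>2 / L * (2 * (real k powr (-3/2) + 1 / real N))" .
  qed
  \<comment> \<open>The N equal terms 1 / N add up to 1 and the other sum is at most 3, which
    explains the factor 8 of the statement.\<close>
  also have "\<dots> = C\<^sup>2 / L * (2 * ((\<Sum>k=1..N. real k powr (-3/2)) + 1))"
    using N by (simp only: sum_distrib_left[symmetric] sum.distrib) simp
  also have "\<dots> \<le> C\<^sup>2 / L * (2 * (3 + 1))"
    using L sum_powr_three_halves_le[of N] by (intro mult_left_mono add_mono) auto
  also have "\<dots> = 8 * C\<^sup>2 / L" by simp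
  finally show ?thesis unfolding E_def C_def L_def .
qed

end

section \<open>Lower and upper asymptotics for the model\<close>

context jump_model
begin

text \<open>One wave is taken for each jump \<open>z\<close> and each quantized frequency for which
  the approximate singular value |\<kappa> z| / cosh (pi a) is at least \<open>t1\<close>. The gap
  between \<open>t\<close> and \<open>t1\<close> pays for the imperfect orthonormality and the
  error.\<close>

lemma jump_density_lower:
  assumes t: "0 < t" "t < t1"
  shows "\<exists>C. \<forall>N\<ge>3. \<forall>A q. has_matrix A (jump_matrix Z \<kappa> N) \<longrightarrow> codim_bound A t q \<longrightarrow>
    jump_density Z \<kappa> t1 * ln (real N) - C \<le> real q"
proof -
  define Z' where "Z' = {z\<in>Z. t1 \<le> cmod (\<kappa> z)}"
  \<comment> \<open>With a = 2 pi m / ln N, the condition |\<kappa>| / cosh (pi a) \<ge> t1 reads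
    |m| \<le> y ln N. About 2 y ln N integers satisfy it, and 2 y is the value of
    \<open>density_c\<close> at t1 / |\<kappa>|.\<close>
  define y where "y z = arcosh (cmod (\<kappa> z) / t1) / (2 * pi\<^sup>2)" for z
  define g where "g = jump_density Z \<kappa> t1"
  define P where "P = real (card Z)"
  have Z': "finite Z'" "Z' \<subseteq> Z" using finite_Z by (auto simp: Z'_def)
  have ratio: "cmod (\<kappa> z) / t1 \<ge> 1" if "z \<in> Z'" for z
    using that t by (simp add: Z'_def)
  have y0: "y z \<ge> 0" if "z \<in> Z'" for z
    using arcosh_nonneg_real[OF ratio[OF that]] by (simp add: y_def)
  have g: "g = (\<Sum>z\<in>Z'. 2 * y z)"
  proof -
    have "g = (\<Sum>z\<in>Z'. density_c (t1 / cmod (\<kappa> z)))"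
      unfolding g_def jump_density_def
    proof (rule sum.mono_neutral_right[OF finite_Z Z'(2)], intro ballI)
      fix z assume "z \<in> Z - Z'"
      then have "t1 / cmod (\<kappa> z) \<ge> 1" using nonzero[of z] by (auto simp: Z'_def)
      then show "density_c (t1 / cmod (\<kappa> z)) = 0" by simp
    qed
    also have "\<dots> = (\<Sum>z\<in>Z'. 2 * y z)"
    proof (rule sum.cong[OF refl])
      fix z assume z: "z \<in> Z'"
      then have "t1 / cmod (\<kappa> z) > 0" using t nonzero by (auto simp: Z'_def)
      then show "density_c (t1 / cmod (\<kappa> z)) = 2 * y z"
        using ratio[OF z] by (simp add: density_c_eq y_def max_def)
    qed
    finally show ?thesis .
  qed
  have g0: "g \<ge> 0" unfolding g using y0 by (intro sum_nonneg) auto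
  have P0: "P \<ge> 0" by (simp add: P_def)
  define a0 where "a0 = 2 * pi * (\<Sum>z\<in>Z'. y z)"
  have ya0: "2 * pi * y z \<le> a0" if "z \<in> Z'" for z
    unfolding a0_def using y0 Z'(1) that by (intro mult_left_mono member_le_sum) auto
  have a0: "a0 \<ge> 0" unfolding a0_def using y0 by (intro mult_nonneg_nonneg sum_nonneg) auto
  \<comment> \<open>At \<delta> = 0 the last inequality is t < t1, so by continuity it persists for
    small \<delta>.\<close>
  obtain \<delta> where \<delta>: "0 < \<delta>" "\<delta> < 1" "t * sqrt (1 + \<delta>) + \<delta> < sqrt (1 - \<delta>) * t1"
  proof -
    have "((\<lambda>\<delta>. sqrt (1 - \<delta>) * t1 - (t * sqrt (1 + \<delta>) + \<delta>)) \<longlongrightarrow> sqrt (1 - 0) * t1 - (t * sqrt (1 + 0) + 0)) (at_right 0)"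
      by (intro tendsto_intros)
    then have "\<forall>\<^sub>F \<delta> in at_right 0. 0 < sqrt (1 - \<delta>) * t1 - (t * sqrt (1 + \<delta>) + \<delta>)"
      by (rule order_tendstoD(1)) (use t in simp)
    moreover have "\<forall>\<^sub>F \<delta> in at_right (0::real). \<delta> < 1"
      by (auto simp: eventually_at_right[of 0 1] intro!: exI[of _ 1])
    moreover have "\<forall>\<^sub>F \<delta> in at_right (0::real). 0 < \<delta>"
      by (simp add: eventually_at_right_less)
    ultimately have "\<forall>\<^sub>F \<delta> in at_right 0. 0 < \<delta> \<and> \<delta> < 1 \<and> t * sqrt (1 + \<delta>) + \<delta> < sqrt (1 - \<delta>) * t1"
      by eventually_elim simp
    then have "\<exists>\<delta>. 0 < \<delta> \<and> \<delta> < 1 \<and> t * sqrt (1 + \<delta>) + \<delta> < sqrt (1 - \<delta>) * t1"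
      by (rule eventually_happens'[OF trivial_limit_at_right_real])
    then show thesis using that by blast
  qed
  define B where "B = D * (4 + 6 * a0)"
  define B' where "B' = 8 * (total * D * (8 + 3 * a0))\<^sup>2"
  \<comment> \<open>With L = ln N and n \<le> (g + P) L waves, the first term bounds the n^2 squared
    Gram errors of size at most (B / L)^2, the second the n squared eigenvector errors of size at
    most B' / L.\<close>
  define H where "H = ((g + P) * B)\<^sup>2 + (g + P) * B'"
  have B: "B \<ge> 0" "B' \<ge> 0" using D_ge_1 a0 by (auto simp: B_def B'_def)
  show ?thesis
  proof (intro exI allI impI)
    fix N :: nat and A q
    assume N3: "N \<ge> 3" and A: "has_matrix A (jump_matrix Z \<kappa> N)" and q: "codim_bound A t q"
    have N: "N \<ge> 2" using N3 by simp
    define L where "L = ln (real N)"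
    \<comment> \<open>N \<ge> 3 > e makes \<open>L\<close> at least 1, so that the additive rounding
      term \<open>P\<close> can be absorbed into \<open>P * L\<close>.\<close>
    have L: "L \<ge> 1"
    proof -
      have "exp 1 \<le> real N" using exp_le N3 by linarith
      then show ?thesis unfolding L_def using N3 by (subst ln_ge_iff) auto
    qed
    define J where "J = (SIGMA z:Z'. {m::int. \<bar>real_of_int m\<bar> \<le> y z * L})"
    define n where "n = card J"
    have yL: "0 \<le> y z * L" if "z \<in> Z'" for z using y0[OF that] L by simp
    have finJ: "finite J" unfolding J_def using Z'(1) card_int_interval(1)[OF yL] by auto
    have nJ: "real n = (\<Sum>z\<in>Z'. real (card {m::int. \<bar>real_of_int m\<bar> \<le> y z * L}))"
      unfolding n_def J_def using Z'(1) card_int_interval(1)[OF yL] by (subst card_SigmaI) auto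
    have cZ': "real (card Z') \<le> P" unfolding P_def using card_mono[OF finite_Z Z'(2)] by simp
    have n_ge: "g * L - P \<le> real n"
    proof -
      have "g * L - real (card Z') = (\<Sum>z\<in>Z'. 2 * (y z * L) - 1)"
        by (simp add: g sum_subtractf sum_distrib_right mult.assoc)
      also have "\<dots> \<le> real n" unfolding nJ using card_int_interval(2)[OF yL] by (intro sum_mono) auto
      finally show ?thesis using cZ' by linarith
    qed
    have n_le: "real n \<le> (g + P) * L"
    proof -
      have "real n \<le> (\<Sum>z\<in>Z'. 2 * (y z * L) + 1)"
        unfolding nJ using card_int_interval(3)[OF yL] by (intro sum_mono) auto
      also have "\<dots> = g * L + real (card Z')"
        by (simp add: g sum.distrib sum_distrib_right mult.assoc)
      also have "\<dots> \<le> g * L + P * L"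
        using cZ' mult_left_mono[OF L P0] by linarith
      finally show ?thesis by (simp add: distrib_right)
    qed
    obtain e where e: "bij_betw e {..<n} J"
      using ex_bij_betw_nat_finite[OF finJ] by (auto simp: n_def atLeast0LessThan)
    have eJ: "e l \<in> J" if "l < n" for l using e that bij_betwE by fastforce
    have einj: "e l = e m \<longleftrightarrow> l = m" if "l < n" "m < n" for l m
      using e that unfolding bij_betw_def inj_on_def by auto
    define a where "a l = 2 * pi * of_int (snd (e l)) / L" for l
    have zl: "fst (e l) \<in> Z'" if "l < n" for l using eJ[OF that] by (auto simp: J_def)
    have al: "\<bar>a l\<bar> \<le> 2 * pi * y (fst (e l))" if "l < n" for l
    proof -
      have "\<bar>real_of_int (snd (e l))\<bar> \<le> y (fst (e l)) * L" using eJ[OF that] by (auto simp: J_def)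
      then have "2 * pi * \<bar>real_of_int (snd (e l))\<bar> / L \<le> 2 * pi * (y (fst (e l)) * L) / L"
        using L by (intro divide_right_mono mult_left_mono) auto
      then show ?thesis using L by (simp add: a_def abs_mult)
    qed
    then have al0: "\<bar>a l\<bar> \<le> a0" if "l < n" for l using ya0[OF zl[OF that]] that by fastforce
    define \<phi> where "\<phi> l = wave N (fst (e l)) (a l)" for l
    define \<psi> where "\<psi> l = wave N (cnj (fst (e l))) (a l)" for l
    define \<mu> where "\<mu> l = \<kappa> (fst (e l)) / (\<i> * of_real (cosh (pi * a l)))" for l
    have gram_sum: "(\<Sum>l<n. \<Sum>m<n. (cmod (G l m))\<^sup>2) \<le> H"
      if "\<And>l m. l < n \<Longrightarrow> m < n \<Longrightarrow> cmod (G l m) \<le> B / L" for G :: "nat \<Rightarrow> nat \<Rightarrow> complex"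
    proof -
      have "(\<Sum>l<n. \<Sum>m<n. (cmod (G l m))\<^sup>2) \<le> (\<Sum>l<n. \<Sum>m<n. (B / L)\<^sup>2)"
        by (intro sum_mono power_mono that) auto
      also have "\<dots> = (real n * (B / L))\<^sup>2" by (simp add: power2_eq_square)
      also have "\<dots> \<le> ((g + P) * L * (B / L))\<^sup>2"
        using n_le B L by (intro power_mono mult_right_mono) auto
      also have "\<dots> = ((g + P) * B)\<^sup>2" using L by simp
      also have "\<dots> \<le> H" using g0 P0 B(2) unfolding H_def by simp
      finally show ?thesis .
    qed
    have fst_snd: "(fst (e l) = fst (e m) \<and> snd (e l) = snd (e m)) \<longleftrightarrow> l = m" if "l < n" "m < n" for l m
      using einj[OF that] by (metis prod_eqI)
    have "real n \<le> real q + 3 * H / \<delta>\<^sup>2"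
    proof (rule approximate_eigenvectors_count[where A = A and t = t and \<phi> = \<phi> and \<psi> = \<psi> and \<mu> = \<mu> and ?t1.0 = t1])
      show "bounded_op A" using A by (simp add: has_matrix_def)
      show "(\<Sum>l<n. \<Sum>m<n. (cmod (cinner (\<phi> l) (\<phi> m) - (if l = m then 1 else 0)))\<^sup>2) \<le> H"
      proof (rule gram_sum)
        fix l m assume lm: "l < n" "m < n"
        have z: "fst (e l) \<in> Z" "fst (e m) \<in> Z" using zl lm Z'(2) by auto
        show "cmod (cinner (\<phi> l) (\<phi> m) - (if l = m then 1 else 0)) \<le> B / L"
          using wave_gram[OF N unit_Z[OF z(1)] unit_Z[OF z(2)] D_ge_1 D_ge[OF z], of "a l" "snd (e l)" a0 "a m" "snd (e m)"]
            al0[OF lm(1)] al0[OF lm(2)]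
          by (simp add: fst_snd[OF lm] \<phi>_def B_def L_def a_def)
      qed
      show "(\<Sum>l<n. \<Sum>m<n. (cmod (cinner (\<psi> l) (\<psi> m) - (if l = m then 1 else 0)))\<^sup>2) \<le> H"
      proof (rule gram_sum)
        fix l m assume lm: "l < n" "m < n"
        have z: "fst (e l) \<in> Z" "fst (e m) \<in> Z" using zl lm Z'(2) by auto
        have u: "cmod (cnj (fst (e l))) = 1" "cmod (cnj (fst (e m))) = 1" using unit_Z z by auto
        have d: "2 / cmod (1 - cnj (fst (e l)) * cnj (cnj (fst (e m)))) \<le> D"
          using D_ge'[OF z] by simp
        show "cmod (cinner (\<psi> l) (\<psi> m) - (if l = m then 1 else 0)) \<le> B / L"
          using wave_gram[OF N u D_ge_1 d, of "a l" "snd (e l)" a0 "a m" "snd (e m)"]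
            al0[OF lm(1)] al0[OF lm(2)]
          by (simp add: fst_snd[OF lm] \<psi>_def B_def L_def a_def)
      qed
      have "(\<Sum>l<n. (norm (A (\<phi> l) - cscale (\<mu> l) (\<psi> l)))\<^sup>2) \<le> (\<Sum>l<n. B' / L)"
        unfolding \<phi>_def \<psi>_def \<mu>_def B'_def L_def
        using zl Z'(2) al0 by (intro sum_mono jump_operator_wave[OF A N]) auto
      also have "\<dots> = real n * (B' / L)" by simp
      also have "\<dots> \<le> (g + P) * L * (B' / L)" using n_le B L by (intro mult_right_mono) auto
      also have "\<dots> = (g + P) * B'" using L by simp
      also have "\<dots> \<le> H" by (simp add: H_def)
      finally show "(\<Sum>l<n. (norm (A (\<phi> l) - cscale (\<mu> l) (\<psi> l)))\<^sup>2) \<le> H" .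
      show "t1 \<le> cmod (\<mu> l)" if "l < n" for l
      proof -
        have "cosh (pi * a l) = cosh \<bar>pi * a l\<bar>" by simp
        also have "\<dots> \<le> cosh (arcosh (cmod (\<kappa> (fst (e l))) / t1))"
        proof (subst cosh_real_nonneg_le_iff)
          have "\<bar>pi * a l\<bar> = pi * \<bar>a l\<bar>" by (simp add: abs_mult)
          also have "\<dots> \<le> pi * (2 * pi * y (fst (e l)))" using al[OF that] by (intro mult_left_mono) auto
          also have "\<dots> = arcosh (cmod (\<kappa> (fst (e l))) / t1)" by (simp add: y_def power2_eq_square)
          finally show "\<bar>pi * a l\<bar> \<le> arcosh (cmod (\<kappa> (fst (e l))) / t1)" .
        qed (use arcosh_nonneg_real[OF ratio[OF zl[OF that]]] in auto)
        also have "\<dots> = cmod (\<kappa> (fst (e l))) / t1" using ratio[OF zl[OF that]] by simp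
        finally have "t1 * cosh (pi * a l) \<le> cmod (\<kappa> (fst (e l)))" using t by (simp add: field_simps)
        then show ?thesis by (simp add: \<mu>_def norm_divide norm_mult pos_le_divide_eq)
      qed
    qed (use q t \<delta> in auto)
    then show "jump_density Z \<kappa> t1 * ln (real N) - (P + 3 * H / \<delta>\<^sup>2) \<le> real q"
      using n_ge by (simp add: g_def L_def)
  qed
qed

lemma isCont_jump_density:
  assumes "t > 0"
  shows "isCont (jump_density Z \<kappa>) t"
proof -
  have "isCont (\<lambda>t. density_c (t / cmod (\<kappa> z))) t" if "z \<in> Z" for z
  proof (rule isCont_o2[of t "\<lambda>t. t / cmod (\<kappa> z)" density_c])
    show "isCont (\<lambda>t. t / cmod (\<kappa> z)) t" using nonzero[OF that] by (intro continuous_intros) auto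
    show "isCont density_c (t / cmod (\<kappa> z))" using nonzero[OF that] assms by (intro isCont_density_c) simp
  qed
  then show ?thesis unfolding jump_density_def[abs_def] by (intro continuous_intros) auto
qed

text \<open>Continuity of the density brings \<open>t1\<close> down to \<open>t\<close> at the cost
  of half of \<epsilon>; the constant \<open>C\<close> is eventually below the other half times ln
  N.\<close>

lemma jump_density_lower_eventually:
  assumes A: "\<And>N. has_matrix (A N) (jump_matrix Z \<kappa> N)" and t: "0 < t" and \<epsilon>: "0 < \<epsilon>"
  shows "\<forall>\<^sub>F N in sequentially. \<forall>q. codim_bound (A N) t q \<longrightarrow> (jump_density Z \<kappa> t - \<epsilon>) * ln (real N) \<le> real q"
proof -
  have "(jump_density Z \<kappa> \<longlongrightarrow> jump_density Z \<kappa> t) (at_right t)"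
    using isCont_jump_density[OF t] by (simp add: continuous_at filterlim_at_split)
  then have "\<forall>\<^sub>F s in at_right t. jump_density Z \<kappa> t - \<epsilon> / 2 < jump_density Z \<kappa> s"
    by (rule order_tendstoD(1)) (use \<epsilon> in simp)
  moreover have "\<forall>\<^sub>F s in at_right t. t < s" by (simp add: eventually_at_right_less)
  ultimately have "\<forall>\<^sub>F s in at_right t. t < s \<and> jump_density Z \<kappa> t - \<epsilon> / 2 < jump_density Z \<kappa> s"
    by eventually_elim simp
  then have "\<exists>s. t < s \<and> jump_density Z \<kappa> t - \<epsilon> / 2 < jump_density Z \<kappa> s"
    by (rule eventually_happens'[OF trivial_limit_at_right_real])
  then obtain t1 where t1: "t < t1" "jump_density Z \<kappa> t - \<epsilon> / 2 < jump_density Z \<kappa> t1" by blast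
  obtain C where C: "\<And>N A q. N \<ge> 3 \<Longrightarrow> has_matrix A (jump_matrix Z \<kappa> N) \<Longrightarrow> codim_bound A t q \<Longrightarrow>
      jump_density Z \<kappa> t1 * ln (real N) - C \<le> real q"
    using jump_density_lower[OF t t1(1)] by blast
  have "filterlim (\<lambda>N. ln (real N)) at_top sequentially"
    by real_asymp
  then have "\<forall>\<^sub>F N in sequentially. max 0 (2 * C / \<epsilon>) < ln (real N)"
    unfolding filterlim_at_top_dense by blast
  then show ?thesis
    using eventually_ge_at_top[of 3]
  proof eventually_elim
    case (elim N)
    show ?case
    proof (intro allI impI)
      fix q assume "codim_bound (A N) t q"
      then have 1: "jump_density Z \<kappa> t1 * ln (real N) - C \<le> real q" using C elim A by blast
      have L: "ln (real N) > 0" using elim by simp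
      have 2: "C \<le> \<epsilon> / 2 * ln (real N)" using elim \<epsilon> by (simp add: field_simps)
      have "(jump_density Z \<kappa> t - \<epsilon> / 2) * ln (real N) \<le> jump_density Z \<kappa> t1 * ln (real N)"
        using t1 L by (intro mult_right_mono) auto
      then show "(jump_density Z \<kappa> t - \<epsilon>) * ln (real N) \<le> real q"
        using 1 2 by (simp add: algebra_simps)
    qed
  qed
qed

text \<open>\<open>counting_upper_bound\<close> is applied at u0 = t^2 with \<open>u1\<close>
  slightly smaller; continuity of the density absorbs the difference between the two levels.\<close>

lemma jump_density_upper_eventually:
  assumes A: "\<And>N. has_matrix (A N) (jump_matrix Z \<kappa> N)" and t: "0 < t" and \<epsilon>: "0 < \<epsilon>"
  shows "\<forall>\<^sub>F N in sequentially. \<exists>q. real q \<le> (jump_density Z \<kappa> t + \<epsilon>) * ln (real N) \<and> codim_bound (A N) t q"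
proof -
  define G where "G u = jump_density Z \<kappa> (sqrt u)" for u
  \<comment> \<open>The primitive of \<open>G\<close>, rescaled for each jump. It becomes constant,
    with value \<open>mass\<close>, as soon as u exceeds every squared |\<kappa> z|;
    \<open>U\<close> is a crude level with this property.\<close>
  define F where "F u = (\<Sum>z\<in>Z. (cmod (\<kappa> z))\<^sup>2 * density_primitive (u / (cmod (\<kappa> z))\<^sup>2))" for u
  define U where "U = (\<Sum>z\<in>Z. (cmod (\<kappa> z))\<^sup>2)"
  define c where "c N u = real (count_above (A N) (sqrt u))" for N u
  note count = codim_bound_iff_count_above[OF A jump_matrix_mass]
  have "isCont G (t\<^sup>2)"
    unfolding G_def
  proof (rule isCont_o2[where f = sqrt and g = "jump_density Z \<kappa>"])
    show "isCont sqrt (t\<^sup>2)" by (rule isCont_real_sqrt)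
    show "isCont (jump_density Z \<kappa>) (sqrt (t\<^sup>2))" using t by (intro isCont_jump_density) simp
  qed
  then have "(G \<longlongrightarrow> G (t\<^sup>2)) (at_left (t\<^sup>2))"
    by (simp add: continuous_at filterlim_at_split)
  then have "\<forall>\<^sub>F u in at_left (t\<^sup>2). G u < G (t\<^sup>2) + \<epsilon> / 2"
    by (rule order_tendstoD(2)) (use \<epsilon> in simp)
  moreover have "\<forall>\<^sub>F u in at_left (t\<^sup>2). u \<in> {0<..<t\<^sup>2}"
    by (rule eventually_at_left_real) (use t in simp)
  ultimately have "\<forall>\<^sub>F u in at_left (t\<^sup>2). G u < G (t\<^sup>2) + \<epsilon> / 2 \<and> u \<in> {0<..<t\<^sup>2}"
    by eventually_elim simp
  then have "\<exists>u. G u < G (t\<^sup>2) + \<epsilon> / 2 \<and> u \<in> {0<..<t\<^sup>2}"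
    by (rule eventually_happens'[OF trivial_limit_at_left_real])
  then obtain u1 where u1: "0 < u1" "u1 < t\<^sup>2" "G u1 < G (t\<^sup>2) + \<epsilon> / 2" by auto
  have "\<forall>\<^sub>F N in sequentially. c N (t\<^sup>2) \<le> (G u1 + \<epsilon> / 2) * ln (real N)"
  proof (rule counting_upper_bound[where c = c and G = G and L = "\<lambda>N. ln (real N)" and U = U and V = mass and F = F and C = "mass + 21 * D * total\<^sup>2"])
    show "filterlim (\<lambda>N. ln (real N)) at_top sequentially" by real_asymp
    show "c N v \<le> c N u" if "0 < u" "u \<le> v" for N u v
      unfolding c_def using that by (intro of_nat_mono count_above_antimono[OF A jump_matrix_mass]) auto
    show "G v \<le> G u" if "0 < u" "u \<le> v" for u v
      unfolding G_def jump_density_def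
      using that nonzero by (intro sum_mono density_c_antimono) (auto intro!: divide_right_mono)
    show "F v - F u \<le> (v - u) * G u" if "0 < u" "u \<le> v" for u v
      unfolding F_def G_def jump_density_def sum_subtractf[symmetric] sum_distrib_left
    proof (rule sum_mono)
      fix z assume "z \<in> Z"
      define k where "k = cmod (\<kappa> z)"
      have k: "k > 0" using nonzero[OF \<open>z \<in> Z\<close>] by (simp add: k_def)
      have "density_primitive (v / k\<^sup>2) - density_primitive (u / k\<^sup>2) \<le> (v / k\<^sup>2 - u / k\<^sup>2) * density_c (sqrt (u / k\<^sup>2))"
        using that k by (intro density_primitive_increment divide_right_mono) auto
      then have "k\<^sup>2 * (density_primitive (v / k\<^sup>2) - density_primitive (u / k\<^sup>2)) \<le> k\<^sup>2 * ((v / k\<^sup>2 - u / k\<^sup>2) * density_c (sqrt (u / k\<^sup>2)))"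
        by (intro mult_left_mono) auto
      also have "\<dots> = (k\<^sup>2 * (v / k\<^sup>2 - u / k\<^sup>2)) * density_c (sqrt u / k)"
        using k by (simp add: real_sqrt_divide)
      also have "k\<^sup>2 * (v / k\<^sup>2 - u / k\<^sup>2) = v - u" using k by (simp add: right_diff_distrib)
      finally show "(cmod (\<kappa> z))\<^sup>2 * density_primitive (v / (cmod (\<kappa> z))\<^sup>2) - (cmod (\<kappa> z))\<^sup>2 * density_primitive (u / (cmod (\<kappa> z))\<^sup>2)
          \<le> (v - u) * density_c (sqrt u / cmod (\<kappa> z))"
        by (simp add: k_def right_diff_distrib)
    qed
    show "F u = mass" if "u \<ge> U" for u
      unfolding F_def mass_def sum_divide_distrib
    proof (rule sum.cong[OF refl])
      fix z assume "z \<in> Z"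
      have "(cmod (\<kappa> z))\<^sup>2 \<le> U" unfolding U_def using \<open>z \<in> Z\<close> finite_Z by (intro member_le_sum) auto
      then have "u / (cmod (\<kappa> z))\<^sup>2 \<ge> 1" using that nonzero[OF \<open>z \<in> Z\<close>] by simp
      then show "(cmod (\<kappa> z))\<^sup>2 * density_primitive (u / (cmod (\<kappa> z))\<^sup>2) = (cmod (\<kappa> z))\<^sup>2 / pi\<^sup>2"
        by (simp add: density_primitive_def)
    qed
    have "(F \<longlongrightarrow> (\<Sum>z\<in>Z. (cmod (\<kappa> z))\<^sup>2 * 0)) (at_right 0)"
      unfolding F_def
    proof (intro tendsto_sum tendsto_mult tendsto_const)
      fix z assume "z \<in> Z"
      define k where "k = (cmod (\<kappa> z))\<^sup>2"
      have k: "k > 0" using nonzero[OF \<open>z \<in> Z\<close>] by (simp add: k_def)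
      have "filterlim (\<lambda>u. u / k) (at_right 0) (at_right 0)"
        unfolding filterlim_at using k
        by (auto intro!: tendsto_eq_intros simp: eventually_at_right[of 0 1] intro: exI[of _ 1])
      then show "((\<lambda>u. density_primitive (u / (cmod (\<kappa> z))\<^sup>2)) \<longlongrightarrow> 0) (at_right 0)"
        unfolding k_def by (rule filterlim_compose[OF density_primitive_tendsto])
    qed
    then show "(F \<longlongrightarrow> 0) (at_right 0)" by simp
    show "\<forall>\<^sub>F N in sequentially. (G u - \<epsilon>') * ln (real N) \<le> c N u" if "0 < u" "0 < \<epsilon>'" for u \<epsilon>'
    proof -
      have s: "0 < sqrt u" using that by simp
      show ?thesis
        using jump_density_lower_eventually[OF A s that(2)]
      proof eventually_elim
        case (elim N)
        have "codim_bound (A N) (sqrt u) (count_above (A N) (sqrt u))"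
          using count[OF s] by simp
        then show ?case using elim unfolding G_def c_def by blast
      qed
    qed
    show "\<forall>\<^sub>F N in sequentially. h * (\<Sum>j=1..k. c N (real j * h)) \<le> mass * ln (real N) + (mass + 21 * D * total\<^sup>2)"
      if "0 < h" for h k
      unfolding c_def using count_above_mass[OF A jump_matrix_mass that] by simp
  qed (use u1 \<epsilon> in auto)
  then show ?thesis
    using eventually_ge_at_top[of 1]
  proof eventually_elim
    case (elim N)
    have "(G u1 + \<epsilon> / 2) * ln (real N) \<le> (G (t\<^sup>2) + \<epsilon>) * ln (real N)"
      using u1 elim(2) by (intro mult_right_mono) auto
    then have "real (count_above (A N) t) \<le> (jump_density Z \<kappa> t + \<epsilon>) * ln (real N)"
      using elim(1) t by (simp add: c_def G_def)
    then show ?case using count[OF t] by blast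
  qed
qed

end

section \<open>Truncations\<close>

lemma sum_antidiagonal_le:
  fixes f :: "nat \<Rightarrow> real"
  assumes "\<And>s. 0 \<le> f s"
  shows "(\<Sum>k<n. \<Sum>j<n. f (j + k)) \<le> (\<Sum>s<2 * n. real (s + 1) * f s)"
proof -
  have row: "(\<Sum>j<n. f (j + k)) \<le> (\<Sum>s<2 * n. if k \<le> s then f s else 0)" if "k < n" for k
  proof -
    have "(\<Sum>j<n. f (j + k)) = (\<Sum>s\<in>(\<lambda>j. j + k) ` {..<n}. f s)"
      by (subst sum.reindex) (auto simp: inj_on_def)
    also have "\<dots> = (\<Sum>s\<in>(\<lambda>j. j + k) ` {..<n}. if k \<le> s then f s else 0)"
      by (intro sum.cong) auto
    also have "\<dots> \<le> (\<Sum>s<2 * n. if k \<le> s then f s else 0)"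
      using that assms by (intro sum_mono2) auto
    finally show ?thesis .
  qed
  have "(\<Sum>k<n. \<Sum>j<n. f (j + k)) \<le> (\<Sum>k<n. \<Sum>s<2 * n. if k \<le> s then f s else 0)"
    by (intro sum_mono row) auto
  also have "\<dots> = (\<Sum>s<2 * n. \<Sum>k<n. if k \<le> s then f s else 0)" by (rule sum.swap)
  also have "\<dots> \<le> (\<Sum>s<2 * n. real (s + 1) * f s)"
  proof (rule sum_mono)
    fix s
    have "card ({..<n} \<inter> {k. k \<le> s}) \<le> card {..s}" by (intro card_mono) auto
    then have "real (card ({..<n} \<inter> {k. k \<le> s})) * f s \<le> real (s + 1) * f s"
      using assms by (intro mult_right_mono) auto
    then show "(\<Sum>k<n. if k \<le> s then f s else 0) \<le> real (s + 1) * f s"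
      by (simp add: sum.If_cases)
  qed
  finally show ?thesis .
qed

text \<open>The summand is the derivative of ln (N / x)^(1 - p) / (p - 1) at x = s, and p > 1 keeps
  this primitive bounded uniformly in N. The restriction 4 s \<le> N stays away from the singularity
  of the logarithm at s = N.\<close>

lemma near_origin_sum_bound:
  fixes p :: real
  assumes p: "p > 1"
  shows "\<exists>C. \<forall>N\<ge>1. \<forall>n. (\<Sum>s=1..n. if 4 * s \<le> N then ln (real N / real s) powr (- p) / real s else 0) \<le> C"
proof (intro exI allI impI)
  fix N n :: nat assume N: "N \<ge> 1"
  define F where "F x = ln (real N / x) powr (1 - p) / (p - 1)" for x
  define m where "m = N div 4"
  have der: "(F has_real_derivative ln (real N / x) powr (- p) / x) (at x)" if x: "0 < x" "x < real N" for x
  proof -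
    have l: "ln (real N / x) > 0" using x by simp
    have "((\<lambda>x. ln (real N / x)) has_real_derivative - 1 / x) (at x)"
      using x N by (auto intro!: derivative_eq_intros simp: field_simps power2_eq_square)
    from DERIV_fun_powr[OF this l, of "1 - p"]
    have "((\<lambda>x. ln (real N / x) powr (1 - p)) has_real_derivative (1 - p) * ln (real N / x) powr (1 - p - real 1) * (- 1 / x)) (at x)"
      by simp
    from DERIV_cdivide[OF this, of "p - 1"] have "(F has_real_derivative (1 - p) * ln (real N / x) powr (1 - p - real 1) * (- 1 / x) / (p - 1)) (at x)"
      unfolding F_def .
    moreover have "(1 - p) * y * (- 1 / x) / (p - 1) = y / x" for y
    proof -
      have "(1 - p) * y * (- 1 / x) = (p - 1) * (y / x)" by (simp add: algebra_simps diff_divide_distrib)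
      then show ?thesis using p by simp
    qed
    ultimately show ?thesis by simp
  qed
  \<comment> \<open>The logarithmic factor increases with x, so the cell to the right of
    \<open>s\<close> is used; the factor 2 pays for 1 / x there, since s + 1 \<le> 2 s.\<close>
  have step: "ln (real N / real s) powr (- p) / real s \<le> 2 * (F (real s + 1) - F (real s))" if s: "1 \<le> s" "4 * s \<le> N" for s
  proof -
    have sN: "real s + 1 < real N" using s by simp
    obtain \<xi> where \<xi>: "real s < \<xi>" "\<xi> < real s + 1" "F (real s + 1) - F (real s) = (real s + 1 - real s) * (ln (real N / \<xi>) powr (- p) / \<xi>)"
      using MVT2[of "real s" "real s + 1" F "\<lambda>x. ln (real N / x) powr (- p) / x"] der s sN by force
    have \<xi>0: "0 < \<xi>" "\<xi> < real N" using \<xi> s sN by auto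
    have "ln (real N / \<xi>) \<le> ln (real N / real s)"
      using \<xi> \<xi>0 s by (intro ln_mono divide_left_mono) auto
    moreover have "0 < ln (real N / \<xi>)" using \<xi>0 by simp
    ultimately have 1: "ln (real N / real s) powr (- p) \<le> ln (real N / \<xi>) powr (- p)"
      using p by (intro powr_mono2') auto
    have "ln (real N / real s) powr (- p) / real s = 2 * (ln (real N / real s) powr (- p) / (2 * real s))" using s by simp
    also have "\<dots> \<le> 2 * (ln (real N / \<xi>) powr (- p) / \<xi>)"
      using 1 \<xi> \<xi>0 s by (intro mult_left_mono frac_le) auto
    finally show ?thesis using \<xi>(3) by simp
  qed
  have F_nonneg: "F x \<ge> 0" for x using p by (simp add: F_def)
  have "(\<Sum>s=1..n. if 4 * s \<le> N then ln (real N / real s) powr (- p) / real s else 0) \<le> 2 * (ln 2 powr (1 - p) / (p - 1))"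
  proof (cases "m = 0")
    case True
    then have "N < 4" by (simp add: m_def div_eq_0_iff)
    then have "(\<Sum>s=1..n. if 4 * s \<le> N then ln (real N / real s) powr (- p) / real s else 0) = 0"
      by (intro sum.neutral) auto
    then show ?thesis using p by simp
  next
    case False
    have "(\<Sum>s=1..n. if 4 * s \<le> N then ln (real N / real s) powr (- p) / real s else 0) =
        (\<Sum>s\<in>{1..n} \<inter> {s. 4 * s \<le> N}. ln (real N / real s) powr (- p) / real s)"
      by (simp add: sum.If_cases)
    also have "\<dots> \<le> (\<Sum>s=1..m. ln (real N / real s) powr (- p) / real s)"
      by (rule sum_mono2) (auto simp: m_def)
    also have "\<dots> \<le> (\<Sum>s=1..m. 2 * (F (real s + 1) - F (real s)))"
      by (intro sum_mono step) (auto simp: m_def)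
    also have "\<dots> = 2 * (F (real m + 1) - F 1)"
    proof -
      have "(\<Sum>s=1..m. F (real s + 1) - F (real s)) = F (real m + 1) - F 1"
        by (induction m) (auto simp: add.commute)
      then show ?thesis by (simp only: sum_distrib_left[symmetric])
    qed
    also have "\<dots> \<le> 2 * F (real m + 1)" using F_nonneg[of 1] by simp
    also have "F (real m + 1) \<le> ln 2 powr (1 - p) / (p - 1)"
    proof -
      have "2 * (m + 1) \<le> 4 * m" using False by simp
      also have "4 * m \<le> N" by (simp add: m_def)
      finally have "real (2 * (m + 1)) \<le> real N" by (simp only: of_nat_le_iff)
      then have "2 * (real m + 1) \<le> real N" by simp
      then have "2 \<le> real N / (real m + 1)" by (simp add: pos_le_divide_eq)
      then have "ln 2 \<le> ln (real N / (real m + 1))" by (intro ln_mono) auto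
      then have "ln (real N / (real m + 1)) powr (1 - p) \<le> ln 2 powr (1 - p)"
        using p by (intro powr_mono2') auto
      then show ?thesis unfolding F_def using p by (intro divide_right_mono) auto
    qed
    finally show ?thesis by simp
  qed
  then show "(\<Sum>s=1..n. if 4 * s \<le> N then ln (real N / real s) powr (- p) / real s else 0) \<le> 2 * (ln 2 powr (1 - p) / (p - 1))" .
qed

text \<open>Here the primitive is a negative power of ln (x / N + 2), whose derivative carries 1 /
  (x + 2 N) in place of 1 / x. For s > \<eta> N the two are comparable up to the factor 1 + 2 /
  \<eta>, and the cell to the left of \<open>s\<close> is used because the summand
  decreases.\<close>

lemma tail_sum_bound:
  fixes p \<eta> :: real
  assumes p: "p > 1" and \<eta>: "\<eta> > 0"
  shows "\<exists>C. \<forall>N\<ge>1. \<forall>n. (\<Sum>s=1..n. if \<eta> * real N < real s then ln (real s / real N + 2) powr (- p) / real s else 0) \<le> C"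
proof (intro exI allI impI)
  fix N n :: nat assume N: "N \<ge> 1"
  define G where "G x = - (ln (x / real N + 2) powr (1 - p)) / (p - 1)" for x
  have der: "(G has_real_derivative ln (x / real N + 2) powr (- p) / (x + 2 * real N)) (at x)" if x: "0 \<le> x" for x
  proof -
    have pos: "x / real N + 2 > 0" using x by (intro add_nonneg_pos) auto
    have l: "ln (x / real N + 2) > 0" using x by (intro ln_gt_zero) (simp add: add_nonneg_pos less_le_trans[of 1 2])
    have "((\<lambda>x. ln (x / real N + 2)) has_real_derivative (1 / real N) / (x / real N + 2)) (at x)"
      using pos N by (auto intro!: derivative_eq_intros)
    moreover have "(1 / real N) / (x / real N + 2) = 1 / (x + 2 * real N)"
    proof -
      have "real N * (x / real N + 2) = x + 2 * real N" using N by (simp add: distrib_left)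
      then show ?thesis by simp
    qed
    ultimately have "((\<lambda>x. ln (x / real N + 2)) has_real_derivative 1 / (x + 2 * real N)) (at x)" by simp
    from DERIV_fun_powr[OF this l, of "1 - p"]
    have "((\<lambda>x. ln (x / real N + 2) powr (1 - p)) has_real_derivative (1 - p) * ln (x / real N + 2) powr (1 - p - real 1) * (1 / (x + 2 * real N))) (at x)"
      by simp
    from DERIV_cdivide[OF DERIV_minus[OF this], of "p - 1"] have G: "(G has_real_derivative - ((1 - p) * ln (x / real N + 2) powr (1 - p - real 1) * (1 / (x + 2 * real N))) / (p - 1)) (at x)"
      unfolding G_def .
    have gen: "- ((1 - p) * y * z) / (p - 1) = y * z" for y z :: real
    proof -
      have "- ((1 - p) * y * z) = (p - 1) * (y * z)" by (simp add: algebra_simps)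
      then show ?thesis using p by simp
    qed
    have "1 - p - real 1 = - p" by simp
    with G show ?thesis unfolding gen by simp
  qed
  have step: "(if \<eta> * real N < real s then ln (real s / real N + 2) powr (- p) / real s else 0) \<le> (1 + 2 / \<eta>) * (G (real s) - G (real s - 1))"
    if s: "1 \<le> s" for s
  proof -
    obtain \<xi> where \<xi>: "real s - 1 < \<xi>" "\<xi> < real s" "G (real s) - G (real s - 1) = (real s - (real s - 1)) * (ln (\<xi> / real N + 2) powr (- p) / (\<xi> + 2 * real N))"
      using MVT2[of "real s - 1" "real s" G "\<lambda>x. ln (x / real N + 2) powr (- p) / (x + 2 * real N)"] der s by force
    have \<xi>0: "0 < \<xi>" using \<xi> s by linarith
    have eq: "G (real s) - G (real s - 1) = ln (\<xi> / real N + 2) powr (- p) / (\<xi> + 2 * real N)" using \<xi>(3) by simp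
    show ?thesis
    proof (cases "\<eta> * real N < real s")
      case True
      have "\<xi> / real N \<le> real s / real N" using \<xi> by (intro divide_right_mono) auto
      moreover have g2: "0 < \<xi> / real N + 2" using \<xi>0 by (intro add_nonneg_pos) auto
      ultimately have "ln (\<xi> / real N + 2) \<le> ln (real s / real N + 2)" by (intro ln_mono) auto
      moreover have "0 < ln (\<xi> / real N + 2)"
      proof (rule ln_gt_zero)
        have "0 \<le> \<xi> / real N" using \<xi>0 by simp
        then show "1 < \<xi> / real N + 2" by linarith
      qed
      ultimately have 1: "ln (real s / real N + 2) powr (- p) \<le> ln (\<xi> / real N + 2) powr (- p)"
        using p by (intro powr_mono2') auto
      have "real N \<le> real s / \<eta>" using True \<eta> by (simp add: pos_le_divide_eq mult.commute)
      then have "\<xi> + 2 * real N \<le> real s + 2 * (real s / \<eta>)" using \<xi> by linarith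
      also have "\<dots> = (1 + 2 / \<eta>) * real s" by (simp add: distrib_right)
      finally have 2: "\<xi> + 2 * real N \<le> (1 + 2 / \<eta>) * real s" .
      have K: "1 + 2 / \<eta> > 0" using \<eta> by (simp add: add_pos_pos)
      have "ln (real s / real N + 2) powr (- p) / real s = (1 + 2 / \<eta>) * (ln (real s / real N + 2) powr (- p) / ((1 + 2 / \<eta>) * real s))"
        using K by simp
      also have "\<dots> \<le> (1 + 2 / \<eta>) * (ln (\<xi> / real N + 2) powr (- p) / (\<xi> + 2 * real N))"
        using 1 2 K \<xi>0 by (intro mult_left_mono frac_le) (auto intro: add_pos_nonneg)
      finally show ?thesis using True by (simp add: eq)
    next
      case False
      then show ?thesis using \<eta> \<xi>0 unfolding eq by (auto intro!: mult_nonneg_nonneg divide_nonneg_nonneg add_nonneg_nonneg)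
    qed
  qed
  have "(\<Sum>s=1..n. if \<eta> * real N < real s then ln (real s / real N + 2) powr (- p) / real s else 0) \<le>
      (\<Sum>s=1..n. (1 + 2 / \<eta>) * (G (real s) - G (real s - 1)))"
    by (intro sum_mono step) auto
  also have "\<dots> = (1 + 2 / \<eta>) * (G (real n) - G 0)"
  proof -
    have "(\<Sum>s=1..n. G (real s) - G (real s - 1)) = G (real n) - G 0"
      by (induction n) auto
    then show ?thesis by (simp only: sum_distrib_left[symmetric])
  qed
  also have "\<dots> \<le> (1 + 2 / \<eta>) * (ln 2 powr (1 - p) / (p - 1))"
  proof (rule mult_left_mono)
    have "G (real n) \<le> 0" using p by (simp add: G_def)
    moreover have "- G 0 = ln 2 powr (1 - p) / (p - 1)" by (simp add: G_def)
    ultimately show "G (real n) - G 0 \<le> ln 2 powr (1 - p) / (p - 1)" by linarith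
  qed (use \<eta> in simp)
  finally show "(\<Sum>s=1..n. if \<eta> * real N < real s then ln (real s / real N + 2) powr (- p) / real s else 0) \<le> (1 + 2 / \<eta>) * (ln 2 powr (1 - p) / (p - 1))" .
qed

text \<open>The decay of the squared Fourier coefficients of a step function; the value 1 at 0
  subjects the entry (0, 0), which involves the mean of the symbol, to the same estimate.\<close>

definition inverse_square_weight :: "nat \<Rightarrow> real" where
  "inverse_square_weight s = (if s = 0 then 1 else 1 / (real s)\<^sup>2)"

text \<open>Near the origin (B) compares \<tau> with 1; away from it (C) bounds \<tau>, and the
  indicator of the box satisfies the same kind of bound. Squaring gives the exponents 2 \<beta> and
  2 \<alpha>, both above 1, which the two preceding lemmas require. On the edges j = 0 or k = 0
  boundedness of \<tau> and summability of the weight suffice.\<close>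

lemma truncation_error_bound:
  fixes \<tau> :: "real \<Rightarrow> real \<Rightarrow> complex"
  assumes bdd: "bounded ((\<lambda>(x, y). \<tau> x y) ` ({0..} \<times> {0..}))"
    and B: "\<exists>\<epsilon>>0. \<exists>\<beta>>1/2. \<exists>C>0. \<forall>x y. 0 \<le> x \<and> x \<le> \<epsilon> \<and> 0 \<le> y \<and> y \<le> \<epsilon> \<and> x + y \<noteq> 1 \<longrightarrow>
              cmod (\<tau> x y - 1) \<le> C * \<bar>ln (x + y)\<bar> powr (- \<beta>)"
    and C: "\<exists>\<alpha>>1/2. \<exists>C. \<forall>x y. 0 \<le> x \<and> 0 \<le> y \<longrightarrow>
              cmod (\<tau> x y) \<le> C * ln (x + y + 2) powr (- \<alpha>)"
  shows "\<exists>H. \<forall>N\<ge>1. \<forall>n. (\<Sum>k<n. \<Sum>j<n. (cmod (dilate \<tau> N j k - (if j \<in> {1..N} \<and> k \<in> {1..N} then 1 else 0)))\<^sup>2 * inverse_square_weight (j + k)) \<le> H"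
proof -
  obtain M where M: "\<And>x y. 0 \<le> x \<Longrightarrow> 0 \<le> y \<Longrightarrow> cmod (\<tau> x y) \<le> M"
    using bdd unfolding bounded_iff by fastforce
  obtain \<epsilon> \<beta> Cb where Bb: "\<epsilon> > 0" "\<beta> > 1/2" "Cb > 0" "\<And>x y. 0 \<le> x \<Longrightarrow> x \<le> \<epsilon> \<Longrightarrow> 0 \<le> y \<Longrightarrow> y \<le> \<epsilon> \<Longrightarrow> x + y \<noteq> 1 \<Longrightarrow>
              cmod (\<tau> x y - 1) \<le> Cb * \<bar>ln (x + y)\<bar> powr (- \<beta>)"
    using B by metis
  obtain \<alpha> Ca where Ca: "\<alpha> > 1/2" "\<And>x y. 0 \<le> x \<Longrightarrow> 0 \<le> y \<Longrightarrow> cmod (\<tau> x y) \<le> Ca * ln (x + y + 2) powr (- \<alpha>)"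
    using C by metis
  \<comment> \<open>The bound 1/4 places the near region inside the box, keeps x + y away from 1 and
    matches the restriction 4 s \<le> N.\<close>
  define \<eta> where "\<eta> = min \<epsilon> (1/4)"
  have \<eta>: "\<eta> > 0" "\<eta> \<le> \<epsilon>" "\<eta> \<le> 1/4" using Bb by (auto simp: \<eta>_def)
  \<comment> \<open>The second summand dominates the indicator: in the box x + y \<le> 2, so the
    logarithm in (C) is at most ln 4.\<close>
  define Cc where "Cc = \<bar>Ca\<bar> + ln 4 powr \<alpha>"
  define w where "w = inverse_square_weight"
  define e where "e N j k = (cmod (dilate \<tau> N j k - (if j \<in> {1..N} \<and> k \<in> {1..N} then 1 else 0)))\<^sup>2 * w (j + k)" for N j k
  define f1 where "f1 N s = (if s \<noteq> 0 \<and> 4 * s \<le> N then ln (real N / real s) powr (- (2 * \<beta>)) / (real s)\<^sup>2 else 0)" for N s :: nat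
  define f2 where "f2 N s = (if s \<noteq> 0 \<and> \<eta> * real N < real s then ln (real s / real N + 2) powr (- (2 * \<alpha>)) / (real s)\<^sup>2 else 0)" for N s :: nat
  define r where "r j k = (if j = 0 \<or> k = 0 then M\<^sup>2 * w (j + k) else 0)" for j k :: nat
  have w0: "w s \<ge> 0" for s by (simp add: w_def inverse_square_weight_def)
  have pw: "(y powr (- x))\<^sup>2 = y powr (- (2 * x))" for x y :: real
    by (simp add: power2_eq_square powr_add[symmetric])
  have pt: "e N j k \<le> r j k + (Cb\<^sup>2 * f1 N (j + k) + Cc\<^sup>2 * f2 N (j + k))" if N: "N \<ge> 1" for N j k
  proof -
    have f0: "0 \<le> Cb\<^sup>2 * f1 N (j + k) + Cc\<^sup>2 * f2 N (j + k)" by (simp add: f1_def f2_def)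
    define x y where "x = real j / real N" and "y = real k / real N"
    have xy: "0 \<le> x" "0 \<le> y" by (simp_all add: x_def y_def)
    have s: "x + y = real (j + k) / real N" by (simp add: x_def y_def add_divide_distrib)
    have d: "dilate \<tau> N j k = \<tau> x y" by (simp add: dilate_def x_def y_def)
    consider (edge) "j = 0 \<or> k = 0" | (near) "j \<noteq> 0" "k \<noteq> 0" "real (j + k) \<le> \<eta> * real N" | (far) "j \<noteq> 0" "k \<noteq> 0" "\<eta> * real N < real (j + k)"
      by fastforce
    then show ?thesis
    proof cases
      case edge
      have "(cmod (\<tau> x y))\<^sup>2 \<le> M\<^sup>2" using M[OF xy] by (intro power_mono) auto
      then have "e N j k \<le> M\<^sup>2 * w (j + k)"
        using edge w0 by (auto simp: e_def d intro!: mult_right_mono)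
      then show ?thesis using edge f0 by (simp add: r_def)
    next
      case near
      have "real (j + k) \<le> 1/4 * real N" using near(3) \<eta>(3) by (meson mult_right_mono of_nat_0_le_iff order_trans)
      then have "real (4 * (j + k)) \<le> real N" by simp
      then have s4: "4 * (j + k) \<le> N" by (simp only: of_nat_le_iff)
      have in_N: "j \<in> {1..N}" "k \<in> {1..N}" using near s4 by auto
      have "x + y \<le> \<eta>" unfolding s using near(3) N by (simp add: pos_divide_le_eq)
      then have xe: "x \<le> \<epsilon>" "y \<le> \<epsilon>" "x + y \<noteq> 1" using xy \<eta> by auto
      have pos: "0 < x + y" unfolding s using near N by simp
      have "\<bar>ln (x + y)\<bar> = ln (real N / real (j + k))"
      proof -
        have "x + y \<le> 1" using \<open>x + y \<le> \<eta>\<close> \<eta> by simp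
        then have "\<bar>ln (x + y)\<bar> = - ln (x + y)" using pos by simp
        also have "\<dots> = ln (real N / real (j + k))" unfolding s using near N by (simp add: ln_div)
        finally show ?thesis .
      qed
      then have "cmod (\<tau> x y - 1) \<le> Cb * ln (real N / real (j + k)) powr (- \<beta>)"
        using Bb(4)[OF xy(1) xe(1) xy(2) xe(2,3)] by simp
      then have "(cmod (\<tau> x y - 1))\<^sup>2 \<le> (Cb * ln (real N / real (j + k)) powr (- \<beta>))\<^sup>2" by (rule power_mono) simp
      also have "\<dots> = Cb\<^sup>2 * ln (real N / real (j + k)) powr (- (2 * \<beta>))" by (simp only: power_mult_distrib pw)
      finally have "e N j k \<le> Cb\<^sup>2 * ln (real N / real (j + k)) powr (- (2 * \<beta>)) * w (j + k)"
        unfolding e_def d using in_N w0 by (auto intro!: mult_right_mono)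
      also have "\<dots> = Cb\<^sup>2 * f1 N (j + k)"
        using near s4 by (simp add: f1_def w_def inverse_square_weight_def)
      finally have "e N j k \<le> Cb\<^sup>2 * f1 N (j + k)" .
      moreover have "0 \<le> r j k" "0 \<le> Cc\<^sup>2 * f2 N (j + k)" using w0 by (simp_all add: r_def f2_def)
      ultimately show ?thesis by simp
    next
      case far
      define l where "l = ln (real (j + k) / real N + 2)"
      have l2: "l \<ge> ln 2" unfolding l_def by (intro ln_mono) auto
      have l0: "l > 0" using l2 ln_gt_zero[of "2::real"] by linarith
      define ind where "ind = (if j \<in> {1..N} \<and> k \<in> {1..N} then 1 else (0::complex))"
      have "cmod ind \<le> ln 4 powr \<alpha> * l powr (- \<alpha>)"
      proof (cases "j \<in> {1..N} \<and> k \<in> {1..N}")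
        case True
        have "real (j + k) / real N + 2 \<le> 4"
        proof -
          have "real (j + k) \<le> 2 * real N" using True by auto
          then show ?thesis using N by (simp add: pos_divide_le_eq)
        qed
        then have "l \<le> ln 4" unfolding l_def by (intro ln_mono) (auto intro: add_nonneg_pos)
        then have "l powr \<alpha> \<le> ln 4 powr \<alpha>" using l0 Ca(1) by (intro powr_mono2) auto
        then have "1 \<le> ln 4 powr \<alpha> * l powr (- \<alpha>)" using l0 by (simp add: powr_minus_divide field_simps)
        then show ?thesis using True by (simp add: ind_def)
      qed (auto simp: ind_def)
      moreover have "cmod (\<tau> x y) \<le> \<bar>Ca\<bar> * l powr (- \<alpha>)"
      proof -
        have "cmod (\<tau> x y) \<le> Ca * l powr (- \<alpha>)" using Ca(2)[OF xy] by (simp add: l_def s)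
        also have "\<dots> \<le> \<bar>Ca\<bar> * l powr (- \<alpha>)" by (intro mult_right_mono) auto
        finally show ?thesis .
      qed
      ultimately have "cmod (\<tau> x y - ind) \<le> Cc * l powr (- \<alpha>)"
        using norm_triangle_ineq4[of "\<tau> x y" ind] by (simp add: Cc_def distrib_right)
      then have "(cmod (\<tau> x y - ind))\<^sup>2 \<le> (Cc * l powr (- \<alpha>))\<^sup>2" by (rule power_mono) simp
      also have "\<dots> = Cc\<^sup>2 * l powr (- (2 * \<alpha>))" by (simp only: power_mult_distrib pw)
      finally have "e N j k \<le> Cc\<^sup>2 * l powr (- (2 * \<alpha>)) * w (j + k)"
        unfolding e_def d ind_def[symmetric] using w0 by (intro mult_right_mono) auto
      also have "\<dots> = Cc\<^sup>2 * f2 N (j + k)"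
        using far by (simp add: f2_def w_def inverse_square_weight_def l_def)
      finally have "e N j k \<le> Cc\<^sup>2 * f2 N (j + k)" .
      moreover have "0 \<le> r j k" "0 \<le> Cb\<^sup>2 * f1 N (j + k)" using w0 by (simp_all add: r_def f1_def)
      ultimately show ?thesis by simp
    qed
  qed
  have w_sum: "(\<Sum>s<n. w s) \<le> 4" for n
  proof -
    have "(\<Sum>s<n. w s) \<le> (\<Sum>s\<in>insert 0 {1..n}. w s)"
      using w0 by (intro sum_mono2) auto
    also have "\<dots> = 1 + (\<Sum>s=1..n. 1 / (real s)\<^sup>2)"
      by (simp add: w_def inverse_square_weight_def)
    also have "(\<Sum>s=1..n. 1 / (real s)\<^sup>2) \<le> (\<Sum>s=1..n. real s powr (-3/2))"
    proof (rule sum_mono)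
      fix s assume s: "s \<in> {1..n}"
      have "1 / (real s)\<^sup>2 = real s powr (-2)" using s by (simp add: powr_minus_divide powr_numeral)
      also have "\<dots> \<le> real s powr (-3/2)" using s by (intro powr_mono) auto
      finally show "1 / (real s)\<^sup>2 \<le> real s powr (-3/2)" .
    qed
    also have "\<dots> \<le> 3" by (rule sum_powr_three_halves_le)
    finally show ?thesis by simp
  qed
  have r_sum: "(\<Sum>k<n. \<Sum>j<n. r j k) \<le> 8 * M\<^sup>2" for n
  proof -
    have "(\<Sum>k<n. \<Sum>j<n. r j k) \<le> (\<Sum>k<n. \<Sum>j<n. (if j = 0 then M\<^sup>2 * w k else 0) + (if k = 0 then M\<^sup>2 * w j else 0))"
      using w0 by (intro sum_mono) (auto simp: r_def)
    also have "\<dots> \<le> (\<Sum>k<n. M\<^sup>2 * w k) + (\<Sum>j<n. M\<^sup>2 * w j)"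
    proof -
      have "(\<Sum>k<n. \<Sum>j<n. if j = 0 then M\<^sup>2 * w k else 0) \<le> (\<Sum>k<n. M\<^sup>2 * w k)"
        using w0 by (intro sum_mono) (simp add: sum.delta')
      moreover have "(\<Sum>k<n. \<Sum>j<n. if k = 0 then M\<^sup>2 * w j else 0) \<le> (\<Sum>j<n. M\<^sup>2 * w j)"
        using w0 by (subst sum.swap) (intro sum_mono, simp add: sum.delta')
      ultimately show ?thesis by (simp add: sum.distrib)
    qed
    also have "\<dots> = 2 * M\<^sup>2 * (\<Sum>k<n. w k)" by (simp add: sum_distrib_left mult.assoc)
    also have "\<dots> \<le> 2 * M\<^sup>2 * 4" by (intro mult_left_mono w_sum) auto
    finally show ?thesis by simp
  qed
  obtain C1 where C1: "\<And>N n. N \<ge> 1 \<Longrightarrow> (\<Sum>s=1..n. if 4 * s \<le> N then ln (real N / real s) powr (- (2 * \<beta>)) / real s else 0) \<le> C1"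
    using near_origin_sum_bound[of "2 * \<beta>"] Bb(2) by auto
  obtain C2 where C2: "\<And>N n. N \<ge> 1 \<Longrightarrow> (\<Sum>s=1..n. if \<eta> * real N < real s then ln (real s / real N + 2) powr (- (2 * \<alpha>)) / real s else 0) \<le> C2"
    using tail_sum_bound[of "2 * \<alpha>" \<eta>] Ca(1) \<eta>(1) by auto
  \<comment> \<open>An antidiagonal holds at most s + 1 \<le> 2 s entries for s \<ge> 1, which turns
    the weight 1 / s^2 into the 1 / s of the one-dimensional sums.\<close>
  have anti: "(\<Sum>k<n. \<Sum>j<n. f (j + k)) \<le> 2 * C" if f: "\<And>s. 0 \<le> f s" "f 0 = 0" and C: "\<And>n. (\<Sum>s=1..n. real s * f s) \<le> C" for f :: "nat \<Rightarrow> real" and C n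
  proof -
    have "(\<Sum>k<n. \<Sum>j<n. f (j + k)) \<le> (\<Sum>s<2 * n. real (s + 1) * f s)" by (rule sum_antidiagonal_le[OF f(1)])
    also have "\<dots> \<le> (\<Sum>s<2 * n. 2 * (real s * f s))"
    proof (rule sum_mono)
      fix s
      show "real (s + 1) * f s \<le> 2 * (real s * f s)"
      proof (cases "s = 0")
        case False
        then have "real (s + 1) * f s \<le> (2 * real s) * f s" using f(1) by (intro mult_right_mono) auto
        then show ?thesis by (simp add: mult.assoc)
      qed (simp add: f(2))
    qed
    also have "\<dots> = 2 * (\<Sum>s<2 * n. real s * f s)" by (simp add: sum_distrib_left)
    also have "(\<Sum>s<2 * n. real s * f s) \<le> (\<Sum>s\<in>insert 0 {1..2 * n}. real s * f s)"
      using f(1) by (intro sum_mono2) auto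
    also have "\<dots> = (\<Sum>s=1..2 * n. real s * f s)" by simp
    also have "\<dots> \<le> C" by (rule C)
    finally show ?thesis by simp
  qed
  have f1_sum: "(\<Sum>k<n. \<Sum>j<n. f1 N (j + k)) \<le> 2 * C1" if "N \<ge> 1" for N n
  proof (rule anti)
    fix n
    have "(\<Sum>s=1..n. real s * f1 N s) = (\<Sum>s=1..n. if 4 * s \<le> N then ln (real N / real s) powr (- (2 * \<beta>)) / real s else 0)"
      by (intro sum.cong refl) (auto simp: f1_def power2_eq_square)
    then show "(\<Sum>s=1..n. real s * f1 N s) \<le> C1" using C1[OF that, of n] by simp
  qed (auto simp: f1_def)
  have f2_sum: "(\<Sum>k<n. \<Sum>j<n. f2 N (j + k)) \<le> 2 * C2" if "N \<ge> 1" for N n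
  proof (rule anti)
    fix n
    have "(\<Sum>s=1..n. real s * f2 N s) = (\<Sum>s=1..n. if \<eta> * real N < real s then ln (real s / real N + 2) powr (- (2 * \<alpha>)) / real s else 0)"
      by (intro sum.cong refl) (auto simp: f2_def power2_eq_square)
    then show "(\<Sum>s=1..n. real s * f2 N s) \<le> C2" using C2[OF that, of n] by simp
  qed (auto simp: f2_def)
  have "(\<Sum>k<n. \<Sum>j<n. e N j k) \<le> 8 * M\<^sup>2 + (Cb\<^sup>2 * (2 * C1) + Cc\<^sup>2 * (2 * C2))" if N: "N \<ge> 1" for N n
  proof -
    have "(\<Sum>k<n. \<Sum>j<n. e N j k) \<le> (\<Sum>k<n. \<Sum>j<n. r j k + (Cb\<^sup>2 * f1 N (j + k) + Cc\<^sup>2 * f2 N (j + k)))"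
      by (intro sum_mono pt[OF N])
    also have "\<dots> = (\<Sum>k<n. \<Sum>j<n. r j k) + (Cb\<^sup>2 * (\<Sum>k<n. \<Sum>j<n. f1 N (j + k)) + Cc\<^sup>2 * (\<Sum>k<n. \<Sum>j<n. f2 N (j + k)))"
      by (simp add: sum.distrib sum_distrib_left)
    also have "\<dots> \<le> 8 * M\<^sup>2 + (Cb\<^sup>2 * (2 * C1) + Cc\<^sup>2 * (2 * C2))"
      by (intro add_mono r_sum mult_left_mono f1_sum[OF N] f2_sum[OF N]) auto
    finally show ?thesis .
  qed
  then show ?thesis unfolding e_def w_def by blast
qed

section \<open>The logarithmic density\<close>

lemma hankel_bounded:
  assumes "h \<in> borel_measurable circle_measure" "\<And>\<theta>. \<theta> \<in> {0..2 * pi} \<Longrightarrow> cmod (h \<theta>) \<le> B"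
  obtains A where "has_matrix A (\<lambda>j k. fourier_int h (int j + int k))" "\<And>x. norm (A x) \<le> B * norm x"
proof -
  have "B \<ge> 0" using order_trans[OF norm_ge_zero assms(2)[of 0]] by simp
  then show ?thesis
    using has_matrix_of_form[OF _ hankel_form_bound[OF assms]] that by blast
qed

lemma finite_matrix_op:
  assumes "\<And>j k. j \<ge> n \<or> k \<ge> n \<Longrightarrow> m j k = 0"
  obtains A where "has_matrix A m"
proof -
  define v where "v j = (\<Sum>k<n. cscale (m j k) (basis_vec k))" for j
  have "coord (v j) k = m j k" for j k
    using assms[of j k] by (auto simp: v_def if_distrib[of "\<lambda>y. _ * y"] cong: if_cong)
  then have "(\<lambda>j k. if j < n then coord (v j) k else 0) = m"
    using assms by (intro ext) auto
  then show ?thesis using has_matrix_combination[of n v] that by metis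
qed

lemma fourier_int_diff:
  assumes h: "h \<in> borel_measurable circle_measure" "\<And>\<theta>. \<theta> \<in> {0..2 * pi} \<Longrightarrow> cmod (h \<theta>) \<le> B"
    and s: "s \<in> borel_measurable circle_measure" "\<And>\<theta>. \<theta> \<in> {0..2 * pi} \<Longrightarrow> cmod (s \<theta>) \<le> B'"
  shows "fourier_int (\<lambda>\<theta>. h \<theta> - s \<theta>) n = fourier_int h n - fourier_int s n"
proof -
  have int: "integrable circle_measure (\<lambda>\<theta>. f \<theta> * cis (- (of_int n * \<theta>)))"
    if "f \<in> borel_measurable circle_measure" "\<And>\<theta>. \<theta> \<in> {0..2 * pi} \<Longrightarrow> cmod (f \<theta>) \<le> B" for f B
    by (rule integrable_circle_measure[of _ B], intro borel_measurable_times that(1),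
        intro borel_measurable_circle_continuous continuous_intros)
      (simp add: norm_mult that(2))
  have "(\<integral>\<theta>. h \<theta> * cis (- (of_int n * \<theta>)) - s \<theta> * cis (- (of_int n * \<theta>)) \<partial>circle_measure) =
      (\<integral>\<theta>. h \<theta> * cis (- (of_int n * \<theta>)) \<partial>circle_measure) - (\<integral>\<theta>. s \<theta> * cis (- (of_int n * \<theta>)) \<partial>circle_measure)"
    by (rule Bochner_Integration.integral_diff[OF int[OF h] int[OF s]])
  then show ?thesis
    unfolding fourier_int_def integral_circle_measure[symmetric] left_diff_distrib diff_divide_distrib[symmetric]
    by (rule arg_cong)
qed

lemma codim_bound_perturb:
  assumes A: "codim_bound A t q" and R: "codim_bound R \<delta> r" and Q: "codim_bound Q \<eta> 0"
    and eq: "\<And>x. B x = A x + R x + Q x"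
  shows "codim_bound B (t + \<delta> + \<eta>) (q + r)"
  using codim_bound_add[OF codim_bound_add[OF A R] Q] eq by (simp add: codim_bound_def)

lemma codim_bound_uminus: "codim_bound (\<lambda>x. - A x) t q \<longleftrightarrow> codim_bound A t q"
  by (simp add: codim_bound_def)

section \<open>From the model back to the symbol\<close>

context
  fixes \<tau> :: "real \<Rightarrow> real \<Rightarrow> complex" and \<omega> :: "complex \<Rightarrow> complex" and M :: real
  assumes bdd: "bounded ((\<lambda>(x, y). \<tau> x y) ` ({0..} \<times> {0..}))"
    and M: "\<And>N. N \<ge> 1 \<Longrightarrow> multiplier_norm (dilate \<tau> N) \<le> ereal M" "M \<ge> 0"
    and B: "\<exists>\<epsilon>>0. \<exists>\<beta>>1/2. \<exists>C>0. \<forall>x y. 0 \<le> x \<and> x \<le> \<epsilon> \<and> 0 \<le> y \<and> y \<le> \<epsilon> \<and> x + y \<noteq> 1 \<longrightarrow>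
              cmod (\<tau> x y - 1) \<le> C * \<bar>ln (x + y)\<bar> powr (- \<beta>)"
    and C: "\<exists>\<alpha>>1/2. \<exists>C. \<forall>x y. 0 \<le> x \<and> 0 \<le> y \<longrightarrow>
              cmod (\<tau> x y) \<le> C * ln (x + y + 2) powr (- \<alpha>)"
    and PC: "\<omega> \<in> PC_circle"
begin

abbreviation "truncated N \<equiv> dilate \<tau> N \<star> hankel (fourier_coeff \<omega>)"

lemma PC_bounded: "\<exists>B. \<forall>\<theta>\<in>{0..2 * pi}. cmod (\<omega> (cis \<theta>)) \<le> B"
proof -
  obtain s K where s: "\<And>x. cmod (s x) \<le> K" "\<And>x. x \<in> {0..2 * pi} \<Longrightarrow> cmod (\<omega> (cis x) - s x) \<le> 1"
    using PC_step_approximation[OF PC, of 1] by (metis zero_less_one)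
  have "cmod (\<omega> (cis x)) \<le> K + 1" if "x \<in> {0..2 * pi}" for x
    using norm_triangle_ineq2[of "\<omega> (cis x)" "s x"] s(1)[of x] s(2)[OF that] by linarith
  then show ?thesis by blast
qed

lemma hankel_symbol: "has_matrix (hankel (fourier_coeff \<omega>)) (\<lambda>j k. fourier_coeff \<omega> (int j + int k))"
proof -
  obtain B where B: "\<And>\<theta>. \<theta> \<in> {0..2 * pi} \<Longrightarrow> cmod (\<omega> (cis \<theta>)) \<le> B" using PC_bounded by blast
  have eq: "fourier_int (\<lambda>\<theta>. \<omega> (cis \<theta>)) = fourier_coeff \<omega>"
    by (rule ext) (simp add: fourier_int_def fourier_coeff_def)
  obtain A where "has_matrix A (\<lambda>j k. fourier_coeff \<omega> (int j + int k))"
    using hankel_bounded[OF PC_measurable[OF PC] B] unfolding eq by blast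
  then show ?thesis unfolding hankel_def using op_of_matrix_eq by metis
qed

lemma truncated_matrix:
  "N \<ge> 1 \<Longrightarrow> has_matrix (truncated N) (\<lambda>j k. dilate \<tau> N j k * fourier_coeff \<omega> (int j + int k))"
  using schur_mult_bounded(1)[OF M(1), of N "hankel (fourier_coeff \<omega>)"] hankel_symbol
  by (simp add: has_matrix_def)

text \<open>The operator is the sum of \<open>A N\<close>, a part \<open>Q N\<close> of norm at most
  M \<delta>, and a part \<open>R N\<close> whose Hilbert-Schmidt norm is bounded in N. The number
  \<open>r\<close> of directions lost is therefore independent of N and of the level, and the
  relation is symmetric, so singular value counts transfer both ways.\<close>

lemma truncated_decomposition:
  assumes \<delta>: "\<delta> > 0"
  obtains Z \<kappa> A r where "jump_model Z \<kappa>" "\<And>N. has_matrix (A N) (jump_matrix Z \<kappa> N)"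
    "\<And>z. z \<in> Z \<Longrightarrow> cmod (\<kappa> z - half_jump \<omega> z) \<le> \<delta>"
    "\<And>z. z \<in> sphere 0 1 - Z \<Longrightarrow> cmod (half_jump \<omega> z) \<le> \<delta>"
    "\<And>N t q. N \<ge> 1 \<Longrightarrow> codim_bound (truncated N) t q \<Longrightarrow> codim_bound (A N) (t + (M + 1) * \<delta>) (q + r)"
    "\<And>N t q. N \<ge> 1 \<Longrightarrow> codim_bound (A N) t q \<Longrightarrow> codim_bound (truncated N) (t + (M + 1) * \<delta>) (q + r)"
proof -
  obtain Z0 \<kappa> s K where s: "finite Z0" "Z0 \<subseteq> sphere 0 1" "s \<in> borel_measurable circle_measure"
    "\<And>x. cmod (s x) \<le> K"
    "\<And>x. x \<in> {0..2 * pi} \<Longrightarrow> cmod (\<omega> (cis x) - s x) \<le> \<delta>"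
    "\<And>n. n \<noteq> 0 \<Longrightarrow> fourier_int s n = (\<Sum>z\<in>Z0. \<kappa> z * z powi (- n)) / (\<i> * pi * of_int n)"
    "\<And>z. z \<in> Z0 \<Longrightarrow> cmod (\<kappa> z - half_jump \<omega> z) \<le> \<delta>"
    "\<And>z. z \<in> sphere 0 1 - Z0 \<Longrightarrow> cmod (half_jump \<omega> z) \<le> \<delta>"
    by (rule PC_step_approximation[OF PC \<delta>]) blast
  \<comment> \<open>Nodes with vanishing coefficient are dropped because the model divides by
    |\<kappa> z|; such a node has a half jump of at most \<delta>, so the last property
    survives.\<close>
  define Z where "Z = {z\<in>Z0. \<kappa> z \<noteq> 0}"
  have model: "jump_model Z \<kappa>"
    by unfold_locales (use s(1,2) in \<open>auto simp: Z_def\<close>)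
  interpret jump_model Z \<kappa> by (rule model)
  have \<kappa>: "cmod (\<kappa> z - half_jump \<omega> z) \<le> \<delta>" if "z \<in> Z" for z using s(7) that by (simp add: Z_def)
  have outside: "cmod (half_jump \<omega> z) \<le> \<delta>" if "z \<in> sphere 0 1 - Z" for z
  proof (cases "z \<in> Z0")
    case True
    then have "\<kappa> z = 0" using that by (auto simp: Z_def)
    then show ?thesis using s(7)[OF True] by simp
  qed (use s(8) that in auto)
  have coeff: "fourier_int s (int j + int k) = jump_coeff Z \<kappa> (j + k)" if "j + k \<noteq> 0" for j k
  proof -
    have "z powi (- (int j + int k)) = cnj z ^ (j + k)" if "z \<in> Z0" for z
    proof -
      have "cmod z = 1" using that s(2) by auto
      then have "inverse z = cnj z" using complex_norm_square[of z] by (metis inverse_unique of_real_1 power_one)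
      have "z powi (- (int j + int k)) = inverse (z powi int (j + k))" by (metis power_int_minus of_nat_add)
      also have "\<dots> = inverse (z ^ (j + k))" by (simp only: power_int_of_nat)
      also have "\<dots> = inverse z ^ (j + k)" by (rule power_inverse[symmetric])
      finally show ?thesis using \<open>inverse z = cnj z\<close> by simp
    qed
    then have "fourier_int s (int j + int k) = (\<Sum>z\<in>Z0. \<kappa> z * cnj z ^ (j + k)) / (\<i> * pi * of_nat (j + k))"
      using s(6)[of "int j + int k"] that by simp
    also have "(\<Sum>z\<in>Z0. \<kappa> z * cnj z ^ (j + k)) = (\<Sum>z\<in>Z. \<kappa> z * cnj z ^ (j + k))"
      by (rule sum.mono_neutral_right) (use s(1) in \<open>auto simp: Z_def\<close>)
    finally show ?thesis by (simp add: jump_coeff_def)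
  qed
  have "\<exists>A. has_matrix A (jump_matrix Z \<kappa> N)" for N
    by (rule finite_matrix_op[of "Suc N" "jump_matrix Z \<kappa> N"]) (auto simp: jump_matrix_def)
  then obtain A where A: "\<And>N. has_matrix (A N) (jump_matrix Z \<kappa> N)" by metis
  obtain K' where K': "\<And>\<theta>. \<theta> \<in> {0..2 * pi} \<Longrightarrow> cmod (\<omega> (cis \<theta>)) \<le> K'" using PC_bounded by blast
  note meas = PC_measurable[OF PC]
  have "\<exists>\<Gamma>. has_matrix \<Gamma> (\<lambda>j k. fourier_int (\<lambda>\<theta>. \<omega> (cis \<theta>) - s \<theta>) (int j + int k)) \<and> (\<forall>x. norm (\<Gamma> x) \<le> \<delta> * norm x)"
    by (rule hankel_bounded[OF borel_measurable_diff[OF meas s(3)] s(5)]) auto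
  then obtain \<Gamma> where \<Gamma>: "has_matrix \<Gamma> (\<lambda>j k. fourier_int (\<lambda>\<theta>. \<omega> (cis \<theta>) - s \<theta>) (int j + int k))" "\<And>x. norm (\<Gamma> x) \<le> \<delta> * norm x"
    by blast
  have b\<Gamma>: "bounded_op \<Gamma>" using \<Gamma>(1) by (simp add: has_matrix_def)
  have n\<Gamma>: "onorm \<Gamma> \<le> \<delta>" by (rule onorm_bound) (use \<delta> \<Gamma>(2) in auto)
  have e\<Gamma>: "entry \<Gamma> j k = fourier_coeff \<omega> (int j + int k) - fourier_int s (int j + int k)" for j k
  proof -
    have "fourier_int (\<lambda>\<theta>. \<omega> (cis \<theta>)) = fourier_coeff \<omega>"
      by (rule ext) (simp add: fourier_int_def fourier_coeff_def)
    then show ?thesis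
      using \<Gamma>(1) fourier_int_diff[OF meas K' s(3), of K] s(4) by (simp add: has_matrix_def)
  qed
  define Q where "Q N = dilate \<tau> N \<star> \<Gamma>" for N
  have Q: "has_matrix (Q N) (\<lambda>j k. dilate \<tau> N j k * (fourier_coeff \<omega> (int j + int k) - fourier_int s (int j + int k)))"
    and nQ: "norm (Q N x) \<le> M * \<delta> * norm x" if "N \<ge> 1" for N x
  proof -
    show "has_matrix (Q N) (\<lambda>j k. dilate \<tau> N j k * (fourier_coeff \<omega> (int j + int k) - fourier_int s (int j + int k)))"
      using schur_mult_bounded(1)[OF M(1)[OF that] b\<Gamma>] by (simp add: Q_def e\<Gamma>)
    have "norm (Q N x) \<le> M * onorm \<Gamma> * norm x"
      unfolding Q_def by (rule schur_mult_bounded(2)[OF M(1)[OF that] b\<Gamma>])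
    also have "\<dots> \<le> M * \<delta> * norm x" using n\<Gamma> M(2) by (intro mult_right_mono mult_left_mono) auto
    finally show "norm (Q N x) \<le> M * \<delta> * norm x" .
  qed
  define R where "R N x = (truncated N x - Q N x) - A N x" for N x
  \<comment> \<open>The coefficient of index 0 is not given by the jump formula and has to be
    dominated separately.\<close>
  define T where "T = max (cmod (fourier_int s 0)) (total / pi)"
  have R: "has_matrix (R N) (\<lambda>j k. dilate \<tau> N j k * fourier_int s (int j + int k) - jump_matrix Z \<kappa> N j k)" if "N \<ge> 1" for N
    using has_matrix_minus[OF has_matrix_minus[OF truncated_matrix[OF that] Q[OF that]] A[of N]]
    unfolding R_def[abs_def] by (simp add: right_diff_distrib)
  obtain H where H: "\<And>N n. N \<ge> 1 \<Longrightarrow> (\<Sum>k<n. \<Sum>j<n. (cmod (dilate \<tau> N j k - (if j \<in> {1..N} \<and> k \<in> {1..N} then 1 else 0)))\<^sup>2 * inverse_square_weight (j + k)) \<le> H"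
    using truncation_error_bound[OF bdd B C] by blast
  have R_entry: "(cmod (dilate \<tau> N j k * fourier_int s (int j + int k) - jump_matrix Z \<kappa> N j k))\<^sup>2 \<le>
      T\<^sup>2 * ((cmod (dilate \<tau> N j k - (if j \<in> {1..N} \<and> k \<in> {1..N} then 1 else 0)))\<^sup>2 * inverse_square_weight (j + k))" for N j k
  proof (cases "j + k = 0")
    case True
    have "(cmod (dilate \<tau> N 0 0) * cmod (fourier_int s 0))\<^sup>2 \<le> (cmod (dilate \<tau> N 0 0) * T)\<^sup>2"
      by (intro power_mono mult_left_mono) (auto simp: T_def)
    then show ?thesis using True
      by (simp add: jump_matrix_def inverse_square_weight_def norm_mult power_mult_distrib mult.commute)
  next
    case False
    define d where "d = dilate \<tau> N j k - (if j \<in> {1..N} \<and> k \<in> {1..N} then 1 else 0)"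
    have d_eq: "dilate \<tau> N j k * fourier_int s (int j + int k) - jump_matrix Z \<kappa> N j k = d * jump_coeff Z \<kappa> (j + k)"
      unfolding d_def using False by (simp add: coeff jump_matrix_def left_diff_distrib)
    have "cmod (jump_coeff Z \<kappa> (j + k)) \<le> T * (1 / real (j + k))"
    proof -
      have "cmod (\<Sum>z\<in>Z. \<kappa> z * cnj z ^ (j + k)) \<le> total"
        unfolding total_def by (rule order_trans[OF norm_sum]) (simp add: norm_mult norm_power unit_Z)
      then have "cmod (\<Sum>z\<in>Z. \<kappa> z * cnj z ^ (j + k)) / (pi * real (j + k)) \<le> total / (pi * real (j + k))"
        by (intro divide_right_mono) auto
      moreover have "cmod (jump_coeff Z \<kappa> (j + k)) = cmod (\<Sum>z\<in>Z. \<kappa> z * cnj z ^ (j + k)) / (pi * real (j + k))"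
        unfolding jump_coeff_def norm_divide norm_mult norm_of_nat by simp
      moreover have "total / (pi * real (j + k)) = total / pi * (1 / real (j + k))" by simp
      moreover have "total / pi * (1 / real (j + k)) \<le> T * (1 / real (j + k))"
        by (intro mult_right_mono) (auto simp: T_def)
      ultimately show ?thesis by linarith
    qed
    then have "(cmod d * cmod (jump_coeff Z \<kappa> (j + k)))\<^sup>2 \<le> (cmod d * (T * (1 / real (j + k))))\<^sup>2"
      by (intro power_mono mult_left_mono) auto
    also have "\<dots> = T\<^sup>2 * ((cmod d)\<^sup>2 * inverse_square_weight (j + k))"
      using False by (simp only: inverse_square_weight_def if_False power_mult_distrib power_divide power_one mult_ac)
    finally show ?thesis unfolding d_def[symmetric] d_eq norm_mult .
  qed
  have R_HS: "(\<Sum>k<n. \<Sum>j<n. (cmod (dilate \<tau> N j k * fourier_int s (int j + int k) - jump_matrix Z \<kappa> N j k))\<^sup>2) \<le> T\<^sup>2 * H"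
    if "N \<ge> 1" for N n
  proof -
    have "(\<Sum>k<n. \<Sum>j<n. (cmod (dilate \<tau> N j k * fourier_int s (int j + int k) - jump_matrix Z \<kappa> N j k))\<^sup>2) \<le>
        T\<^sup>2 * (\<Sum>k<n. \<Sum>j<n. (cmod (dilate \<tau> N j k - (if j \<in> {1..N} \<and> k \<in> {1..N} then 1 else 0)))\<^sup>2 * inverse_square_weight (j + k))"
      unfolding sum_distrib_left by (intro sum_mono R_entry)
    also have "\<dots> \<le> T\<^sup>2 * H" by (intro mult_left_mono H that) auto
    finally show ?thesis .
  qed
  \<comment> \<open>The Chebyshev bound at level \<delta>, rounded up: the same number of
    exceptional directions for every N.\<close>
  define r where "r = nat \<lceil>T\<^sup>2 * H / \<delta>\<^sup>2\<rceil>"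
  have Rr: "codim_bound (R N) \<delta> r" if N: "N \<ge> 1" for N
  proof -
    obtain q where q: "real q \<le> T\<^sup>2 * H / \<delta>\<^sup>2" "codim_bound (R N) \<delta> q"
      using Hilbert_Schmidt_codim_bound[OF R[OF N] R_HS[OF N] \<delta>] by blast
    have "q \<le> r" using q(1) unfolding r_def by linarith
    then show ?thesis using codim_bound_mono[OF q(2) order_refl] by blast
  qed
  have Qr: "codim_bound (Q N) (M * \<delta>) 0" if "N \<ge> 1" for N
    by (rule codim_bound_norm) (rule nQ[OF that])
  have shift: "t + \<delta> + M * \<delta> = t + (M + 1) * \<delta>" for t by (simp add: distrib_right)
  show ?thesis
  proof (rule that[OF model A \<kappa> outside])
    fix N t q assume N: "(1::nat) \<le> N"
    show "codim_bound (A N) (t + (M + 1) * \<delta>) (q + r)" if "codim_bound (truncated N) t q"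
      unfolding shift[symmetric]
      by (rule codim_bound_perturb[OF that codim_bound_uminus[THEN iffD2, OF Rr[OF N]] codim_bound_uminus[THEN iffD2, OF Qr[OF N]]])
        (simp add: R_def)
    show "codim_bound (truncated N) (t + (M + 1) * \<delta>) (q + r)" if "codim_bound (A N) t q"
      unfolding shift[symmetric]
      by (rule codim_bound_perturb[OF that Rr[OF N] Qr[OF N]]) (simp add: R_def)
  qed
qed

text \<open>Every \<delta> gives a decomposition into Hilbert-Schmidt operators and an operator of
  norm O(\<delta>), so compactness comes for free.\<close>

lemma truncated_compact:
  assumes "N \<ge> 1"
  shows "compact_op (truncated N)"
  unfolding compact_op_def
proof (intro allI impI)
  fix t :: real assume t: "t > 0"
  \<comment> \<open>Half of the level \<open>t\<close> goes to the perturbation, the other half to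
    the model.\<close>
  define \<delta> where "\<delta> = t / (2 * (M + 1))"
  have \<delta>: "\<delta> > 0" "(M + 1) * \<delta> = t / 2" 
  proof -
    have M1: "M + 1 > 0" using M(2) by simp
    then show "\<delta> > 0" using t by (simp add: \<delta>_def)
    have "x * (t / (2 * x)) = t / 2" if "x > 0" for x using that by simp
    from this[OF M1] show "(M + 1) * \<delta> = t / 2" unfolding \<delta>_def .
  qed
  obtain Z \<kappa> A r where d: "jump_model Z \<kappa>" "\<And>N. has_matrix (A N) (jump_matrix Z \<kappa> N)"
    "\<And>N t q. N \<ge> 1 \<Longrightarrow> codim_bound (A N) t q \<Longrightarrow> codim_bound (truncated N) (t + (M + 1) * \<delta>) (q + r)"
    using truncated_decomposition[OF \<delta>(1)] by metis
  have "\<exists>q. codim_bound (A N) (t / 2) q"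
    using Hilbert_Schmidt_codim_bound[OF d(2) jump_model.jump_matrix_mass[OF d(1)], of "t / 2"] t by auto
  then obtain q where "codim_bound (A N) (t / 2) q" ..
  from d(3)[OF assms this] show "\<exists>n. codim_bound (truncated N) t n" unfolding \<delta>(2) by auto
qed

text \<open>A half jump above the accuracy of a step approximation can only sit at one of its
  finitely many nodes.\<close>

lemma finite_large_jumps:
  assumes "t > 0"
  shows "finite {z \<in> sphere 0 1. t \<le> cmod (half_jump \<omega> z)}"
proof -
  obtain Z \<kappa> where d: "jump_model Z \<kappa>" "\<And>z. z \<in> sphere 0 1 - Z \<Longrightarrow> cmod (half_jump \<omega> z) \<le> t / 2"
    using truncated_decomposition[of "t / 2"] assms by (metis half_gt_zero)
  have "{z \<in> sphere 0 1. t \<le> cmod (half_jump \<omega> z)} \<subseteq> Z"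
  proof
    fix z assume z: "z \<in> {z \<in> sphere 0 1. t \<le> cmod (half_jump \<omega> z)}"
    show "z \<in> Z"
    proof (rule ccontr)
      assume "z \<notin> Z"
      then have "cmod (half_jump \<omega> z) \<le> t / 2" using z by (intro d(2)) auto
      then show False using z assms by auto
    qed
  qed
  then show ?thesis using jump_model.finite_Z[OF d(1)] finite_subset by blast
qed

text \<open>The number of nodes is not controlled as \<delta> shrinks. This does no harm: a node
  where the half jump of \<open>\<omega>\<close> is below t / 2 has |\<kappa>| below every
  admissible level \<open>s\<close>, so its density vanishes, and only the fixed finite set
  \<open>S\<close> contributes.\<close>

lemma jump_density_tendsto:
  assumes t: "t > 0" and \<epsilon>: "\<epsilon> > 0"
  defines "g \<equiv> \<Sum>z\<in>{z \<in> sphere 0 1. t / 2 \<le> cmod (half_jump \<omega> z)}. density_c (t / cmod (half_jump \<omega> z))"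
  shows "\<exists>\<delta>>0. (M + 1) * \<delta> < t / 4 \<and> (\<forall>Z \<kappa> s. finite Z \<longrightarrow> Z \<subseteq> sphere 0 1 \<longrightarrow> (\<forall>z\<in>Z. \<kappa> z \<noteq> 0) \<longrightarrow>
     (\<forall>z\<in>Z. cmod (\<kappa> z - half_jump \<omega> z) \<le> \<delta>) \<longrightarrow> (\<forall>z\<in>sphere 0 1 - Z. cmod (half_jump \<omega> z) \<le> \<delta>) \<longrightarrow>
     \<bar>s - t\<bar> \<le> (M + 1) * \<delta> \<longrightarrow> \<bar>jump_density Z \<kappa> s - g\<bar> \<le> \<epsilon>)"
proof -
  define S where "S = {z \<in> sphere 0 1. t / 2 \<le> cmod (half_jump \<omega> z)}"
  have finS: "finite S" unfolding S_def using finite_large_jumps[of "t / 2"] t by simp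
  define \<epsilon>1 where "\<epsilon>1 = \<epsilon> / (real (card S) + 1)"
  have \<epsilon>1: "\<epsilon>1 > 0" using \<epsilon> by (simp add: \<epsilon>1_def)
  have "\<forall>\<^sub>F \<eta> in at_right 0. \<forall>s k. \<bar>s - t\<bar> \<le> \<eta> \<longrightarrow> \<bar>k - cmod (half_jump \<omega> z)\<bar> \<le> \<eta> \<longrightarrow>
      \<bar>density_c (s / k) - density_c (t / cmod (half_jump \<omega> z))\<bar> < \<epsilon>1" if z: "z \<in> S" for z
  proof -
    define k0 where "k0 = cmod (half_jump \<omega> z)"
    have k0: "k0 > 0" using z t by (auto simp: S_def k0_def)
    have "isCont (\<lambda>p. density_c (fst p / snd p)) (t, k0)"
    proof (rule isCont_o2[where f = "\<lambda>p. fst p / snd p" and g = density_c])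
      show "isCont (\<lambda>p. fst p / snd p) (t, k0)" using k0 by (intro continuous_intros) auto
      show "isCont density_c (fst (t, k0) / snd (t, k0))" using t k0 by (intro isCont_density_c) simp
    qed
    then obtain \<eta>0 where \<eta>0: "\<eta>0 > 0" "\<And>p. dist p (t, k0) < \<eta>0 \<Longrightarrow> dist (density_c (fst p / snd p)) (density_c (t / k0)) < \<epsilon>1"
      unfolding continuous_at_eps_delta using \<epsilon>1 by (metis fst_conv snd_conv)
    have "\<bar>density_c (s / k) - density_c (t / k0)\<bar> < \<epsilon>1" if "\<bar>s - t\<bar> \<le> \<eta>" "\<bar>k - k0\<bar> \<le> \<eta>" "\<eta> < \<eta>0 / 2" for \<eta> s k
    proof -
      have "dist (s, k) (t, k0) \<le> \<bar>s - t\<bar> + \<bar>k - k0\<bar>"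
        by (simp add: dist_Pair_Pair dist_real_def sqrt_sum_squares_le_sum_abs)
      also have "\<dots> < \<eta>0" using that by simp
      finally show ?thesis using \<eta>0(2)[of "(s, k)"] by (simp add: dist_real_def)
    qed
    moreover have "\<forall>\<^sub>F \<eta> in at_right 0. \<eta> < \<eta>0 / 2"
      using \<eta>0(1) by (auto simp: eventually_at_right[of 0 1] intro!: exI[of _ "\<eta>0 / 2"])
    ultimately show ?thesis unfolding k0_def by (auto elim!: eventually_mono)
  qed
  then have "\<forall>\<^sub>F \<eta> in at_right 0. \<forall>z\<in>S. \<forall>s k. \<bar>s - t\<bar> \<le> \<eta> \<longrightarrow> \<bar>k - cmod (half_jump \<omega> z)\<bar> \<le> \<eta> \<longrightarrow>
      \<bar>density_c (s / k) - density_c (t / cmod (half_jump \<omega> z))\<bar> < \<epsilon>1"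
    using finS by (intro eventually_ball_finite) auto
  moreover have "\<forall>\<^sub>F \<eta> in at_right (0::real). \<eta> < t / 4"
    using t by (auto simp: eventually_at_right[of 0 1] intro!: exI[of _ "t / 4"])
  moreover have "\<forall>\<^sub>F \<eta> in at_right (0::real). 0 < \<eta>" by (simp add: eventually_at_right_less)
  ultimately have "\<forall>\<^sub>F \<eta> in at_right 0. 0 < \<eta> \<and> \<eta> < t / 4 \<and> (\<forall>z\<in>S. \<forall>s k. \<bar>s - t\<bar> \<le> \<eta> \<longrightarrow> \<bar>k - cmod (half_jump \<omega> z)\<bar> \<le> \<eta> \<longrightarrow>
      \<bar>density_c (s / k) - density_c (t / cmod (half_jump \<omega> z))\<bar> < \<epsilon>1)"
    by eventually_elim simp
  then have "\<exists>\<eta>. 0 < \<eta> \<and> \<eta> < t / 4 \<and> (\<forall>z\<in>S. \<forall>s k. \<bar>s - t\<bar> \<le> \<eta> \<longrightarrow> \<bar>k - cmod (half_jump \<omega> z)\<bar> \<le> \<eta> \<longrightarrow>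
      \<bar>density_c (s / k) - density_c (t / cmod (half_jump \<omega> z))\<bar> < \<epsilon>1)"
    by (rule eventually_happens'[OF trivial_limit_at_right_real])
  then obtain \<eta> where \<eta>: "0 < \<eta>" "\<eta> < t / 4" "\<And>z s k. z \<in> S \<Longrightarrow> \<bar>s - t\<bar> \<le> \<eta> \<Longrightarrow> \<bar>k - cmod (half_jump \<omega> z)\<bar> \<le> \<eta> \<Longrightarrow>
      \<bar>density_c (s / k) - density_c (t / cmod (half_jump \<omega> z))\<bar> < \<epsilon>1" by blast
  define \<delta> where "\<delta> = \<eta> / (M + 1)"
  have \<delta>: "\<delta> > 0" "(M + 1) * \<delta> = \<eta>" "\<delta> \<le> \<eta>"
  proof -
    have M1: "M + 1 > 0" using M(2) by simp
    then show "\<delta> > 0" "(M + 1) * \<delta> = \<eta>" using \<eta>(1) by (simp_all add: \<delta>_def)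
    have "\<eta> * 1 \<le> \<eta> * (M + 1)" using \<eta>(1) M(2) by (intro mult_left_mono) auto
    then show "\<delta> \<le> \<eta>" using M1 by (simp add: \<delta>_def pos_divide_le_eq)
  qed
  show ?thesis
  proof (intro exI[of _ \<delta>] conjI allI impI)
    fix Z \<kappa> and s :: real
    assume Z: "finite Z" "Z \<subseteq> sphere 0 1" "\<forall>z\<in>Z. \<kappa> z \<noteq> 0" "\<forall>z\<in>Z. cmod (\<kappa> z - half_jump \<omega> z) \<le> \<delta>"
      "\<forall>z\<in>sphere 0 1 - Z. cmod (half_jump \<omega> z) \<le> \<delta>" and s: "\<bar>s - t\<bar> \<le> (M + 1) * \<delta>"
    have s': "\<bar>s - t\<bar> \<le> \<eta>" using s \<delta>(2) by simp
    have "S \<subseteq> Z"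
    proof
      fix z assume z: "z \<in> S"
      show "z \<in> Z"
      proof (rule ccontr)
        assume "z \<notin> Z"
        then have "cmod (half_jump \<omega> z) \<le> \<delta>" using Z(5) z by (auto simp: S_def)
        then show False using z \<delta>(3) \<eta>(2) t by (simp add: S_def)
      qed
    qed
    have "jump_density Z \<kappa> s = (\<Sum>z\<in>S. density_c (s / cmod (\<kappa> z)))"
      unfolding jump_density_def
    proof (rule sum.mono_neutral_right[OF Z(1) \<open>S \<subseteq> Z\<close>], intro ballI)
      fix z assume z: "z \<in> Z - S"
      then have "cmod (half_jump \<omega> z) < t / 2" using Z(2) by (auto simp: S_def)
      moreover have "cmod (\<kappa> z) \<le> cmod (half_jump \<omega> z) + \<delta>"
        using Z(4) z norm_triangle_sub[of "\<kappa> z" "half_jump \<omega> z"] by fastforce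
      ultimately have "cmod (\<kappa> z) \<le> s" using \<delta>(3) \<eta>(2) s' by linarith
      then have "s / cmod (\<kappa> z) \<ge> 1" using Z(3) z by simp
      then show "density_c (s / cmod (\<kappa> z)) = 0" by simp
    qed
    then have "\<bar>jump_density Z \<kappa> s - g\<bar> = \<bar>\<Sum>z\<in>S. density_c (s / cmod (\<kappa> z)) - density_c (t / cmod (half_jump \<omega> z))\<bar>"
      by (simp only: g_def S_def[symmetric] sum_subtractf)
    also have "\<dots> \<le> (\<Sum>z\<in>S. \<bar>density_c (s / cmod (\<kappa> z)) - density_c (t / cmod (half_jump \<omega> z))\<bar>)"
      by (rule sum_abs)
    also have "\<dots> \<le> (\<Sum>z\<in>S. \<epsilon>1)"
    proof (rule sum_mono)
      fix z assume z: "z \<in> S"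
      have "\<bar>cmod (\<kappa> z) - cmod (half_jump \<omega> z)\<bar> \<le> cmod (\<kappa> z - half_jump \<omega> z)" by (rule norm_triangle_ineq3)
      also have "\<dots> \<le> \<delta>" using Z(4) z \<open>S \<subseteq> Z\<close> by blast
      finally show "\<bar>density_c (s / cmod (\<kappa> z)) - density_c (t / cmod (half_jump \<omega> z))\<bar> \<le> \<epsilon>1"
        using \<eta>(3)[OF z s', of "cmod (\<kappa> z)"] \<delta>(3) by simp
    qed
    also have "\<dots> \<le> \<epsilon>" using \<epsilon> by (simp add: \<epsilon>1_def field_simps)
    finally show "\<bar>jump_density Z \<kappa> s - g\<bar> \<le> \<epsilon>" .
  qed (use \<delta> \<eta> in auto)
qed

text \<open>The counts are squeezed between those of the model at the levels t + \<eta> and t -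
  \<eta>. One quarter of \<epsilon> each goes to the change of level and jumps, to the model
  asymptotics and to the \<open>r\<close> lost directions; the last quarter makes the inequalities
  strict.\<close>

lemma log_ratio_tendsto:
  assumes t: "t > 0"
  shows "log_ratio \<tau> t (hankel (fourier_coeff \<omega>)) \<longlonglongrightarrow>
    (\<Sum>z\<in>{z \<in> sphere 0 1. t / 2 \<le> cmod (half_jump \<omega> z)}. density_c (t / cmod (half_jump \<omega> z)))"
    (is "_ \<longlonglongrightarrow> ?g")
proof (rule tendstoI)
  define g where "g = ?g"
  fix \<epsilon> :: real assume \<epsilon>: "\<epsilon> > 0"
  have \<epsilon>4: "0 < \<epsilon> / 4" using \<epsilon> by simp
  from jump_density_tendsto[OF t this, folded g_def] obtain \<delta> where \<delta>: "\<delta> > 0" "(M + 1) * \<delta> < t / 4"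
    "\<forall>Z \<kappa> s. finite Z \<longrightarrow> Z \<subseteq> sphere 0 1 \<longrightarrow> (\<forall>z\<in>Z. \<kappa> z \<noteq> 0) \<longrightarrow>
     (\<forall>z\<in>Z. cmod (\<kappa> z - half_jump \<omega> z) \<le> \<delta>) \<longrightarrow> (\<forall>z\<in>sphere 0 1 - Z. cmod (half_jump \<omega> z) \<le> \<delta>) \<longrightarrow>
     \<bar>s - t\<bar> \<le> (M + 1) * \<delta> \<longrightarrow> \<bar>jump_density Z \<kappa> s - g\<bar> \<le> \<epsilon> / 4"
    by (elim exE conjE)
  define \<eta> where "\<eta> = (M + 1) * \<delta>"
  have \<eta>: "0 < \<eta>" "\<eta> < t / 4" using \<delta> M(2) by (simp_all add: \<eta>_def)
  obtain Z \<kappa> A r where d: "jump_model Z \<kappa>" "\<And>N. has_matrix (A N) (jump_matrix Z \<kappa> N)"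
    "\<And>z. z \<in> Z \<Longrightarrow> cmod (\<kappa> z - half_jump \<omega> z) \<le> \<delta>"
    "\<And>z. z \<in> sphere 0 1 - Z \<Longrightarrow> cmod (half_jump \<omega> z) \<le> \<delta>"
    "\<And>N t q. N \<ge> 1 \<Longrightarrow> codim_bound (truncated N) t q \<Longrightarrow> codim_bound (A N) (t + \<eta>) (q + r)"
    "\<And>N t q. N \<ge> 1 \<Longrightarrow> codim_bound (A N) t q \<Longrightarrow> codim_bound (truncated N) (t + \<eta>) (q + r)"
    unfolding \<eta>_def by (rule truncated_decomposition[OF \<delta>(1)]) blast
  interpret jump_model Z \<kappa> by (rule d(1))
  have "Z \<subseteq> sphere 0 1" using unit_Z by auto
  then have close: "\<bar>jump_density Z \<kappa> s - g\<bar> \<le> \<epsilon> / 4" if "\<bar>s - t\<bar> \<le> \<eta>" for s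
    using that nonzero d(3,4) finite_Z unfolding \<eta>_def by (intro \<delta>(3)[rule_format]) auto
  have dens: "g - \<epsilon> / 4 \<le> jump_density Z \<kappa> s" "jump_density Z \<kappa> s \<le> g + \<epsilon> / 4" if "\<bar>s - t\<bar> \<le> \<eta>" for s
    using close[OF that] unfolding abs_le_iff by linarith+
  have upper_t: "0 < t - \<eta>" and lower_t: "0 < t + \<eta>" using t \<eta> by auto
  have "filterlim (\<lambda>N. ln (real N)) at_top sequentially" by real_asymp
  then have "\<forall>\<^sub>F N in sequentially. max 0 (4 * real r / \<epsilon>) < ln (real N)"
    unfolding filterlim_at_top_dense by blast
  then have "\<forall>\<^sub>F N in sequentially. dist (log_ratio \<tau> t (hankel (fourier_coeff \<omega>)) N) g < \<epsilon>"
    using eventually_ge_at_top[of 1] jump_density_lower_eventually[OF d(2) lower_t \<epsilon>4]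
      jump_density_upper_eventually[OF d(2) upper_t \<epsilon>4]
  proof eventually_elim
    case (elim N)
    define L where "L = ln (real N)"
    have "L > 0" "4 * real r / \<epsilon> < L" using elim(1) by (simp_all add: L_def)
    then have L: "L > 0" "real r < \<epsilon> / 4 * L" using \<epsilon> by (simp_all add: field_simps)
    have bK: "bounded_op (truncated N)" using truncated_matrix[OF elim(2)] by (simp add: has_matrix_def)
    note count = codim_bound_iff_sing_count[OF bK truncated_compact[OF elim(2)] t]
    define n where "n = sing_count t (truncated N)"
    have "codim_bound (truncated N) t n" using count by (simp add: n_def)
    from d(5)[OF elim(2) this] have "(jump_density Z \<kappa> (t + \<eta>) - \<epsilon> / 4) * L \<le> real (n + r)"
      using elim(3) unfolding L_def by blast
    moreover have "(g - \<epsilon> / 4 - \<epsilon> / 4) * L \<le> (jump_density Z \<kappa> (t + \<eta>) - \<epsilon> / 4) * L"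
      using dens[of "t + \<eta>"] \<eta> L by (intro mult_right_mono) auto
    ultimately have lo: "(g - \<epsilon>) * L < real n"
      using L \<epsilon> by (simp add: algebra_simps)
    obtain q where q: "real q \<le> (jump_density Z \<kappa> (t - \<eta>) + \<epsilon> / 4) * L" "codim_bound (A N) (t - \<eta>) q"
      using elim(4) unfolding L_def by blast
    from d(6)[OF elim(2) q(2)] have "n \<le> q + r" using count by (simp add: n_def)
    then have "real n \<le> real q + real r" by (simp flip: of_nat_add)
    moreover have "(jump_density Z \<kappa> (t - \<eta>) + \<epsilon> / 4) * L \<le> (g + \<epsilon> / 4 + \<epsilon> / 4) * L"
      using dens[of "t - \<eta>"] \<eta> L by (intro mult_right_mono) auto
    ultimately have hi: "real n < (g + \<epsilon>) * L"
      using L q(1) \<epsilon> by (simp add: algebra_simps)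
    have "g - \<epsilon> < real n / L" "real n / L < g + \<epsilon>"
      using lo hi L by (simp_all add: pos_less_divide_eq pos_divide_less_eq)
    then show ?case by (simp add: dist_real_def abs_less_iff log_ratio_def n_def L_def)
  qed
  then show "\<forall>\<^sub>F N in sequentially. dist (log_ratio \<tau> t (hankel (fourier_coeff \<omega>)) N) ?g < \<epsilon>"
    unfolding g_def .
qed

end

theorem theorem1p1:
  fixes \<tau> :: "real \<Rightarrow> real \<Rightarrow> complex" and \<omega> :: "complex \<Rightarrow> complex" and t :: real
  assumes bdd: "bounded ((\<lambda>(x, y). \<tau> x y) ` ({0..} \<times> {0..}))"
    and A: "(SUP N\<in>{1..}. multiplier_norm (dilate \<tau> N)) < \<infinity>"
    and B0: "\<tau> 0 0 = 1"
    and B: "\<exists>\<epsilon>>0. \<exists>\<beta>>1/2. \<exists>C>0. \<forall>x y. 0 \<le> x \<and> x \<le> \<epsilon> \<and> 0 \<le> y \<and> y \<le> \<epsilon> \<and> x + y \<noteq> 1 \<longrightarrow>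
              cmod (\<tau> x y - 1) \<le> C * \<bar>ln (x + y)\<bar> powr (- \<beta>)"
    and C: "\<exists>\<alpha>>1/2. \<exists>C. \<forall>x y. 0 \<le> x \<and> 0 \<le> y \<longrightarrow>
              cmod (\<tau> x y) \<le> C * ln (x + y + 2) powr (- \<alpha>)"
    and PC: "\<omega> \<in> PC_circle"
    and t: "t > 0"
  shows "convergent (log_ratio \<tau> t (hankel (fourier_coeff \<omega>))) \<and>
         LogDens \<tau> t (hankel (fourier_coeff \<omega>)) =
           (\<Sum>\<^sub>\<infinity>z\<in>jump_set \<omega>. density_c (t * inverse (cmod (half_jump \<omega> z))))"
proof -
  \<comment> \<open>A finite set that contains every jump with nonzero density: a jump outside it
    has t / |\<kappa>| > 2, where \<open>density_c\<close> vanishes. The infinite sum thus reduces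
    to a finite one.\<close>
  define S where "S = {z \<in> sphere 0 1. t / 2 \<le> cmod (half_jump \<omega> z)}"
  obtain M where M: "\<And>N. N \<ge> 1 \<Longrightarrow> multiplier_norm (dilate \<tau> N) \<le> ereal M" "M \<ge> 0"
  proof -
    obtain M0 where "(SUP N\<in>{1..}. multiplier_norm (dilate \<tau> N)) \<le> ereal M0"
      using A by (cases "SUP N\<in>{1..}. multiplier_norm (dilate \<tau> N)") auto
    then have "multiplier_norm (dilate \<tau> N) \<le> ereal (max M0 0)" if "N \<ge> 1" for N
    proof -
      assume le: "(SUP N\<in>{1..}. multiplier_norm (dilate \<tau> N)) \<le> ereal M0"
      have "multiplier_norm (dilate \<tau> N) \<le> (SUP N\<in>{1..}. multiplier_norm (dilate \<tau> N))"
        by (rule SUP_upper) (use that in simp)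
      also note le
      also have "ereal M0 \<le> ereal (max M0 0)" by simp
      finally show ?thesis .
    qed
    then show thesis using that[of "max M0 0"] by simp
  qed
  have lim: "log_ratio \<tau> t (hankel (fourier_coeff \<omega>)) \<longlonglongrightarrow> (\<Sum>z\<in>S. density_c (t / cmod (half_jump \<omega> z)))"
    unfolding S_def by (rule log_ratio_tendsto[OF bdd M B C PC t])
  have finS: "finite S" unfolding S_def using finite_large_jumps[OF bdd M B C PC, of "t / 2"] t by simp
  have "(\<Sum>\<^sub>\<infinity>z\<in>jump_set \<omega>. density_c (t * inverse (cmod (half_jump \<omega> z)))) =
      (\<Sum>\<^sub>\<infinity>z\<in>S. density_c (t / cmod (half_jump \<omega> z)))"
  proof (rule infsum_cong_neutral)
    fix z assume "z \<in> S - jump_set \<omega>"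
    then show "density_c (t / cmod (half_jump \<omega> z)) = 0" using t by (auto simp: S_def jump_set_def)
  next
    fix z assume z: "z \<in> jump_set \<omega> - S"
    then have "cmod (half_jump \<omega> z) < t / 2" "cmod (half_jump \<omega> z) > 0" by (auto simp: S_def jump_set_def)
    then have "t * inverse (cmod (half_jump \<omega> z)) \<ge> 1" using t by (simp add: field_simps)
    then show "density_c (t * inverse (cmod (half_jump \<omega> z))) = 0" by simp
  qed (simp add: divide_inverse)
  also have "\<dots> = (\<Sum>z\<in>S. density_c (t / cmod (half_jump \<omega> z)))"
    using finS by simp
  finally show ?thesis
    using lim limI[OF lim] unfolding LogDens_def by (auto simp: convergent_def)
qed

end
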